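(* Let $\mathcal{O}$ be a complete discrete valuation ring, let $n,g\ge 1$ be integers, $T=\{1,\dots,n\}$, and let $A=\mathcal{O}[[x_1,\dots,x_n,y_1,\dots,y_n,t_1,\dots,t_g]]/(x_1y_1,\dots,x_ny_n)$ and $A_\Sigma=A/(x_i\mid i\notin\Sigma)$ for $\Sigma\subseteq T$. Let $\{M_\Sigma\}_{\Sigma\subseteq T}$ be a family in which $M_\Sigma$ is an $A_\Sigma$-module, equipped with $A_\Sigma$-linear surjections $\pi_{\Sigma,\Sigma'}\colon M_\Sigma\twoheadrightarrow M_{\Sigma'}$ whenever $\Sigma'\subseteq\Sigma\subseteq T$, satisfying: (1) each $M_\Sigma$ is a self-dual maximal Cohen--Macaulay $A_\Sigma$-module; (2) for all $\Sigma'\subseteq \Sigma$, the map $\pi_{\Sigma,\Sigma'}$ is an isomorphism after localization at $\mathfrak{p}_{\boldsymbol v}$ for each $\boldsymbol v\in\mathcal{V}^\circ_{\Sigma'}$; (3) for any $\Sigma'\subsetneq T$, any $s\in T\setminus\Sigma'$, and $\Sigma=\Sigma'\cup\{s\}$, the composition $$M_{\Sigma'}\cong (M_{\Sigma'})^\vee\xrightarrow{(\pi_{\Sigma,\Sigma'})^\vee}(M_\Sigma)^\vee\cong M_\Sigma\xrightarrow{\pi_{\Sigma,\Sigma'}}M_{\Sigma'}$$ is multiplication by $y_s$. For $\Sigma\subseteq T$ let $\mu_\Sigma$ be the rank of $M_T$ on the component of $\operatorname{Spec}A$ indexed by $\Sigma$. If $\mu_T\le\mu_\varnothing$, then $M_\Sigma\cong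 A_\Sigma^{\mu_\varnothing}$ as $A_\Sigma$-modules for each $\Sigma\subseteq T$.
   Context: Let $\varpi$ be a uniformizer of $\mathcal{O}$. The $\mathcal{O}$-points of $\operatorname{Spec}A$ are $$\mathcal{V}=\{\boldsymbol v=(a_1,\dots,a_n,b_1,\dots,b_n,c_1,\dots,c_g)\in(\varpi\mathcal{O})^{2n+g}\mid a_ib_i=0 \text{ for } 1\le i\le n\}.$$ The point $\boldsymbol v$ corresponds to the map of $\mathcal{O}$-algebras $\lambda_{\boldsymbol v}\colon A\to\mathcal{O}$ with $x_i\mapsto a_i$, $y_i\mapsto b_i$, $t_k\mapsto c_k$, and $\mathfrak{p}_{\boldsymbol v}=\operatorname{Ker}\lambda_{\boldsymbol v}$. For $\Sigma\subseteq T$ set $\mathcal{Z}^\circ_\Sigma=\{(\boldsymbol a,\boldsymbol b,\boldsymbol c)\in\mathcal{V}\mid a_i\ne0 \text{ for } i\in\Sigma \text{ and } b_j\neq 0\text{ for }j\notin\Sigma\}$ and $\mathcal{V}^\circ_\Sigma=\bigsqcup_{\Sigma'\subseteq\Sigma}\mathcal{Z}^\circ_{\Sigma'}$. The irreducible components of $\operatorname{Spec}A$ are the closed sets $V(I_\Sigma)$ with $I_\Sigma=(x_i\mid i\notin\Sigma)+(y_j\mid j\in\Sigma)$. The points in $\mathcal{Z}^\circ_\Sigma$ are those $\mathcal{O}$-points which lie on $V(I_\Sigma)$ and on no other component. At such points $A_{\mathfrak{p}_{\boldsymbol v}}$ is regular, and $A_{\mathfrak p_{\boldsymbol v}}\cong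 (A_{\Sigma'})_{\mathfrak p_{\boldsymbol v}}$ for each $\Sigma'\supseteq\Sigma$. A maximal Cohen--Macaulay module over $A_\Sigma$ is also maximal Cohen--Macaulay over $A$, and it is free at $\mathfrak{p}_{\boldsymbol v}$ for $\boldsymbol v\in\mathcal{V}^\circ_{\Sigma}$. The rank $\mu_\Sigma$ is $\operatorname{rank}_{A_{\mathfrak{p}_{\boldsymbol v}}}(M_T)_{\mathfrak{p}_{\boldsymbol v}}$ for any $\boldsymbol v\in\mathcal{Z}^\circ_\Sigma$; it does not depend on the choice of $\boldsymbol v$. Duality: the rings $A$ and $A_\Sigma$ are complete intersections of the same dimension, and $(-)^\vee=\operatorname{Hom}_A(-,\omega_A)$ with $\omega_A\cong A$ the dualizing module. Self-dual means that an isomorphism of $A_\Sigma$-modules $M_\Sigma\cong (M_\Sigma)^\vee$ is given; these fixed isomorphisms are the ones used in (3). *)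

theory Defs
  imports "HOL-Algebra.Algebra" "HOL-Library.Multiset" "HOL-Library.Extended_Nat"
begin

section \<open>Complete discrete valuation rings\<close>

text \<open>A discrete valuation ring is a principal ideal domain with a unique maximal ideal, which is
  nonzero; \<open>u\<close> is a uniformizer.\<close>

locale dvr = principal_domain R for R (structure) +
  fixes u
  assumes uniformizer_carrier: "u \<in> carrier R"
    and uniformizer_nonzero: "u \<noteq> \<zero>"
    and uniformizer_maximal: "maximalideal (PIdl u) R"
    and unique_maximal: "maximalideal J R \<Longrightarrow> J = PIdl u"

text \<open>Completeness says that the map to the inverse limit of the quotients by \<open>PIdl (u [^] k)\<close>
  is injective and surjective.\<close>

locale complete_dvr = dvr +
  assumes adic_separated: "(\<Inter>k::nat. PIdl (u [^] k)) = {\<zero>}"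
    and adic_complete:
      "\<lbrakk> \<And>k::nat. s k \<in> carrier R; \<And>k. s (Suc k) \<ominus> s k \<in> PIdl (u [^] k) \<rbrakk>
       \<Longrightarrow> \<exists>z\<in>carrier R. \<forall>k. z \<ominus> s k \<in> PIdl (u [^] k)"

section \<open>Modules\<close>

definition mod_hom ::
    "('r, 'c) ring_scheme \<Rightarrow> ('r, 'm) module \<Rightarrow> ('r, 'k) module \<Rightarrow> ('m \<Rightarrow> 'k) set" where
  "mod_hom R M N = {f. f \<in> carrier M \<rightarrow> carrier N \<and>
     (\<forall>x\<in>carrier M. \<forall>y\<in>carrier M. f (x \<oplus>\<^bsub>M\<^esub> y) = f x \<oplus>\<^bsub>N\<^esub> f y) \<and>
     (\<forall>a\<in>carrier R. \<forall>x\<in>carrier M. f (a \<odot>\<^bsub>M\<^esub> x) = a \<odot>\<^bsub>N\<^esub> f x)}"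

definition mod_iso ::
    "('r, 'c) ring_scheme \<Rightarrow> ('r, 'm) module \<Rightarrow> ('r, 'k) module \<Rightarrow> ('m \<Rightarrow> 'k) set" where
  "mod_iso R M N = {f \<in> mod_hom R M N. bij_betw f (carrier M) (carrier N)}"

text \<open>The record type \<^type>\<open>module\<close> extends \<^type>\<open>ring\<close>; the fields \<^const>\<open>monoid.mult\<close> and \<^const>\<open>one\<close>
  of a module carry no information and are left unspecified below.\<close>

definition self_module :: "('r, 'c) ring_scheme \<Rightarrow> ('r, 'r) module" where
  "self_module R = \<lparr>carrier = carrier R, monoid.mult = undefined, one = undefined,
     ring.zero = \<zero>\<^bsub>R\<^esub>, add = (\<oplus>\<^bsub>R\<^esub>), smult = (\<otimes>\<^bsub>R\<^esub>)\<rparr>"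

definition free_module :: "('r, 'c) ring_scheme \<Rightarrow> nat \<Rightarrow> ('r, nat \<Rightarrow> 'r) module" where
  "free_module R r = \<lparr>carrier = {..<r} \<rightarrow>\<^sub>E carrier R, monoid.mult = undefined, one = undefined,
     ring.zero = (\<lambda>i\<in>{..<r}. \<zero>\<^bsub>R\<^esub>),
     add = (\<lambda>x y. \<lambda>i\<in>{..<r}. x i \<oplus>\<^bsub>R\<^esub> y i),
     smult = (\<lambda>a x. \<lambda>i\<in>{..<r}. a \<otimes>\<^bsub>R\<^esub> x i)\<rparr>"

definition restrict_scalars :: "('q \<Rightarrow> 'r) \<Rightarrow> ('r, 'm) module \<Rightarrow> ('q, 'm) module" where
  "restrict_scalars p M = \<lparr>carrier = carrier M, monoid.mult = undefined, one = undefined,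
     ring.zero = \<zero>\<^bsub>M\<^esub>, add = (\<oplus>\<^bsub>M\<^esub>), smult = (\<lambda>a x. p a \<odot>\<^bsub>M\<^esub> x)\<rparr>"

definition module_span :: "('r, 'c) ring_scheme \<Rightarrow> ('r, 'm) module \<Rightarrow> 'm set \<Rightarrow> 'm set" where
  "module_span R M E = \<Inter>{N. submodule N R M \<and> E \<subseteq> N}"

definition finitely_generated :: "('r, 'c) ring_scheme \<Rightarrow> ('r, 'm) module \<Rightarrow> bool" where
  "finitely_generated R M \<longleftrightarrow>
     (\<exists>E. finite E \<and> E \<subseteq> carrier M \<and> module_span R M E = carrier M)"

text \<open>The rank of a module over an integral domain: the maximal number of linearly independent
  elements, i.e. the dimension over the field of fractions. On free modules it is the number of
  elements of a basis.\<close>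

definition lin_indep ::
    "('r, 'c) ring_scheme \<Rightarrow> ('r, 'm) module \<Rightarrow> nat \<Rightarrow> (nat \<Rightarrow> 'm) \<Rightarrow> bool" where
  "lin_indep R M r e \<longleftrightarrow> e \<in> {..<r} \<rightarrow> carrier M \<and>
     (\<forall>c \<in> {..<r} \<rightarrow> carrier R.
        (\<Oplus>\<^bsub>M\<^esub>i\<in>{..<r}. c i \<odot>\<^bsub>M\<^esub> e i) = \<zero>\<^bsub>M\<^esub> \<longrightarrow> (\<forall>i<r. c i = \<zero>\<^bsub>R\<^esub>))"

definition module_rank :: "('r, 'c) ring_scheme \<Rightarrow> ('r, 'm) module \<Rightarrow> nat" where
  "module_rank R M = (GREATEST r. \<exists>e. lin_indep R M r e)"

section \<open>Depth, Krull dimension, maximal Cohen--Macaulay modules\<close>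

text \<open>The submodule generated by the products of elements of \<open>J\<close> and elements of \<open>M\<close>.\<close>

definition scaled_submodule ::
    "('r, 'c) ring_scheme \<Rightarrow> 'r set \<Rightarrow> ('r, 'm) module \<Rightarrow> 'm set" where
  "scaled_submodule R J M = module_span R M {a \<odot>\<^bsub>M\<^esub> x | a x. a \<in> J \<and> x \<in> carrier M}"

text \<open>Each entry acts injectively on the quotient of \<open>M\<close> by its predecessors, and the quotient of
  \<open>M\<close> by the whole sequence is nonzero.\<close>

definition regular_sequence :: "('r, 'c) ring_scheme \<Rightarrow> ('r, 'm) module \<Rightarrow> 'r list \<Rightarrow> bool" where
  "regular_sequence R M rs \<longleftrightarrow> set rs \<subseteq> carrier R \<and>
     (\<forall>i<length rs. \<forall>x\<in>carrier M.
        rs ! i \<odot>\<^bsub>M\<^esub> x \<in> scaled_submodule R (set (take i rs)) M \<longrightarrow>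
        x \<in> scaled_submodule R (set (take i rs)) M) \<and>
     scaled_submodule R (set rs) M \<noteq> carrier M"

definition depth :: "('r, 'c) ring_scheme \<Rightarrow> 'r set \<Rightarrow> ('r, 'm) module \<Rightarrow> enat" where
  "depth R J M = (if scaled_submodule R J M = carrier M then \<infinity>
     else (SUP rs\<in>{rs. set rs \<subseteq> J \<and> regular_sequence R M rs}. enat (length rs)))"

definition krull_dim :: "('r, 'c) ring_scheme \<Rightarrow> enat" where
  "krull_dim R = (SUP k\<in>{k. \<exists>P. (\<forall>i\<le>k. primeideal (P i) R) \<and> (\<forall>i<k. P i \<subset> P (Suc i))}. enat k)"

text \<open>For modules over a Noetherian local ring. The zero module has infinite depth and is therefore
  not maximal Cohen--Macaulay.\<close>

definition maximal_cohen_macaulay :: "('r, 'c) ring_scheme \<Rightarrow> ('r, 'm) module \<Rightarrow> bool" where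
  "maximal_cohen_macaulay R M \<longleftrightarrow> module R M \<and> finitely_generated R M \<and>
     depth R (THE J. maximalideal J R) M = krull_dim R"

section \<open>Localization\<close>

text \<open>Here \<open>D\<close> is the set of denominators; a fraction is the class of a pair of a numerator
  and a denominator.\<close>

definition frac_rel ::
    "('r, 'c) ring_scheme \<Rightarrow> 'r set \<Rightarrow> ('r, 'm) module \<Rightarrow> (('m \<times> 'r) \<times> ('m \<times> 'r)) set" where
  "frac_rel R D M = {((x, s), (y, t)). x \<in> carrier M \<and> y \<in> carrier M \<and> s \<in> D \<and> t \<in> D \<and>
     (\<exists>d\<in>D. d \<odot>\<^bsub>M\<^esub> (t \<odot>\<^bsub>M\<^esub> x) = d \<odot>\<^bsub>M\<^esub> (s \<odot>\<^bsub>M\<^esub> y))}"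

definition frac ::
    "('r, 'c) ring_scheme \<Rightarrow> 'r set \<Rightarrow> ('r, 'm) module \<Rightarrow> 'm \<Rightarrow> 'r \<Rightarrow> ('m \<times> 'r) set" where
  "frac R D M x s = frac_rel R D M `` {(x, s)}"

definition loc_ring :: "('r, 'c) ring_scheme \<Rightarrow> 'r set \<Rightarrow> ('r \<times> 'r) set ring" where
  "loc_ring R D = \<lparr>
     carrier = (carrier R \<times> D) // frac_rel R D (self_module R),
     monoid.mult = (\<lambda>E F. \<Union>(a, s)\<in>E. \<Union>(b, t)\<in>F. frac R D (self_module R) (a \<otimes>\<^bsub>R\<^esub> b) (s \<otimes>\<^bsub>R\<^esub> t)),
     one = frac R D (self_module R) \<one>\<^bsub>R\<^esub> \<one>\<^bsub>R\<^esub>,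
     ring.zero = frac R D (self_module R) \<zero>\<^bsub>R\<^esub> \<one>\<^bsub>R\<^esub>,
     add = (\<lambda>E F. \<Union>(a, s)\<in>E. \<Union>(b, t)\<in>F.
       frac R D (self_module R) ((t \<otimes>\<^bsub>R\<^esub> a) \<oplus>\<^bsub>R\<^esub> (s \<otimes>\<^bsub>R\<^esub> b)) (s \<otimes>\<^bsub>R\<^esub> t))\<rparr>"

definition loc_module ::
    "('r, 'c) ring_scheme \<Rightarrow> 'r set \<Rightarrow> ('r, 'm) module \<Rightarrow> (('r \<times> 'r) set, ('m \<times> 'r) set) module" where
  "loc_module R D M = \<lparr>
     carrier = (carrier M \<times> D) // frac_rel R D M,
     monoid.mult = undefined, one = undefined,
     ring.zero = frac R D M \<zero>\<^bsub>M\<^esub> \<one>\<^bsub>R\<^esub>,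
     add = (\<lambda>E F. \<Union>(x, s)\<in>E. \<Union>(y, t)\<in>F.
       frac R D M ((t \<odot>\<^bsub>M\<^esub> x) \<oplus>\<^bsub>M\<^esub> (s \<odot>\<^bsub>M\<^esub> y)) (s \<otimes>\<^bsub>R\<^esub> t)),
     smult = (\<lambda>E F. \<Union>(a, s)\<in>E. \<Union>(y, t)\<in>F. frac R D M (a \<odot>\<^bsub>M\<^esub> y) (s \<otimes>\<^bsub>R\<^esub> t))\<rparr>"

text \<open>The map induced by \<open>f\<close> on localizations, with values in the localization of \<open>N\<close>.\<close>

definition loc_map ::
    "('r, 'c) ring_scheme \<Rightarrow> 'r set \<Rightarrow> ('r, 'k) module \<Rightarrow> ('m \<Rightarrow> 'k)
      \<Rightarrow> ('m \<times> 'r) set \<Rightarrow> ('k \<times> 'r) set" where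
  "loc_map R D N f E = (\<Union>(x, s)\<in>E. frac R D N (f x) s)"

section \<open>Formal power series in several variables\<close>

datatype variable = VX nat | VY nat | VT nat

text \<open>A monomial is a multiset of variables and a power series is its family of coefficients.\<close>

type_synonym 'o series = "variable multiset \<Rightarrow> 'o"

definition series_ring :: "('o, 'c) ring_scheme \<Rightarrow> variable set \<Rightarrow> 'o series ring" where
  "series_ring R V = \<lparr>
     carrier = {f. (\<forall>m. f m \<in> carrier R) \<and> (\<forall>m. \<not> set_mset m \<subseteq> V \<longrightarrow> f m = \<zero>\<^bsub>R\<^esub>)},
     monoid.mult = (\<lambda>f h m. \<Oplus>\<^bsub>R\<^esub>k\<in>{k. k \<subseteq># m}. f k \<otimes>\<^bsub>R\<^esub> h (m - k)),
     one = (\<lambda>m. if m = {#} then \<one>\<^bsub>R\<^esub> else \<zero>\<^bsub>R\<^esub>),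
     ring.zero = (\<lambda>m. \<zero>\<^bsub>R\<^esub>),
     add = (\<lambda>f h m. f m \<oplus>\<^bsub>R\<^esub> h m)\<rparr>"

definition series_const :: "('o, 'c) ring_scheme \<Rightarrow> 'o \<Rightarrow> 'o series" where
  "series_const R c = (\<lambda>m. if m = {#} then c else \<zero>\<^bsub>R\<^esub>)"

definition series_var :: "('o, 'c) ring_scheme \<Rightarrow> variable \<Rightarrow> 'o series" where
  "series_var R z = (\<lambda>m. if m = {#z#} then \<one>\<^bsub>R\<^esub> else \<zero>\<^bsub>R\<^esub>)"

section \<open>The rings \<open>A\<close> and \<open>A\<^sub>S\<close>\<close>

text \<open>Here \<open>S\<close> ranges over the subsets of \<open>{1..n}\<close>; the ring \<open>A\<^sub>S\<close> is the quotient of \<open>A\<close> by the classes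
  of the variables \<open>VX i\<close> with \<open>i \<notin> S\<close>.\<close>

definition vars :: "nat \<Rightarrow> nat \<Rightarrow> variable set" where
  "vars n g = VX ` {1..n} \<union> VY ` {1..n} \<union> VT ` {1..g}"

abbreviation P_ring :: "('o, 'c) ring_scheme \<Rightarrow> nat \<Rightarrow> nat \<Rightarrow> 'o series ring" where
  "P_ring \<O> n g \<equiv> series_ring \<O> (vars n g)"

definition A_ideal :: "('o, 'c) ring_scheme \<Rightarrow> nat \<Rightarrow> nat \<Rightarrow> 'o series set" where
  "A_ideal \<O> n g = genideal (P_ring \<O> n g)
     ((\<lambda>i. series_var \<O> (VX i) \<otimes>\<^bsub>P_ring \<O> n g\<^esub> series_var \<O> (VY i)) ` {1..n})"

definition A_ring :: "('o, 'c) ring_scheme \<Rightarrow> nat \<Rightarrow> nat \<Rightarrow> 'o series set ring" where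
  "A_ring \<O> n g = P_ring \<O> n g Quot A_ideal \<O> n g"

definition A_const :: "('o, 'c) ring_scheme \<Rightarrow> nat \<Rightarrow> nat \<Rightarrow> 'o \<Rightarrow> 'o series set" where
  "A_const \<O> n g c = A_ideal \<O> n g +>\<^bsub>P_ring \<O> n g\<^esub> series_const \<O> c"

definition A_var :: "('o, 'c) ring_scheme \<Rightarrow> nat \<Rightarrow> nat \<Rightarrow> variable \<Rightarrow> 'o series set" where
  "A_var \<O> n g z = A_ideal \<O> n g +>\<^bsub>P_ring \<O> n g\<^esub> series_var \<O> z"

definition AS_ideal :: "('o, 'c) ring_scheme \<Rightarrow> nat \<Rightarrow> nat \<Rightarrow> nat set \<Rightarrow> 'o series set set" where
  "AS_ideal \<O> n g S = genideal (A_ring \<O> n g) ((\<lambda>i. A_var \<O> n g (VX i)) ` ({1..n} - S))"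

definition AS_ring :: "('o, 'c) ring_scheme \<Rightarrow> nat \<Rightarrow> nat \<Rightarrow> nat set \<Rightarrow> 'o series set set ring" where
  "AS_ring \<O> n g S = A_ring \<O> n g Quot AS_ideal \<O> n g S"

definition AS_proj ::
    "('o, 'c) ring_scheme \<Rightarrow> nat \<Rightarrow> nat \<Rightarrow> nat set \<Rightarrow> 'o series set \<Rightarrow> 'o series set set" where
  "AS_proj \<O> n g S a = AS_ideal \<O> n g S +>\<^bsub>A_ring \<O> n g\<^esub> a"

text \<open>For \<open>S' \<subseteq> S\<close> this is the projection from \<^term>\<open>AS_ring \<O> n g S\<close> to \<^term>\<open>AS_ring \<O> n g S'\<close>
  (the argument is a coset of the smaller ideal, the union is a single coset of the larger one).\<close>

definition AS_trans ::
    "('o, 'c) ring_scheme \<Rightarrow> nat \<Rightarrow> nat \<Rightarrow> nat set \<Rightarrow> 'o series set set \<Rightarrow> 'o series set set" where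
  "AS_trans \<O> n g S' E = (\<Union>a\<in>E. AS_proj \<O> n g S' a)"

abbreviation as_A_module ::
    "('o, 'c) ring_scheme \<Rightarrow> nat \<Rightarrow> nat \<Rightarrow> nat set \<Rightarrow> ('o series set set, 'm) module
      \<Rightarrow> ('o series set, 'm) module" where
  "as_A_module \<O> n g S M \<equiv> restrict_scalars (AS_proj \<O> n g S) M"

text \<open>The dual \<open>Hom\<^sub>A(M, \<omega>\<^sub>A)\<close> of an \<open>A\<^sub>S\<close>-module, with \<open>\<omega>\<^sub>A = A\<close>, as an \<open>A\<^sub>S\<close>-module; homomorphisms are
  represented by extensional functions.\<close>

definition dual ::
    "('o, 'c) ring_scheme \<Rightarrow> nat \<Rightarrow> nat \<Rightarrow> nat set \<Rightarrow> ('o series set set, 'm) module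
      \<Rightarrow> ('o series set set, 'm \<Rightarrow> 'o series set) module" where
  "dual \<O> n g S M = \<lparr>
     carrier = mod_hom (A_ring \<O> n g) (as_A_module \<O> n g S M) (self_module (A_ring \<O> n g))
       \<inter> extensional (carrier M),
     monoid.mult = undefined, one = undefined,
     ring.zero = (\<lambda>x\<in>carrier M. \<zero>\<^bsub>A_ring \<O> n g\<^esub>),
     add = (\<lambda>f h. \<lambda>x\<in>carrier M. f x \<oplus>\<^bsub>A_ring \<O> n g\<^esub> h x),
     smult = (\<lambda>b f. \<lambda>x\<in>carrier M. f (b \<odot>\<^bsub>M\<^esub> x))\<rparr>"

section \<open>The \<open>\<O>\<close>-points of \<open>Spec A\<close>\<close>

text \<open>A point \<open>v\<close> assigns to the variables \<open>VX i\<close>, \<open>VY i\<close>, \<open>VT k\<close> its coordinates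
  \<open>a\<^sub>i\<close>, \<open>b\<^sub>i\<close>, \<open>c\<^sub>k\<close>.\<close>

definition points :: "('o, 'c) ring_scheme \<Rightarrow> 'o \<Rightarrow> nat \<Rightarrow> nat \<Rightarrow> (variable \<Rightarrow> 'o) set" where
  "points \<O> u n g = {v \<in> vars n g \<rightarrow>\<^sub>E PIdl\<^bsub>\<O>\<^esub> u.
     \<forall>i\<in>{1..n}. v (VX i) \<otimes>\<^bsub>\<O>\<^esub> v (VY i) = \<zero>\<^bsub>\<O>\<^esub>}"

definition Z_points ::
    "('o, 'c) ring_scheme \<Rightarrow> 'o \<Rightarrow> nat \<Rightarrow> nat \<Rightarrow> nat set \<Rightarrow> (variable \<Rightarrow> 'o) set" where
  "Z_points \<O> u n g S = {v \<in> points \<O> u n g.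
     (\<forall>i\<in>S. v (VX i) \<noteq> \<zero>\<^bsub>\<O>\<^esub>) \<and> (\<forall>j\<in>{1..n} - S. v (VY j) \<noteq> \<zero>\<^bsub>\<O>\<^esub>)}"

definition V_points ::
    "('o, 'c) ring_scheme \<Rightarrow> 'o \<Rightarrow> nat \<Rightarrow> nat \<Rightarrow> nat set \<Rightarrow> (variable \<Rightarrow> 'o) set" where
  "V_points \<O> u n g S = (\<Union>S'\<in>Pow S. Z_points \<O> u n g S')"

text \<open>The homomorphism of \<open>\<O>\<close>-algebras \<open>A \<rightarrow> \<O>\<close> sending the variables to the coordinates of \<open>v\<close>.
  It is unique: a power series is the sum of a polynomial and an element of the \<open>k\<close>-th power of the
  ideal generated by the variables, whose image is divisible by the \<open>k\<close>-th power of the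
  uniformizer.\<close>

definition point_hom ::
    "('o, 'c) ring_scheme \<Rightarrow> nat \<Rightarrow> nat \<Rightarrow> (variable \<Rightarrow> 'o) \<Rightarrow> 'o series set \<Rightarrow> 'o" where
  "point_hom \<O> n g v = (THE h. h \<in> ring_hom (A_ring \<O> n g) \<O> \<and> h \<in> extensional (carrier (A_ring \<O> n g)) \<and>
     (\<forall>c\<in>carrier \<O>. h (A_const \<O> n g c) = c) \<and> (\<forall>z\<in>vars n g. h (A_var \<O> n g z) = v z))"

definition point_prime ::
    "('o, 'c) ring_scheme \<Rightarrow> nat \<Rightarrow> nat \<Rightarrow> (variable \<Rightarrow> 'o) \<Rightarrow> 'o series set set" where
  "point_prime \<O> n g v = a_kernel (A_ring \<O> n g) \<O> (point_hom \<O> n g v)"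

abbreviation off_prime ::
    "('o, 'c) ring_scheme \<Rightarrow> nat \<Rightarrow> nat \<Rightarrow> (variable \<Rightarrow> 'o) \<Rightarrow> 'o series set set" where
  "off_prime \<O> n g v \<equiv> carrier (A_ring \<O> n g) - point_prime \<O> n g v"

text \<open>The rank of the \<open>A\<close>-module \<open>M\<close> on the component of \<open>Spec A\<close> indexed by \<open>S\<close>: the common value of
  the ranks of its localizations at the points which lie on this component only.\<close>

definition component_rank ::
    "('o, 'c) ring_scheme \<Rightarrow> 'o \<Rightarrow> nat \<Rightarrow> nat \<Rightarrow> ('o series set, 'm) module \<Rightarrow> nat set \<Rightarrow> nat" where
  "component_rank \<O> u n g M S = (THE r. \<forall>v\<in>Z_points \<O> u n g S.
     module_rank (loc_ring (A_ring \<O> n g) (off_prime \<O> n g v))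
       (loc_module (A_ring \<O> n g) (off_prime \<O> n g v) M) = r)"

end

theory Submission
  imports Defs "HOL-Library.Multiset_Order"
begin

text \<open>Self-duality gives perfect pairings \<open>\<langle>m, m'\<rangle>\<^sub>S\<close> on \<open>M\<^sub>S\<close> with values in \<open>A\<close>, and the
  condition on the composition becomes \<open>y\<^sub>s \<langle>m, m'\<rangle> = \<langle>\<pi> m, \<pi> m'\<rangle>\<close> for \<open>\<pi>\<close> from \<open>S \<union> {s}\<close> to \<open>S\<close>.
  The Cohen--Macaulay property is needed only for \<open>S = {}\<close>: a Koszul complex argument shows that
  the module is free over the regular ring \<open>A\<^sub>{}\<close>, of rank \<open>r\<close>, say. Lifts \<open>e\<^sub>i\<close>, \<open>f\<^sub>j\<close> to \<open>M\<^sub>S\<close>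
  of a basis and its dual basis have pairings \<open>\<delta>\<^sub>i\<^sub>j\<close> times the product \<open>Y\<close> of the \<open>y\<^sub>i\<close> with \<open>i \<notin>
  S\<close>, up to multiples of \<open>Y\<close> by elements of the prime of the component \<open>{}\<close>; such a Gram matrix is
  \<open>Y\<close> times an invertible one, so \<open>f\<close> can be corrected to a system dual to \<open>e\<close>, and \<open>M\<^sub>S\<close> is
  spanned by the \<open>f\<^sub>j\<close> and the elements \<open>z\<close> orthogonal to all \<open>e\<^sub>i\<close>. If \<open>\<langle>z, z'\<rangle>\<close> does not vanish
  on the component \<open>S\<close>, then the rank there exceeds \<open>r\<close>. If the rank on the component \<open>S \<union> {s}\<close> is
  at most \<open>r\<close>, then the values \<open>\<langle>z, z'\<rangle>\<close> on the component \<open>S\<close> are divisible by all powers of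
  \<open>y\<^sub>s\<close>, up to powers of the \<open>x\<^sub>i\<close> with \<open>i \<in> S\<close>, and hence zero, so that the rank on \<open>S\<close> is at
  most \<open>r\<close> as well. Descending from \<open>T\<close>, all ranks are at most \<open>r\<close>, every \<open>z\<close> is zero, and the
  \<open>f\<^sub>j\<close> form a basis.\<close>

section \<open>Pairings over a ring with crossing components\<close>

text \<open>No \<open>M_S\<close> with S nonempty is known to be free in advance, so nothing can be
  tested on a basis. The pairing is the test instead: an element is zero once all its pairings are,
  and, A being reduced, a pairing is zero once it vanishes on every component. The factor Y is
  forced: values of the pairing on \<open>M_S\<close> are killed by all \<open>x_i\<close> with
  \<open>i\<close> outside S, and the elements of A with this property are the multiples of Y.
  Adjacent pairings determine each other only up to the annihilator of \<open>y_s\<close>, so a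
  lifted dual system leaves the cofactors of Y undetermined up to the kernel of A onto the smaller
  ring. All these kernels lie in the prime of the component {}, which consists of nonunits of a
  local ring, so the accumulated errors never spoil invertibility. Divisibility by
  \<open>y_s\<close> can be iterated because a functional can be divided inside the dual: multiplied
  by the product X of the \<open>x_i\<close> with \<open>i\<close> in S, the pairings of z vanish on
  all components except S, their quotients by \<open>y_s\<close> form a functional again, and it is
  represented by some z' with \<open>y_s\<close> z' = X z. Since z' is orthogonal to the
  \<open>e_i\<close> like z, the argument applies to it anew.\<close>

lemma (in ideal) finsum_mem:
  "finite K \<Longrightarrow> (\<And>k. k \<in> K \<Longrightarrow> f k \<in> I) \<Longrightarrow> finsum R f K \<in> I"
proof (induction K rule: finite_induct)
  case (insert k K)
  then show ?case by (subst finsum_insert) (auto intro: Icarr)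
qed simp

text \<open>Fraction-free Gaussian elimination over the domain R/I, carried out in R so that neither
  the quotient nor its field of fractions has to be formed.\<close>

lemma (in primeideal) linear_dependence:
  assumes "finite J" "finite K" "card J < card K"
    and "\<And>k j. k \<in> K \<Longrightarrow> j \<in> J \<Longrightarrow> a k j \<in> carrier R"
  shows "\<exists>c. c \<in> K \<rightarrow> carrier R \<and> (\<exists>k\<in>K. c k \<notin> I) \<and> (\<forall>j\<in>J. (\<Oplus>k\<in>K. c k \<otimes> a k j) \<in> I)"
  using assms
proof (induction J arbitrary: K a rule: finite_induct)
  case empty
  then obtain k where "k \<in> K" by fastforce
  moreover have "\<one> \<notin> I" using I_notcarr one_imp_carrier by blast
  ultimately show ?case by (intro exI[of _ "\<lambda>_. \<one>"]) auto
next
  case (insert j J)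
  show ?case
  proof (cases "\<forall>k\<in>K. a k j \<in> I")
    case True
    obtain c where c: "c \<in> K \<rightarrow> carrier R" "\<exists>k\<in>K. c k \<notin> I"
      "\<forall>j\<in>J. (\<Oplus>k\<in>K. c k \<otimes> a k j) \<in> I"
      using insert.IH[of K a] insert.prems insert.hyps by auto
    have "(\<Oplus>k\<in>K. c k \<otimes> a k j) \<in> I"
      using c(1) True insert.prems(1) by (intro finsum_mem) (auto intro: I_l_closed)
    then show ?thesis using c by blast
  next
    case False
    then obtain k0 where k0: "k0 \<in> K" "a k0 j \<notin> I" by blast
    define K' where "K' = K - {k0}"
    have K': "K = insert k0 K'" "k0 \<notin> K'" "finite K'" using k0 insert.prems by (auto simp: K'_def)
    \<comment> \<open>Column \<open>j\<close> is eliminated by cross-multiplication with the pivot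
      \<open>a k0 j\<close>, so no inverse is required.\<close>
    define b where "b = (\<lambda>k j'. a k0 j \<otimes> a k j' \<ominus> a k j \<otimes> a k0 j')"
    have ac: "a k j' \<in> carrier R" if "k \<in> K" "j' \<in> insert j J" for k j'
      using insert.prems that by blast
    have bc: "b k j' \<in> carrier R" if "k \<in> K" "j' \<in> insert j J" for k j'
      using ac that k0(1) by (simp add: b_def)
    have "card J < card K'" using insert.prems insert.hyps K' by auto
    then obtain c where c: "c \<in> K' \<rightarrow> carrier R" "\<exists>k\<in>K'. c k \<notin> I"
      "\<forall>j\<in>J. (\<Oplus>k\<in>K'. c k \<otimes> b k j) \<in> I"
      using insert.IH[of K' b] K' bc by auto
    \<comment> \<open>The coefficient of the pivot row is chosen so that the sum for column
      \<open>j\<close> becomes exactly zero. Scaling the others by the pivot keeps one of them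
      outside I, because I is prime.\<close>
    define c' where "c' = (\<lambda>k. if k = k0 then \<ominus> (\<Oplus>k\<in>K'. c k \<otimes> a k j) else a k0 j \<otimes> c k)"
    have cc: "c k \<in> carrier R" if "k \<in> K'" for k using c that by auto
    have akc: "a k j' \<in> carrier R" if "k \<in> K'" "j' \<in> insert j J" for k j' using ac that K' by blast
    have c'c: "c' \<in> K \<rightarrow> carrier R"
      using cc akc k0 ac by (auto simp: c'_def K' intro!: finsum_closed a_inv_closed)
    have key: "(\<Oplus>k\<in>K. c' k \<otimes> a k j') = (\<Oplus>k\<in>K'. c k \<otimes> b k j')" if j': "j' \<in> insert j J" for j'
    proof -
      have 1: "(\<Oplus>k\<in>K. c' k \<otimes> a k j') = c' k0 \<otimes> a k0 j' \<oplus> (\<Oplus>k\<in>K'. c' k \<otimes> a k j')"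
        unfolding K'(1) using K' c'c ac j' by (subst finsum_insert) auto
      have 2: "(\<Oplus>k\<in>K'. c' k \<otimes> a k j') = (\<Oplus>k\<in>K'. a k0 j \<otimes> c k \<otimes> a k j')"
        using K' cc ac akc k0 j' by (intro finsum_cong') (auto simp: c'_def)
      have 3: "c' k0 \<otimes> a k0 j' = (\<Oplus>k\<in>K'. \<ominus> (c k \<otimes> a k j \<otimes> a k0 j'))"
      proof -
        have "c' k0 \<otimes> a k0 j' = (\<Oplus>k\<in>K'. c k \<otimes> a k j) \<otimes> (\<ominus> a k0 j')"
          using cc ac akc k0 j' by (simp add: c'_def l_minus r_minus finsum_closed Pi_def)
        also have "\<dots> = (\<Oplus>k\<in>K'. c k \<otimes> a k j \<otimes> (\<ominus> a k0 j'))"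
          using cc ac akc k0 j' K' by (intro finsum_ldistr) auto
        also have "\<dots> = (\<Oplus>k\<in>K'. \<ominus> (c k \<otimes> a k j \<otimes> a k0 j'))"
          using cc ac akc k0 j' K' by (intro finsum_cong') (auto simp: r_minus)
        finally show ?thesis .
      qed
      have "(\<Oplus>k\<in>K. c' k \<otimes> a k j')
          = (\<Oplus>k\<in>K'. \<ominus> (c k \<otimes> a k j \<otimes> a k0 j') \<oplus> a k0 j \<otimes> c k \<otimes> a k j')"
        unfolding 1 2 3 using cc ac akc k0 j' K' by (subst finsum_addf) auto
      also have "\<dots> = (\<Oplus>k\<in>K'. c k \<otimes> b k j')"
      proof (intro finsum_cong')
        fix k assume k: "k \<in> K'"
        have [simp]: "c k \<in> carrier R" "a k j \<in> carrier R" "a k0 j' \<in> carrier R" "a k0 j \<in> carrier R"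
          "a k j' \<in> carrier R"
          using cc ac akc k k0 j' by auto
        show "\<ominus> (c k \<otimes> a k j \<otimes> a k0 j') \<oplus> a k0 j \<otimes> c k \<otimes> a k j' = c k \<otimes> b k j'"
          by (simp add: b_def a_minus_def r_distr r_minus m_ac a_ac)
      qed (use cc bc j' K' in auto)
      finally show ?thesis .
    qed
    have "(\<Oplus>k\<in>K. c' k \<otimes> a k j') \<in> I" if j': "j' \<in> insert j J" for j'
    proof (cases "j' = j")
      case True
      have "b k j = \<zero>" if "k \<in> K'" for k
        using that akc ac k0 K' unfolding b_def by (simp add: m_comm r_right_minus_eq)
      then have "(\<Oplus>k\<in>K'. c k \<otimes> b k j) = (\<Oplus>k\<in>K'. \<zero>)"
        using cc by (intro finsum_cong') auto
      then show ?thesis using key[of j] True by simp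
    next
      case False
      then show ?thesis using key[OF j'] c(3) j' by auto
    qed
    moreover have "\<exists>k\<in>K. c' k \<notin> I"
    proof -
      obtain k where k: "k \<in> K'" "c k \<notin> I" using c(2) by blast
      then have "a k0 j \<otimes> c k \<notin> I" using I_prime[of "a k0 j" "c k"] k0 ac cc by auto
      then show ?thesis using k K' by (auto simp: c'_def)
    qed
    ultimately show ?thesis using c'c by blast
  qed
qed

lemma (in module) finsum_smult_closed [simp]:
  "c \<in> K \<rightarrow> carrier R \<Longrightarrow> e \<in> K \<rightarrow> carrier M \<Longrightarrow> (\<Oplus>\<^bsub>M\<^esub>i\<in>K. c i \<odot>\<^bsub>M\<^esub> e i) \<in> carrier M"
  by (rule M.finsum_closed) auto

lemma (in module) diff_smult:
  "a \<in> carrier R \<Longrightarrow> b \<in> carrier R \<Longrightarrow> m \<in> carrier M \<Longrightarrow>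
   (a \<ominus> b) \<odot>\<^bsub>M\<^esub> m = a \<odot>\<^bsub>M\<^esub> m \<ominus>\<^bsub>M\<^esub> b \<odot>\<^bsub>M\<^esub> m"
  by (simp add: a_minus_def smult_l_distr smult_l_minus)

lemma (in abelian_group) minus_eq_zero_iff:
  "a \<in> carrier G \<Longrightarrow> b \<in> carrier G \<Longrightarrow> a \<ominus> b = \<zero> \<longleftrightarrow> a = b"
  by (metis a_minus_def a_inv_closed local.minus_equality minus_minus r_neg)

lemma (in abelian_group) minus_add_cancel:
  "a \<in> carrier G \<Longrightarrow> b \<in> carrier G \<Longrightarrow> (a \<ominus> b) \<oplus> b = a"
  by (simp add: a_minus_def a_assoc l_neg)

text \<open>The properties of A that the pairing argument uses, free of power series;
  \<open>p S\<close> is the prime of the component S. Reducedness is \<open>p_separate\<close>,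
  while \<open>p_minimal\<close> and \<open>J_minimal\<close> bound the ideal of a component and the
  kernel onto \<open>A_S\<close> by their generators. \<open>annihilator\<close> computes the
  homomorphisms from \<open>A_S\<close> to A, and \<open>coprime_powers\<close> is an intersection
  theorem on the component S, where the \<open>x i\<close> with \<open>i\<close> in S are
  nonzerodivisors modulo the powers of \<open>y s\<close>.\<close>

locale crossing = cring A for A (structure) +
  fixes T :: "'i set" and x y :: "'i \<Rightarrow> 'a" and p :: "'i set \<Rightarrow> 'a set"
  assumes finite_T: "finite T"
    and x_closed [simp]: "i \<in> T \<Longrightarrow> x i \<in> carrier A"
    and y_closed [simp]: "i \<in> T \<Longrightarrow> y i \<in> carrier A"
    and p_prime: "S \<subseteq> T \<Longrightarrow> primeideal (p S) A"
    and x_mem: "S \<subseteq> T \<Longrightarrow> i \<in> T - S \<Longrightarrow> x i \<in> p S"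
    and x_nmem: "S \<subseteq> T \<Longrightarrow> i \<in> S \<Longrightarrow> x i \<notin> p S"
    and y_mem: "S \<subseteq> T \<Longrightarrow> i \<in> S \<Longrightarrow> y i \<in> p S"
    and y_nmem: "S \<subseteq> T \<Longrightarrow> i \<in> T - S \<Longrightarrow> y i \<notin> p S"
    and p_separate: "a \<in> carrier A \<Longrightarrow> (\<And>S. S \<subseteq> T \<Longrightarrow> a \<in> p S) \<Longrightarrow> a = \<zero>"
    and p_minimal: "S \<subseteq> T \<Longrightarrow> ideal I A \<Longrightarrow> x ` (T - S) \<subseteq> I \<Longrightarrow> y ` S \<subseteq> I \<Longrightarrow> p S \<subseteq> I"
    and J_minimal: "S \<subseteq> T \<Longrightarrow> ideal I A \<Longrightarrow> x ` (T - S) \<subseteq> I \<Longrightarrow> a \<in> carrier A \<Longrightarrow>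
      (\<And>S'. S' \<subseteq> S \<Longrightarrow> a \<in> p S') \<Longrightarrow> a \<in> I"
    and annihilator: "S \<subseteq> T \<Longrightarrow> a \<in> carrier A \<Longrightarrow> (\<And>i. i \<in> T - S \<Longrightarrow> x i \<otimes> a = \<zero>) \<Longrightarrow>
      \<exists>b\<in>carrier A. a = finprod A y (T - S) \<otimes> b"
    and unit_near_one: "a \<in> carrier A \<Longrightarrow> a \<ominus> \<one> \<in> p {} \<Longrightarrow> a \<in> Units A"
    and coprime_powers: "S \<subseteq> T \<Longrightarrow> s \<in> T - S \<Longrightarrow> a \<in> carrier A \<Longrightarrow>
      (\<And>k::nat. \<exists>d\<in>carrier A. finprod A x S [^] k \<otimes> a \<ominus> y s [^] k \<otimes> d \<in> p S) \<Longrightarrow> a \<in> p S"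
begin

section \<open>Products of variables and the components on which they vanish\<close>

abbreviation xprod :: "'i set \<Rightarrow> 'a" where "xprod S \<equiv> finprod A x S"
abbreviation yprod :: "'i set \<Rightarrow> 'a" where "yprod S \<equiv> finprod A y S"

text \<open>The ideal of the union of the components indexed by the subsets of S. In the concrete
  ring it is the kernel of the projection onto \<open>A_S\<close>, see \<open>J_eq\<close>.\<close>

definition J :: "'i set \<Rightarrow> 'a set" where
  "J S = {a \<in> carrier A. \<forall>S'. S' \<subseteq> S \<longrightarrow> a \<in> p S'}"

lemma finite_sub: "S \<subseteq> T \<Longrightarrow> finite S"
  using finite_T finite_subset by blast

lemma X_closed [simp]: "S \<subseteq> T \<Longrightarrow> xprod S \<in> carrier A"
  by (rule finprod_closed) auto

lemma Y_closed [simp]: "S \<subseteq> T \<Longrightarrow> yprod S \<in> carrier A"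
  by (rule finprod_closed) auto

lemma p_ideal: "S \<subseteq> T \<Longrightarrow> ideal (p S) A"
  using p_prime primeideal.axioms(1) by blast

lemma p_carrier: "S \<subseteq> T \<Longrightarrow> a \<in> p S \<Longrightarrow> a \<in> carrier A"
  by (rule ideal.Icarr[OF p_ideal])

lemma p_zero: "S \<subseteq> T \<Longrightarrow> \<zero> \<in> p S"
  using p_ideal[of S] by (simp add: additive_subgroup.zero_closed ideal.axioms(1))

lemma p_one: "S \<subseteq> T \<Longrightarrow> \<one> \<notin> p S"
  using primeideal.I_notcarr[OF p_prime[of S]] ideal.one_imp_carrier[OF p_ideal[of S]] by blast

lemma p_mult_iff:
  assumes "S \<subseteq> T" "a \<in> carrier A" "b \<in> carrier A"
  shows "a \<otimes> b \<in> p S \<longleftrightarrow> a \<in> p S \<or> b \<in> p S"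
  using assms primeideal.I_prime[OF p_prime] ideal.I_l_closed[OF p_ideal] ideal.I_r_closed[OF p_ideal]
  by metis

lemma p_add: "S \<subseteq> T \<Longrightarrow> a \<in> p S \<Longrightarrow> b \<in> p S \<Longrightarrow> a \<oplus> b \<in> p S"
  using p_ideal by (meson additive_subgroup.a_closed ideal.axioms(1))

lemma p_minus: "S \<subseteq> T \<Longrightarrow> a \<in> p S \<Longrightarrow> b \<in> p S \<Longrightarrow> a \<ominus> b \<in> p S"
  using p_ideal by (simp add: a_minus_def additive_subgroup.a_closed additive_subgroup.a_inv_closed
      ideal.axioms(1))

lemma finprod_p_iff:
  assumes "S \<subseteq> T" "finite K" "f \<in> K \<rightarrow> carrier A"
  shows "finprod A f K \<in> p S \<longleftrightarrow> (\<exists>k\<in>K. f k \<in> p S)"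
  using assms(2,3)
proof (induction K rule: finite_induct)
  case empty
  then show ?case using p_one assms by simp
next
  case (insert k K)
  then show ?case by (simp add: p_mult_iff[OF assms(1)] Pi_def)
qed

lemma x_mem_iff: "S \<subseteq> T \<Longrightarrow> i \<in> T \<Longrightarrow> x i \<in> p S \<longleftrightarrow> i \<notin> S"
  using x_mem x_nmem by blast

lemma y_mem_iff: "S \<subseteq> T \<Longrightarrow> i \<in> T \<Longrightarrow> y i \<in> p S \<longleftrightarrow> i \<in> S"
  using y_mem y_nmem by blast

lemma X_mem_iff: "S \<subseteq> T \<Longrightarrow> K \<subseteq> T \<Longrightarrow> xprod K \<in> p S \<longleftrightarrow> \<not> K \<subseteq> S"
  by (subst finprod_p_iff) (auto simp: finite_sub subset_iff x_mem_iff)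

lemma Y_mem_iff: "S \<subseteq> T \<Longrightarrow> K \<subseteq> T \<Longrightarrow> yprod K \<in> p S \<longleftrightarrow> K \<inter> S \<noteq> {}"
  by (subst finprod_p_iff) (auto simp: finite_sub subset_iff y_mem_iff)

lemma Y_insert:
  assumes "S \<subseteq> T" "s \<in> T - S"
  shows "yprod (T - S) = y s \<otimes> yprod (T - insert s S)"
proof -
  have "T - S = insert s (T - insert s S)" using assms(2) by auto
  then have "yprod (T - S) = yprod (insert s (T - insert s S))" by (rule arg_cong)
  also have "\<dots> = y s \<otimes> yprod (T - insert s S)"
    using assms finite_T by (intro finprod_insert) auto
  finally show ?thesis .
qed

lemma eq_zero_iff: "a \<in> carrier A \<Longrightarrow> a = \<zero> \<longleftrightarrow> (\<forall>S. S \<subseteq> T \<longrightarrow> a \<in> p S)"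
  using p_separate p_zero by blast

lemma eq_iff: "a \<in> carrier A \<Longrightarrow> b \<in> carrier A \<Longrightarrow> a = b \<longleftrightarrow> (\<forall>S. S \<subseteq> T \<longrightarrow> a \<ominus> b \<in> p S)"
  using eq_zero_iff[of "a \<ominus> b"] r_right_minus_eq by simp

lemma J_ideal: "S \<subseteq> T \<Longrightarrow> ideal (J S) A"
proof -
  assume S: "S \<subseteq> T"
  have "J S = \<Inter> (p ` Pow S)"
    using S p_carrier by (auto simp: J_def)
  then show ?thesis
    using S by (auto intro!: i_Intersect p_ideal)
qed

text \<open>The product of the \<open>y i\<close> with \<open>i\<close> outside S vanishes precisely
  on the components not contained in S, so its annihilator consists of the elements vanishing on all
  the others.\<close>

lemma Y_cancel:
  assumes "S \<subseteq> T" "b \<in> carrier A"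
  shows "yprod (T - S) \<otimes> b = \<zero> \<longleftrightarrow> b \<in> J S"
proof -
  have "yprod (T - S) \<otimes> b = \<zero> \<longleftrightarrow> (\<forall>S'. S' \<subseteq> T \<longrightarrow> (T - S) \<inter> S' \<noteq> {} \<or> b \<in> p S')"
    using assms by (subst eq_zero_iff) (auto simp: p_mult_iff Y_mem_iff)
  also have "\<dots> \<longleftrightarrow> b \<in> J S" using assms unfolding J_def by blast
  finally show ?thesis .
qed

lemma J_mono: "S' \<subseteq> S \<Longrightarrow> J S \<subseteq> J S'"
  unfolding J_def by blast

text \<open>The set is the sum of I and the principal ideal of \<open>z\<close>, in the form in
  which \<open>p_insert_cases\<close> and \<open>J_remove_cases\<close> deliver their
  witnesses.\<close>

lemma ideal_sum_cgen:
  assumes "ideal I A" "z \<in> carrier A"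
  shows "ideal {a \<in> carrier A. \<exists>d\<in>carrier A. a \<ominus> z \<otimes> d \<in> I} A"
proof -
  have *: "{a \<in> carrier A. \<exists>d\<in>carrier A. a \<ominus> z \<otimes> d \<in> I} = I <+> (PIdl z)"
  proof (rule Set.set_eqI)
    fix a
    have "a \<in> I <+> (PIdl z) \<longleftrightarrow> (\<exists>i\<in>I. \<exists>d\<in>carrier A. a = i \<oplus> d \<otimes> z)"
      by (auto simp: set_add_def' cgenideal_def)
    also have "\<dots> \<longleftrightarrow> a \<in> carrier A \<and> (\<exists>d\<in>carrier A. a \<ominus> z \<otimes> d \<in> I)"
    proof safe
      fix i d assume h: "i \<in> I" "d \<in> carrier A"
      then have i: "i \<in> carrier A" using assms ideal.Icarr by metis
      then show "i \<oplus> d \<otimes> z \<in> carrier A" using h assms by simp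
      have "i \<oplus> d \<otimes> z \<ominus> z \<otimes> d = i"
        using h i assms by (simp add: a_minus_def a_assoc r_neg m_comm)
      then show "\<exists>da\<in>carrier A. i \<oplus> d \<otimes> z \<ominus> z \<otimes> da \<in> I" using h by metis
    next
      fix d assume h: "a \<in> carrier A" "d \<in> carrier A" "a \<ominus> z \<otimes> d \<in> I"
      have "a = (a \<ominus> z \<otimes> d) \<oplus> d \<otimes> z"
        using h assms by (simp add: a_minus_def a_assoc l_neg m_comm)
      then show "\<exists>i\<in>I. \<exists>d\<in>carrier A. a = i \<oplus> d \<otimes> z" using h by metis
    qed
    finally show "a \<in> {a \<in> carrier A. \<exists>d\<in>carrier A. a \<ominus> z \<otimes> d \<in> I} \<longleftrightarrow> a \<in> I <+> (PIdl z)"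
      by simp
  qed
  show ?thesis unfolding * by (intro add_ideals assms cgenideal_ideal)
qed

lemma ideal_sum_cgen_mem:
  assumes "ideal I A" "z \<in> carrier A"
  shows "a \<in> I \<Longrightarrow> a \<in> {a \<in> carrier A. \<exists>d\<in>carrier A. a \<ominus> z \<otimes> d \<in> I}"
    and "z \<in> {a \<in> carrier A. \<exists>d\<in>carrier A. a \<ominus> z \<otimes> d \<in> I}"
proof -
  assume a: "a \<in> I"
  then have "a \<in> carrier A" using assms ideal.Icarr by metis
  moreover then have "a \<ominus> z \<otimes> \<zero> \<in> I" using a assms by (simp add: a_minus_def)
  ultimately show "a \<in> {a \<in> carrier A. \<exists>d\<in>carrier A. a \<ominus> z \<otimes> d \<in> I}" by blast
next
  have "\<zero> \<in> I" using assms by (simp add: additive_subgroup.zero_closed ideal.axioms(1))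
  moreover have "z \<ominus> z \<otimes> \<one> = \<zero>" using assms(2) by (simp add: a_minus_def r_neg)
  ultimately have "z \<ominus> z \<otimes> \<one> \<in> I" by simp
  then show "z \<in> {a \<in> carrier A. \<exists>d\<in>carrier A. a \<ominus> z \<otimes> d \<in> I}" using assms by blast
qed

text \<open>Among the generators of \<open>p (insert s S)\<close> only \<open>y s\<close> lies
  outside \<open>p S\<close>.\<close>

lemma p_insert_cases:
  assumes S: "S \<subseteq> T" and s: "s \<in> T - S" and a: "a \<in> p (insert s S)"
  obtains d where "d \<in> carrier A" "a \<ominus> y s \<otimes> d \<in> p S"
proof -
  define I where "I = {a \<in> carrier A. \<exists>d\<in>carrier A. a \<ominus> y s \<otimes> d \<in> p S}"
  have ys: "y s \<in> carrier A" using s by simp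
  note mem = ideal_sum_cgen_mem[OF p_ideal[OF S] ys, folded I_def]
  have "p (insert s S) \<subseteq> I"
  proof (rule p_minimal)
    show "ideal I A" unfolding I_def by (rule ideal_sum_cgen[OF p_ideal[OF S] ys])
    show "x ` (T - insert s S) \<subseteq> I"
    proof (rule image_subsetI)
      fix i assume "i \<in> T - insert s S"
      then show "x i \<in> I" using mem(1) x_mem[OF S] by simp
    qed
    show "y ` insert s S \<subseteq> I"
    proof (rule image_subsetI)
      fix i assume "i \<in> insert s S"
      then show "y i \<in> I" using mem y_mem[OF S] by auto
    qed
  qed (use S s in auto)
  then have "a \<in> I" using a by (rule subsetD)
  then show ?thesis unfolding I_def using that by blast
qed

text \<open>Of the \<open>x i\<close> with \<open>i\<close> outside S, which generate
  \<open>J S\<close>, all but \<open>x s\<close> vanish on every component contained in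
  \<open>insert s S\<close>.\<close>

lemma J_remove_cases:
  assumes S: "S \<subseteq> T" and s: "s \<in> T - S" and a: "a \<in> J S"
  obtains d where "d \<in> carrier A" "a \<ominus> x s \<otimes> d \<in> J (insert s S)"
proof -
  define I where "I = {a \<in> carrier A. \<exists>d\<in>carrier A. a \<ominus> x s \<otimes> d \<in> J (insert s S)}"
  have sub: "insert s S \<subseteq> T" using S s by auto
  have xs: "x s \<in> carrier A" using s by simp
  note mem = ideal_sum_cgen_mem[OF J_ideal[OF sub] xs, folded I_def]
  have "a \<in> I"
  proof (rule J_minimal[OF S])
    show "ideal I A" unfolding I_def by (rule ideal_sum_cgen[OF J_ideal[OF sub] xs])
    show "x ` (T - S) \<subseteq> I"
    proof (rule image_subsetI)
      fix i assume i: "i \<in> T - S"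
      show "x i \<in> I"
      proof (cases "i = s")
        case True
        then show ?thesis using mem(2) by simp
      next
        case False
        have "x i \<in> p S'" if "S' \<subseteq> insert s S" for S'
          using that sub i False by (intro x_mem) auto
        then have "x i \<in> J (insert s S)" using i by (simp add: J_def)
        then show ?thesis by (rule mem(1))
      qed
    qed
  qed (use a in \<open>auto simp: J_def\<close>)
  then show ?thesis unfolding I_def using that by blast
qed


text \<open>Linear independence after localization at a point lying on the component S only, where
  \<open>p S\<close> becomes the zero ideal, but phrased by relations over A;
  \<open>lin_indep_loc_iff\<close> gives the translation.\<close>

definition indep :: "('a, 'm) module \<Rightarrow> 'i set \<Rightarrow> nat \<Rightarrow> bool" where
  "indep N S k \<longleftrightarrow> (\<exists>e \<in> {..<k} \<rightarrow> carrier N. \<forall>c \<in> {..<k} \<rightarrow> carrier A.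
     (\<Oplus>\<^bsub>N\<^esub>i\<in>{..<k}. c i \<odot>\<^bsub>N\<^esub> e i) = \<zero>\<^bsub>N\<^esub> \<longrightarrow> (\<forall>i<k. c i \<in> p S))"

text \<open>The product of all \<open>x i\<close> with \<open>i\<close> in S and all
  \<open>y i\<close> with \<open>i\<close> outside S vanishes on every component except S, and there
  \<open>b\<close> vanishes.\<close>

lemma XY_mult_zero:
  assumes "S \<subseteq> T" "b \<in> p S"
  shows "xprod S \<otimes> (yprod (T - S) \<otimes> b) = \<zero>"
proof -
  have b: "b \<in> carrier A" using assms p_carrier by blast
  have "xprod S \<otimes> (yprod (T - S) \<otimes> b) \<in> p S'" if "S' \<subseteq> T" for S'
  proof (cases "S' = S")
    case False
    then have "\<not> S \<subseteq> S' \<or> (T - S) \<inter> S' \<noteq> {}" using that by blast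
    then show ?thesis using assms that b by (auto simp: p_mult_iff X_mem_iff Y_mem_iff)
  qed (use assms b in \<open>simp add: p_mult_iff\<close>)
  then show ?thesis using assms b by (intro p_separate) auto
qed

end

text \<open>A perfect A-valued pairing on a module over A/J S: the map from the left argument to
  functionals is injective and surjective. As the pairing need not be symmetric, orthogonality and
  representation always refer to the left argument.\<close>

locale paired = crossing A T x y p + N: module A N
  for A :: "('a, 'c) ring_scheme" (structure) and T :: "'i set" and x y p and N :: "('a, 'm) module" +
  fixes S :: "'i set" and B :: "'m \<Rightarrow> 'm \<Rightarrow> 'a"
  assumes S_sub: "S \<subseteq> T"
    and J_null: "a \<in> J S \<Longrightarrow> m \<in> carrier N \<Longrightarrow> a \<odot>\<^bsub>N\<^esub> m = \<zero>\<^bsub>N\<^esub>"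
    and B_closed [simp]: "m \<in> carrier N \<Longrightarrow> m' \<in> carrier N \<Longrightarrow> B m m' \<in> carrier A"
    and B_add_left: "m \<in> carrier N \<Longrightarrow> m' \<in> carrier N \<Longrightarrow> w \<in> carrier N \<Longrightarrow>
      B (m \<oplus>\<^bsub>N\<^esub> m') w = B m w \<oplus> B m' w"
    and B_smult_left: "a \<in> carrier A \<Longrightarrow> m \<in> carrier N \<Longrightarrow> w \<in> carrier N \<Longrightarrow>
      B (a \<odot>\<^bsub>N\<^esub> m) w = a \<otimes> B m w"
    and B_add_right: "m \<in> carrier N \<Longrightarrow> m' \<in> carrier N \<Longrightarrow> w \<in> carrier N \<Longrightarrow>
      B w (m \<oplus>\<^bsub>N\<^esub> m') = B w m \<oplus> B w m'"
    and B_smult_right: "a \<in> carrier A \<Longrightarrow> m \<in> carrier N \<Longrightarrow> w \<in> carrier N \<Longrightarrow>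
      B w (a \<odot>\<^bsub>N\<^esub> m) = a \<otimes> B w m"
    and B_nondegenerate: "m \<in> carrier N \<Longrightarrow> (\<And>w. w \<in> carrier N \<Longrightarrow> B m w = \<zero>) \<Longrightarrow> m = \<zero>\<^bsub>N\<^esub>"
    and B_represents: "h \<in> mod_hom A N (self_module A) \<Longrightarrow>
      \<exists>m\<in>carrier N. \<forall>w\<in>carrier N. B m w = h w"
begin

section \<open>Perfect pairings on the module of a single subset\<close>

lemma B_zero_left [simp]: "w \<in> carrier N \<Longrightarrow> B \<zero>\<^bsub>N\<^esub> w = \<zero>"
  using B_smult_left[of \<zero> "\<zero>\<^bsub>N\<^esub>" w] by simp

lemma B_neg_left: "m \<in> carrier N \<Longrightarrow> w \<in> carrier N \<Longrightarrow> B (\<ominus>\<^bsub>N\<^esub> m) w = \<ominus> B m w"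
  using B_smult_left[of "\<ominus> \<one>" m w] by (simp add: N.smult_l_minus l_minus)

lemma B_diff_left: "m \<in> carrier N \<Longrightarrow> m' \<in> carrier N \<Longrightarrow> w \<in> carrier N \<Longrightarrow>
    B (m \<ominus>\<^bsub>N\<^esub> m') w = B m w \<ominus> B m' w"
  by (simp add: a_minus_def B_add_left B_neg_left)

lemma B_finsum_left:
  assumes "finite K" "c \<in> K \<rightarrow> carrier A" "e \<in> K \<rightarrow> carrier N" "w \<in> carrier N"
  shows "B (\<Oplus>\<^bsub>N\<^esub>i\<in>K. c i \<odot>\<^bsub>N\<^esub> e i) w = (\<Oplus>i\<in>K. c i \<otimes> B (e i) w)"
  using assms(1-3)
proof (induction K rule: finite_induct)
  case (insert k K)
  have "B (\<Oplus>\<^bsub>N\<^esub>i\<in>insert k K. c i \<odot>\<^bsub>N\<^esub> e i) w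
      = B (c k \<odot>\<^bsub>N\<^esub> e k \<oplus>\<^bsub>N\<^esub> (\<Oplus>\<^bsub>N\<^esub>i\<in>K. c i \<odot>\<^bsub>N\<^esub> e i)) w"
    using insert by (subst N.M.finsum_insert) auto
  also have "\<dots> = c k \<otimes> B (e k) w \<oplus> (\<Oplus>i\<in>K. c i \<otimes> B (e i) w)"
    using insert assms(4) by (subst B_add_left) (auto simp: B_smult_left Pi_def)
  also have "\<dots> = (\<Oplus>i\<in>insert k K. c i \<otimes> B (e i) w)"
    using insert assms(4) by (subst finsum_insert) (auto simp: Pi_iff)
  finally show ?case .
qed (use assms in simp)

text \<open>If \<open>i\<close> lies in S' but not in S, then \<open>x i\<close> annihilates the
  module without lying in \<open>p S'\<close>.\<close>

lemma B_mem:
  assumes "S' \<subseteq> T" "\<not> S' \<subseteq> S" "m \<in> carrier N" "w \<in> carrier N"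
  shows "B m w \<in> p S'"
proof -
  obtain i where i: "i \<in> S'" "i \<notin> S" using assms by blast
  have iT: "i \<in> T" using i assms by blast
  have "x i \<in> J S"
    using i iT S_sub by (auto simp: J_def intro!: x_mem)
  then have "x i \<otimes> B m w = \<zero>"
    using B_smult_left[of "x i" m w] assms iT by (simp add: J_null)
  then have "x i \<otimes> B m w \<in> p S'" using p_zero assms by simp
  then show ?thesis using assms i iT by (simp add: p_mult_iff x_mem_iff)
qed

lemma B_divisible:
  assumes "m \<in> carrier N" "w \<in> carrier N"
  obtains b where "b \<in> carrier A" "B m w = yprod (T - S) \<otimes> b"
proof -
  have "x i \<otimes> B m w = \<zero>" if "i \<in> T - S" for i
  proof -
    have "x i \<in> J S" using that S_sub by (auto simp: J_def intro!: x_mem)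
    then show ?thesis using B_smult_left[of "x i" m w] assms that by (simp add: J_null)
  qed
  then show ?thesis using annihilator[OF S_sub, of "B m w"] assms that by auto
qed

text \<open>All values are multiples of Y and YA is isomorphic to A/J S, so this is duality in the
  usual sense for the pairing with values in \<open>A_S\<close>.\<close>

definition dual_systems :: "nat \<Rightarrow> (nat \<Rightarrow> 'm) \<Rightarrow> (nat \<Rightarrow> 'm) \<Rightarrow> bool" where
  "dual_systems r e f \<longleftrightarrow> e \<in> {..<r} \<rightarrow> carrier N \<and> f \<in> {..<r} \<rightarrow> carrier N \<and>
     (\<forall>i<r. \<forall>j<r. B (f i) (e j) = (if i = j then yprod (T - S) else \<zero>))"

text \<open>The Gram matrix divided by Y is required to be the identity only modulo
  \<open>p {}\<close>, which is what survives the passage to a larger subset in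
  \<open>almost_dual_lift\<close>.\<close>

definition almost_dual :: "nat \<Rightarrow> (nat \<Rightarrow> 'm) \<Rightarrow> (nat \<Rightarrow> 'm) \<Rightarrow> bool" where
  "almost_dual r e f \<longleftrightarrow> e \<in> {..<r} \<rightarrow> carrier N \<and> f \<in> {..<r} \<rightarrow> carrier N \<and>
     (\<forall>i<r. \<forall>j<r. \<exists>c\<in>carrier A. B (f i) (e j) = yprod (T - S) \<otimes> c \<and>
        c \<ominus> (if i = j then \<one> else \<zero>) \<in> p {})"

text \<open>Gaussian elimination on the Gram matrix, which is congruent to the identity matrix modulo
  the ideal \<open>p {}\<close> and hence has invertible pivots.\<close>

lemma almost_dual_imp_dual_systems:
  assumes "almost_dual r e f"
  shows "\<exists>f'. dual_systems r e f'"
proof -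
  let ?Y = "yprod (T - S)"
  define \<delta> where "\<delta> = (\<lambda>i j::nat. if i = j then \<one> else \<zero>)"
  have [simp]: "\<delta> i j \<in> carrier A" for i j by (simp add: \<delta>_def)
  have Y [simp]: "?Y \<in> carrier A" by simp
  have e: "e j \<in> carrier N" if "j < r" for j using assms that by (auto simp: almost_dual_def)
  have pe: "ideal (p {}) A" by (rule p_ideal) simp
  \<comment> \<open>After \<open>k\<close> rounds the first \<open>k\<close> columns are exact. Only
    row operations on \<open>f\<close> are used, so the vectors \<open>e\<close>, which may be
    prescribed lifts, stay fixed.\<close>
  have "\<exists>f c. (\<forall>i<r. f i \<in> carrier N) \<and> (\<forall>i<r. \<forall>j<r. c i j \<in> carrier A \<and>
      B (f i) (e j) = ?Y \<otimes> c i j \<and> c i j \<ominus> \<delta> i j \<in> p {} \<and> (j < k \<longrightarrow> c i j = \<delta> i j))"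
    if "k \<le> r" for k
    using that
  proof (induction k)
    case 0
    from assms have *: "\<forall>i<r. \<forall>j<r. \<exists>c\<in>carrier A. B (f i) (e j) = yprod (T - S) \<otimes> c \<and>
        c \<ominus> \<delta> i j \<in> p {}" by (simp add: almost_dual_def \<delta>_def)
    obtain c where "\<And>i j. i < r \<Longrightarrow> j < r \<Longrightarrow> c i j \<in> carrier A \<and>
      B (f i) (e j) = ?Y \<otimes> c i j \<and> c i j \<ominus> \<delta> i j \<in> p {}"
      using that[of "\<lambda>i j. SOME c. c \<in> carrier A \<and> B (f i) (e j) = ?Y \<otimes> c \<and> c \<ominus> \<delta> i j \<in> p {}"]
        someI_ex[of "\<lambda>c. c \<in> carrier A \<and> B (f i) (e j) = ?Y \<otimes> c \<and> c \<ominus> \<delta> i j \<in> p {}" for i j] *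
      by (smt (verit, best))
    then show ?case using assms by (intro exI[of _ f] exI[of _ c]) (auto simp: almost_dual_def)
  next
    case (Suc k)
    then have k: "k < r" by simp
    obtain f c where f: "\<And>i. i < r \<Longrightarrow> f i \<in> carrier N"
      and c: "\<And>i j. i < r \<Longrightarrow> j < r \<Longrightarrow> c i j \<in> carrier A"
      and Bf: "\<And>i j. i < r \<Longrightarrow> j < r \<Longrightarrow> B (f i) (e j) = ?Y \<otimes> c i j"
      and near: "\<And>i j. i < r \<Longrightarrow> j < r \<Longrightarrow> c i j \<ominus> \<delta> i j \<in> p {}"
      and exact: "\<And>i j. i < r \<Longrightarrow> j < k \<Longrightarrow> c i j = \<delta> i j"
    proof -
      obtain f c where "\<forall>i<r. f i \<in> carrier N" and *: "\<forall>i<r. \<forall>j<r. c i j \<in> carrier A \<and>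
          B (f i) (e j) = ?Y \<otimes> c i j \<and> c i j \<ominus> \<delta> i j \<in> p {} \<and> (j < k \<longrightarrow> c i j = \<delta> i j)"
        using Suc.IH Suc_leD[OF Suc.prems] by blast
      moreover have "c i j = \<delta> i j" if "i < r" "j < k" for i j
        using * that less_trans[OF that(2) k] by blast
      ultimately show ?thesis using that by blast
    qed
    have off: "c i j \<in> p {}" if "i < r" "j < r" "i \<noteq> j" for i j
      using near[OF that(1,2)] c[OF that(1,2)] that by (simp add: \<delta>_def a_minus_def)
    have "c k k \<in> Units A" using near[OF k k] c[OF k k] by (intro unit_near_one) (simp_all add: \<delta>_def)
    then obtain v where v: "v \<in> carrier A" "v \<otimes> c k k = \<one>" by (metis Units_inv_closed Units_l_inv)
    define f' where "f' = (\<lambda>i. if i = k then v \<odot>\<^bsub>N\<^esub> f k else f i \<ominus>\<^bsub>N\<^esub> c i k \<odot>\<^bsub>N\<^esub> (v \<odot>\<^bsub>N\<^esub> f k))"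
    define c' where "c' = (\<lambda>i j. if i = k then v \<otimes> c k j else c i j \<ominus> c i k \<otimes> (v \<otimes> c k j))"
    have f'c: "f' i \<in> carrier N" if "i < r" for i using that f c v k by (simp add: f'_def)
    have c'c: "c' i j \<in> carrier A" if "i < r" "j < r" for i j using that c v k by (simp add: c'_def)
    have "B (f' i) (e j) = ?Y \<otimes> c' i j" if i: "i < r" and j: "j < r" for i j
    proof -
      have vk: "B (v \<odot>\<^bsub>N\<^esub> f k) (e j) = ?Y \<otimes> (v \<otimes> c k j)"
        using v f[OF k] e[OF j] Bf[OF k j] c[OF k j] by (simp add: B_smult_left m_lcomm)
      have "B (f i \<ominus>\<^bsub>N\<^esub> c i k \<odot>\<^bsub>N\<^esub> (v \<odot>\<^bsub>N\<^esub> f k)) (e j) = ?Y \<otimes> c i j \<ominus> c i k \<otimes> (?Y \<otimes> (v \<otimes> c k j))"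
        using v f[OF k] f[OF i] e[OF j] Bf[OF i j] c[OF i k] vk by (simp add: B_diff_left B_smult_left)
      also have "\<dots> = ?Y \<otimes> (c i j \<ominus> c i k \<otimes> (v \<otimes> c k j))"
        using v c[OF i k] c[OF k j] c[OF i j]
        by (simp add: a_minus_def r_distr r_minus m_lcomm[of "c i k" ?Y])
      finally show ?thesis using vk by (simp add: f'_def c'_def)
    qed
    moreover have "c' i j = \<delta> i j" if i: "i < r" and j: "j < Suc k" for i j
    proof (cases "j = k")
      case True
      then show ?thesis using v c[OF i k] by (auto simp: c'_def \<delta>_def r_right_minus_eq)
    next
      case False
      then have jk: "j < k" using j by simp
      \<comment> \<open>Row \<open>k\<close> already has a zero in column \<open>j\<close>, so
        subtracting its multiples leaves the earlier columns untouched.\<close>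
      then have "c k j = \<zero>" "c i j = \<delta> i j" using exact[OF k jk] exact[OF i jk] False
        by (auto simp: \<delta>_def)
      then show ?thesis using v c[OF i k] jk by (auto simp: c'_def \<delta>_def a_minus_def)
    qed
    moreover have "c' i j \<ominus> \<delta> i j \<in> p {}" if i: "i < r" and j: "j < r" for i j
    proof (cases "i = k")
      case True
      show ?thesis
      proof (cases "j = k")
        case True
        then show ?thesis using \<open>i = k\<close> v p_zero[of "{}"] by (simp add: c'_def \<delta>_def a_minus_def r_neg)
      next
        case False
        then have "v \<otimes> c k j \<in> p {}" using off[OF k j] v ideal.I_l_closed[OF pe] by simp
        then show ?thesis using False True v c[OF k j] by (simp add: c'_def \<delta>_def a_minus_def)
      qed
    next
      case False
      have "c i k \<otimes> (v \<otimes> c k j) \<in> p {}"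
        using off[OF i k False] v c[OF k j] ideal.I_r_closed[OF pe] by simp
      then have "(c i j \<ominus> \<delta> i j) \<ominus> c i k \<otimes> (v \<otimes> c k j) \<in> p {}"
        using near[OF i j] p_minus by simp
      moreover have "(c i j \<ominus> \<delta> i j) \<ominus> c i k \<otimes> (v \<otimes> c k j) = c' i j \<ominus> \<delta> i j"
        using False v c[OF k j] c[OF i k] c[OF i j]
        by (simp add: c'_def a_minus_def a_ac)
      ultimately show ?thesis by simp
    qed
    ultimately show ?case
      using f'c c'c less_SucI by (intro exI[of _ f'] exI[of _ c']) simp
  qed
  from this[OF order_refl] obtain f' c where f': "\<And>i. i < r \<Longrightarrow> f' i \<in> carrier N"
    and c: "\<And>i j. i < r \<Longrightarrow> j < r \<Longrightarrow> B (f' i) (e j) = ?Y \<otimes> c i j \<and> c i j = \<delta> i j" by blast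
  have "dual_systems r e f'"
    using f' c e by (auto simp: dual_systems_def \<delta>_def)
  then show ?thesis by blast
qed

lemma dual_systems_pairing:
  assumes "dual_systems r e f" "c \<in> {..<r} \<rightarrow> carrier A" "j < r"
  shows "B (\<Oplus>\<^bsub>N\<^esub>i\<in>{..<r}. c i \<odot>\<^bsub>N\<^esub> f i) (e j) = yprod (T - S) \<otimes> c j"
proof -
  have "B (\<Oplus>\<^bsub>N\<^esub>i\<in>{..<r}. c i \<odot>\<^bsub>N\<^esub> f i) (e j) = (\<Oplus>i\<in>{..<r}. c i \<otimes> B (f i) (e j))"
    using assms by (intro B_finsum_left) (auto simp: dual_systems_def)
  also have "\<dots> = (\<Oplus>i\<in>{..<r}. if j = i then yprod (T - S) \<otimes> c i else \<zero>)"
    using assms by (intro finsum_cong') (auto simp: dual_systems_def m_comm Pi_def)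
  also have "\<dots> = yprod (T - S) \<otimes> c j"
    using assms by (intro add.finprod_singleton) auto
  finally show ?thesis .
qed

text \<open>The coordinates of \<open>m\<close> are its pairings with the \<open>e j\<close> divided
  by Y. The division is unique only modulo \<open>J S\<close>, which annihilates the module.\<close>

lemma dual_systems_decompose:
  assumes d: "dual_systems r e f" and m: "m \<in> carrier N"
  obtains c n where "c \<in> {..<r} \<rightarrow> carrier A" "n \<in> carrier N"
    "m = (\<Oplus>\<^bsub>N\<^esub>i\<in>{..<r}. c i \<odot>\<^bsub>N\<^esub> f i) \<oplus>\<^bsub>N\<^esub> n" "\<And>j. j < r \<Longrightarrow> B n (e j) = \<zero>"
    "\<And>j. j < r \<Longrightarrow> B m (e j) = yprod (T - S) \<otimes> c j"
proof -
  have e: "e j \<in> carrier N" if "j < r" for j using d that by (auto simp: dual_systems_def)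
  have "\<forall>j\<in>{..<r}. \<exists>c. c \<in> carrier A \<and> B m (e j) = yprod (T - S) \<otimes> c"
    using B_divisible[OF m] e by (metis lessThan_iff)
  then obtain c where c: "\<And>j. j < r \<Longrightarrow> c j \<in> carrier A \<and> B m (e j) = yprod (T - S) \<otimes> c j"
    using bchoice[of "{..<r}"] by (metis lessThan_iff)
  then have cP: "c \<in> {..<r} \<rightarrow> carrier A" by auto
  let ?s = "\<Oplus>\<^bsub>N\<^esub>i\<in>{..<r}. c i \<odot>\<^bsub>N\<^esub> f i"
  have s: "?s \<in> carrier N" using cP d by (intro N.finsum_smult_closed) (auto simp: dual_systems_def)
  have "m = ?s \<oplus>\<^bsub>N\<^esub> (m \<ominus>\<^bsub>N\<^esub> ?s)" using m s
    by (simp add: a_minus_def N.M.a_lcomm[of ?s m] N.M.r_neg)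
  moreover have "B (m \<ominus>\<^bsub>N\<^esub> ?s) (e j) = \<zero>" if "j < r" for j
    using dual_systems_pairing[OF d cP that] c[OF that] m s e[OF that] S_sub
    by (simp add: B_diff_left r_right_minus_eq)
  ultimately show ?thesis using that[of c "m \<ominus>\<^bsub>N\<^esub> ?s"] cP c m s by simp
qed

text \<open>Pairing a relation with \<open>e j\<close> puts the coefficient of \<open>f j\<close>
  into \<open>J S\<close>, which annihilates the module. What remains is a multiple of
  \<open>n\<close>, and pairing it with \<open>w\<close> puts its coefficient into
  \<open>p S'\<close>.\<close>

lemma dual_systems_indep:
  assumes d: "dual_systems r e f" and n: "n \<in> carrier N" "\<And>j. j < r \<Longrightarrow> B n (e j) = \<zero>"
    and w: "w \<in> carrier N" "B n w \<notin> p S'" and S': "S' \<subseteq> S"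
  shows "indep N S' (Suc r)"
proof -
  have S'T: "S' \<subseteq> T" using S' S_sub by blast
  have e: "e j \<in> carrier N" if "j < r" for j using d that by (auto simp: dual_systems_def)
  have f: "f j \<in> carrier N" if "j < r" for j using d that by (auto simp: dual_systems_def)
  define g where "g = (\<lambda>i. if i < r then f i else n)"
  have g: "g \<in> {..<Suc r} \<rightarrow> carrier N" using f n by (auto simp: g_def)
  have "c i \<in> p S'" if c: "c \<in> {..<Suc r} \<rightarrow> carrier A"
    and z: "(\<Oplus>\<^bsub>N\<^esub>i\<in>{..<Suc r}. c i \<odot>\<^bsub>N\<^esub> g i) = \<zero>\<^bsub>N\<^esub>" and i: "i < Suc r" for c i
  proof -
    let ?s = "\<Oplus>\<^bsub>N\<^esub>i\<in>{..<r}. c i \<odot>\<^bsub>N\<^esub> f i"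
    have cr: "c r \<in> carrier A" "c \<in> {..<r} \<rightarrow> carrier A" using c by auto
    have s: "?s \<in> carrier N" using cr f by (intro N.finsum_smult_closed) auto
    have "(\<Oplus>\<^bsub>N\<^esub>i\<in>{..<Suc r}. c i \<odot>\<^bsub>N\<^esub> g i) = c r \<odot>\<^bsub>N\<^esub> g r \<oplus>\<^bsub>N\<^esub> (\<Oplus>\<^bsub>N\<^esub>i\<in>{..<r}. c i \<odot>\<^bsub>N\<^esub> g i)"
      unfolding lessThan_Suc using Pi_mem[OF c] Pi_mem[OF g] by (intro N.M.finsum_insert) auto
    also have "(\<Oplus>\<^bsub>N\<^esub>i\<in>{..<r}. c i \<odot>\<^bsub>N\<^esub> g i) = ?s"
      using cr f by (intro N.M.finsum_cong') (auto simp: g_def)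
    finally have sum: "c r \<odot>\<^bsub>N\<^esub> n \<oplus>\<^bsub>N\<^esub> ?s = \<zero>\<^bsub>N\<^esub>" using z by (simp add: g_def)
    have cJ: "c j \<in> J S" if "j < r" for j
    proof -
      have "B (c r \<odot>\<^bsub>N\<^esub> n \<oplus>\<^bsub>N\<^esub> ?s) (e j) = \<zero>" using sum e[OF that] by simp
      then have "yprod (T - S) \<otimes> c j = \<zero>"
        using cr n e[OF that] s dual_systems_pairing[OF d cr(2) that] n(2)[OF that] S_sub that c
        by (simp add: B_add_left B_smult_left Pi_def)
      then show ?thesis using Y_cancel[OF S_sub, of "c j"] cr(2) that by auto
    qed
    then have "?s = (\<Oplus>\<^bsub>N\<^esub>i\<in>{..<r}. \<zero>\<^bsub>N\<^esub>)"
      using f by (intro N.M.finsum_cong') (auto simp: J_null)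
    then have "c r \<odot>\<^bsub>N\<^esub> n = \<zero>\<^bsub>N\<^esub>" using sum cr n by simp
    then have "c r \<otimes> B n w = \<zero>" using B_smult_left[of "c r" n w] cr n w by simp
    then have "c r \<otimes> B n w \<in> p S'" using p_zero[OF S'T] by simp
    then have "c r \<in> p S'" using w n cr by (simp add: p_mult_iff[OF S'T])
    moreover have "c i \<in> p S'" if "i < r" using cJ[OF that] S' by (simp add: J_def)
    ultimately show ?thesis using i by (cases "i = r") auto
  qed
  then show ?thesis unfolding indep_def using g by blast
qed

text \<open>The pairings of \<open>r + 1\<close> elements with the \<open>r\<close> vectors
  \<open>e j\<close> are linearly dependent modulo \<open>p S\<close>. The corresponding
  combination, multiplied by the product X of the \<open>x i\<close> with \<open>i\<close> in S, is
  orthogonal to every \<open>e j\<close>; hence it pairs to zero on the component S by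
  \<open>null\<close>, and on the others for reasons of support. Nondegeneracy makes it a relation
  with a coefficient outside \<open>p S\<close>.\<close>

lemma not_indepI:
  assumes d: "dual_systems r e f"
    and null: "\<And>z w. z \<in> carrier N \<Longrightarrow> (\<And>j. j < r \<Longrightarrow> B z (e j) = \<zero>) \<Longrightarrow> w \<in> carrier N \<Longrightarrow> B z w \<in> p S"
  shows "\<not> indep N S (Suc r)"
proof
  assume "indep N S (Suc r)"
  then obtain g where g: "g \<in> {..<Suc r} \<rightarrow> carrier N"
    and ind: "\<And>c i. c \<in> {..<Suc r} \<rightarrow> carrier A \<Longrightarrow>
      (\<Oplus>\<^bsub>N\<^esub>i\<in>{..<Suc r}. c i \<odot>\<^bsub>N\<^esub> g i) = \<zero>\<^bsub>N\<^esub> \<Longrightarrow> i < Suc r \<Longrightarrow> c i \<in> p S"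
    unfolding indep_def by blast
  let ?Y = "yprod (T - S)" and ?X = "xprod S"
  have XY: "?X \<in> carrier A" "?Y \<in> carrier A" using S_sub by auto
  have e: "e j \<in> carrier N" if "j < r" for j using d that by (auto simp: dual_systems_def)
  have "\<forall>i\<in>{..<Suc r}. \<forall>j\<in>{..<r}. \<exists>b. b \<in> carrier A \<and> B (g i) (e j) = ?Y \<otimes> b"
    using B_divisible e g by (metis Pi_mem lessThan_iff)
  then obtain a where a: "\<And>i j. i < Suc r \<Longrightarrow> j < r \<Longrightarrow> a i j \<in> carrier A \<and> B (g i) (e j) = ?Y \<otimes> a i j"
    by (metis lessThan_iff)
  have "\<exists>c. c \<in> {..<Suc r} \<rightarrow> carrier A \<and> (\<exists>k\<in>{..<Suc r}. c k \<notin> p S) \<and>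
      (\<forall>j\<in>{..<r}. (\<Oplus>k\<in>{..<Suc r}. c k \<otimes> a k j) \<in> p S)"
    by (rule primeideal.linear_dependence[OF p_prime[OF S_sub]]) (use a in auto)
  then obtain c where c: "c \<in> {..<Suc r} \<rightarrow> carrier A" "\<exists>k\<in>{..<Suc r}. c k \<notin> p S"
    and dep': "\<forall>j\<in>{..<r}. (\<Oplus>k\<in>{..<Suc r}. c k \<otimes> a k j) \<in> p S" by (elim exE conjE) (rule that)
  have dep: "(\<Oplus>k\<in>{..<Suc r}. c k \<otimes> a k j) \<in> p S" if "j < r" for j using dep' that by simp
  define F where "F = (\<Oplus>\<^bsub>N\<^esub>i\<in>{..<Suc r}. c i \<odot>\<^bsub>N\<^esub> g i)"
  have F: "F \<in> carrier N" unfolding F_def using c g by (intro N.finsum_smult_closed)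
  define Z where "Z = ?X \<odot>\<^bsub>N\<^esub> F"
  have Z: "Z \<in> carrier N" using F XY by (simp add: Z_def)
  have BF: "B F (e j) = ?Y \<otimes> (\<Oplus>k\<in>{..<Suc r}. c k \<otimes> a k j)" if j: "j < r" for j
  proof -
    have cc: "c k \<in> carrier A" if "k < Suc r" for k using c that by auto
    have "B F (e j) = (\<Oplus>k\<in>{..<Suc r}. c k \<otimes> B (g k) (e j))"
      unfolding F_def using c g e[OF j] by (intro B_finsum_left) auto
    also have "\<dots> = (\<Oplus>k\<in>{..<Suc r}. ?Y \<otimes> (c k \<otimes> a k j))"
      using cc a j XY by (intro finsum_cong') (auto simp: m_lcomm)
    also have "\<dots> = ?Y \<otimes> (\<Oplus>k\<in>{..<Suc r}. c k \<otimes> a k j)"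
      using cc a j XY by (intro finsum_rdistr[symmetric]) auto
    finally show ?thesis .
  qed
  have "B Z (e j) = \<zero>" if j: "j < r" for j
    using XY_mult_zero[OF S_sub dep[OF j]] BF[OF j] F XY e[OF j] by (simp add: Z_def B_smult_left)
  then have BZ: "B Z w \<in> p S" if "w \<in> carrier N" for w using null[OF Z] that by blast
  have "Z = \<zero>\<^bsub>N\<^esub>"
  proof (rule B_nondegenerate[OF Z])
    fix w assume w: "w \<in> carrier N"
    have BZw: "B Z w = ?X \<otimes> B F w" using F XY w by (simp add: Z_def B_smult_left)
    have "?X \<otimes> B F w \<in> p S'" if S': "S' \<subseteq> T" for S'
    proof (cases "S \<subseteq> S'")
      case True
      show ?thesis
      proof (cases "S' = S")
        case True
        then show ?thesis using BZ[OF w] BZw by simp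
      next
        case False
        then show ?thesis using B_mem[OF S' _ F w] True F w XY S' by (auto simp: p_mult_iff)
      qed
    qed (use F w XY S' S_sub in \<open>auto simp: p_mult_iff X_mem_iff\<close>)
    then show "B Z w = \<zero>" using p_separate[of "B Z w"] BZw F w XY by simp
  qed
  moreover have "Z = (\<Oplus>\<^bsub>N\<^esub>i\<in>{..<Suc r}. (?X \<otimes> c i) \<odot>\<^bsub>N\<^esub> g i)"
  proof -
    have cc: "c k \<in> carrier A" "g k \<in> carrier N" if "k < Suc r" for k using c g that by auto
    have "Z = (\<Oplus>\<^bsub>N\<^esub>i\<in>{..<Suc r}. ?X \<odot>\<^bsub>N\<^esub> (c i \<odot>\<^bsub>N\<^esub> g i))"
      unfolding Z_def F_def using XY cc by (intro N.finsum_smult_ldistr) auto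
    also have "\<dots> = (\<Oplus>\<^bsub>N\<^esub>i\<in>{..<Suc r}. (?X \<otimes> c i) \<odot>\<^bsub>N\<^esub> g i)"
      using XY cc by (intro N.M.finsum_cong') (auto simp: N.smult_assoc1)
    finally show ?thesis .
  qed
  moreover have "(\<lambda>i. ?X \<otimes> c i) \<in> {..<Suc r} \<rightarrow> carrier A" using c XY by auto
  ultimately have "?X \<otimes> c i \<in> p S" if "i < Suc r" for i
    using ind[of "\<lambda>i. ?X \<otimes> c i" i] that by simp
  then have "c i \<in> p S" if "i < Suc r" for i
    using that c XY S_sub by (auto simp: p_mult_iff X_mem_iff Pi_def)
  then show False using c(2) by auto
qed

text \<open>Perfectness allows X z to be divided by \<open>y s\<close> as soon as its pairings can
  be.\<close>

lemma divisible_functional_step: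
  assumes s: "s \<in> T - S" and z: "z \<in> carrier N"
    and div: "\<And>w. w \<in> carrier N \<Longrightarrow> \<exists>d\<in>carrier A. B z w \<ominus> y s \<otimes> (yprod (T - S) \<otimes> d) \<in> p S"
  shows "\<exists>z'\<in>carrier N. y s \<odot>\<^bsub>N\<^esub> z' = xprod S \<odot>\<^bsub>N\<^esub> z \<and>
    (\<forall>w\<in>carrier N. B z w = \<zero> \<longrightarrow> B z' w = \<zero>)"
proof -
  let ?Y = "yprod (T - S)" and ?X = "xprod S"
  have XY: "?X \<in> carrier A" "?Y \<in> carrier A" "y s \<in> carrier A" using S_sub s by auto
  have ys: "y s \<notin> p S" using s S_sub y_nmem by blast
  \<comment> \<open>\<open>q\<close> is the quotient by \<open>y s\<close>, normalized to vanish on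
    all components except S. On S the element \<open>y s\<close> is a nonzerodivisor, so
    \<open>q\<close> is unique; without the normalization it would be determined only up to the
    annihilator of \<open>y s\<close>, and the choice \<open>h\<close> below need not be
    linear.\<close>
  define Q where "Q = (\<lambda>w q. q \<in> carrier A \<and> y s \<otimes> q = ?X \<otimes> B z w \<and> (\<forall>S'. S' \<subseteq> T \<and> S' \<noteq> S \<longrightarrow> q \<in> p S'))"
  have ex: "\<exists>q. Q w q" if w: "w \<in> carrier N" for w
  proof -
    obtain d where d: "d \<in> carrier A" "B z w \<ominus> y s \<otimes> (?Y \<otimes> d) \<in> p S" using div[OF w] by blast
    \<comment> \<open>The product of X and Y vanishes on all components except S, so the quotient X
      Y d is normalized.\<close>
    have "?X \<otimes> (?Y \<otimes> d) \<in> p S'" if "S' \<subseteq> T" "S' \<noteq> S" for S'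
    proof -
      have "\<not> S \<subseteq> S' \<or> (T - S) \<inter> S' \<noteq> {}" using that by blast
      then show ?thesis using d that XY S_sub by (auto simp: p_mult_iff X_mem_iff Y_mem_iff)
    qed
    moreover have "y s \<otimes> (?X \<otimes> (?Y \<otimes> d)) = ?X \<otimes> B z w"
    proof -
      have "y s \<otimes> (?X \<otimes> (?Y \<otimes> d)) \<ominus> ?X \<otimes> B z w \<in> p S'" if S': "S' \<subseteq> T" for S'
      proof -
        have eq: "y s \<otimes> (?X \<otimes> (?Y \<otimes> d)) \<ominus> ?X \<otimes> B z w = \<ominus> (?X \<otimes> (B z w \<ominus> y s \<otimes> (?Y \<otimes> d)))"
          using d z w XY by (simp add: a_minus_def r_distr r_minus m_lcomm[of ?X "y s"] minus_add a_comm)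
        have "?X \<otimes> (B z w \<ominus> y s \<otimes> (?Y \<otimes> d)) \<in> p S'"
        proof (cases "S \<subseteq> S'")
          case True
          show ?thesis
          proof (cases "S' = S")
            case True
            then show ?thesis using d z w XY S_sub by (simp add: p_mult_iff)
          next
            case False
            then have "(T - S) \<inter> S' \<noteq> {}" using True S' by blast
            then have "y s \<otimes> (?Y \<otimes> d) \<in> p S'" using d XY S' by (simp add: p_mult_iff Y_mem_iff)
            moreover have "B z w \<in> p S'" using B_mem[OF S' _ z w] True False by blast
            ultimately show ?thesis using p_minus[OF S'] d z w XY S' by (simp add: p_mult_iff)
          qed
        next
          case False
          then show ?thesis using d z w XY S' S_sub by (simp add: p_mult_iff X_mem_iff)
        qed
        then show ?thesis unfolding eq using p_ideal[OF S']
          by (simp add: additive_subgroup.a_inv_closed ideal.axioms(1))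
      qed
      then show ?thesis using d z w XY by (subst eq_iff) auto
    qed
    ultimately show ?thesis unfolding Q_def using d XY by (intro exI[of _ "?X \<otimes> (?Y \<otimes> d)"]) auto
  qed
  have uniq: "q = q'" if "Q w q" "Q w q'" "w \<in> carrier N" for w q q'
  proof -
    have q: "q \<in> carrier A" "q' \<in> carrier A" using that by (auto simp: Q_def)
    have "q \<ominus> q' \<in> p S'" if S': "S' \<subseteq> T" for S'
    proof (cases "S' = S")
      case True
      have "y s \<otimes> (q \<ominus> q') = y s \<otimes> q \<ominus> y s \<otimes> q'"
        using q XY by (simp add: a_minus_def r_distr r_minus)
      also have "\<dots> = \<zero>" using \<open>Q w q\<close> \<open>Q w q'\<close> XY \<open>w \<in> carrier N\<close> z q
        by (simp add: Q_def r_right_minus_eq)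
      finally have "y s \<otimes> (q \<ominus> q') \<in> p S" using p_zero[OF S_sub] by simp
      then show ?thesis using True ys q XY S_sub by (simp add: p_mult_iff)
    qed (use \<open>Q w q\<close> \<open>Q w q'\<close> p_minus S' in \<open>auto simp: Q_def\<close>)
    then show ?thesis using eq_iff[OF q] by blast
  qed
  define h where "h = (\<lambda>w. SOME q. Q w q)"
  have h: "Q w (h w)" if "w \<in> carrier N" for w unfolding h_def using ex[OF that] by (rule someI_ex)
  have "h \<in> mod_hom A N (self_module A)"
  proof -
    have "h (w \<oplus>\<^bsub>N\<^esub> w') = h w \<oplus> h w'" if w: "w \<in> carrier N" "w' \<in> carrier N" for w w'
    proof (rule uniq)
      show "Q (w \<oplus>\<^bsub>N\<^esub> w') (h (w \<oplus>\<^bsub>N\<^esub> w'))" using h w by simp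
      show "Q (w \<oplus>\<^bsub>N\<^esub> w') (h w \<oplus> h w')"
        using h[OF w(1)] h[OF w(2)] w z XY by (auto simp: Q_def r_distr B_add_right p_add)
    qed (use w in simp)
    moreover have "h (a \<odot>\<^bsub>N\<^esub> w) = a \<otimes> h w" if w: "w \<in> carrier N" "a \<in> carrier A" for w a
    proof (rule uniq)
      show "Q (a \<odot>\<^bsub>N\<^esub> w) (h (a \<odot>\<^bsub>N\<^esub> w))" using h w by simp
      show "Q (a \<odot>\<^bsub>N\<^esub> w) (a \<otimes> h w)"
        using h[OF w(1)] w z XY by (auto simp: Q_def B_smult_right m_lcomm[of _ a] p_mult_iff)
    qed (use w in simp)
    ultimately show ?thesis using h by (auto simp: mod_hom_def self_module_def Q_def)
  qed
  then obtain z' where z': "z' \<in> carrier N" "\<And>w. w \<in> carrier N \<Longrightarrow> B z' w = h w"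
    using B_represents by blast
  have "y s \<odot>\<^bsub>N\<^esub> z' \<ominus>\<^bsub>N\<^esub> ?X \<odot>\<^bsub>N\<^esub> z = \<zero>\<^bsub>N\<^esub>"
  proof (rule B_nondegenerate)
    fix w assume w: "w \<in> carrier N"
    then have "y s \<otimes> h w = ?X \<otimes> B z w" using h by (simp add: Q_def)
    then show "B (y s \<odot>\<^bsub>N\<^esub> z' \<ominus>\<^bsub>N\<^esub> ?X \<odot>\<^bsub>N\<^esub> z) w = \<zero>"
      using z z' w XY by (simp add: B_diff_left B_smult_left r_right_minus_eq)
  qed (use z z' XY in simp)
  then have "y s \<odot>\<^bsub>N\<^esub> z' = ?X \<odot>\<^bsub>N\<^esub> z" using z z' XY by (simp add: N.M.minus_eq_zero_iff)
  moreover have "B z' w = \<zero>" if "w \<in> carrier N" "B z w = \<zero>" for w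
  proof -
    \<comment> \<open>Zero is the normalized quotient when the pairing of \<open>z\<close> with
      \<open>w\<close> vanishes, so by uniqueness \<open>z'\<close> inherits the orthogonality of
      \<open>z\<close>.\<close>
    have "Q w \<zero>" using that XY p_zero by (simp add: Q_def)
    then show ?thesis using uniq[OF h[OF that(1)]] that z' by simp
  qed
  ultimately show ?thesis using z' by blast
qed

text \<open>Each vector produced by the previous lemma is orthogonal to the \<open>e j\<close> again
  and so meets the hypothesis \<open>div\<close> itself. After \<open>k\<close> rounds X^k z is a
  multiple of the k-th power of \<open>y s\<close>, and so are its pairings.\<close>

lemma divisible_pairing_vanishes:
  assumes s: "s \<in> T - S"
    and div: "\<And>z w. z \<in> carrier N \<Longrightarrow> (\<And>j. j < r \<Longrightarrow> B z (e j) = \<zero>) \<Longrightarrow> w \<in> carrier N \<Longrightarrow>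
      \<exists>d\<in>carrier A. B z w \<ominus> y s \<otimes> (yprod (T - S) \<otimes> d) \<in> p S"
    and e: "\<And>j::nat. j < r \<Longrightarrow> e j \<in> carrier N"
    and z: "z \<in> carrier N" "\<And>j. j < r \<Longrightarrow> B z (e j) = \<zero>" and w: "w \<in> carrier N"
  shows "B z w \<in> p S"
proof (rule coprime_powers[OF S_sub s])
  have ys: "y s \<in> carrier A" "xprod S \<in> carrier A" using s S_sub by auto
  fix k :: nat
  have "\<exists>z'\<in>carrier N. (\<forall>j<r. B z' (e j) = \<zero>) \<and> y s [^] k \<odot>\<^bsub>N\<^esub> z' = xprod S [^] k \<odot>\<^bsub>N\<^esub> z"
  proof (induction k)
    case 0
    then show ?case using z by (intro bexI[of _ z]) auto
  next
    case (Suc k)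
    then obtain z' where z': "z' \<in> carrier N" "\<And>j. j < r \<Longrightarrow> B z' (e j) = \<zero>"
      "y s [^] k \<odot>\<^bsub>N\<^esub> z' = xprod S [^] k \<odot>\<^bsub>N\<^esub> z" by blast
    obtain z'' where z'': "z'' \<in> carrier N" "y s \<odot>\<^bsub>N\<^esub> z'' = xprod S \<odot>\<^bsub>N\<^esub> z'"
      "\<And>j. j < r \<Longrightarrow> B z'' (e j) = \<zero>"
      using divisible_functional_step[OF s z'(1) div[OF z'(1,2)]] z'(2) e by blast
    have "y s [^] Suc k \<odot>\<^bsub>N\<^esub> z'' = y s [^] k \<odot>\<^bsub>N\<^esub> (xprod S \<odot>\<^bsub>N\<^esub> z')"
      using ys z'' by (simp add: N.smult_assoc1)
    also have "\<dots> = xprod S \<odot>\<^bsub>N\<^esub> (y s [^] k \<odot>\<^bsub>N\<^esub> z')"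
      using ys z'(1) by (simp flip: N.smult_assoc1 add: m_comm)
    also have "\<dots> = xprod S [^] Suc k \<odot>\<^bsub>N\<^esub> z"
      unfolding z'(3) using ys z by (subst N.smult_assoc1[symmetric]) (auto simp: m_comm)
    finally show ?case using z'' by blast
  qed
  then obtain z' where z': "z' \<in> carrier N" "y s [^] k \<odot>\<^bsub>N\<^esub> z' = xprod S [^] k \<odot>\<^bsub>N\<^esub> z" by blast
  have "xprod S [^] k \<otimes> B z w = y s [^] k \<otimes> B z' w"
    using B_smult_left[of "xprod S [^] k" z w] B_smult_left[of "y s [^] k" z' w] z z' w ys by simp
  then have "xprod S [^] k \<otimes> B z w \<ominus> y s [^] k \<otimes> B z' w = \<zero>"
    using z' w ys by (simp add: r_right_minus_eq)
  then show "\<exists>d\<in>carrier A. xprod S [^] k \<otimes> B z w \<ominus> y s [^] k \<otimes> d \<in> p S"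
    using z' w p_zero[OF S_sub] by (intro bexI[of _ "B z' w"]) auto
qed (use z w in simp)

end

text \<open>\<open>N'\<close> belongs to S and \<open>N\<close> to \<open>insert s S\<close>.
  \<open>\<pi>_null\<close> expresses that \<open>\<pi>\<close> is injective at the components
  contained in S. In \<open>\<pi>_adjoint\<close> the element \<open>w\<close> corresponds by
  self-duality to the image of \<open>z\<close> under the transpose of \<open>\<pi>\<close>, and its
  image under \<open>\<pi>\<close> is given by the hypothesis on the composition.\<close>

locale adjacent = crossing A T x y p + P: paired A T x y p N' S B' + Q: paired A T x y p N "insert s S" B
  for A :: "('a, 'c) ring_scheme" (structure) and T :: "'i set" and x y p
    and N' :: "('a, 'm) module" and S B' and N :: "('a, 'm) module" and s B +
  fixes \<pi> :: "'m \<Rightarrow> 'm"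
  assumes s: "s \<in> T - S"
    and \<pi>_closed [simp]: "m \<in> carrier N \<Longrightarrow> \<pi> m \<in> carrier N'"
    and \<pi>_add: "m \<in> carrier N \<Longrightarrow> m' \<in> carrier N \<Longrightarrow> \<pi> (m \<oplus>\<^bsub>N\<^esub> m') = \<pi> m \<oplus>\<^bsub>N'\<^esub> \<pi> m'"
    and \<pi>_smult: "a \<in> carrier A \<Longrightarrow> m \<in> carrier N \<Longrightarrow> \<pi> (a \<odot>\<^bsub>N\<^esub> m) = a \<odot>\<^bsub>N'\<^esub> \<pi> m"
    and \<pi>_surj: "z \<in> carrier N' \<Longrightarrow> \<exists>m\<in>carrier N. \<pi> m = z"
    and \<pi>_null: "m \<in> carrier N \<Longrightarrow> \<pi> m = \<zero>\<^bsub>N'\<^esub> \<Longrightarrow> S' \<subseteq> S \<Longrightarrow>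
      \<exists>a\<in>carrier A. a \<notin> p S' \<and> a \<odot>\<^bsub>N\<^esub> m = \<zero>\<^bsub>N\<^esub>"
    and \<pi>_adjoint: "z \<in> carrier N' \<Longrightarrow>
      \<exists>w\<in>carrier N. (\<forall>m\<in>carrier N. B w m = B' z (\<pi> m)) \<and> \<pi> w = y s \<odot>\<^bsub>N'\<^esub> z"
begin

section \<open>Two adjacent subsets\<close>

lemma \<pi>_neg: "m \<in> carrier N \<Longrightarrow> \<pi> (\<ominus>\<^bsub>N\<^esub> m) = \<ominus>\<^bsub>N'\<^esub> \<pi> m"
  using \<pi>_smult[of "\<ominus> \<one>" m] by (simp add: P.N.smult_l_minus Q.N.smult_l_minus)

lemma \<pi>_diff: "m \<in> carrier N \<Longrightarrow> m' \<in> carrier N \<Longrightarrow> \<pi> (m \<ominus>\<^bsub>N\<^esub> m') = \<pi> m \<ominus>\<^bsub>N'\<^esub> \<pi> m'"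
  by (simp add: a_minus_def \<pi>_add \<pi>_neg)

lemma s_closed [simp]: "y s \<in> carrier A" "x s \<in> carrier A"
  using s by auto

text \<open>Let \<open>w\<close> correspond to the functional pairing \<open>\<pi> m\<close> with
  \<open>\<pi>\<close> of the argument. Then \<open>w\<close> and \<open>y s\<close> times
  \<open>m\<close> have the same image under \<open>\<pi>\<close>, so their difference is locally
  zero on the components contained in S. On the components containing \<open>s\<close> both sides of
  the claim vanish, one because of \<open>y s\<close> and the other because \<open>x s\<close>
  annihilates \<open>N'\<close>.\<close>

lemma y_pairing:
  assumes m: "m \<in> carrier N" "m' \<in> carrier N"
  shows "y s \<otimes> B m m' = B' (\<pi> m) (\<pi> m')"
proof -
  obtain w where w: "w \<in> carrier N" "\<And>m'. m' \<in> carrier N \<Longrightarrow> B w m' = B' (\<pi> m) (\<pi> m')"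
    "\<pi> w = y s \<odot>\<^bsub>N'\<^esub> \<pi> m"
    using \<pi>_adjoint[of "\<pi> m"] m by auto
  define v where "v = w \<ominus>\<^bsub>N\<^esub> y s \<odot>\<^bsub>N\<^esub> m"
  have v: "v \<in> carrier N" using w m by (simp add: v_def)
  have \<pi>v: "\<pi> v = \<zero>\<^bsub>N'\<^esub>"
    using w m by (simp add: v_def \<pi>_diff \<pi>_smult P.N.M.minus_eq_zero_iff)
  have Bv: "B v m' = B' (\<pi> m) (\<pi> m') \<ominus> y s \<otimes> B m m'"
    using w m by (simp add: v_def Q.B_diff_left Q.B_smult_left)
  have "B v m' \<in> p S'" if S': "S' \<subseteq> T" for S'
  proof -
    consider "S' \<subseteq> S" | "S' \<subseteq> insert s S" "s \<in> S'" | "\<not> S' \<subseteq> insert s S" by blast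
    then show ?thesis
    proof cases
      case 1
      then obtain a where a: "a \<in> carrier A" "a \<notin> p S'" "a \<odot>\<^bsub>N\<^esub> v = \<zero>\<^bsub>N\<^esub>"
        using \<pi>_null[OF v \<pi>v] by blast
      then have "a \<otimes> B v m' = \<zero>" using Q.B_smult_left[of a v m'] v m by simp
      then have "a \<otimes> B v m' \<in> p S'" using p_zero[OF S'] by simp
      then show ?thesis using a v m by (simp add: p_mult_iff[OF S'])
    next
      case 2
      have "x s \<in> J S" using s P.S_sub by (auto simp: J_def intro!: x_mem)
      then have "x s \<otimes> B' (\<pi> m) (\<pi> m') = \<zero>"
        using P.B_smult_left[of "x s" "\<pi> m" "\<pi> m'"] m by (simp add: P.J_null)
      then have "x s \<otimes> B' (\<pi> m) (\<pi> m') \<in> p S'" using p_zero[OF S'] by simp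
      then have "B' (\<pi> m) (\<pi> m') \<in> p S'"
        using x_nmem[OF S' 2(2)] m by (simp add: p_mult_iff[OF S'])
      moreover have "y s \<otimes> B m m' \<in> p S'" using y_mem[OF S' 2(2)] m by (simp add: p_mult_iff[OF S'])
      ultimately show ?thesis using Bv p_minus[OF S'] by simp
    next
      case 3
      then show ?thesis using Q.B_mem[OF S' _ v] m by blast
    qed
  qed
  then have "B v m' = \<zero>" using v m by (intro p_separate) auto
  then show ?thesis using Bv m r_right_minus_eq[of "B' (\<pi> m) (\<pi> m')" "y s \<otimes> B m m'"] by simp
qed

text \<open>By \<open>y_pairing\<close> the cofactors \<open>b\<close> and \<open>c\<close> of a new
  and an old pairing agree after multiplication by the product Y for S, that is, modulo
  \<open>J S\<close>. This is contained in \<open>p {}\<close>, so the congruence survives although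
  equality does not.\<close>

lemma almost_dual_lift:
  assumes "P.almost_dual r e' f'"
  shows "\<exists>e f. Q.almost_dual r e f \<and> (\<forall>j<r. \<pi> (e j) = e' j)"
proof -
  have e': "e' j \<in> carrier N'" "f' j \<in> carrier N'" if "j < r" for j
    using assms that by (auto simp: P.almost_dual_def)
  define e where "e = (\<lambda>j. SOME m. m \<in> carrier N \<and> \<pi> m = e' j)"
  define f where "f = (\<lambda>j. SOME m. m \<in> carrier N \<and> \<pi> m = f' j)"
  have e: "e j \<in> carrier N" "\<pi> (e j) = e' j" if "j < r" for j
    using someI_ex[of "\<lambda>m. m \<in> carrier N \<and> \<pi> m = e' j"] \<pi>_surj[OF e'(1)[OF that]]
    unfolding e_def by blast+
  have f: "f j \<in> carrier N" "\<pi> (f j) = f' j" if "j < r" for j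
    using someI_ex[of "\<lambda>m. m \<in> carrier N \<and> \<pi> m = f' j"] \<pi>_surj[OF e'(2)[OF that]]
    unfolding f_def by blast+
  have "\<exists>c\<in>carrier A. B (f i) (e j) = yprod (T - insert s S) \<otimes> c \<and>
        c \<ominus> (if i = j then \<one> else \<zero>) \<in> p {}" if ij: "i < r" "j < r" for i j
  proof -
    obtain c where c: "c \<in> carrier A" "B' (f' i) (e' j) = yprod (T - S) \<otimes> c"
      "c \<ominus> (if i = j then \<one> else \<zero>) \<in> p {}"
      using assms ij unfolding P.almost_dual_def by blast
    obtain b where b: "b \<in> carrier A" "B (f i) (e j) = yprod (T - insert s S) \<otimes> b"
      using Q.B_divisible[OF f(1) e(1)] ij by blast
    have "yprod (T - S) \<otimes> b = y s \<otimes> B (f i) (e j)"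
      using b Y_insert[OF P.S_sub s] Q.S_sub by (simp add: m_assoc)
    also have "\<dots> = yprod (T - S) \<otimes> c" using y_pairing[OF f(1) e(1)] f e ij c by simp
    finally have "yprod (T - S) \<otimes> (b \<ominus> c) = \<zero>"
      using b c P.S_sub by (simp add: a_minus_def r_distr r_minus r_neg)
    then have "b \<ominus> c \<in> p {}" using Y_cancel[OF P.S_sub, of "b \<ominus> c"] b c by (simp add: J_def)
    then have "(b \<ominus> c) \<oplus> (c \<ominus> (if i = j then \<one> else \<zero>)) \<in> p {}" using c p_add by simp
    moreover have "(b \<ominus> c) \<oplus> (c \<ominus> d) = b \<ominus> d" if "d \<in> carrier A" for d
      using b c that by (simp add: a_minus_def a_assoc r_neg2 r_neg1)
    ultimately show ?thesis using b by auto
  qed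
  then have "Q.almost_dual r e f" using e f by (auto simp: Q.almost_dual_def)
  then show ?thesis using e by blast
qed

text \<open>The rank bound over \<open>insert s S\<close> makes the part orthogonal to the
  \<open>e j\<close> pair into \<open>p (insert s S)\<close>, which is contained in
  \<open>p S\<close> plus the multiples of \<open>y s\<close>. This is one factor
  \<open>y s\<close>. Passing to the pairing on \<open>N'\<close> multiplies by a second one, which
  is absorbed in the Y for S; the first is the surplus that
  \<open>divisible_pairing_vanishes\<close> iterates.\<close>

lemma not_indep_descend:
  assumes dP: "P.dual_systems r e' f'" and dQ: "Q.dual_systems r e f"
    and lift: "\<And>j. j < r \<Longrightarrow> \<pi> (e j) = e' j"
    and ni: "\<not> indep N (insert s S) (Suc r)"
  shows "\<not> indep N' S (Suc r)"
proof (rule P.not_indepI[OF dP])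
  let ?Y = "yprod (T - S)" and ?Y' = "yprod (T - insert s S)"
  have Y: "?Y = y s \<otimes> ?Y'" using Y_insert[OF P.S_sub s] .
  have Yc: "?Y' \<in> carrier A" "?Y \<in> carrier A" by auto
  have ec: "e j \<in> carrier N" "f j \<in> carrier N" if "j < r" for j
    using dQ that by (auto simp: Q.dual_systems_def)
  have e'c: "e' j \<in> carrier N'" if "j < r" for j using dP that by (auto simp: P.dual_systems_def)
  fix z w assume z: "z \<in> carrier N'" "\<And>j. j < r \<Longrightarrow> B' z (e' j) = \<zero>" and w: "w \<in> carrier N'"
  show "B' z w \<in> p S"
  proof (rule P.divisible_pairing_vanishes[OF s _ e'c z w])
    fix z w' assume z: "z \<in> carrier N'" "\<And>j. j < r \<Longrightarrow> B' z (e' j) = \<zero>" and w': "w' \<in> carrier N'"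
    obtain m where m: "m \<in> carrier N" "\<pi> m = z" using \<pi>_surj[OF z(1)] by blast
    obtain w where w: "w \<in> carrier N" "\<pi> w = w'" using \<pi>_surj[OF w'] by blast
    obtain c n where c: "c \<in> {..<r} \<rightarrow> carrier A" and n: "n \<in> carrier N" "\<And>j. j < r \<Longrightarrow> B n (e j) = \<zero>"
      and m_eq: "m = (\<Oplus>\<^bsub>N\<^esub>i\<in>{..<r}. c i \<odot>\<^bsub>N\<^esub> f i) \<oplus>\<^bsub>N\<^esub> n"
      and Bm: "\<And>j. j < r \<Longrightarrow> B m (e j) = ?Y' \<otimes> c j"
      by (rule Q.dual_systems_decompose[OF dQ m(1)]) (rule that; assumption)
    \<comment> \<open>As \<open>z\<close> is orthogonal to the \<open>e' j\<close>, the coordinates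
      of its lift lie in \<open>J S\<close>, hence are multiples of \<open>x s\<close> up to
      elements annihilating the module. The combination of the \<open>f j\<close> is thus invisible
      on the component S, where \<open>x s\<close> vanishes.\<close>
    have "\<exists>d. d \<in> carrier A \<and> c j \<odot>\<^bsub>N\<^esub> f j = x s \<odot>\<^bsub>N\<^esub> (d \<odot>\<^bsub>N\<^esub> f j)" if j: "j < r" for j
    proof -
      have cj: "c j \<in> carrier A" using c j by auto
      have "?Y \<otimes> c j = y s \<otimes> B m (e j)" using Y Bm[OF j] cj Yc by (simp add: m_assoc)
      also have "\<dots> = \<zero>" using y_pairing[OF m(1) ec(1)[OF j]] m lift[OF j] z(2)[OF j] by simp
      finally have "c j \<in> J S" using Y_cancel[OF P.S_sub cj] by simp
      then obtain d where d: "d \<in> carrier A" "c j \<ominus> x s \<otimes> d \<in> J (insert s S)"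
        using J_remove_cases[OF P.S_sub s] by blast
      have "(c j \<ominus> x s \<otimes> d) \<odot>\<^bsub>N\<^esub> f j = \<zero>\<^bsub>N\<^esub>" using Q.J_null[OF d(2)] ec j by simp
      then have "c j \<odot>\<^bsub>N\<^esub> f j = (x s \<otimes> d) \<odot>\<^bsub>N\<^esub> f j"
        using d cj ec(2)[OF j] by (simp add: Q.N.diff_smult Q.N.M.minus_eq_zero_iff)
      then show ?thesis using d ec(2)[OF j] by (auto simp: Q.N.smult_assoc1)
    qed
    then obtain d where d: "\<And>j. j < r \<Longrightarrow> d j \<in> carrier A"
      "\<And>j. j < r \<Longrightarrow> c j \<odot>\<^bsub>N\<^esub> f j = x s \<odot>\<^bsub>N\<^esub> (d j \<odot>\<^bsub>N\<^esub> f j)" by metis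
    define m1 where "m1 = (\<Oplus>\<^bsub>N\<^esub>i\<in>{..<r}. d i \<odot>\<^bsub>N\<^esub> f i)"
    have m1: "m1 \<in> carrier N" unfolding m1_def using d ec by (intro Q.N.finsum_smult_closed) auto
    have "(\<Oplus>\<^bsub>N\<^esub>i\<in>{..<r}. c i \<odot>\<^bsub>N\<^esub> f i) = (\<Oplus>\<^bsub>N\<^esub>i\<in>{..<r}. x s \<odot>\<^bsub>N\<^esub> (d i \<odot>\<^bsub>N\<^esub> f i))"
      using d ec by (intro Q.N.M.finsum_cong') auto
    also have "\<dots> = x s \<odot>\<^bsub>N\<^esub> m1"
      unfolding m1_def using d ec by (intro Q.N.finsum_smult_ldistr[symmetric]) auto
    finally have m_eq': "m = x s \<odot>\<^bsub>N\<^esub> m1 \<oplus>\<^bsub>N\<^esub> n" using m_eq by simp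
    obtain b where b: "b \<in> carrier A" "B m1 w = ?Y' \<otimes> b" using Q.B_divisible[OF m1 w(1)] .
    obtain a where a: "a \<in> carrier A" "B m w = ?Y' \<otimes> a" using Q.B_divisible[OF m(1) w(1)] .
    have "B n w \<in> p (insert s S)" using Q.dual_systems_indep[OF dQ n w(1)] ni by blast
    moreover have "B n w = ?Y' \<otimes> (a \<ominus> x s \<otimes> b)"
    proof -
      have "?Y' \<otimes> a = x s \<otimes> (?Y' \<otimes> b) \<oplus> B n w"
        using m_eq' m1 n(1) w a b by (simp add: Q.B_add_left Q.B_smult_left)
      then have "?Y' \<otimes> a \<ominus> x s \<otimes> (?Y' \<otimes> b) = B n w"
        using n(1) w b Yc by (simp add: a_minus_def a_ac r_neg r_neg1)
      then show ?thesis using a b Yc by (simp add: a_minus_def r_distr r_minus m_lcomm)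
    qed
    ultimately have "?Y' \<otimes> (a \<ominus> x s \<otimes> b) \<in> p (insert s S)" by simp
    then have "a \<ominus> x s \<otimes> b \<in> p (insert s S)"
      using a b Q.S_sub by (auto simp: p_mult_iff Y_mem_iff)
    then obtain t where t: "t \<in> carrier A" "a \<ominus> x s \<otimes> b \<ominus> y s \<otimes> t \<in> p S"
      using p_insert_cases[OF P.S_sub s] by blast
    have "x s \<otimes> b \<in> p S" using x_mem[OF P.S_sub s] b by (simp add: p_mult_iff[OF P.S_sub])
    then have "(a \<ominus> x s \<otimes> b \<ominus> y s \<otimes> t) \<oplus> x s \<otimes> b \<in> p S" using t p_add[OF P.S_sub] by blast
    moreover have "(a \<ominus> x s \<otimes> b \<ominus> y s \<otimes> t) \<oplus> x s \<otimes> b = a \<ominus> y s \<otimes> t"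
    proof -
      have "(a \<ominus> X' \<ominus> Z') \<oplus> X' = a \<ominus> Z'" if "X' \<in> carrier A" "Z' \<in> carrier A" for X' Z'
        using that a by (simp add: a_minus_def a_assoc a_comm[of _ X'] a_lcomm[of X' a] r_neg1 r_neg2)
      then show ?thesis using a b t by simp
    qed
    ultimately have "a \<ominus> y s \<otimes> t \<in> p S" by simp
    then have "?Y \<otimes> (a \<ominus> y s \<otimes> t) \<in> p S" using a t Yc by (simp add: p_mult_iff[OF P.S_sub])
    moreover have "B' z w' = ?Y \<otimes> a"
      using y_pairing[OF m(1) w(1)] m w a Y Yc by (simp add: m_assoc)
    ultimately have "B' z w' \<ominus> y s \<otimes> (?Y \<otimes> t) \<in> p S"
      using a t Yc by (simp add: a_minus_def r_distr r_minus m_lcomm)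
    then show "\<exists>d\<in>carrier A. B' z w' \<ominus> y s \<otimes> (?Y \<otimes> d) \<in> p S" using t by blast
  qed
qed

end

section \<open>The freeness criterion\<close>

context crossing begin

text \<open>A basis over the quotient A/J S, with coefficients written in A.\<close>

definition basis_mod_J :: "('a, 'm) module \<Rightarrow> 'i set \<Rightarrow> nat \<Rightarrow> (nat \<Rightarrow> 'm) \<Rightarrow> bool" where
  "basis_mod_J N S r f \<longleftrightarrow> f \<in> {..<r} \<rightarrow> carrier N \<and>
     (\<forall>m\<in>carrier N. \<exists>c\<in>{..<r} \<rightarrow> carrier A. m = (\<Oplus>\<^bsub>N\<^esub>i\<in>{..<r}. c i \<odot>\<^bsub>N\<^esub> f i)) \<and>
     (\<forall>c\<in>{..<r} \<rightarrow> carrier A. (\<Oplus>\<^bsub>N\<^esub>i\<in>{..<r}. c i \<odot>\<^bsub>N\<^esub> f i) = \<zero>\<^bsub>N\<^esub> \<longrightarrow> (\<forall>i<r. c i \<in> J S))"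

end

text \<open>Coordinates are unique modulo \<open>J S\<close>, the annihilator of Y, so Y times a
  coordinate is a well-defined A-linear functional. The elements representing these functionals are
  the dual basis.\<close>

lemma (in paired) basis_imp_almost_dual:
  assumes b: "basis_mod_J N S r e"
  shows "\<exists>f. almost_dual r e f"
proof -
  let ?Y = "yprod (T - S)"
  have Y: "?Y \<in> carrier A" by simp
  have e: "e \<in> {..<r} \<rightarrow> carrier N" using b by (simp add: basis_mod_J_def)
  have uniq: "c i \<ominus> d i \<in> J S"
    if c: "c \<in> {..<r} \<rightarrow> carrier A" and d: "d \<in> {..<r} \<rightarrow> carrier A"
      and eq: "(\<Oplus>\<^bsub>N\<^esub>i\<in>{..<r}. c i \<odot>\<^bsub>N\<^esub> e i) = (\<Oplus>\<^bsub>N\<^esub>i\<in>{..<r}. d i \<odot>\<^bsub>N\<^esub> e i)" and i: "i < r" for c d i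
  proof -
    have cc: "c i \<in> carrier A" "d i \<in> carrier A" "e i \<in> carrier N" if "i < r" for i
      using c d e that by auto
    have dd: "(\<lambda>i. c i \<ominus> d i) \<in> {..<r} \<rightarrow> carrier A" using cc by auto
    have "(\<Oplus>\<^bsub>N\<^esub>i\<in>{..<r}. c i \<odot>\<^bsub>N\<^esub> e i) = (\<Oplus>\<^bsub>N\<^esub>i\<in>{..<r}. (c i \<ominus> d i) \<odot>\<^bsub>N\<^esub> e i \<oplus>\<^bsub>N\<^esub> d i \<odot>\<^bsub>N\<^esub> e i)"
      using cc by (intro N.M.finsum_cong') (auto simp: N.diff_smult N.M.minus_add_cancel)
    also have "\<dots> = (\<Oplus>\<^bsub>N\<^esub>i\<in>{..<r}. (c i \<ominus> d i) \<odot>\<^bsub>N\<^esub> e i) \<oplus>\<^bsub>N\<^esub> (\<Oplus>\<^bsub>N\<^esub>i\<in>{..<r}. d i \<odot>\<^bsub>N\<^esub> e i)"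
      using cc by (intro N.M.finsum_addf) auto
    finally have "(\<Oplus>\<^bsub>N\<^esub>i\<in>{..<r}. (c i \<ominus> d i) \<odot>\<^bsub>N\<^esub> e i) = \<zero>\<^bsub>N\<^esub>"
      using eq N.finsum_smult_closed[OF dd e] N.finsum_smult_closed[OF d e] by simp
    moreover have "\<forall>c\<in>{..<r} \<rightarrow> carrier A. (\<Oplus>\<^bsub>N\<^esub>i\<in>{..<r}. c i \<odot>\<^bsub>N\<^esub> e i) = \<zero>\<^bsub>N\<^esub> \<longrightarrow> (\<forall>i<r. c i \<in> J S)"
      using b by (simp add: basis_mod_J_def)
    ultimately show ?thesis using bspec[OF _ dd] i by auto
  qed
  define co where "co = (\<lambda>m. SOME c. c \<in> {..<r} \<rightarrow> carrier A \<and> m = (\<Oplus>\<^bsub>N\<^esub>i\<in>{..<r}. c i \<odot>\<^bsub>N\<^esub> e i))"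
  have co: "co m \<in> {..<r} \<rightarrow> carrier A" "m = (\<Oplus>\<^bsub>N\<^esub>i\<in>{..<r}. co m i \<odot>\<^bsub>N\<^esub> e i)" if "m \<in> carrier N" for m
    using someI_ex[of "\<lambda>c. c \<in> {..<r} \<rightarrow> carrier A \<and> m = (\<Oplus>\<^bsub>N\<^esub>i\<in>{..<r}. c i \<odot>\<^bsub>N\<^esub> e i)"] b that
    unfolding co_def basis_mod_J_def by blast+
  have coc: "co m i \<in> carrier A" if "m \<in> carrier N" "i < r" for m i using co(1)[OF that(1)] that(2) by auto
  have Y_eq: "?Y \<otimes> co m i = ?Y \<otimes> c i" if m: "m \<in> carrier N" and c: "c \<in> {..<r} \<rightarrow> carrier A"
    "m = (\<Oplus>\<^bsub>N\<^esub>i\<in>{..<r}. c i \<odot>\<^bsub>N\<^esub> e i)" and i: "i < r" for m c i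
  proof -
    have ci: "c i \<in> carrier A" using c i by auto
    have "co m i \<ominus> c i \<in> J S"
      using co[OF m] c by (intro uniq[OF _ _ _ i]) auto
    then have "?Y \<otimes> (co m i \<ominus> c i) = \<zero>" using Y_cancel[OF S_sub] coc[OF m i] ci by simp
    then have "?Y \<otimes> co m i \<ominus> ?Y \<otimes> c i = \<zero>"
      using coc[OF m i] ci Y by (simp add: a_minus_def r_distr r_minus)
    then show ?thesis using coc[OF m i] ci Y by (simp add: r_right_minus_eq)
  qed
  have "\<exists>f. f \<in> carrier N \<and> (\<forall>m\<in>carrier N. B f m = ?Y \<otimes> co m i)" if i: "i < r" for i
  proof -
    have "(\<lambda>m. ?Y \<otimes> co m i) \<in> mod_hom A N (self_module A)"
    proof -
      have "?Y \<otimes> co (m \<oplus>\<^bsub>N\<^esub> m') i = ?Y \<otimes> co m i \<oplus> ?Y \<otimes> co m' i"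
        if m: "m \<in> carrier N" "m' \<in> carrier N" for m m'
      proof -
        have "m \<oplus>\<^bsub>N\<^esub> m' = (\<Oplus>\<^bsub>N\<^esub>i\<in>{..<r}. co m i \<odot>\<^bsub>N\<^esub> e i) \<oplus>\<^bsub>N\<^esub> (\<Oplus>\<^bsub>N\<^esub>i\<in>{..<r}. co m' i \<odot>\<^bsub>N\<^esub> e i)"
          using co(2)[OF m(1)] co(2)[OF m(2)] by simp
        also have "\<dots> = (\<Oplus>\<^bsub>N\<^esub>i\<in>{..<r}. co m i \<odot>\<^bsub>N\<^esub> e i \<oplus>\<^bsub>N\<^esub> co m' i \<odot>\<^bsub>N\<^esub> e i)"
          using coc m e by (intro N.M.finsum_addf[symmetric]) auto
        also have "\<dots> = (\<Oplus>\<^bsub>N\<^esub>i\<in>{..<r}. (co m i \<oplus> co m' i) \<odot>\<^bsub>N\<^esub> e i)"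
          using coc m e by (intro N.M.finsum_cong') (auto simp: N.smult_l_distr Pi_iff)
        finally have "?Y \<otimes> co (m \<oplus>\<^bsub>N\<^esub> m') i = ?Y \<otimes> (co m i \<oplus> co m' i)"
          using m coc by (intro Y_eq[OF N.M.a_closed[OF m] _ _ i]) auto
        then show ?thesis using coc[OF _ i] m Y by (simp add: r_distr)
      qed
      moreover have "?Y \<otimes> co (a \<odot>\<^bsub>N\<^esub> m) i = a \<otimes> (?Y \<otimes> co m i)"
        if m: "m \<in> carrier N" and a: "a \<in> carrier A" for m a
      proof -
        have "a \<odot>\<^bsub>N\<^esub> m = a \<odot>\<^bsub>N\<^esub> (\<Oplus>\<^bsub>N\<^esub>i\<in>{..<r}. co m i \<odot>\<^bsub>N\<^esub> e i)"
          using co(2)[OF m] by simp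
        also have "\<dots> = (\<Oplus>\<^bsub>N\<^esub>i\<in>{..<r}. a \<odot>\<^bsub>N\<^esub> (co m i \<odot>\<^bsub>N\<^esub> e i))"
          using coc m e a by (intro N.finsum_smult_ldistr) auto
        also have "\<dots> = (\<Oplus>\<^bsub>N\<^esub>i\<in>{..<r}. (a \<otimes> co m i) \<odot>\<^bsub>N\<^esub> e i)"
          using coc m e a by (intro N.M.finsum_cong') (auto simp: N.smult_assoc1 Pi_iff)
        finally have "?Y \<otimes> co (a \<odot>\<^bsub>N\<^esub> m) i = ?Y \<otimes> (a \<otimes> co m i)"
          using m a coc by (intro Y_eq[OF N.smult_closed[OF a m] _ _ i]) auto
        then show ?thesis using coc[OF m i] a Y by (simp add: m_lcomm)
      qed
      ultimately show ?thesis using coc[OF _ i] by (auto simp: mod_hom_def self_module_def)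
    qed
    then show ?thesis using B_represents by blast
  qed
  then obtain f where f: "\<And>i. i < r \<Longrightarrow> f i \<in> carrier N"
    "\<And>i m. i < r \<Longrightarrow> m \<in> carrier N \<Longrightarrow> B (f i) m = ?Y \<otimes> co m i" by metis
  have "\<exists>c\<in>carrier A. B (f i) (e j) = ?Y \<otimes> c \<and> c \<ominus> (if i = j then \<one> else \<zero>) \<in> p {}"
    if ij: "i < r" "j < r" for i j
  proof (intro bexI conjI)
    let ?c = "if i = j then \<one> else \<zero>"
    have ej: "e j \<in> carrier N" using e ij by auto
    have "e j = (\<Oplus>\<^bsub>N\<^esub>k\<in>{..<r}. (if j = k then e k else \<zero>\<^bsub>N\<^esub>))"
      using e ij by (intro N.M.add.finprod_singleton[symmetric]) auto
    also have "\<dots> = (\<Oplus>\<^bsub>N\<^esub>k\<in>{..<r}. (if k = j then \<one> else \<zero>) \<odot>\<^bsub>N\<^esub> e k)"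
      using e by (intro N.M.finsum_cong') (auto simp: Pi_iff)
    finally have "?Y \<otimes> co (e j) i = ?Y \<otimes> ?c"
      by (intro Y_eq[OF ej _ _ ij(1)]) auto
    then show "B (f i) (e j) = ?Y \<otimes> ?c" using f ij ej by simp
    show "?c \<ominus> ?c \<in> p {}" using p_zero[of "{}"] by (simp add: a_minus_def r_neg)
  qed simp
  then have "almost_dual r e f" using e f by (auto simp: almost_dual_def)
  then show ?thesis by blast
qed

theorem (in crossing) free_of_rank_bound:
  fixes N :: "'i set \<Rightarrow> ('a, 'm) module"
  assumes fam: "\<And>S. S \<subseteq> T \<Longrightarrow> paired A T x y p (N S) S (B S)"
    and adj: "\<And>S s. S \<subseteq> T \<Longrightarrow> s \<in> T - S \<Longrightarrow>
      adjacent A T x y p (N S) S (B S) (N (insert s S)) s (B (insert s S)) (\<pi> S s)"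
    and transfer: "\<And>S S' k. S \<subseteq> T \<Longrightarrow> S' \<subseteq> S \<Longrightarrow> indep (N S) S' k \<Longrightarrow> indep (N S') S' k"
    and base: "basis_mod_J (N {}) {} r e0"
    and top: "\<not> indep (N T) T (Suc r)"
    and S: "S \<subseteq> T"
  shows "\<exists>f. basis_mod_J (N S) S r f"
proof -
  \<comment> \<open>Upward induction: the system for \<open>insert s S\<close> lifts the one for
    S.\<close>
  have almost: "\<exists>e f. paired.almost_dual A T y p (N S) S (B S) r e f" if "S \<subseteq> T" for S
    using finite_sub[OF that] that
  proof (induction S rule: finite_induct)
    case empty
    interpret paired A T x y p "N {}" "{}" "B {}" by (rule fam) simp
    show ?case using basis_imp_almost_dual[OF base] by blast
  next
    case (insert s S)
    then have S: "S \<subseteq> T" "s \<in> T - S" by auto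
    interpret adjacent A T x y p "N S" S "B S" "N (insert s S)" s "B (insert s S)" "\<pi> S s"
      by (rule adj[OF S])
    obtain e f where "P.almost_dual r e f" using insert.IH S by blast
    then show ?case using almost_dual_lift by blast
  qed
  \<comment> \<open>Downward induction on the subset, run as an induction on its complement
    \<open>K\<close>.\<close>
  have ni: "\<not> indep (N (T - K)) (T - K) (Suc r)" if "K \<subseteq> T" for K
    using finite_sub[OF that] that
  proof (induction K rule: finite_induct)
    case empty
    then show ?case using top by simp
  next
    case (insert s K)
    define S where "S = T - insert s K"
    have S: "S \<subseteq> T" "s \<in> T - S" "insert s S = T - K" using insert by (auto simp: S_def)
    interpret adjacent A T x y p "N S" S "B S" "N (insert s S)" s "B (insert s S)" "\<pi> S s"
      by (rule adj[OF S(1,2)])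
    obtain e' f' where near: "P.almost_dual r e' f'" using almost S by blast
    then obtain e f where "Q.almost_dual r e f" and lift: "\<And>j. j < r \<Longrightarrow> \<pi> S s (e j) = e' j"
      using almost_dual_lift by blast
    then obtain f1 where dQ: "Q.dual_systems r e f1" using Q.almost_dual_imp_dual_systems by blast
    obtain f1' where dP: "P.dual_systems r e' f1'" using near P.almost_dual_imp_dual_systems by blast
    have "\<not> indep (N (insert s S)) (insert s S) (Suc r)" unfolding S(3) using insert by simp
    from not_indep_descend[OF dP dQ lift this] show ?case unfolding S_def by simp
  qed
  have ni': "\<not> indep (N S') S' (Suc r)" if "S' \<subseteq> T" for S'
  proof -
    have "T - (T - S') = S'" using that by blast
    then show ?thesis using ni[of "T - S'"] by simp
  qed
  interpret paired A T x y p "N S" S "B S" by (rule fam[OF S])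
  obtain e f where d: "dual_systems r e f" using almost[OF S] almost_dual_imp_dual_systems by blast
  have f: "f \<in> {..<r} \<rightarrow> carrier (N S)" using d by (simp add: dual_systems_def)
  have e: "e j \<in> carrier (N S)" if "j < r" for j using d that by (auto simp: dual_systems_def)
  have "basis_mod_J (N S) S r f"
    unfolding basis_mod_J_def
  proof (intro conjI ballI impI allI f)
    fix m assume m: "m \<in> carrier (N S)"
    obtain c n where c: "c \<in> {..<r} \<rightarrow> carrier A" and n: "n \<in> carrier (N S)"
        "\<And>j. j < r \<Longrightarrow> B S n (e j) = \<zero>"
      and m_eq: "m = (\<Oplus>\<^bsub>N S\<^esub>i\<in>{..<r}. c i \<odot>\<^bsub>N S\<^esub> f i) \<oplus>\<^bsub>N S\<^esub> n"
      using dual_systems_decompose[OF d m] by blast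
    \<comment> \<open>A pairing of \<open>n\<close> that is nonzero on a component S' contained in S
      would give \<open>r + 1\<close> independent elements of \<open>N S\<close> there, hence by
      \<open>transfer\<close> also of \<open>N S'\<close>.\<close>
    have "n = \<zero>\<^bsub>N S\<^esub>"
    proof (rule B_nondegenerate[OF n(1)])
      fix w assume w: "w \<in> carrier (N S)"
      have "B S n w \<in> p S'" if S': "S' \<subseteq> T" for S'
      proof (cases "S' \<subseteq> S")
        case True
        then show ?thesis
          using dual_systems_indep[OF d n w] transfer[OF S True] ni'[OF S'] by blast
      next
        case False
        then show ?thesis using B_mem[OF S' _ n(1) w] by blast
      qed
      then show "B S n w = \<zero>" using n w by (intro p_separate) auto
    qed
    then have "m = (\<Oplus>\<^bsub>N S\<^esub>i\<in>{..<r}. c i \<odot>\<^bsub>N S\<^esub> f i)"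
      using m_eq N.finsum_smult_closed[OF c f] by simp
    then show "\<exists>c\<in>{..<r} \<rightarrow> carrier A. m = (\<Oplus>\<^bsub>N S\<^esub>i\<in>{..<r}. c i \<odot>\<^bsub>N S\<^esub> f i)" using c by blast
  next
    fix c i assume c: "c \<in> {..<r} \<rightarrow> carrier A" and z: "(\<Oplus>\<^bsub>N S\<^esub>i\<in>{..<r}. c i \<odot>\<^bsub>N S\<^esub> f i) = \<zero>\<^bsub>N S\<^esub>"
      and i: "i < r"
    have "yprod (T - S) \<otimes> c i = \<zero>" using dual_systems_pairing[OF d c i] z e[OF i] by simp
    then show "c i \<in> J S" using Y_cancel[OF S] c i by auto
  qed
  then show ?thesis by blast
qed

section \<open>The Koszul complex\<close>

context module
begin

text \<open>The exterior algebra on \<open>d\<close> generators with coefficients in \<open>M\<close> is encoded by functions on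
  the boolean lists of length \<open>d\<close>, a list being the indicator of a set of generators. Splitting off
  the first generator \<open>e\<close>, an element is \<open>w\<^sub>0 + e \<and> w\<^sub>1\<close>; then \<open>koszul xs\<close> is the contraction with
  \<open>xs\<close> and \<open>wedge ps\<close> the left multiplication with the vector \<open>ps\<close>.\<close>

primrec koszul :: "'a list \<Rightarrow> (bool list \<Rightarrow> 'c) \<Rightarrow> bool list \<Rightarrow> 'c" where
  "koszul [] w = (\<lambda>_. \<zero>\<^bsub>M\<^esub>)"
| "koszul (x # xs) w = (\<lambda>bs. case bs of [] \<Rightarrow> \<zero>\<^bsub>M\<^esub> | b # bs \<Rightarrow>
     if b then \<ominus>\<^bsub>M\<^esub> koszul xs (\<lambda>bs. w (True # bs)) bs
     else koszul xs (\<lambda>bs. w (False # bs)) bs \<oplus>\<^bsub>M\<^esub> x \<odot>\<^bsub>M\<^esub> w (True # bs))"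

primrec wedge :: "'a list \<Rightarrow> (bool list \<Rightarrow> 'c) \<Rightarrow> bool list \<Rightarrow> 'c" where
  "wedge [] w = (\<lambda>_. \<zero>\<^bsub>M\<^esub>)"
| "wedge (p # ps) w = (\<lambda>bs. case bs of [] \<Rightarrow> \<zero>\<^bsub>M\<^esub> | b # bs \<Rightarrow>
     if b then p \<odot>\<^bsub>M\<^esub> w (False # bs) \<ominus>\<^bsub>M\<^esub> wedge ps (\<lambda>bs. w (True # bs)) bs
     else wedge ps (\<lambda>bs. w (False # bs)) bs)"

fun dot :: "'a list \<Rightarrow> 'a list \<Rightarrow> 'a" where
  "dot (p # ps) (x # xs) = p \<otimes> x \<oplus> dot ps xs"
| "dot _ _ = \<zero>"

fun mdot :: "'a list \<Rightarrow> 'c list \<Rightarrow> 'c" where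
  "mdot (x # xs) (k # ks) = x \<odot>\<^bsub>M\<^esub> k \<oplus>\<^bsub>M\<^esub> mdot xs ks"
| "mdot _ _ = \<zero>\<^bsub>M\<^esub>"

lemma dot_closed: "set ps \<subseteq> carrier R \<Longrightarrow> set xs \<subseteq> carrier R \<Longrightarrow> dot ps xs \<in> carrier R"
  by (induction ps xs rule: dot.induct) auto

lemma koszul_closed:
  "set xs \<subseteq> carrier R \<Longrightarrow> (\<And>bs. w bs \<in> carrier M) \<Longrightarrow> koszul xs w bs \<in> carrier M"
  by (induction xs arbitrary: w bs) (auto split: list.split)

lemma wedge_closed:
  "set ps \<subseteq> carrier R \<Longrightarrow> (\<And>bs. w bs \<in> carrier M) \<Longrightarrow> wedge ps w bs \<in> carrier M"
  by (induction ps arbitrary: w bs) (auto split: list.split)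

lemma koszul_cong:
  "(\<And>bs. length bs = length xs \<Longrightarrow> v bs = w bs) \<Longrightarrow> length bs = length xs \<Longrightarrow>
    koszul xs v bs = koszul xs w bs"
proof (induction xs arbitrary: v w bs)
  case (Cons x xs)
  obtain b bs' where bs: "bs = b # bs'" "length bs' = length xs" using Cons.prems(2) by (cases bs) auto
  have "koszul xs (\<lambda>bs. v (c # bs)) bs' = koszul xs (\<lambda>bs. w (c # bs)) bs'" for c
    using Cons.prems bs by (intro Cons.IH) auto
  then show ?case using Cons.prems bs by simp
qed simp

lemma koszul_zero: "set xs \<subseteq> carrier R \<Longrightarrow> koszul xs (\<lambda>_. \<zero>\<^bsub>M\<^esub>) bs = \<zero>\<^bsub>M\<^esub>"
  by (induction xs arbitrary: bs) (auto split: list.split)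

lemma koszul_add:
  "set xs \<subseteq> carrier R \<Longrightarrow> (\<And>bs. v bs \<in> carrier M) \<Longrightarrow> (\<And>bs. w bs \<in> carrier M) \<Longrightarrow>
    koszul xs (\<lambda>bs. v bs \<oplus>\<^bsub>M\<^esub> w bs) bs = koszul xs v bs \<oplus>\<^bsub>M\<^esub> koszul xs w bs"
  by (induction xs arbitrary: v w bs)
    (auto split: list.split simp: koszul_closed smult_r_distr M.minus_add M.a_ac)

lemma wedge_add:
  "set xs \<subseteq> carrier R \<Longrightarrow> (\<And>bs. v bs \<in> carrier M) \<Longrightarrow> (\<And>bs. w bs \<in> carrier M) \<Longrightarrow>
    wedge xs (\<lambda>bs. v bs \<oplus>\<^bsub>M\<^esub> w bs) bs = wedge xs v bs \<oplus>\<^bsub>M\<^esub> wedge xs w bs"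
  by (induction xs arbitrary: v w bs)
    (auto split: list.split simp: wedge_closed smult_r_distr M.minus_add M.a_ac a_minus_def)

lemma koszul_smult:
  "set xs \<subseteq> carrier R \<Longrightarrow> (\<And>bs. w bs \<in> carrier M) \<Longrightarrow> a \<in> carrier R \<Longrightarrow>
    koszul xs (\<lambda>bs. a \<odot>\<^bsub>M\<^esub> w bs) bs = a \<odot>\<^bsub>M\<^esub> koszul xs w bs"
proof (induction xs arbitrary: w bs)
  case (Cons x xs)
  have "x \<odot>\<^bsub>M\<^esub> (a \<odot>\<^bsub>M\<^esub> w c) = a \<odot>\<^bsub>M\<^esub> (x \<odot>\<^bsub>M\<^esub> w c)" for c
    using Cons.prems by (simp flip: smult_assoc1 add: m_comm)
  then show ?case
    using Cons by (auto split: list.split simp: koszul_closed smult_r_distr smult_r_minus)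
qed simp

lemma wedge_smult:
  "set xs \<subseteq> carrier R \<Longrightarrow> (\<And>bs. w bs \<in> carrier M) \<Longrightarrow> a \<in> carrier R \<Longrightarrow>
    wedge xs (\<lambda>bs. a \<odot>\<^bsub>M\<^esub> w bs) bs = a \<odot>\<^bsub>M\<^esub> wedge xs w bs"
proof (induction xs arbitrary: w bs)
  case (Cons x xs)
  have "x \<odot>\<^bsub>M\<^esub> (a \<odot>\<^bsub>M\<^esub> w c) = a \<odot>\<^bsub>M\<^esub> (x \<odot>\<^bsub>M\<^esub> w c)" for c
    using Cons.prems by (simp flip: smult_assoc1 add: m_comm)
  then show ?case
    using Cons by (auto split: list.split
        simp: wedge_closed smult_r_distr smult_r_minus a_minus_def)
qed simp

lemma koszul_neg:
  "set xs \<subseteq> carrier R \<Longrightarrow> (\<And>bs. w bs \<in> carrier M) \<Longrightarrow>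
    koszul xs (\<lambda>bs. \<ominus>\<^bsub>M\<^esub> w bs) bs = \<ominus>\<^bsub>M\<^esub> koszul xs w bs"
  using koszul_smult[of xs w "\<ominus> \<one>" bs] by (simp add: smult_l_minus koszul_closed)

lemma wedge_neg:
  "set xs \<subseteq> carrier R \<Longrightarrow> (\<And>bs. w bs \<in> carrier M) \<Longrightarrow>
    wedge xs (\<lambda>bs. \<ominus>\<^bsub>M\<^esub> w bs) bs = \<ominus>\<^bsub>M\<^esub> wedge xs w bs"
  using wedge_smult[of xs w "\<ominus> \<one>" bs] by (simp add: smult_l_minus wedge_closed)

lemma koszul_koszul:
  "set xs \<subseteq> carrier R \<Longrightarrow> (\<And>bs. w bs \<in> carrier M) \<Longrightarrow> koszul xs (koszul xs w) bs = \<zero>\<^bsub>M\<^esub>"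
proof (induction xs arbitrary: w bs)
  case (Cons x xs)
  show ?case
  proof (cases bs)
    case (Cons b bs')
    note c = koszul_closed
    show ?thesis
    proof (cases b)
      case True
      then show ?thesis using Cons Cons.prems Cons.IH by (simp add: koszul_neg c)
    next
      case False
      then show ?thesis using Cons Cons.prems Cons.IH
        by (simp add: koszul_add koszul_smult c smult_r_minus M.r_neg)
    qed
  qed simp
qed simp

text \<open>Contraction is an antiderivation of the exterior algebra. The formula is a null
  homotopy: elements of the ideal generated by \<open>xs\<close> act as zero on Koszul
  homology.\<close>

lemma koszul_wedge:
  "set xs \<subseteq> carrier R \<Longrightarrow> set ps \<subseteq> carrier R \<Longrightarrow> (\<And>bs. w bs \<in> carrier M) \<Longrightarrow>
    length ps = length xs \<Longrightarrow> length bs = length xs \<Longrightarrow>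
    koszul xs (wedge ps w) bs \<oplus>\<^bsub>M\<^esub> wedge ps (koszul xs w) bs = dot ps xs \<odot>\<^bsub>M\<^esub> w bs"
proof (induction xs arbitrary: ps w bs)
  case (Cons x xs)
  obtain b bs' where bs: "bs = b # bs'" "length bs' = length xs" using Cons.prems(5) by (cases bs) auto
  obtain p ps' where ps: "ps = p # ps'" "length ps' = length xs" using Cons.prems(4) by (cases ps) auto
  have cl: "x \<in> carrier R" "p \<in> carrier R" "set xs \<subseteq> carrier R" "set ps' \<subseteq> carrier R"
    "\<And>bs. w bs \<in> carrier M"
    using Cons.prems ps by auto
  note c = koszul_closed wedge_closed dot_closed
  have IH: "koszul xs (wedge ps' (\<lambda>bs. w (d # bs))) bs' \<oplus>\<^bsub>M\<^esub> wedge ps' (koszul xs (\<lambda>bs. w (d # bs))) bs'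
      = dot ps' xs \<odot>\<^bsub>M\<^esub> w (d # bs')" for d
    using cl ps bs by (intro Cons.IH) auto
  define A1 where "A1 d = koszul xs (wedge ps' (\<lambda>bs. w (d # bs))) bs'" for d
  define A2 where "A2 d = wedge ps' (koszul xs (\<lambda>bs. w (d # bs))) bs'" for d
  define K0 where "K0 = koszul xs (\<lambda>bs. w (False # bs)) bs'"
  define W1 where "W1 = wedge ps' (\<lambda>bs. w (True # bs)) bs'"
  have mem: "A1 d \<in> carrier M" "A2 d \<in> carrier M" "K0 \<in> carrier M" "W1 \<in> carrier M" for d
    using cl by (auto simp: A1_def A2_def K0_def W1_def c)
  have IH: "A1 d \<oplus>\<^bsub>M\<^esub> A2 d = dot ps' xs \<odot>\<^bsub>M\<^esub> w (d # bs')" for d using IH by (simp add: A1_def A2_def)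
  have d: "dot ps' xs \<in> carrier R" using cl c by simp
  have px: "x \<odot>\<^bsub>M\<^esub> (p \<odot>\<^bsub>M\<^esub> m) = (p \<otimes> x) \<odot>\<^bsub>M\<^esub> m" "p \<odot>\<^bsub>M\<^esub> (x \<odot>\<^bsub>M\<^esub> m) = (p \<otimes> x) \<odot>\<^bsub>M\<^esub> m"
    if "m \<in> carrier M" for m
    using cl that by (simp_all flip: smult_assoc1 add: m_comm)
  show ?case
  proof (cases b)
    case True
    have 1: "koszul (x # xs) (wedge ps w) bs = \<ominus>\<^bsub>M\<^esub> (p \<odot>\<^bsub>M\<^esub> K0 \<oplus>\<^bsub>M\<^esub> \<ominus>\<^bsub>M\<^esub> A1 True)"
      using True bs ps cl by (simp add: a_minus_def koszul_add koszul_smult koszul_neg c A1_def K0_def)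
    have 2: "wedge ps (koszul (x # xs) w) bs
        = p \<odot>\<^bsub>M\<^esub> (K0 \<oplus>\<^bsub>M\<^esub> x \<odot>\<^bsub>M\<^esub> w (True # bs')) \<oplus>\<^bsub>M\<^esub> A2 True"
      using True bs ps cl by (simp add: a_minus_def wedge_neg c A2_def K0_def)
    have "koszul (x # xs) (wedge ps w) bs \<oplus>\<^bsub>M\<^esub> wedge ps (koszul (x # xs) w) bs
        = (p \<otimes> x) \<odot>\<^bsub>M\<^esub> w (True # bs') \<oplus>\<^bsub>M\<^esub> (A1 True \<oplus>\<^bsub>M\<^esub> A2 True)"
      unfolding 1 2 using mem cl px[of "w (True # bs')"]
      by (simp add: smult_r_distr M.minus_add M.a_ac M.r_neg1 M.r_neg2)
    then show ?thesis unfolding IH using True bs ps cl d by (simp add: smult_l_distr)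
  next
    case False
    have 1: "koszul (x # xs) (wedge ps w) bs
        = A1 False \<oplus>\<^bsub>M\<^esub> x \<odot>\<^bsub>M\<^esub> (p \<odot>\<^bsub>M\<^esub> w (False # bs') \<oplus>\<^bsub>M\<^esub> \<ominus>\<^bsub>M\<^esub> W1)"
      using False bs ps cl by (simp add: a_minus_def c A1_def W1_def)
    have 2: "wedge ps (koszul (x # xs) w) bs = A2 False \<oplus>\<^bsub>M\<^esub> x \<odot>\<^bsub>M\<^esub> W1"
      using False bs ps cl by (simp add: wedge_add wedge_smult c A2_def W1_def)
    have "koszul (x # xs) (wedge ps w) bs \<oplus>\<^bsub>M\<^esub> wedge ps (koszul (x # xs) w) bs
        = (p \<otimes> x) \<odot>\<^bsub>M\<^esub> w (False # bs') \<oplus>\<^bsub>M\<^esub> (A1 False \<oplus>\<^bsub>M\<^esub> A2 False)"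
      unfolding 1 2 using mem cl px[of "w (False # bs')"]
      by (simp add: smult_r_distr smult_r_minus M.a_ac M.r_neg1 M.r_neg2 M.r_neg M.l_neg)
    then show ?thesis unfolding IH using False bs ps cl d by (simp add: smult_l_distr)
  qed
qed simp

text \<open>The number of entries \<open>True\<close> in a list is the exterior degree.\<close>

definition degree_at_least :: "nat \<Rightarrow> (bool list \<Rightarrow> 'c) \<Rightarrow> bool" where
  "degree_at_least j w \<longleftrightarrow> (\<forall>bs. length (filter (\<lambda>b. b) bs) < j \<longrightarrow> w bs = \<zero>\<^bsub>M\<^esub>)"

lemma wedge_degree:
  assumes "set ps \<subseteq> carrier R" "\<And>bs. w bs \<in> carrier M" "degree_at_least j w"
  shows "degree_at_least (Suc j) (wedge ps w)"
  unfolding degree_at_least_def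
proof (intro allI impI)
  fix bs :: "bool list" assume "length (filter (\<lambda>b. b) bs) < Suc j"
  then show "wedge ps w bs = \<zero>\<^bsub>M\<^esub>" using assms
  proof (induction ps arbitrary: w bs j)
    case (Cons p ps)
    show ?case
    proof (cases bs)
      case (Cons b bs')
      show ?thesis
      proof (cases b)
        case True
        then obtain j' where j': "j = Suc j'" using Cons Cons.prems(1) by (cases j) auto
        have "degree_at_least j' (\<lambda>bs. w (True # bs))"
          using Cons.prems(4) j' by (auto simp: degree_at_least_def)
        then have "wedge ps (\<lambda>bs. w (True # bs)) bs' = \<zero>\<^bsub>M\<^esub>"
          using Cons Cons.prems j' True by (intro Cons.IH) auto
        moreover have "w (False # bs') = \<zero>\<^bsub>M\<^esub>"
          using Cons.prems(1,4) Cons True by (auto simp: degree_at_least_def)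
        ultimately show ?thesis using Cons True Cons.prems by (simp add: a_minus_def)
      next
        case False
        have "degree_at_least j (\<lambda>bs. w (False # bs))"
          using Cons.prems(4) by (auto simp: degree_at_least_def)
        then have "wedge ps (\<lambda>bs. w (False # bs)) bs' = \<zero>\<^bsub>M\<^esub>"
          using Cons Cons.prems False by (intro Cons.IH) auto
        then show ?thesis using Cons False by simp
      qed
    qed simp
  qed simp
qed

lemma koszul_mem:
  assumes "submodule N R M"
  shows "set xs \<subseteq> carrier R \<Longrightarrow> (\<And>bs. length bs = length xs \<Longrightarrow> w bs \<in> N) \<Longrightarrow> length bs = length xs \<Longrightarrow>
    koszul xs w bs \<in> N"
proof (induction xs arbitrary: w bs)
  case Nil
  then show ?case using submodule.axioms(1)[OF assms] by (simp add: subgroup.one_closed[where G = "add_monoid M", simplified])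
next
  case (Cons x xs)
  obtain b bs' where bs: "bs = b # bs'" "length bs' = length xs" using Cons.prems(3) by (cases bs) auto
  have "koszul xs (\<lambda>bs. w (c # bs)) bs' \<in> N" for c using Cons.prems bs by (intro Cons.IH) auto
  then show ?case using bs Cons.prems submoduleE[OF assms] by auto
qed

lemma wedge_mem:
  assumes "submodule N R M"
  shows "set xs \<subseteq> carrier R \<Longrightarrow> (\<And>bs. length bs = length xs \<Longrightarrow> w bs \<in> N) \<Longrightarrow> length bs = length xs \<Longrightarrow>
    wedge xs w bs \<in> N"
proof (induction xs arbitrary: w bs)
  case Nil
  then show ?case using submodule.axioms(1)[OF assms] by (simp add: subgroup.one_closed[where G = "add_monoid M", simplified])
next
  case (Cons x xs)
  obtain b bs' where bs: "bs = b # bs'" "length bs' = length xs" using Cons.prems(3) by (cases bs) auto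
  have "wedge xs (\<lambda>bs. w (c # bs)) bs' \<in> N" for c using Cons.prems bs by (intro Cons.IH) auto
  then show ?case using bs Cons.prems submoduleE[OF assms] by (auto simp: a_minus_def)
qed

section \<open>Regular sequences modulo a submodule and exactness of the Koszul complex\<close>

definition enlarge :: "'c set \<Rightarrow> 'a \<Rightarrow> 'c set" where
  "enlarge N a = {n \<oplus>\<^bsub>M\<^esub> a \<odot>\<^bsub>M\<^esub> m | n m. n \<in> N \<and> m \<in> carrier M}"

text \<open>Regularity on the quotient of M by N, with quotients replaced by a submodule that grows
  along the sequence. Thus the Koszul complex always has coefficients in the same M.\<close>

primrec regular_mod :: "'c set \<Rightarrow> 'a list \<Rightarrow> bool" where
  "regular_mod N [] = True"
| "regular_mod N (a # as) = ((\<forall>m\<in>carrier M. a \<odot>\<^bsub>M\<^esub> m \<in> N \<longrightarrow> m \<in> N) \<and> regular_mod (enlarge N a) as)"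

lemma submodule_zero: "submodule N R M \<Longrightarrow> \<zero>\<^bsub>M\<^esub> \<in> N"
  using submodule.axioms(1) subgroup.one_closed by fastforce

lemma enlarge_submodule:
  assumes "submodule N R M" "a \<in> carrier R"
  shows "submodule (enlarge N a) R M"
proof (rule submoduleI)
  note N = submoduleE[OF assms(1)]
  have Nc: "n \<in> carrier M" if "n \<in> N" for n using N that by blast
  show "enlarge N a \<subseteq> carrier M" using Nc assms by (auto simp: enlarge_def)
  have "\<zero>\<^bsub>M\<^esub> = \<zero>\<^bsub>M\<^esub> \<oplus>\<^bsub>M\<^esub> a \<odot>\<^bsub>M\<^esub> \<zero>\<^bsub>M\<^esub>" using assms by simp
  then show "\<zero>\<^bsub>M\<^esub> \<in> enlarge N a" unfolding enlarge_def using submodule_zero[OF assms(1)] by blast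
  show "\<ominus>\<^bsub>M\<^esub> z \<in> enlarge N a" if h: "z \<in> enlarge N a" for z
  proof -
    obtain n m where z: "n \<in> N" "m \<in> carrier M" "z = n \<oplus>\<^bsub>M\<^esub> a \<odot>\<^bsub>M\<^esub> m" using h by (auto simp: enlarge_def)
    then have "\<ominus>\<^bsub>M\<^esub> z = \<ominus>\<^bsub>M\<^esub> n \<oplus>\<^bsub>M\<^esub> a \<odot>\<^bsub>M\<^esub> (\<ominus>\<^bsub>M\<^esub> m)"
      using Nc assms by (simp add: M.minus_add smult_r_minus)
    then show ?thesis using z N(3) M.a_inv_closed unfolding enlarge_def by blast
  qed
  show "z \<oplus>\<^bsub>M\<^esub> z' \<in> enlarge N a" if h: "z \<in> enlarge N a" "z' \<in> enlarge N a" for z z'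
  proof -
    obtain n m where z: "n \<in> N" "m \<in> carrier M" "z = n \<oplus>\<^bsub>M\<^esub> a \<odot>\<^bsub>M\<^esub> m" using h by (auto simp: enlarge_def)
    obtain n' m' where z': "n' \<in> N" "m' \<in> carrier M" "z' = n' \<oplus>\<^bsub>M\<^esub> a \<odot>\<^bsub>M\<^esub> m'" using h by (auto simp: enlarge_def)
    have "z \<oplus>\<^bsub>M\<^esub> z' = (n \<oplus>\<^bsub>M\<^esub> n') \<oplus>\<^bsub>M\<^esub> a \<odot>\<^bsub>M\<^esub> (m \<oplus>\<^bsub>M\<^esub> m')"
      using z z' Nc assms by (simp add: smult_r_distr M.a_ac)
    then show ?thesis using z z' N(5) M.a_closed unfolding enlarge_def by blast
  qed
  show "b \<odot>\<^bsub>M\<^esub> z \<in> enlarge N a" if h: "b \<in> carrier R" "z \<in> enlarge N a" for b z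
  proof -
    obtain n m where z: "n \<in> N" "m \<in> carrier M" "z = n \<oplus>\<^bsub>M\<^esub> a \<odot>\<^bsub>M\<^esub> m" using h by (auto simp: enlarge_def)
    then have "b \<odot>\<^bsub>M\<^esub> z = b \<odot>\<^bsub>M\<^esub> n \<oplus>\<^bsub>M\<^esub> a \<odot>\<^bsub>M\<^esub> (b \<odot>\<^bsub>M\<^esub> m)"
      using Nc assms h by (simp add: smult_r_distr flip: smult_assoc1) (simp add: m_comm)
    then show ?thesis using z N(4) h(1) smult_closed unfolding enlarge_def by blast
  qed
qed

text \<open>Depth sensitivity: a regular sequence of length l in the ideal of \<open>xs\<close>
  kills the homology of M/N in degrees above \<open>length xs\<close> minus l. The induction trades
  one entry \<open>a\<close> for one degree. With \<open>a = dot ps xs\<close>, the wedge of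
  \<open>ps\<close> with a cycle \<open>w\<close> is a cycle modulo N + aM of degree one higher,
  hence a boundary there up to some \<open>a u\<close>. Contracting and comparing with the homotopy
  formula, \<open>a\<close> times the difference of \<open>w\<close> and the boundary of
  \<open>u\<close> lies in N, and \<open>a\<close> can be cancelled.\<close>

lemma koszul_exact:
  assumes "submodule N R M" "regular_mod N as" "set xs \<subseteq> carrier R"
    and "\<And>a. a \<in> set as \<Longrightarrow> \<exists>ps. length ps = length xs \<and> set ps \<subseteq> carrier R \<and> a = dot ps xs"
    and "length xs < length as + j" "\<And>bs. w bs \<in> carrier M" "degree_at_least j w"
    and "\<And>bs. length bs = length xs \<Longrightarrow> koszul xs w bs \<in> N"
  shows "\<exists>v. (\<forall>bs. v bs \<in> carrier M) \<and>
    (\<forall>bs. length bs = length xs \<longrightarrow> w bs \<ominus>\<^bsub>M\<^esub> koszul xs v bs \<in> N)"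
  using assms
proof (induction as arbitrary: N j w)
  case Nil
  have "w bs \<ominus>\<^bsub>M\<^esub> koszul xs (\<lambda>_. \<zero>\<^bsub>M\<^esub>) bs \<in> N" if "length bs = length xs" for bs
  proof -
    \<comment> \<open>The degree exceeds the number of generators, so \<open>w\<close> vanishes on
      all lists of the relevant length.\<close>
    have "length (filter (\<lambda>b. b) bs) < j"
      using Nil.prems(5) that le_less_trans[OF length_filter_le, of bs j "\<lambda>b. b"] by simp
    then have "w bs = \<zero>\<^bsub>M\<^esub>" using Nil.prems(7) by (simp add: degree_at_least_def)
    then show ?thesis using Nil.prems(3) submoduleE(3)[OF Nil.prems(1) submodule_zero[OF Nil.prems(1)]]
      by (simp add: koszul_zero a_minus_def)
  qed
  then show ?case by (intro exI[of _ "\<lambda>_. \<zero>\<^bsub>M\<^esub>"]) auto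
next
  case (Cons a as)
  note N = submoduleE[OF Cons.prems(1)] and xs = Cons.prems(3) and w = Cons.prems(6)
  obtain ps where ps: "length ps = length xs" "set ps \<subseteq> carrier R" "a = dot ps xs"
    using Cons.prems(4)[of a] by auto
  have a: "a \<in> carrier R" using ps xs dot_closed by simp
  define w' where "w' = wedge ps w"
  have w': "w' bs \<in> carrier M" for bs using ps w by (simp add: w'_def wedge_closed)
  have dw: "koszul xs w' bs = \<ominus>\<^bsub>M\<^esub> wedge ps (koszul xs w) bs \<oplus>\<^bsub>M\<^esub> a \<odot>\<^bsub>M\<^esub> w bs"
    "wedge ps (koszul xs w) bs \<in> N" if bs: "length bs = length xs" for bs
  proof -
    show "wedge ps (koszul xs w) bs \<in> N"
      using Cons.prems(8) ps bs by (intro wedge_mem[OF Cons.prems(1)]) auto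
    then have 1: "wedge ps (koszul xs w) bs \<in> carrier M" using N by blast
    have 2: "koszul xs w' bs \<in> carrier M" using w' xs by (simp add: koszul_closed)
    show "koszul xs w' bs = \<ominus>\<^bsub>M\<^esub> wedge ps (koszul xs w) bs \<oplus>\<^bsub>M\<^esub> a \<odot>\<^bsub>M\<^esub> w bs"
    proof -
      have "koszul xs w' bs \<oplus>\<^bsub>M\<^esub> wedge ps (koszul xs w) bs = a \<odot>\<^bsub>M\<^esub> w bs"
        unfolding w'_def ps(3) by (rule koszul_wedge[OF xs ps(2) w ps(1) bs])
      then have "a \<odot>\<^bsub>M\<^esub> w bs = wedge ps (koszul xs w) bs \<oplus>\<^bsub>M\<^esub> koszul xs w' bs"
        using M.a_comm[OF 2 1] by simp
      then show ?thesis using M.r_neg1[OF 1 2] by simp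
    qed
  qed
  have "\<exists>v. (\<forall>bs. v bs \<in> carrier M) \<and>
    (\<forall>bs. length bs = length xs \<longrightarrow> w' bs \<ominus>\<^bsub>M\<^esub> koszul xs v bs \<in> enlarge N a)"
  proof (rule Cons.IH)
    show "submodule (enlarge N a) R M" using enlarge_submodule[OF Cons.prems(1) a] .
    show "degree_at_least (Suc j) w'" unfolding w'_def using ps w Cons.prems(7) by (intro wedge_degree)
    fix bs :: "bool list" assume bs: "length bs = length xs"
    show "koszul xs w' bs \<in> enlarge N a"
      unfolding enlarge_def dw(1)[OF bs] using dw(2)[OF bs] N(3) w by blast
  qed (use Cons.prems w' in auto)
  then obtain v where v: "\<And>bs. v bs \<in> carrier M"
    "\<And>bs. length bs = length xs \<Longrightarrow> w' bs \<ominus>\<^bsub>M\<^esub> koszul xs v bs \<in> enlarge N a" by blast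
  have "\<forall>bs. \<exists>n m. n \<in> N \<and> m \<in> carrier M \<and>
      (length bs = length xs \<longrightarrow> w' bs \<ominus>\<^bsub>M\<^esub> koszul xs v bs = n \<oplus>\<^bsub>M\<^esub> a \<odot>\<^bsub>M\<^esub> m)"
    using v(2) submodule_zero[OF Cons.prems(1)] unfolding enlarge_def by blast
  then obtain n u where n: "\<And>bs. n bs \<in> N" and u: "\<And>bs. u bs \<in> carrier M"
    and nu: "\<And>bs. length bs = length xs \<Longrightarrow> w' bs \<ominus>\<^bsub>M\<^esub> koszul xs v bs = n bs \<oplus>\<^bsub>M\<^esub> a \<odot>\<^bsub>M\<^esub> u bs" by metis
  have nc: "n bs \<in> carrier M" for bs using n N by blast
  have kv: "koszul xs v bs \<in> carrier M" for bs using v xs by (simp add: koszul_closed)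
  have "w bs \<ominus>\<^bsub>M\<^esub> koszul xs u bs \<in> N" if bs: "length bs = length xs" for bs
  proof -
    have ku: "koszul xs u bs \<in> carrier M" using u xs by (simp add: koszul_closed)
    have kn: "koszul xs n bs \<in> N" using koszul_mem[OF Cons.prems(1) xs _ bs] n by blast
    \<comment> \<open>The boundary of \<open>v\<close> contributes nothing, so the boundary of
      \<open>w'\<close> can be read off the remainder \<open>n + a u\<close>.\<close>
    have "koszul xs w' bs = koszul xs (\<lambda>bs. w' bs \<ominus>\<^bsub>M\<^esub> koszul xs v bs) bs"
      using xs w' v kv
      by (simp add: a_minus_def koszul_add koszul_neg koszul_koszul koszul_closed)
    also have "\<dots> = koszul xs (\<lambda>bs. n bs \<oplus>\<^bsub>M\<^esub> a \<odot>\<^bsub>M\<^esub> u bs) bs"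
      by (rule koszul_cong[OF nu bs])
    also have "\<dots> = koszul xs n bs \<oplus>\<^bsub>M\<^esub> a \<odot>\<^bsub>M\<^esub> koszul xs u bs"
      using xs nc u a by (simp add: koszul_add koszul_smult)
    finally have eq: "\<ominus>\<^bsub>M\<^esub> wedge ps (koszul xs w) bs \<oplus>\<^bsub>M\<^esub> a \<odot>\<^bsub>M\<^esub> w bs
        = koszul xs n bs \<oplus>\<^bsub>M\<^esub> a \<odot>\<^bsub>M\<^esub> koszul xs u bs" using dw(1)[OF bs] by simp
    define p q where "p = wedge ps (koszul xs w) bs" and "q = koszul xs n bs"
    have pq: "p \<in> N" "q \<in> N" "p \<in> carrier M" "q \<in> carrier M"
      using dw(2)[OF bs] kn N(1) by (auto simp: p_def q_def)
    have "a \<odot>\<^bsub>M\<^esub> w bs = p \<oplus>\<^bsub>M\<^esub> (\<ominus>\<^bsub>M\<^esub> p \<oplus>\<^bsub>M\<^esub> a \<odot>\<^bsub>M\<^esub> w bs)"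
      using pq a w by (simp add: M.r_neg2)
    also have "\<dots> = p \<oplus>\<^bsub>M\<^esub> (q \<oplus>\<^bsub>M\<^esub> a \<odot>\<^bsub>M\<^esub> koszul xs u bs)" using eq by (simp add: p_def q_def)
    finally have "a \<odot>\<^bsub>M\<^esub> w bs \<ominus>\<^bsub>M\<^esub> a \<odot>\<^bsub>M\<^esub> koszul xs u bs = p \<oplus>\<^bsub>M\<^esub> q"
      using pq ku a by (simp add: a_minus_def M.a_assoc M.r_neg)
    then have "a \<odot>\<^bsub>M\<^esub> (w bs \<ominus>\<^bsub>M\<^esub> koszul xs u bs) = p \<oplus>\<^bsub>M\<^esub> q"
      using w ku a by (simp add: a_minus_def smult_r_distr smult_r_minus)
    then have "a \<odot>\<^bsub>M\<^esub> (w bs \<ominus>\<^bsub>M\<^esub> koszul xs u bs) \<in> N" using pq N(5) by simp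
    then show ?thesis using Cons.prems(2) w ku by simp
  qed
  then show ?case using u by blast
qed

text \<open>The exterior element of degree one with coefficients \<open>fs\<close>: each entry is
  placed at the list whose only \<open>True\<close> marks its position.\<close>

fun degree_one :: "'c list \<Rightarrow> bool list \<Rightarrow> 'c" where
  "degree_one (f # fs) (b # bs) = (if b then (if filter (\<lambda>b. b) bs = [] then f else \<zero>\<^bsub>M\<^esub>) else degree_one fs bs)"
| "degree_one _ _ = \<zero>\<^bsub>M\<^esub>"

lemma degree_one_closed: "set fs \<subseteq> carrier M \<Longrightarrow> degree_one fs bs \<in> carrier M"
  by (induction fs bs rule: degree_one.induct) auto

lemma degree_one_degree: "degree_at_least (Suc 0) (degree_one fs)"
proof -
  have "filter (\<lambda>b. b) bs = [] \<Longrightarrow> degree_one fs bs = \<zero>\<^bsub>M\<^esub>" for bs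
    by (induction fs bs rule: degree_one.induct) auto
  then show ?thesis by (simp add: degree_at_least_def)
qed

lemma koszul_constant:
  "set xs \<subseteq> carrier R \<Longrightarrow> f \<in> carrier M \<Longrightarrow> length bs = length xs \<Longrightarrow>
    koszul xs (\<lambda>bs. if filter (\<lambda>b. b) bs = [] then f else \<zero>\<^bsub>M\<^esub>) bs = \<zero>\<^bsub>M\<^esub>"
proof (induction xs arbitrary: bs)
  case (Cons x xs)
  then obtain b bs' where bs: "bs = b # bs'" "length bs' = length xs" by (cases bs) auto
  show ?case using Cons bs by (auto simp: koszul_zero)
qed simp

lemma koszul_degree_one:
  "set xs \<subseteq> carrier R \<Longrightarrow> set fs \<subseteq> carrier M \<Longrightarrow> length fs = length xs \<Longrightarrow> length bs = length xs \<Longrightarrow>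
    koszul xs (degree_one fs) bs = (if filter (\<lambda>b. b) bs = [] then mdot xs fs else \<zero>\<^bsub>M\<^esub>)"
proof (induction xs arbitrary: fs bs)
  case (Cons x xs)
  obtain b bs' where bs: "bs = b # bs'" "length bs' = length xs" using Cons.prems(4) by (cases bs) auto
  obtain f fs' where fs: "fs = f # fs'" "length fs' = length xs" using Cons.prems(3) by (cases fs) auto
  have mc: "set fs \<subseteq> carrier M \<Longrightarrow> set xs \<subseteq> carrier R \<Longrightarrow> mdot xs fs \<in> carrier M" for fs xs
    by (induction xs fs rule: mdot.induct) auto
  show ?case
    using Cons bs fs mc by (auto simp: koszul_constant koszul_zero M.a_comm)
qed simp

text \<open>Only the coefficients of \<open>w\<close> in degree one contribute to its contraction in
  degree zero.\<close>

lemma koszul_at_zero: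
  assumes "submodule N R M"
  shows "set xs \<subseteq> carrier R \<Longrightarrow> (\<And>bs. length bs = length xs \<Longrightarrow> w bs \<in> N) \<Longrightarrow>
    \<exists>ks. length ks = length xs \<and> set ks \<subseteq> N \<and> koszul xs w (replicate (length xs) False) = mdot xs ks"
proof (induction xs arbitrary: w)
  case (Cons x xs)
  have "\<exists>ks. length ks = length xs \<and> set ks \<subseteq> N \<and>
      koszul xs (\<lambda>bs. w (False # bs)) (replicate (length xs) False) = mdot xs ks"
    using Cons.prems by (intro Cons.IH) auto
  then obtain ks where ks: "length ks = length xs" "set ks \<subseteq> N"
    "koszul xs (\<lambda>bs. w (False # bs)) (replicate (length xs) False) = mdot xs ks" by blast
  let ?k = "w (True # replicate (length xs) False)"
  have k: "?k \<in> N" using Cons.prems(2) by simp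
  have Nc: "N \<subseteq> carrier M" using submoduleE(1)[OF assms] .
  have mc: "set fs \<subseteq> carrier M \<Longrightarrow> set xs \<subseteq> carrier R \<Longrightarrow> mdot xs fs \<in> carrier M" for fs xs
    by (induction xs fs rule: mdot.induct) auto
  have "mdot xs ks \<in> carrier M" using ks Nc Cons.prems by (intro mc) auto
  moreover have "?k \<in> carrier M" using k Nc by blast
  ultimately show ?case
    using ks k Cons.prems by (intro exI[of _ "?k # ks"]) (auto simp: M.a_comm)
qed simp

text \<open>The vanishing of the first Koszul homology of M/N: the element of degree one with
  coefficients \<open>fs\<close> is a cycle modulo N, hence a boundary up to coefficients in N, and
  contracting this remainder yields \<open>ks\<close>. For N the relations of a minimal
  presentation, it says that N meets the multiples of the ideal in the multiples of N, the vanishing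
  of a Tor.\<close>

lemma relations_in_maximal_multiple:
  assumes N: "submodule N R M" "regular_mod N as" and xs: "set xs \<subseteq> carrier R"
    and as: "\<And>a. a \<in> set as \<Longrightarrow> \<exists>ps. length ps = length xs \<and> set ps \<subseteq> carrier R \<and> a = dot ps xs"
    and len: "length xs \<le> length as"
    and fs: "set fs \<subseteq> carrier M" "length fs = length xs" "mdot xs fs \<in> N"
  shows "\<exists>ks. length ks = length xs \<and> set ks \<subseteq> N \<and> mdot xs fs = mdot xs ks"
proof -
  let ?w = "degree_one fs"
  have w: "?w bs \<in> carrier M" for bs using fs by (simp add: degree_one_closed)
  have "koszul xs ?w bs \<in> N" if "length bs = length xs" for bs
    using that koszul_degree_one[OF xs fs(1,2)] fs(3) submodule_zero[OF N(1)] by simp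
  then obtain v where v: "\<And>bs. v bs \<in> carrier M"
    "\<And>bs. length bs = length xs \<Longrightarrow> ?w bs \<ominus>\<^bsub>M\<^esub> koszul xs v bs \<in> N"
    using koszul_exact[OF N xs as, of "Suc 0" ?w] len w degree_one_degree by auto
  let ?F = "replicate (length xs) False"
  have "koszul xs (\<lambda>bs. ?w bs \<ominus>\<^bsub>M\<^esub> koszul xs v bs) ?F = koszul xs ?w ?F"
    using xs w v by (simp add: a_minus_def koszul_add koszul_neg koszul_koszul koszul_closed)
  also have "\<dots> = mdot xs fs"
    using koszul_degree_one[OF xs fs(1,2), of ?F] by simp
  finally show ?thesis using koszul_at_zero[OF N(1) xs, of "\<lambda>bs. ?w bs \<ominus>\<^bsub>M\<^esub> koszul xs v bs"] v(2) by simp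
qed


section \<open>Free modules from long regular sequences\<close>

definition lin :: "'c set \<Rightarrow> 'c set" where
  "lin E = {(\<Oplus>\<^bsub>M\<^esub>x\<in>E. c x \<odot>\<^bsub>M\<^esub> x) | c. c \<in> E \<rightarrow> carrier R}"

lemma finsum_add_smult:
  assumes "c \<in> K \<rightarrow> carrier R" "d \<in> K \<rightarrow> carrier R" "e \<in> K \<rightarrow> carrier M"
  shows "(\<Oplus>\<^bsub>M\<^esub>i\<in>K. (c i \<oplus> d i) \<odot>\<^bsub>M\<^esub> e i) = (\<Oplus>\<^bsub>M\<^esub>i\<in>K. c i \<odot>\<^bsub>M\<^esub> e i) \<oplus>\<^bsub>M\<^esub> (\<Oplus>\<^bsub>M\<^esub>i\<in>K. d i \<odot>\<^bsub>M\<^esub> e i)"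
proof -
  have "(\<Oplus>\<^bsub>M\<^esub>i\<in>K. (c i \<oplus> d i) \<odot>\<^bsub>M\<^esub> e i) = (\<Oplus>\<^bsub>M\<^esub>i\<in>K. c i \<odot>\<^bsub>M\<^esub> e i \<oplus>\<^bsub>M\<^esub> d i \<odot>\<^bsub>M\<^esub> e i)"
    using assms by (intro M.finsum_cong') (auto simp: smult_l_distr Pi_iff)
  also have "\<dots> = (\<Oplus>\<^bsub>M\<^esub>i\<in>K. c i \<odot>\<^bsub>M\<^esub> e i) \<oplus>\<^bsub>M\<^esub> (\<Oplus>\<^bsub>M\<^esub>i\<in>K. d i \<odot>\<^bsub>M\<^esub> e i)"
    using assms by (intro M.finsum_addf) auto
  finally show ?thesis .
qed

lemma finsum_mult_smult:
  assumes "finite K" "a \<in> carrier R" "c \<in> K \<rightarrow> carrier R" "e \<in> K \<rightarrow> carrier M"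
  shows "(\<Oplus>\<^bsub>M\<^esub>i\<in>K. (a \<otimes> c i) \<odot>\<^bsub>M\<^esub> e i) = a \<odot>\<^bsub>M\<^esub> (\<Oplus>\<^bsub>M\<^esub>i\<in>K. c i \<odot>\<^bsub>M\<^esub> e i)"
proof -
  have "(\<Oplus>\<^bsub>M\<^esub>i\<in>K. (a \<otimes> c i) \<odot>\<^bsub>M\<^esub> e i) = (\<Oplus>\<^bsub>M\<^esub>i\<in>K. a \<odot>\<^bsub>M\<^esub> (c i \<odot>\<^bsub>M\<^esub> e i))"
    using assms by (intro M.finsum_cong') (auto simp: smult_assoc1 Pi_iff)
  also have "\<dots> = a \<odot>\<^bsub>M\<^esub> (\<Oplus>\<^bsub>M\<^esub>i\<in>K. c i \<odot>\<^bsub>M\<^esub> e i)"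
    using assms by (intro finsum_smult_ldistr[symmetric]) auto
  finally show ?thesis .
qed

lemma submodule_finsum:
  assumes "submodule H R M" "finite K" "\<And>i. i \<in> K \<Longrightarrow> f i \<in> H"
  shows "(\<Oplus>\<^bsub>M\<^esub>i\<in>K. f i) \<in> H"
  using assms(2,3)
proof (induction K rule: finite_induct)
  case empty
  then show ?case using submodule_zero[OF assms(1)] by simp
next
  case (insert k K)
  have "f i \<in> carrier M" if "i \<in> insert k K" for i
    using insert.prems[OF that] submoduleE(1)[OF assms(1)] by blast
  then have "(\<Oplus>\<^bsub>M\<^esub>i\<in>insert k K. f i) = f k \<oplus>\<^bsub>M\<^esub> (\<Oplus>\<^bsub>M\<^esub>i\<in>K. f i)"
    using insert.hyps by (intro M.finsum_insert) auto
  then show ?case using insert submoduleE(5)[OF assms(1)] by simp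
qed

lemma linI: "c \<in> E \<rightarrow> carrier R \<Longrightarrow> (\<Oplus>\<^bsub>M\<^esub>x\<in>E. c x \<odot>\<^bsub>M\<^esub> x) \<in> lin E"
  by (auto simp: lin_def)

lemma lin_submodule:
  assumes "finite E" "E \<subseteq> carrier M"
  shows "submodule (lin E) R M"
proof (rule submoduleI)
  have id: "(\<lambda>x. x) \<in> E \<rightarrow> carrier M" using assms by auto
  show "lin E \<subseteq> carrier M" using assms by (auto simp: lin_def intro!: M.finsum_closed)
  have "(\<Oplus>\<^bsub>M\<^esub>x\<in>E. \<zero> \<odot>\<^bsub>M\<^esub> x) = (\<Oplus>\<^bsub>M\<^esub>x\<in>E. \<zero>\<^bsub>M\<^esub>)" using assms by (intro M.finsum_cong') auto
  then have "\<zero>\<^bsub>M\<^esub> = (\<Oplus>\<^bsub>M\<^esub>x\<in>E. \<zero> \<odot>\<^bsub>M\<^esub> x)" by simp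
  then show "\<zero>\<^bsub>M\<^esub> \<in> lin E" unfolding lin_def by (intro CollectI exI[of _ "\<lambda>_. \<zero>"]) auto
  show sm: "a \<odot>\<^bsub>M\<^esub> z \<in> lin E" if a: "a \<in> carrier R" and z: "z \<in> lin E" for a z
  proof -
    obtain c where c: "c \<in> E \<rightarrow> carrier R" "z = (\<Oplus>\<^bsub>M\<^esub>x\<in>E. c x \<odot>\<^bsub>M\<^esub> x)" using z by (auto simp: lin_def)
    have "(\<lambda>x. a \<otimes> c x) \<in> E \<rightarrow> carrier R" using a c by auto
    then show ?thesis unfolding c(2) finsum_mult_smult[OF assms(1) a c(1) id, symmetric] by (rule linI)
  qed
  show "z \<oplus>\<^bsub>M\<^esub> z' \<in> lin E" if z: "z \<in> lin E" "z' \<in> lin E" for z z'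
  proof -
    obtain c where c: "c \<in> E \<rightarrow> carrier R" "z = (\<Oplus>\<^bsub>M\<^esub>x\<in>E. c x \<odot>\<^bsub>M\<^esub> x)" using z by (auto simp: lin_def)
    obtain d where d: "d \<in> E \<rightarrow> carrier R" "z' = (\<Oplus>\<^bsub>M\<^esub>x\<in>E. d x \<odot>\<^bsub>M\<^esub> x)" using z by (auto simp: lin_def)
    have "(\<lambda>x. c x \<oplus> d x) \<in> E \<rightarrow> carrier R" using c d by auto
    then show ?thesis unfolding c(2) d(2) finsum_add_smult[OF c(1) d(1) id, symmetric] by (rule linI)
  qed
  show "\<ominus>\<^bsub>M\<^esub> z \<in> lin E" if z: "z \<in> lin E" for z
    using sm[of "\<ominus> \<one>" z] z \<open>lin E \<subseteq> carrier M\<close> by (auto simp: smult_l_minus subset_iff)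
qed

lemma lin_self:
  assumes "finite E" "E \<subseteq> carrier M" "x \<in> E"
  shows "x \<in> lin E"
proof -
  have "x = (\<Oplus>\<^bsub>M\<^esub>y\<in>E. if x = y then y else \<zero>\<^bsub>M\<^esub>)"
    using assms by (intro M.add.finprod_singleton[symmetric]) auto
  also have "\<dots> = (\<Oplus>\<^bsub>M\<^esub>y\<in>E. (if x = y then \<one> else \<zero>) \<odot>\<^bsub>M\<^esub> y)"
    using assms by (intro M.finsum_cong') auto
  finally show ?thesis unfolding lin_def by (auto intro!: exI[of _ "\<lambda>y. if x = y then \<one> else \<zero>"])
qed

lemma lin_minimal:
  assumes "finite E" "submodule H R M" "E \<subseteq> H"
  shows "lin E \<subseteq> H"
  using assms submoduleE(4)[OF assms(2)] by (auto simp: lin_def intro!: submodule_finsum[OF assms(2)])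

end

text \<open>\<open>module_span\<close> and the notions built on it are declared for the unextended
  module record, whence this specialization of the locale.\<close>

locale plain_module = module R M for R :: "('a, 'c) ring_scheme" (structure) and M :: "('a, 'm) module" (structure)
begin

lemma module_span_submodule:
  assumes "E \<subseteq> carrier M"
  shows "submodule (module_span R M E) R M" "E \<subseteq> module_span R M E"
proof -
  have "carrier M \<in> {N. submodule N R M \<and> E \<subseteq> N}" using assms carrier_is_submodule by blast
  then show "submodule (module_span R M E) R M"
    unfolding module_span_def
    by (intro submoduleI) (auto dest: submoduleE submodule_zero intro: submoduleE(3,4,5))
qed (auto simp: module_span_def)

lemma module_span_minimal: "submodule H R M \<Longrightarrow> E \<subseteq> H \<Longrightarrow> module_span R M E \<subseteq> H"
  unfolding module_span_def by blast

text \<open>In a generating set of least cardinality no relation has a unit coefficient, since it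
  would express one generator by the others.\<close>

lemma minimal_generators:
  assumes "finitely_generated R M"
  obtains E where "finite E" "E \<subseteq> carrier M" "lin E = carrier M"
    "\<And>c x. c \<in> E \<rightarrow> carrier R \<Longrightarrow> (\<Oplus>\<^bsub>M\<^esub>x\<in>E. c x \<odot>\<^bsub>M\<^esub> x) = \<zero>\<^bsub>M\<^esub> \<Longrightarrow> x \<in> E \<Longrightarrow> c x \<notin> Units R"
proof -
  define G where "G E \<longleftrightarrow> finite E \<and> E \<subseteq> carrier M \<and> lin E = carrier M" for E
  obtain E0 where E0: "finite E0" "E0 \<subseteq> carrier M" "module_span R M E0 = carrier M"
    using assms by (auto simp: finitely_generated_def)
  have "carrier M \<subseteq> lin E0"
    unfolding E0(3)[symmetric] using lin_submodule lin_self E0 by (intro module_span_minimal) auto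
  then have "G E0" using E0 submoduleE(1)[OF lin_submodule[OF E0(1,2)]] by (auto simp: G_def)
  then obtain E where E: "G E" and min: "\<And>E'. G E' \<Longrightarrow> card E \<le> card E'"
    using ex_has_least_nat[of G E0 card] by blast
  have fin: "finite E" and sub: "E \<subseteq> carrier M" and gen: "lin E = carrier M" using E by (auto simp: G_def)
  have "c x \<notin> Units R" if c: "c \<in> E \<rightarrow> carrier R" "(\<Oplus>\<^bsub>M\<^esub>x\<in>E. c x \<odot>\<^bsub>M\<^esub> x) = \<zero>\<^bsub>M\<^esub>" and x: "x \<in> E" for c x
  proof
    assume u: "c x \<in> Units R"
    define E' where "E' = E - {x}"
    have E': "finite E'" "E' \<subseteq> carrier M" "E = insert x E'" "x \<notin> E'" using fin sub x by (auto simp: E'_def)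
    let ?s = "\<Oplus>\<^bsub>M\<^esub>y\<in>E'. c y \<odot>\<^bsub>M\<^esub> y"
    have lsub: "submodule (lin E') R M" using lin_submodule E' by blast
    have s: "?s \<in> lin E'" using c E' by (auto simp: lin_def)
    then have sc: "?s \<in> carrier M" using submoduleE(1)[OF lsub] by blast
    have xc: "x \<in> carrier M" "c x \<in> carrier R" "inv (c x) \<in> carrier R" using x sub u by auto
    have "(\<Oplus>\<^bsub>M\<^esub>x\<in>E. c x \<odot>\<^bsub>M\<^esub> x) = c x \<odot>\<^bsub>M\<^esub> x \<oplus>\<^bsub>M\<^esub> ?s"
      unfolding E'(3) using c E' xc by (intro M.finsum_insert) auto
    then have "c x \<odot>\<^bsub>M\<^esub> x = \<ominus>\<^bsub>M\<^esub> ?s"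
      using c(2) xc sc by (simp add: M.minus_equality[symmetric])
    then have "inv (c x) \<odot>\<^bsub>M\<^esub> (c x \<odot>\<^bsub>M\<^esub> x) \<in> lin E'"
      using submoduleE(3,4)[OF lsub] s xc by auto
    moreover have "inv (c x) \<odot>\<^bsub>M\<^esub> (c x \<odot>\<^bsub>M\<^esub> x) = x"
      using xc u by (simp flip: smult_assoc1)
    ultimately have "x \<in> lin E'" by simp
    then have "E \<subseteq> lin E'" using E' lin_self[OF E'(1,2)] by blast
    then have "lin E \<subseteq> lin E'" using lin_minimal[OF fin lsub] by blast
    then have "G E'" using E' gen submoduleE(1)[OF lsub] by (auto simp: G_def)
    then have "card E \<le> card E'" by (rule min)
    then show False using E' by simp
  qed
  then show ?thesis using that fin sub gen by blast
qed

text \<open>Converts the regular sequences in the definition of depth into the recursive form of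
  \<open>regular_mod\<close>.\<close>

lemma scaled_submodule_snoc:
  assumes "set rs \<subseteq> carrier R" "i < length rs"
  shows "scaled_submodule R (set (take (Suc i) rs)) M
    = enlarge (scaled_submodule R (set (take i rs)) M) (rs ! i)"
proof -
  let ?G = "\<lambda>J. {a \<odot>\<^bsub>M\<^esub> x | a x. a \<in> J \<and> x \<in> carrier M}"
  let ?S = "\<lambda>i. scaled_submodule R (set (take i rs)) M"
  have G: "?G (set (take i rs)) \<subseteq> carrier M" for i using assms set_take_subset[of i rs] by auto
  note sub = module_span_submodule[OF G, folded scaled_submodule_def]
  have a: "rs ! i \<in> carrier R" using assms by auto
  have set: "set (take (Suc i) rs) = insert (rs ! i) (set (take i rs))"
    using assms by (simp add: take_Suc_conv_app_nth)
  have "enlarge (?S i) (rs ! i) \<subseteq> ?S (Suc i)"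
  proof -
    have "?S i \<subseteq> ?S (Suc i)"
      unfolding scaled_submodule_def[of R "set (take i rs)"]
      using sub(2)[of "Suc i"] set by (intro module_span_minimal[OF sub(1)]) auto
    moreover have "rs ! i \<odot>\<^bsub>M\<^esub> m \<in> ?S (Suc i)" if "m \<in> carrier M" for m
      using sub(2)[of "Suc i"] set that by blast
    ultimately show ?thesis using submoduleE(5)[OF sub(1)] by (auto simp: enlarge_def)
  qed
  moreover have "?S (Suc i) \<subseteq> enlarge (?S i) (rs ! i)"
    unfolding scaled_submodule_def[of R "set (take (Suc i) rs)"]
  proof (rule module_span_minimal)
    show "submodule (enlarge (?S i) (rs ! i)) R M" using enlarge_submodule[OF sub(1) a] .
    show "?G (set (take (Suc i) rs)) \<subseteq> enlarge (?S i) (rs ! i)"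
    proof safe
      fix b m assume b: "b \<in> set (take (Suc i) rs)" and m: "m \<in> carrier M"
      show "b \<odot>\<^bsub>M\<^esub> m \<in> enlarge (?S i) (rs ! i)"
      proof (cases "b = rs ! i")
        case True
        have "b \<odot>\<^bsub>M\<^esub> m = \<zero>\<^bsub>M\<^esub> \<oplus>\<^bsub>M\<^esub> rs ! i \<odot>\<^bsub>M\<^esub> m" using True a m by simp
        then show ?thesis using submodule_zero[OF sub(1)] m unfolding enlarge_def by blast
      next
        case False
        then have "b \<odot>\<^bsub>M\<^esub> m \<in> ?S i" using b set sub(2)[of i] m by blast
        moreover then have "b \<odot>\<^bsub>M\<^esub> m = b \<odot>\<^bsub>M\<^esub> m \<oplus>\<^bsub>M\<^esub> rs ! i \<odot>\<^bsub>M\<^esub> \<zero>\<^bsub>M\<^esub>"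
          using a m submoduleE(1)[OF sub(1), of i] by auto
        ultimately show ?thesis unfolding enlarge_def by blast
      qed
    qed
  qed
  ultimately show ?thesis by blast
qed

end

lemma (in cring) free_module_module: "module R (free_module R r)"
proof (rule moduleI)
  show "abelian_group (free_module R r)"
  proof (rule abelian_groupI)
    fix v assume v: "v \<in> carrier (free_module R r)"
    then show "\<exists>w\<in>carrier (free_module R r). w \<oplus>\<^bsub>free_module R r\<^esub> v = \<zero>\<^bsub>free_module R r\<^esub>"
      by (intro bexI[of _ "\<lambda>i\<in>{..<r}. \<ominus> v i"])
        (auto simp: free_module_def l_neg fun_eq_iff PiE_iff)
  qed (auto simp: free_module_def a_ac fun_eq_iff PiE_iff extensional_def)
qed (auto simp: free_module_def l_distr r_distr m_assoc fun_eq_iff PiE_iff extensional_def is_cring)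

text \<open>The case of projective dimension zero in the Auslander-Buchsbaum formula, for a local
  ring with maximal ideal J generated by \<open>xs\<close>. Let L be the relations of a minimal
  generating system. Minimality puts L into J times the free module, and the regular sequence makes
  L meet these multiples in JL only, so L = JL. Finite generation of L is not known, so Nakayama's
  lemma gives way to the separated filtration Q, a stand-in for the powers of J: L lies in every
  step of it.\<close>

theorem (in plain_module) free_of_depth:
  fixes Q :: "nat \<Rightarrow> 'a set" and xs :: "'a list"
  defines "J \<equiv> {dot ps xs | ps. length ps = length xs \<and> set ps \<subseteq> carrier R}"
  assumes fg: "finitely_generated R M" and xs: "set xs \<subseteq> carrier R"
    and J_ideal: "ideal J R"
    and J_units: "\<And>a. a \<in> carrier R \<Longrightarrow> a \<notin> J \<Longrightarrow> a \<in> Units R"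
    and J_one: "\<one> \<notin> J"
    and Q_0: "Q 0 = carrier R" and Q_zero: "\<And>k. \<zero> \<in> Q k"
    and Q_add: "\<And>k a b. a \<in> Q k \<Longrightarrow> b \<in> Q k \<Longrightarrow> a \<oplus> b \<in> Q k"
    and Q_mult: "\<And>k a x. x \<in> set xs \<Longrightarrow> a \<in> Q k \<Longrightarrow> x \<otimes> a \<in> Q (Suc k)"
    and Q_separated: "\<And>a. (\<And>k. a \<in> Q k) \<Longrightarrow> a = \<zero>"
    and depth: "scaled_submodule R J M = carrier M \<or>
      (\<exists>rs. set rs \<subseteq> J \<and> regular_sequence R M rs \<and> length xs \<le> length rs)"
  shows "\<exists>(r::nat) e. e \<in> {..<r} \<rightarrow> carrier M \<and>
    (\<forall>m\<in>carrier M. \<exists>c\<in>{..<r} \<rightarrow> carrier R. m = (\<Oplus>\<^bsub>M\<^esub>i\<in>{..<r}. c i \<odot>\<^bsub>M\<^esub> e i)) \<and>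
    (\<forall>c\<in>{..<r} \<rightarrow> carrier R. (\<Oplus>\<^bsub>M\<^esub>i\<in>{..<r}. c i \<odot>\<^bsub>M\<^esub> e i) = \<zero>\<^bsub>M\<^esub> \<longrightarrow> (\<forall>i<r. c i = \<zero>))"
proof -
  obtain E where E: "finite E" "E \<subseteq> carrier M" "lin E = carrier M"
    and rel: "\<And>c x. c \<in> E \<rightarrow> carrier R \<Longrightarrow> (\<Oplus>\<^bsub>M\<^esub>x\<in>E. c x \<odot>\<^bsub>M\<^esub> x) = \<zero>\<^bsub>M\<^esub> \<Longrightarrow> x \<in> E \<Longrightarrow> c x \<notin> Units R"
    using minimal_generators[OF fg] by blast
  define r where "r = card E"
  obtain e where e: "bij_betw e {..<r} E"
    using E(1) unfolding r_def by (metis bij_betw_from_nat_into_finite bij_betw_iff_card card_lessThan finite_lessThan)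
  have ec: "e \<in> {..<r} \<rightarrow> carrier M" using e E(2) by (auto simp: bij_betw_def)
  have reindex: "(\<Oplus>\<^bsub>M\<^esub>x\<in>E. c x \<odot>\<^bsub>M\<^esub> x) = (\<Oplus>\<^bsub>M\<^esub>i\<in>{..<r}. c (e i) \<odot>\<^bsub>M\<^esub> e i)"
    if "c \<in> E \<rightarrow> carrier R" for c
  proof -
    have "(\<Oplus>\<^bsub>M\<^esub>x\<in>e ` {..<r}. c x \<odot>\<^bsub>M\<^esub> x) = (\<Oplus>\<^bsub>M\<^esub>i\<in>{..<r}. c (e i) \<odot>\<^bsub>M\<^esub> e i)"
      using e E(2) that by (intro M.finsum_reindex) (auto simp: bij_betw_def)
    then show ?thesis using e by (simp add: bij_betw_def)
  qed
  define ev where "ev c = (\<Oplus>\<^bsub>M\<^esub>i\<in>{..<r}. c i \<odot>\<^bsub>M\<^esub> e i)" for c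
  have gen: "\<exists>c\<in>{..<r} \<rightarrow> carrier R. m = ev c" if m: "m \<in> carrier M" for m
  proof -
    obtain c where c: "c \<in> E \<rightarrow> carrier R" "m = (\<Oplus>\<^bsub>M\<^esub>x\<in>E. c x \<odot>\<^bsub>M\<^esub> x)"
    proof -
      have "m \<in> lin E" using m E(3) by simp
      then show ?thesis unfolding lin_def using that by blast
    qed
    then show ?thesis using reindex[OF c(1)] e
      by (intro bexI[of _ "\<lambda>i. c (e i)"]) (auto simp: ev_def bij_betw_def)
  qed
  have rel_J: "c i \<in> J" if c: "c \<in> {..<r} \<rightarrow> carrier R" "ev c = \<zero>\<^bsub>M\<^esub>" and i: "i < r" for c i
  proof (rule ccontr)
    assume "c i \<notin> J"
    then have u: "c i \<in> Units R" using J_units c i by auto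
    define d where "d = (\<lambda>x. c (inv_into {..<r} e x))"
    have d: "d (e i) = c i" if "i < r" for i
      using e that by (simp add: d_def bij_betw_def inv_into_f_f)
    have dc: "d \<in> E \<rightarrow> carrier R"
      using c e by (auto simp: d_def bij_betw_def inv_into_into Pi_iff intro!: c(1)[THEN funcset_mem])
    have "(\<Oplus>\<^bsub>M\<^esub>i\<in>{..<r}. d (e i) \<odot>\<^bsub>M\<^esub> e i) = ev c"
      unfolding ev_def using c ec by (intro M.finsum_cong') (auto simp: d Pi_iff)
    then have "(\<Oplus>\<^bsub>M\<^esub>x\<in>E. d x \<odot>\<^bsub>M\<^esub> x) = \<zero>\<^bsub>M\<^esub>" using reindex[OF dc] c by simp
    moreover have "e i \<in> E" using e i by (auto simp: bij_betw_def)
    ultimately show False using rel[OF dc, of "e i"] u d[OF i] by simp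
  qed
  define F where "F = free_module R r"
  interpret F: module R F unfolding F_def by (rule free_module_module)
  have Fc: "c \<in> {..<r} \<rightarrow> carrier R" if "c \<in> carrier F" for c
    using that by (auto simp: F_def free_module_def)
  have F_res: "restrict c {..<r} \<in> carrier F" if "c \<in> {..<r} \<rightarrow> carrier R" for c
    using that by (auto simp: F_def free_module_def)
  have ev_res: "ev (restrict c {..<r}) = ev c" if "c \<in> {..<r} \<rightarrow> carrier R" for c
    unfolding ev_def using that ec by (intro M.finsum_cong') (auto simp: Pi_iff)
  have ev_closed: "ev c \<in> carrier M" if "c \<in> carrier F" for c
    unfolding ev_def using Fc[OF that] ec by (intro M.finsum_closed) auto
  have ev_add: "ev (c \<oplus>\<^bsub>F\<^esub> d) = ev c \<oplus>\<^bsub>M\<^esub> ev d" if c: "c \<in> carrier F" and d: "d \<in> carrier F" for c d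
  proof -
    have "ev (c \<oplus>\<^bsub>F\<^esub> d) = ev (restrict (\<lambda>i. c i \<oplus> d i) {..<r})" by (simp add: F_def free_module_def)
    also have "\<dots> = ev (\<lambda>i. c i \<oplus> d i)" using Fc[OF c] Fc[OF d] by (intro ev_res) auto
    also have "\<dots> = ev c \<oplus>\<^bsub>M\<^esub> ev d"
      unfolding ev_def using Fc[OF c] Fc[OF d] ec by (rule finsum_add_smult)
    finally show ?thesis .
  qed
  have ev_smult: "ev (a \<odot>\<^bsub>F\<^esub> c) = a \<odot>\<^bsub>M\<^esub> ev c" if c: "c \<in> carrier F" and a: "a \<in> carrier R" for a c
  proof -
    have "ev (a \<odot>\<^bsub>F\<^esub> c) = ev (restrict (\<lambda>i. a \<otimes> c i) {..<r})" by (simp add: F_def free_module_def)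
    also have "\<dots> = ev (\<lambda>i. a \<otimes> c i)" using Fc[OF c] a by (intro ev_res) auto
    also have "\<dots> = a \<odot>\<^bsub>M\<^esub> ev c"
      unfolding ev_def by (rule finsum_mult_smult[OF finite_lessThan a Fc[OF c] ec])
    finally show ?thesis .
  qed
  have ev_neg: "ev (\<ominus>\<^bsub>F\<^esub> c) = \<ominus>\<^bsub>M\<^esub> ev c" if c: "c \<in> carrier F" for c
    using ev_smult[OF c, of "\<ominus> \<one>"] c ev_closed by (simp add: F.smult_l_minus smult_l_minus)
  have ev_zero: "ev \<zero>\<^bsub>F\<^esub> = \<zero>\<^bsub>M\<^esub>" using ev_smult[of "\<zero>\<^bsub>F\<^esub>" \<zero>] ev_closed by simp
  have ev_surj: "\<exists>c\<in>carrier F. ev c = m" if "m \<in> carrier M" for m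
    using gen[OF that] F_res ev_res by metis
  \<comment> \<open>The Koszul argument runs in the free module F modulo preimages of submodules of
    M. These quotients are those of M, and the relation module becomes one of the submodules to
    which the argument applies.\<close>
  define pre where "pre H = {c \<in> carrier F. ev c \<in> H}" for H
  have pre_sub: "submodule (pre H) R F" if H: "submodule H R M" for H
    using submoduleE[OF H] submodule_zero[OF H]
    by (intro F.submoduleI) (auto simp: pre_def ev_add ev_smult ev_neg ev_zero)
  have pre_enlarge: "F.enlarge (pre H) a = pre (enlarge H a)" if H: "submodule H R M" and a: "a \<in> carrier R" for H a
  proof (rule equalityI; rule subsetI)
    fix c assume "c \<in> F.enlarge (pre H) a"
    then show "c \<in> pre (enlarge H a)"
      using a by (auto simp: F.enlarge_def pre_def enlarge_def ev_add ev_smult) (use ev_closed in blast)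
  next
    fix c assume "c \<in> pre (enlarge H a)"
    then obtain n m where c: "c \<in> carrier F" "n \<in> H" "m \<in> carrier M" "ev c = n \<oplus>\<^bsub>M\<^esub> a \<odot>\<^bsub>M\<^esub> m"
      by (auto simp: pre_def enlarge_def)
    obtain d where d: "d \<in> carrier F" "ev d = m" using ev_surj c(3) by blast
    have nc: "n \<in> carrier M" using c(2) submoduleE(1)[OF H] by blast
    have "ev (c \<ominus>\<^bsub>F\<^esub> a \<odot>\<^bsub>F\<^esub> d) = n"
      using c d a nc by (simp add: a_minus_def ev_add ev_neg ev_smult M.a_assoc M.r_neg)
    then have "c \<ominus>\<^bsub>F\<^esub> a \<odot>\<^bsub>F\<^esub> d \<in> pre H" using c d a by (simp add: pre_def)
    moreover have "c = (c \<ominus>\<^bsub>F\<^esub> a \<odot>\<^bsub>F\<^esub> d) \<oplus>\<^bsub>F\<^esub> a \<odot>\<^bsub>F\<^esub> d"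
      using c d a by (simp add: a_minus_def F.M.a_assoc F.M.l_neg)
    ultimately show "c \<in> F.enlarge (pre H) a" using d unfolding F.enlarge_def by blast
  qed
  show ?thesis
  proof (cases "scaled_submodule R J M = carrier M")
    case True
    \<comment> \<open>The case of infinite depth, JM = M. A generator \<open>e 0\<close> would be a
      combination with coefficients \<open>c\<close> in J; minimality puts the coefficient
      \<open>1 - c 0\<close> of the resulting relation into J, and then 1 as well.\<close>
    have "r = 0"
    proof (rule ccontr)
      assume "r \<noteq> 0"
      then have r: "0 < r" by simp
      define H where "H = {ev c | c. c \<in> {..<r} \<rightarrow> J}"
      have Jc: "a \<in> carrier R" if "a \<in> J" for a using that ideal.Icarr[OF J_ideal] by blast
      note Jsub = ideal.axioms(1)[OF J_ideal]
      have Ja: "a \<oplus> b \<in> J" if "a \<in> J" "b \<in> J" for a b using that additive_subgroup.a_closed[OF Jsub] by blast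
      have "submodule H R M"
      proof (rule submoduleI)
        have cc: "c \<in> {..<r} \<rightarrow> carrier R" if "c \<in> {..<r} \<rightarrow> J" for c using that Jc by auto
        show "H \<subseteq> carrier M" using finsum_smult_closed[OF cc ec] by (auto simp: H_def ev_def)
        have z: "(\<lambda>_. \<zero>) \<in> {..<r} \<rightarrow> J" using additive_subgroup.zero_closed[OF Jsub] by auto
        have "ev (\<lambda>_. \<zero>) = \<zero> \<odot>\<^bsub>M\<^esub> ev (\<lambda>_. \<zero>)"
          unfolding ev_def using finsum_mult_smult[OF finite_lessThan R.zero_closed cc[OF z] ec] by simp
        then have "ev (\<lambda>_. \<zero>) = \<zero>\<^bsub>M\<^esub>" using cc[OF z] ec by (simp add: ev_def)
        then show "\<zero>\<^bsub>M\<^esub> \<in> H" unfolding H_def using z by force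
        show sm: "a \<odot>\<^bsub>M\<^esub> h \<in> H" if a: "a \<in> carrier R" and h: "h \<in> H" for a h
        proof -
          obtain c where c: "c \<in> {..<r} \<rightarrow> J" "h = ev c" using h by (auto simp: H_def)
          have "(\<lambda>i. a \<otimes> c i) \<in> {..<r} \<rightarrow> J" using c a ideal.I_l_closed[OF J_ideal] by auto
          moreover have "a \<odot>\<^bsub>M\<^esub> h = ev (\<lambda>i. a \<otimes> c i)"
            unfolding ev_def c(2) using finsum_mult_smult[OF finite_lessThan a cc[OF c(1)] ec] by simp
          ultimately show ?thesis unfolding H_def by blast
        qed
        show "\<ominus>\<^bsub>M\<^esub> h \<in> H" if "h \<in> H" for h
          using sm[of "\<ominus> \<one>" h] that \<open>H \<subseteq> carrier M\<close> by (auto simp: smult_l_minus subset_iff)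
        show "h \<oplus>\<^bsub>M\<^esub> h' \<in> H" if h: "h \<in> H" "h' \<in> H" for h h'
        proof -
          obtain c where c: "c \<in> {..<r} \<rightarrow> J" "h = ev c" using h by (auto simp: H_def)
          obtain d where d: "d \<in> {..<r} \<rightarrow> J" "h' = ev d" using h by (auto simp: H_def)
          have "(\<lambda>i. c i \<oplus> d i) \<in> {..<r} \<rightarrow> J" using c d Ja by auto
          moreover have "h \<oplus>\<^bsub>M\<^esub> h' = ev (\<lambda>i. c i \<oplus> d i)"
            unfolding ev_def c(2) d(2) using finsum_add_smult[OF cc[OF c(1)] cc[OF d(1)] ec] by simp
          ultimately show ?thesis unfolding H_def by blast
        qed
      qed
      moreover have "{a \<odot>\<^bsub>M\<^esub> x | a x. a \<in> J \<and> x \<in> carrier M} \<subseteq> H"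
      proof safe
        fix a m assume a: "a \<in> J" and m: "m \<in> carrier M"
        obtain c where c: "c \<in> {..<r} \<rightarrow> carrier R" "m = ev c" using gen[OF m] by blast
        have "(\<lambda>i. a \<otimes> c i) \<in> {..<r} \<rightarrow> J" using c a ideal.I_r_closed[OF J_ideal] by auto
        moreover have "a \<odot>\<^bsub>M\<^esub> m = ev (\<lambda>i. a \<otimes> c i)"
          unfolding ev_def c(2) using finsum_mult_smult[OF finite_lessThan Jc[OF a] c(1) ec] by simp
        ultimately show "a \<odot>\<^bsub>M\<^esub> m \<in> H" unfolding H_def by blast
      qed
      ultimately have "scaled_submodule R J M \<subseteq> H"
        unfolding scaled_submodule_def by (rule module_span_minimal)
      then have "carrier M \<subseteq> H" using True by simp
      moreover have "e 0 \<in> carrier M" using ec r by auto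
      ultimately obtain c where c: "c \<in> {..<r} \<rightarrow> J" "e 0 = ev c" by (auto simp: H_def)
      have cc: "c \<in> {..<r} \<rightarrow> carrier R" using c Jc by auto
      define \<delta> where "\<delta> = (\<lambda>i::nat. if i = 0 then \<one> else \<zero>)"
      have \<delta>: "\<delta> \<in> {..<r} \<rightarrow> carrier R" by (auto simp: \<delta>_def)
      have "ev \<delta> = (\<Oplus>\<^bsub>M\<^esub>i\<in>{..<r}. if 0 = i then e i else \<zero>\<^bsub>M\<^esub>)"
        unfolding ev_def using ec by (intro M.finsum_cong') (auto simp: \<delta>_def Pi_iff)
      also have "\<dots> = e 0" using ec r by (intro M.add.finprod_singleton) auto
      finally have ev\<delta>: "ev \<delta> = e 0" .
      have nc: "(\<lambda>i. \<ominus> \<one> \<otimes> c i) \<in> {..<r} \<rightarrow> carrier R" using cc by auto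
      have "ev (\<lambda>i. \<delta> i \<oplus> \<ominus> \<one> \<otimes> c i) = ev \<delta> \<oplus>\<^bsub>M\<^esub> ev (\<lambda>i. \<ominus> \<one> \<otimes> c i)"
        unfolding ev_def by (rule finsum_add_smult[OF \<delta> nc ec])
      also have "ev (\<lambda>i. \<ominus> \<one> \<otimes> c i) = \<ominus> \<one> \<odot>\<^bsub>M\<^esub> ev c"
        unfolding ev_def by (rule finsum_mult_smult[OF finite_lessThan _ cc ec]) simp
      finally have "ev (\<lambda>i. \<delta> i \<oplus> \<ominus> \<one> \<otimes> c i) = \<zero>\<^bsub>M\<^esub>"
        using ev\<delta> c(2) \<open>e 0 \<in> carrier M\<close> by (simp add: smult_l_minus M.r_neg)
      then have "\<delta> 0 \<oplus> \<ominus> \<one> \<otimes> c 0 \<in> J"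
        using rel_J[of "\<lambda>i. \<delta> i \<oplus> \<ominus> \<one> \<otimes> c i" 0] \<delta> cc r by auto
      moreover have c0: "c 0 \<in> J" "c 0 \<in> carrier R" using c(1) cc r by auto
      ultimately have "(\<delta> 0 \<oplus> \<ominus> \<one> \<otimes> c 0) \<oplus> c 0 \<in> J" using Ja by blast
      then have "\<one> \<in> J" using c0 by (simp add: \<delta>_def l_minus R.a_assoc R.l_neg)
      then show False using J_one by blast
    qed
    then show ?thesis
      using gen[unfolded ev_def] ec by (intro exI[of _ r], intro exI[of _ e]) simp
  next
    case False
    then obtain rs where rs: "set rs \<subseteq> J" "regular_sequence R M rs" "length xs \<le> length rs"
      using depth by blast
    have rsR: "set rs \<subseteq> carrier R" using rs(2) by (simp add: regular_sequence_def)
    define S where "S = (\<lambda>i. scaled_submodule R (set (take i rs)) M)"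
    have S_sub: "submodule (S i) R M" for i
      unfolding S_def scaled_submodule_def
      using rsR set_take_subset[of i rs] by (intro module_span_submodule) auto
    have regular: "F.regular_mod (pre (S i)) (drop i rs)" if "i \<le> length rs" for i
      using that
    proof (induction "length rs - i" arbitrary: i)
      case 0
      then show ?case by simp
    next
      case (Suc k)
      then have i: "i < length rs" by simp
      have a: "rs ! i \<in> carrier R" using rsR i by auto
      have "F.regular_mod (pre (S (Suc i))) (drop (Suc i) rs)" using Suc i by auto
      moreover have "S (Suc i) = enlarge (S i) (rs ! i)"
        unfolding S_def by (rule scaled_submodule_snoc[OF rsR i])
      then have "pre (S (Suc i)) = F.enlarge (pre (S i)) (rs ! i)"
        using pre_enlarge[OF S_sub a] by simp
      moreover have "m \<in> pre (S i)" if "m \<in> carrier F" "rs ! i \<odot>\<^bsub>F\<^esub> m \<in> pre (S i)" for m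
        using that rs(2) i a ev_closed[OF that(1)]
        by (auto simp: pre_def ev_smult S_def regular_sequence_def)
      ultimately show ?case using i by (simp add: Cons_nth_drop_Suc[symmetric])
    qed
    define L where "L = pre {\<zero>\<^bsub>M\<^esub>}"
    have "S 0 = {\<zero>\<^bsub>M\<^esub>}"
    proof -
      have "submodule {\<zero>\<^bsub>M\<^esub>} R M" by (rule submoduleI) auto
      then have "S 0 \<subseteq> {\<zero>\<^bsub>M\<^esub>}" unfolding S_def scaled_submodule_def by (intro module_span_minimal) auto
      then show ?thesis using submodule_zero[OF S_sub[of 0]] by blast
    qed
    then have L_reg: "F.regular_mod L rs" using regular[of 0] by (simp add: L_def)
    have L_sub: "submodule L R F" unfolding L_def by (rule pre_sub, rule submoduleI) auto
    have F_add: "(c \<oplus>\<^bsub>F\<^esub> d) i = c i \<oplus> d i" and F_smult: "(a \<odot>\<^bsub>F\<^esub> c) i = a \<otimes> c i" if "i < r" for a c d i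
      using that by (simp_all add: F_def free_module_def)
    have F_zero: "\<zero>\<^bsub>F\<^esub> i = \<zero>" if "i < r" for i
      using that by (simp add: F_def free_module_def)
    have F_ext: "c = d" if "c \<in> carrier F" "d \<in> carrier F" "\<And>i. i < r \<Longrightarrow> c i = d i" for c d
      by (rule PiE_ext[of c "{..<r}" "\<lambda>_. carrier R" d]) (use that in \<open>simp_all add: F_def free_module_def\<close>)
    \<comment> \<open>Cofactors found for each coordinate separately are regrouped into vectors, one
      for each entry of \<open>ys\<close>.\<close>
    have coords: "\<exists>fs. set fs \<subseteq> carrier F \<and> length fs = length ys \<and> c = F.mdot ys fs"
      if "set ys \<subseteq> carrier R" "c \<in> carrier F"
        "\<And>i. i < r \<Longrightarrow> \<exists>ps. length ps = length ys \<and> set ps \<subseteq> carrier R \<and> c i = dot ps ys" for ys c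
      using that
    proof (induction ys arbitrary: c)
      case Nil
      then have "c = \<zero>\<^bsub>F\<^esub>" by (intro F_ext) (auto simp: F_zero)
      then show ?case by simp
    next
      case (Cons y ys)
      have "\<forall>i. \<exists>ps. i < r \<longrightarrow> length ps = length (y # ys) \<and> set ps \<subseteq> carrier R \<and> c i = dot ps (y # ys)"
        using Cons.prems(3) by blast
      then obtain P where P: "\<And>i. i < r \<Longrightarrow> length (P i) = length (y # ys)"
        "\<And>i. i < r \<Longrightarrow> set (P i) \<subseteq> carrier R" "\<And>i. i < r \<Longrightarrow> c i = dot (P i) (y # ys)" by metis
      have P': "\<exists>q qs. P i = q # qs \<and> q \<in> carrier R \<and> set qs \<subseteq> carrier R \<and> length qs = length ys" if "i < r" for i
        using P(1,2)[OF that] by (cases "P i") auto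
      define f where "f = restrict (\<lambda>i. hd (P i)) {..<r}"
      define c' where "c' = restrict (\<lambda>i. dot (tl (P i)) ys) {..<r}"
      have f: "f \<in> carrier F" unfolding f_def using P' by (intro F_res) fastforce
      have c': "c' \<in> carrier F" unfolding c'_def using P' Cons.prems(1)
        by (intro F_res) (fastforce intro: dot_closed)
      have "\<exists>fs. set fs \<subseteq> carrier F \<and> length fs = length ys \<and> c' = F.mdot ys fs"
      proof (rule Cons.IH)
        fix i assume "i < r"
        then show "\<exists>ps. length ps = length ys \<and> set ps \<subseteq> carrier R \<and> c' i = dot ps ys"
          using P'[of i] by (auto simp: c'_def)
      qed (use Cons.prems c' in auto)
      then obtain fs where fs: "set fs \<subseteq> carrier F" "length fs = length ys" "c' = F.mdot ys fs" by blast
      have "c = y \<odot>\<^bsub>F\<^esub> f \<oplus>\<^bsub>F\<^esub> c'"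
      proof (rule F_ext)
        fix i assume i: "i < r"
        then obtain q qs where "P i = q # qs" "q \<in> carrier R" using P' by blast
        then show "c i = (y \<odot>\<^bsub>F\<^esub> f \<oplus>\<^bsub>F\<^esub> c') i"
          using i P(3)[OF i] Cons.prems(1) by (simp add: F_add F_smult f_def c'_def m_comm)
      qed (use Cons.prems f c' in auto)
      then show ?case using fs f by (intro exI[of _ "f # fs"]) auto
    qed
    have Fmdot_closed: "F.mdot ys ks \<in> carrier F" if "set ys \<subseteq> carrier R" "set ks \<subseteq> carrier F" for ys ks
      using that by (induction ys ks rule: F.mdot.induct) auto
    have mdot_Q: "F.mdot ys ks i \<in> Q (Suc k)"
      if "set ys \<subseteq> set xs" "\<forall>c\<in>set ks. c i \<in> Q k" "i < r" for ys ks i k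
      using that by (induction ys ks rule: F.mdot.induct) (auto simp: F_add F_smult F_zero Q_zero Q_add Q_mult)
    have L_F: "L \<subseteq> carrier F" by (auto simp: L_def pre_def)
    \<comment> \<open>Each round uses L = JL once and gains one step of the filtration.\<close>
    have L_Q: "\<forall>c\<in>L. \<forall>i<r. c i \<in> Q k" for k
    proof (induction k)
      case 0
      then show ?case using L_F Fc Q_0 by blast
    next
      case (Suc k)
      show ?case
      proof (intro ballI allI impI)
        fix c i assume c: "c \<in> L" and i: "i < r"
        have "\<exists>fs. set fs \<subseteq> carrier F \<and> length fs = length xs \<and> c = F.mdot xs fs"
        proof (rule coords[OF xs])
          show "c \<in> carrier F" using c L_F by blast
          fix i assume "i < r"
          then have "c i \<in> J" using rel_J Fc c by (auto simp: L_def pre_def)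
          then show "\<exists>ps. length ps = length xs \<and> set ps \<subseteq> carrier R \<and> c i = dot ps xs"
            unfolding J_def by blast
        qed
        then obtain fs where fs: "set fs \<subseteq> carrier F" "length fs = length xs" "c = F.mdot xs fs" by blast
        have "\<exists>ks. length ks = length xs \<and> set ks \<subseteq> L \<and> F.mdot xs fs = F.mdot xs ks"
        proof (rule F.relations_in_maximal_multiple[OF L_sub L_reg xs _ rs(3) fs(1,2)])
          fix a assume "a \<in> set rs"
          then show "\<exists>ps. length ps = length xs \<and> set ps \<subseteq> carrier R \<and> a = F.dot ps xs"
            using rs(1) unfolding J_def by blast
        qed (use c fs in simp)
        then obtain ks where ks: "set ks \<subseteq> L" "c = F.mdot xs ks" using fs(3) by blast
        have "\<forall>c\<in>set ks. c i \<in> Q k" using ks(1) Suc.IH i by blast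
        then show "c i \<in> Q (Suc k)" unfolding ks(2) using i by (intro mdot_Q) auto
      qed
    qed
    have "c i = \<zero>" if c: "c \<in> {..<r} \<rightarrow> carrier R" "ev c = \<zero>\<^bsub>M\<^esub>" and i: "i < r" for c i
    proof -
      have "restrict c {..<r} \<in> L" using F_res[OF c(1)] ev_res[OF c(1)] c(2) by (simp add: L_def pre_def)
      then have "c i \<in> Q k" for k using L_Q[of k] i by fastforce
      then show ?thesis by (rule Q_separated)
    qed
    then show ?thesis using gen ec unfolding ev_def by (intro exI[of _ r] exI[of _ e] conjI ballI impI allI) auto
  qed
qed

section \<open>Localization\<close>

text \<open>Operations on fractions are unions over all representatives; independence of the
  representative collapses such a union to a single value.\<close>

lemma UN_constant_on: "A \<noteq> {} \<Longrightarrow> (\<And>z. z \<in> A \<Longrightarrow> f z = c) \<Longrightarrow> (\<Union>z\<in>A. f z) = c"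
  by auto

lemma (in cring) self_module_module: "module R (self_module R)"
  by (rule moduleI) (auto simp: self_module_def l_distr r_distr m_assoc is_cring a_ac l_neg
      intro!: abelian_groupI)

locale localization = module R M
  for R :: "('a, 'c) ring_scheme" (structure) and M :: "('a, 'm) module" (structure) +
  fixes D :: "'a set"
  assumes D_sub: "D \<subseteq> carrier R" and D_one: "\<one> \<in> D"
    and D_mult: "s \<in> D \<Longrightarrow> t \<in> D \<Longrightarrow> s \<otimes> t \<in> D"
begin

lemma D_carrier [simp]: "s \<in> D \<Longrightarrow> s \<in> carrier R"
  using D_sub by blast

lemma localization_self_module: "localization R (self_module R) D"
  by (intro localization.intro localization_axioms.intro self_module_module D_sub D_one D_mult)

lemma frac_rel_equiv: "equiv (carrier M \<times> D) (frac_rel R D M)"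
proof (rule equivI)
  show "frac_rel R D M \<subseteq> (carrier M \<times> D) \<times> carrier M \<times> D" by (auto simp: frac_rel_def)
  show "refl_on (carrier M \<times> D) (frac_rel R D M)"
    using D_one by (auto simp: refl_on_def frac_rel_def)
  show "sym (frac_rel R D M)" by (auto simp: sym_def frac_rel_def) metis
  show "trans (frac_rel R D M)"
  proof (rule transI, clarify)
    fix x s y t z w
    assume "((x, s), y, t) \<in> frac_rel R D M" "((y, t), z, w) \<in> frac_rel R D M"
    then obtain d d' where d: "d \<in> D" "d \<odot>\<^bsub>M\<^esub> (t \<odot>\<^bsub>M\<^esub> x) = d \<odot>\<^bsub>M\<^esub> (s \<odot>\<^bsub>M\<^esub> y)"
      and d': "d' \<in> D" "d' \<odot>\<^bsub>M\<^esub> (w \<odot>\<^bsub>M\<^esub> y) = d' \<odot>\<^bsub>M\<^esub> (t \<odot>\<^bsub>M\<^esub> z)"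
      and c: "x \<in> carrier M" "y \<in> carrier M" "z \<in> carrier M" "s \<in> D" "t \<in> D" "w \<in> D"
      by (auto simp: frac_rel_def)
    have R: "d \<in> carrier R" "d' \<in> carrier R" "s \<in> carrier R" "t \<in> carrier R" "w \<in> carrier R"
      using d d' c by auto
    \<comment> \<open>The witness for transitivity needs the middle denominator \<open>t\<close>
      besides both given witnesses, as \<open>t\<close> has to be moved past \<open>x\<close> and
      \<open>z\<close>.\<close>
    have "(d \<otimes> d' \<otimes> t) \<odot>\<^bsub>M\<^esub> (w \<odot>\<^bsub>M\<^esub> x) = (d' \<otimes> w) \<odot>\<^bsub>M\<^esub> (d \<odot>\<^bsub>M\<^esub> (t \<odot>\<^bsub>M\<^esub> x))"
      using R c by (simp flip: smult_assoc1 add: m_ac)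
    also have "\<dots> = (d \<otimes> s) \<odot>\<^bsub>M\<^esub> (d' \<odot>\<^bsub>M\<^esub> (w \<odot>\<^bsub>M\<^esub> y))"
      unfolding d(2) using R c by (simp flip: smult_assoc1 add: m_ac)
    also have "\<dots> = (d \<otimes> d' \<otimes> t) \<odot>\<^bsub>M\<^esub> (s \<odot>\<^bsub>M\<^esub> z)"
      unfolding d'(2) using R c by (simp flip: smult_assoc1 add: m_ac)
    finally show "((x, s), z, w) \<in> frac_rel R D M"
      using c d d' D_mult unfolding frac_rel_def by blast
  qed
qed

lemma frac_eq_iff:
  assumes "x \<in> carrier M" "y \<in> carrier M" "s \<in> D" "t \<in> D"
  shows "frac R D M x s = frac R D M y t \<longleftrightarrow> (\<exists>d\<in>D. d \<odot>\<^bsub>M\<^esub> (t \<odot>\<^bsub>M\<^esub> x) = d \<odot>\<^bsub>M\<^esub> (s \<odot>\<^bsub>M\<^esub> y))"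
  unfolding frac_def using eq_equiv_class_iff[OF frac_rel_equiv, of "(x, s)" "(y, t)"] assms
  by (auto simp: frac_rel_def)

lemma frac_eqI:
  assumes "x \<in> carrier M" "y \<in> carrier M" "s \<in> D" "t \<in> D" "t \<odot>\<^bsub>M\<^esub> x = s \<odot>\<^bsub>M\<^esub> y"
  shows "frac R D M x s = frac R D M y t"
  using assms D_one by (subst frac_eq_iff) auto

lemma frac_self: "x \<in> carrier M \<Longrightarrow> s \<in> D \<Longrightarrow> (x, s) \<in> frac R D M x s"
  unfolding frac_def by (rule equiv_class_self[OF frac_rel_equiv]) simp

lemma frac_memD: "(y, t) \<in> frac R D M x s \<Longrightarrow> y \<in> carrier M \<and> t \<in> D \<and> frac R D M y t = frac R D M x s"
  using equiv_class_eq[OF frac_rel_equiv, of "(x, s)" "(y, t)"]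
  by (auto simp: frac_def frac_rel_def)

lemma frac_carrier: "carrier (loc_module R D M) = {frac R D M x s | x s. x \<in> carrier M \<and> s \<in> D}"
  by (auto simp: loc_module_def quotient_def frac_def)

lemma frac_closed [simp]: "x \<in> carrier M \<Longrightarrow> s \<in> D \<Longrightarrow> frac R D M x s \<in> carrier (loc_module R D M)"
  by (auto simp: frac_carrier)

lemma frac_zero: "\<zero>\<^bsub>loc_module R D M\<^esub> = frac R D M \<zero>\<^bsub>M\<^esub> \<one>"
  by (simp add: loc_module_def)

lemma frac_eq_zero_iff:
  assumes "x \<in> carrier M" "s \<in> D"
  shows "frac R D M x s = \<zero>\<^bsub>loc_module R D M\<^esub> \<longleftrightarrow> (\<exists>d\<in>D. d \<odot>\<^bsub>M\<^esub> x = \<zero>\<^bsub>M\<^esub>)"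
  using assms D_one by (simp add: frac_zero frac_eq_iff)

lemma frac_cancel:
  assumes "x \<in> carrier M" "s \<in> D" "t \<in> D"
  shows "frac R D M (t \<odot>\<^bsub>M\<^esub> x) (t \<otimes> s) = frac R D M x s"
  using assms by (intro frac_eqI) (auto simp: D_mult simp flip: smult_assoc1 intro!: m_comm arg_cong2[of _ _ _ _ "smult M"])

lemma frac_add:
  assumes x: "x \<in> carrier M" "s \<in> D" and y: "y \<in> carrier M" "t \<in> D"
  shows "frac R D M x s \<oplus>\<^bsub>loc_module R D M\<^esub> frac R D M y t
    = frac R D M (t \<odot>\<^bsub>M\<^esub> x \<oplus>\<^bsub>M\<^esub> s \<odot>\<^bsub>M\<^esub> y) (s \<otimes> t)"
proof -
  have *: "frac R D M (t' \<odot>\<^bsub>M\<^esub> x' \<oplus>\<^bsub>M\<^esub> s' \<odot>\<^bsub>M\<^esub> y') (s' \<otimes> t') = frac R D M (t \<odot>\<^bsub>M\<^esub> x \<oplus>\<^bsub>M\<^esub> s \<odot>\<^bsub>M\<^esub> y) (s \<otimes> t)"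
    if x': "(x', s') \<in> frac R D M x s" and y': "(y', t') \<in> frac R D M y t" for x' s' y' t'
  proof -
    note mx = frac_memD[OF x'] and my = frac_memD[OF y']
    obtain d where d: "d \<in> D" "d \<odot>\<^bsub>M\<^esub> (s \<odot>\<^bsub>M\<^esub> x') = d \<odot>\<^bsub>M\<^esub> (s' \<odot>\<^bsub>M\<^esub> x)"
      using frac_eq_iff[of x' x s' s] mx x by auto
    obtain d' where d': "d' \<in> D" "d' \<odot>\<^bsub>M\<^esub> (t \<odot>\<^bsub>M\<^esub> y') = d' \<odot>\<^bsub>M\<^esub> (t' \<odot>\<^bsub>M\<^esub> y)"
      using frac_eq_iff[of y' y t' t] my y by auto
    have R: "d \<in> carrier R" "d' \<in> carrier R" "s \<in> carrier R" "t \<in> carrier R" "s' \<in> carrier R" "t' \<in> carrier R"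
      and M: "x' \<in> carrier M" "y' \<in> carrier M"
      using d d' x y mx my by auto
    have 1: "(d \<otimes> d') \<odot>\<^bsub>M\<^esub> ((s \<otimes> t) \<odot>\<^bsub>M\<^esub> (t' \<odot>\<^bsub>M\<^esub> x')) = (d \<otimes> d') \<odot>\<^bsub>M\<^esub> ((s' \<otimes> t') \<odot>\<^bsub>M\<^esub> (t \<odot>\<^bsub>M\<^esub> x))"
    proof -
      have "(d \<otimes> d') \<odot>\<^bsub>M\<^esub> ((s \<otimes> t) \<odot>\<^bsub>M\<^esub> (t' \<odot>\<^bsub>M\<^esub> x')) = (d' \<otimes> t \<otimes> t') \<odot>\<^bsub>M\<^esub> (d \<odot>\<^bsub>M\<^esub> (s \<odot>\<^bsub>M\<^esub> x'))"
        using R M by (simp flip: smult_assoc1 add: m_ac)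
      also have "\<dots> = (d \<otimes> d') \<odot>\<^bsub>M\<^esub> ((s' \<otimes> t') \<odot>\<^bsub>M\<^esub> (t \<odot>\<^bsub>M\<^esub> x))"
        unfolding d(2) using R x by (simp flip: smult_assoc1 add: m_ac)
      finally show ?thesis .
    qed
    have 2: "(d \<otimes> d') \<odot>\<^bsub>M\<^esub> ((s \<otimes> t) \<odot>\<^bsub>M\<^esub> (s' \<odot>\<^bsub>M\<^esub> y')) = (d \<otimes> d') \<odot>\<^bsub>M\<^esub> ((s' \<otimes> t') \<odot>\<^bsub>M\<^esub> (s \<odot>\<^bsub>M\<^esub> y))"
    proof -
      have "(d \<otimes> d') \<odot>\<^bsub>M\<^esub> ((s \<otimes> t) \<odot>\<^bsub>M\<^esub> (s' \<odot>\<^bsub>M\<^esub> y')) = (d \<otimes> s \<otimes> s') \<odot>\<^bsub>M\<^esub> (d' \<odot>\<^bsub>M\<^esub> (t \<odot>\<^bsub>M\<^esub> y'))"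
        using R M by (simp flip: smult_assoc1 add: m_ac)
      also have "\<dots> = (d \<otimes> d') \<odot>\<^bsub>M\<^esub> ((s' \<otimes> t') \<odot>\<^bsub>M\<^esub> (s \<odot>\<^bsub>M\<^esub> y))"
        unfolding d'(2) using R y by (simp flip: smult_assoc1 add: m_ac)
      finally show ?thesis .
    qed
    have "(d \<otimes> d') \<odot>\<^bsub>M\<^esub> ((s \<otimes> t) \<odot>\<^bsub>M\<^esub> (t' \<odot>\<^bsub>M\<^esub> x' \<oplus>\<^bsub>M\<^esub> s' \<odot>\<^bsub>M\<^esub> y'))
        = (d \<otimes> d') \<odot>\<^bsub>M\<^esub> ((s' \<otimes> t') \<odot>\<^bsub>M\<^esub> (t \<odot>\<^bsub>M\<^esub> x \<oplus>\<^bsub>M\<^esub> s \<odot>\<^bsub>M\<^esub> y))"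
      using R M x y 1 2 by (simp only: smult_r_distr smult_closed m_closed)
    moreover have "d \<otimes> d' \<in> D" using d d' D_mult by blast
    ultimately show ?thesis using x y mx my D_mult by (subst frac_eq_iff) auto
  qed
  have "frac R D M x s \<oplus>\<^bsub>loc_module R D M\<^esub> frac R D M y t
      = (\<Union>z\<in>frac R D M x s. \<Union>w\<in>frac R D M y t. case z of (x', s') \<Rightarrow> case w of (y', t') \<Rightarrow>
          frac R D M (t' \<odot>\<^bsub>M\<^esub> x' \<oplus>\<^bsub>M\<^esub> s' \<odot>\<^bsub>M\<^esub> y') (s' \<otimes> t'))"
    by (auto simp: loc_module_def)
  also have "\<dots> = frac R D M (t \<odot>\<^bsub>M\<^esub> x \<oplus>\<^bsub>M\<^esub> s \<odot>\<^bsub>M\<^esub> y) (s \<otimes> t)"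
  proof (intro UN_constant_on)
    fix z w assume "z \<in> frac R D M x s" "w \<in> frac R D M y t"
    then show "(case z of (x', s') \<Rightarrow> case w of (y', t') \<Rightarrow>
        frac R D M (t' \<odot>\<^bsub>M\<^esub> x' \<oplus>\<^bsub>M\<^esub> s' \<odot>\<^bsub>M\<^esub> y') (s' \<otimes> t'))
      = frac R D M (t \<odot>\<^bsub>M\<^esub> x \<oplus>\<^bsub>M\<^esub> s \<odot>\<^bsub>M\<^esub> y) (s \<otimes> t)"
      using *[of "fst z" "snd z" "fst w" "snd w"] by (cases z; cases w) simp
  qed (use frac_self[OF x] frac_self[OF y] in blast)+
  finally show ?thesis .
qed

lemma frac_add_same:
  assumes "x \<in> carrier M" "y \<in> carrier M" "s \<in> D"
  shows "frac R D M x s \<oplus>\<^bsub>loc_module R D M\<^esub> frac R D M y s = frac R D M (x \<oplus>\<^bsub>M\<^esub> y) s"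
proof -
  have "frac R D M x s \<oplus>\<^bsub>loc_module R D M\<^esub> frac R D M y s = frac R D M (s \<odot>\<^bsub>M\<^esub> (x \<oplus>\<^bsub>M\<^esub> y)) (s \<otimes> s)"
    using assms by (simp add: frac_add smult_r_distr)
  then show ?thesis using frac_cancel assms by simp
qed

lemma loc_abelian_monoid: "abelian_monoid (loc_module R D M)"
proof (rule abelian_monoidI)
  fix E F G assume "E \<in> carrier (loc_module R D M)" "F \<in> carrier (loc_module R D M)" "G \<in> carrier (loc_module R D M)"
  then obtain x s y t z w where E: "E = frac R D M x s" "x \<in> carrier M" "s \<in> D"
    and F: "F = frac R D M y t" "y \<in> carrier M" "t \<in> D"
    and G: "G = frac R D M z w" "z \<in> carrier M" "w \<in> D" by (auto simp: frac_carrier)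
  have R: "s \<in> carrier R" "t \<in> carrier R" "w \<in> carrier R" using E F G by auto
  show "E \<oplus>\<^bsub>loc_module R D M\<^esub> F \<oplus>\<^bsub>loc_module R D M\<^esub> G = E \<oplus>\<^bsub>loc_module R D M\<^esub> (F \<oplus>\<^bsub>loc_module R D M\<^esub> G)"
    unfolding E(1) F(1) G(1) using E(2,3) F(2,3) G(2,3) R
    by (simp add: frac_add D_mult smult_r_distr M.a_assoc m_assoc flip: smult_assoc1)
      (simp add: m_ac)
  show "E \<oplus>\<^bsub>loc_module R D M\<^esub> F = F \<oplus>\<^bsub>loc_module R D M\<^esub> E"
    unfolding E(1) F(1) using E(2,3) F(2,3) R by (simp add: frac_add M.a_comm m_comm)
  show "\<zero>\<^bsub>loc_module R D M\<^esub> \<oplus>\<^bsub>loc_module R D M\<^esub> E = E"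
    unfolding E(1) frac_zero using E(2,3) R D_one by (simp add: frac_add)
  show "E \<oplus>\<^bsub>loc_module R D M\<^esub> F \<in> carrier (loc_module R D M)"
    unfolding E(1) F(1) using E(2,3) F(2,3) R by (simp add: frac_add D_mult)
qed (simp add: frac_zero D_one)

section \<open>Fractions as scalars, and independence over the localization\<close>

lemma loc_ring_carrier: "carrier (loc_ring R D) = {frac R D (self_module R) a s | a s. a \<in> carrier R \<and> s \<in> D}"
  by (auto simp: loc_ring_def quotient_def frac_def)

lemma loc_ring_frac: "a \<in> carrier R \<Longrightarrow> s \<in> D \<Longrightarrow> frac R D (self_module R) a s \<in> carrier (loc_ring R D)"
  unfolding loc_ring_carrier by (rule CollectI, intro exI conjI) auto

lemma frac_smult:
  assumes a: "a \<in> carrier R" "s \<in> D" and y: "y \<in> carrier M" "t \<in> D"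
  shows "frac R D (self_module R) a s \<odot>\<^bsub>loc_module R D M\<^esub> frac R D M y t = frac R D M (a \<odot>\<^bsub>M\<^esub> y) (s \<otimes> t)"
proof -
  interpret S: localization R "self_module R" D by (rule localization_self_module)
  have self [simp]: "carrier (self_module R) = carrier R" "smult (self_module R) = (\<otimes>)"
    by (simp_all add: self_module_def)
  have *: "frac R D M (a' \<odot>\<^bsub>M\<^esub> y') (s' \<otimes> t') = frac R D M (a \<odot>\<^bsub>M\<^esub> y) (s \<otimes> t)"
    if a': "(a', s') \<in> frac R D (self_module R) a s" and y': "(y', t') \<in> frac R D M y t" for a' s' y' t'
  proof -
    note ma = S.frac_memD[OF a'] and my = frac_memD[OF y']
    obtain d where d: "d \<in> D" "d \<otimes> (s \<otimes> a') = d \<otimes> (s' \<otimes> a)"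
      using S.frac_eq_iff[of a' a s' s] ma a by auto
    obtain d' where d': "d' \<in> D" "d' \<odot>\<^bsub>M\<^esub> (t \<odot>\<^bsub>M\<^esub> y') = d' \<odot>\<^bsub>M\<^esub> (t' \<odot>\<^bsub>M\<^esub> y)"
      using frac_eq_iff[of y' y t' t] my y by auto
    have R: "d \<in> carrier R" "d' \<in> carrier R" "s \<in> carrier R" "t \<in> carrier R" "s' \<in> carrier R" "t' \<in> carrier R"
        "a' \<in> carrier R" "a \<in> carrier R"
      and M: "y' \<in> carrier M"
      using d d' a y ma my by auto
    have "(d \<otimes> d') \<odot>\<^bsub>M\<^esub> ((s \<otimes> t) \<odot>\<^bsub>M\<^esub> (a' \<odot>\<^bsub>M\<^esub> y')) = (d \<otimes> (s \<otimes> a')) \<odot>\<^bsub>M\<^esub> (d' \<odot>\<^bsub>M\<^esub> (t \<odot>\<^bsub>M\<^esub> y'))"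
      using R M by (simp flip: smult_assoc1 add: m_ac)
    also have "\<dots> = (d \<otimes> (s' \<otimes> a)) \<odot>\<^bsub>M\<^esub> (d' \<odot>\<^bsub>M\<^esub> (t' \<odot>\<^bsub>M\<^esub> y))" unfolding d d' ..
    also have "\<dots> = (d \<otimes> d') \<odot>\<^bsub>M\<^esub> ((s' \<otimes> t') \<odot>\<^bsub>M\<^esub> (a \<odot>\<^bsub>M\<^esub> y))"
      using R y by (simp flip: smult_assoc1 add: m_ac)
    finally show ?thesis using R a y ma my d d' D_mult by (subst frac_eq_iff) auto
  qed
  have "frac R D (self_module R) a s \<odot>\<^bsub>loc_module R D M\<^esub> frac R D M y t
      = (\<Union>z\<in>frac R D (self_module R) a s. \<Union>w\<in>frac R D M y t. case z of (a', s') \<Rightarrow> case w of (y', t') \<Rightarrow>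
          frac R D M (a' \<odot>\<^bsub>M\<^esub> y') (s' \<otimes> t'))"
    by (auto simp: loc_module_def)
  also have "\<dots> = frac R D M (a \<odot>\<^bsub>M\<^esub> y) (s \<otimes> t)"
  proof (intro UN_constant_on)
    fix z w assume "z \<in> frac R D (self_module R) a s" "w \<in> frac R D M y t"
    then show "(case z of (a', s') \<Rightarrow> case w of (y', t') \<Rightarrow> frac R D M (a' \<odot>\<^bsub>M\<^esub> y') (s' \<otimes> t'))
      = frac R D M (a \<odot>\<^bsub>M\<^esub> y) (s \<otimes> t)"
      using *[of "fst z" "snd z" "fst w" "snd w"] by (cases z; cases w) simp
  qed (use frac_self[OF y] S.frac_self[of a s] a in auto)
  finally show ?thesis .
qed

lemma frac_finsum:
  assumes "finite K" "\<And>i. i \<in> K \<Longrightarrow> f i \<in> carrier M" "s \<in> D"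
  shows "(\<Oplus>\<^bsub>loc_module R D M\<^esub>i\<in>K. frac R D M (f i) s) = frac R D M (\<Oplus>\<^bsub>M\<^esub>i\<in>K. f i) s"
  using assms(1,2)
proof (induction K rule: finite_induct)
  interpret L: abelian_monoid "loc_module R D M" by (rule loc_abelian_monoid)
  case empty
  have "frac R D M \<zero>\<^bsub>M\<^esub> s = \<zero>\<^bsub>loc_module R D M\<^esub>" using assms(3) D_one by (subst frac_eq_zero_iff) auto
  then show ?case by simp
next
  interpret L: abelian_monoid "loc_module R D M" by (rule loc_abelian_monoid)
  case (insert k K)
  have fin: "finsum M f K \<in> carrier M" using insert by (intro M.finsum_closed) auto
  have "(\<Oplus>\<^bsub>loc_module R D M\<^esub>i\<in>insert k K. frac R D M (f i) s)
      = frac R D M (f k) s \<oplus>\<^bsub>loc_module R D M\<^esub> frac R D M (\<Oplus>\<^bsub>M\<^esub>i\<in>K. f i) s"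
    using insert assms(3) by (subst L.finsum_insert) auto
  also have "\<dots> = frac R D M (f k \<oplus>\<^bsub>M\<^esub> (\<Oplus>\<^bsub>M\<^esub>i\<in>K. f i)) s"
    using insert assms(3) fin by (intro frac_add_same) auto
  also have "f k \<oplus>\<^bsub>M\<^esub> (\<Oplus>\<^bsub>M\<^esub>i\<in>K. f i) = (\<Oplus>\<^bsub>M\<^esub>i\<in>insert k K. f i)"
    using insert by (intro M.finsum_insert[symmetric]) auto
  finally show ?case .
qed

text \<open>By hypothesis \<open>p\<close> is the kernel of the map from R to its localization. A
  family of fractions may be replaced by its numerators, and a relation between fractions, brought
  to a common denominator, becomes one over R after multiplication by an element of D.\<close>

theorem lin_indep_loc_iff:
  assumes p: "\<And>a. a \<in> carrier R \<Longrightarrow> a \<in> p \<longleftrightarrow> (\<exists>d\<in>D. d \<otimes> a = \<zero>)"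
  shows "(\<exists>e. lin_indep (loc_ring R D) (loc_module R D M) k e) \<longleftrightarrow>
    (\<exists>x\<in>{..<k} \<rightarrow> carrier M. \<forall>c\<in>{..<k} \<rightarrow> carrier R.
      (\<Oplus>\<^bsub>M\<^esub>i\<in>{..<k}. c i \<odot>\<^bsub>M\<^esub> x i) = \<zero>\<^bsub>M\<^esub> \<longrightarrow> (\<forall>i<k. c i \<in> p))"
proof
  interpret L: abelian_monoid "loc_module R D M" by (rule loc_abelian_monoid)
  interpret S: localization R "self_module R" D by (rule localization_self_module)
  have self [simp]: "carrier (self_module R) = carrier R" "smult (self_module R) = (\<otimes>)"
    "\<zero>\<^bsub>self_module R\<^esub> = \<zero>"
    by (simp_all add: self_module_def)
  have zero_iff: "frac R D (self_module R) a s = \<zero>\<^bsub>loc_ring R D\<^esub> \<longleftrightarrow> a \<in> p"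
    if "a \<in> carrier R" "s \<in> D" for a s
    using S.frac_eq_zero_iff[of a s] p[OF that(1)] that by (simp add: S.frac_zero loc_ring_def)
  have p_cancel: "a \<in> p" if a: "a \<in> carrier R" "d \<in> D" "d \<otimes> a \<in> p" for a d
  proof -
    obtain d' where "d' \<in> D" "d' \<otimes> (d \<otimes> a) = \<zero>" using p[of "d \<otimes> a"] a by auto
    then have "(d' \<otimes> d) \<otimes> a = \<zero>" "d' \<otimes> d \<in> D" using a D_mult by (auto simp: m_assoc)
    then show ?thesis using p[OF a(1)] by blast
  qed
  {
    assume "\<exists>e. lin_indep (loc_ring R D) (loc_module R D M) k e"
    then obtain e where l: "lin_indep (loc_ring R D) (loc_module R D M) k e" by blast
    then have e: "e \<in> {..<k} \<rightarrow> carrier (loc_module R D M)" by (simp add: lin_indep_def)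
    note ind = l[unfolded lin_indep_def, THEN conjunct2, rule_format]
    have "\<exists>z. fst z \<in> carrier M \<and> snd z \<in> D \<and> e i = frac R D M (fst z) (snd z)" if "i < k" for i
    proof -
      have "e i \<in> carrier (loc_module R D M)" using e that by auto
      then show ?thesis by (auto simp: frac_carrier)
    qed
    then obtain w where w: "\<And>i. i < k \<Longrightarrow> fst (w i) \<in> carrier M \<and> snd (w i) \<in> D \<and> e i = frac R D M (fst (w i)) (snd (w i))"
      by metis
    define x s where "x i = fst (w i)" and "s i = snd (w i)" for i
    have x: "\<And>i. i < k \<Longrightarrow> x i \<in> carrier M" and s: "\<And>i. i < k \<Longrightarrow> s i \<in> D"
      and e_eq: "\<And>i. i < k \<Longrightarrow> e i = frac R D M (x i) (s i)" using w by (auto simp: x_def s_def)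
    have "c i \<in> p" if c: "c \<in> {..<k} \<rightarrow> carrier R" and z: "(\<Oplus>\<^bsub>M\<^esub>i\<in>{..<k}. c i \<odot>\<^bsub>M\<^esub> x i) = \<zero>\<^bsub>M\<^esub>" and i: "i < k" for c i
    proof -
      have cc: "c i \<in> carrier R" if "i < k" for i using c that by auto
      \<comment> \<open>The factor \<open>s i\<close> cancels the denominator of \<open>e i\<close>,
        so that the terms of the two relations agree.\<close>
      define C where "C = (\<lambda>i. frac R D (self_module R) (s i \<otimes> c i) \<one>)"
      have C: "C \<in> {..<k} \<rightarrow> carrier (loc_ring R D)"
        unfolding C_def using cc s D_one by (intro funcsetI loc_ring_frac) auto
      have Ce: "C i \<odot>\<^bsub>loc_module R D M\<^esub> e i = frac R D M (c i \<odot>\<^bsub>M\<^esub> x i) \<one>" if i: "i < k" for i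
      proof -
        have "C i \<odot>\<^bsub>loc_module R D M\<^esub> e i = frac R D M (s i \<odot>\<^bsub>M\<^esub> (c i \<odot>\<^bsub>M\<^esub> x i)) (s i \<otimes> \<one>)"
          using i cc s x D_one by (simp add: C_def e_eq frac_smult smult_assoc1)
        also have "\<dots> = frac R D M (c i \<odot>\<^bsub>M\<^esub> x i) \<one>" using i cc s x D_one by (intro frac_cancel) auto
        finally show ?thesis .
      qed
      have "(\<Oplus>\<^bsub>loc_module R D M\<^esub>i\<in>{..<k}. C i \<odot>\<^bsub>loc_module R D M\<^esub> e i)
          = (\<Oplus>\<^bsub>loc_module R D M\<^esub>i\<in>{..<k}. frac R D M (c i \<odot>\<^bsub>M\<^esub> x i) \<one>)"
        using cc x D_one by (intro L.finsum_cong') (auto simp: Ce)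
      also have "\<dots> = frac R D M (\<Oplus>\<^bsub>M\<^esub>i\<in>{..<k}. c i \<odot>\<^bsub>M\<^esub> x i) \<one>"
        using cc x D_one by (intro frac_finsum) auto
      finally have "C i = \<zero>\<^bsub>loc_ring R D\<^esub>" using ind[OF C _ i] z by (simp add: frac_zero)
      then have "s i \<otimes> c i \<in> p" using zero_iff[of "s i \<otimes> c i" \<one>] cc[OF i] s[OF i] D_one by (simp add: C_def)
      then show ?thesis using p_cancel cc[OF i] s[OF i] by blast
    qed
    then show "\<exists>x\<in>{..<k} \<rightarrow> carrier M. \<forall>c\<in>{..<k} \<rightarrow> carrier R.
      (\<Oplus>\<^bsub>M\<^esub>i\<in>{..<k}. c i \<odot>\<^bsub>M\<^esub> x i) = \<zero>\<^bsub>M\<^esub> \<longrightarrow> (\<forall>i<k. c i \<in> p)"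
      using x by (intro bexI[of _ x]) auto
  }
  {
    assume "\<exists>x\<in>{..<k} \<rightarrow> carrier M. \<forall>c\<in>{..<k} \<rightarrow> carrier R.
      (\<Oplus>\<^bsub>M\<^esub>i\<in>{..<k}. c i \<odot>\<^bsub>M\<^esub> x i) = \<zero>\<^bsub>M\<^esub> \<longrightarrow> (\<forall>i<k. c i \<in> p)"
    then obtain x where xP: "x \<in> {..<k} \<rightarrow> carrier M"
      and indP: "\<forall>c\<in>{..<k} \<rightarrow> carrier R.
        (\<Oplus>\<^bsub>M\<^esub>i\<in>{..<k}. c i \<odot>\<^bsub>M\<^esub> x i) = \<zero>\<^bsub>M\<^esub> \<longrightarrow> (\<forall>i<k. c i \<in> p)" by (elim bexE)
    have x: "\<And>i. i < k \<Longrightarrow> x i \<in> carrier M" using xP by auto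
    note ind = indP[rule_format]
    define e where "e = (\<lambda>i. frac R D M (x i) \<one>)"
    have e: "e \<in> {..<k} \<rightarrow> carrier (loc_module R D M)" using x D_one by (auto simp: e_def)
    have "C i = \<zero>\<^bsub>loc_ring R D\<^esub>" if C: "C \<in> {..<k} \<rightarrow> carrier (loc_ring R D)"
      and z: "(\<Oplus>\<^bsub>loc_module R D M\<^esub>i\<in>{..<k}. C i \<odot>\<^bsub>loc_module R D M\<^esub> e i) = \<zero>\<^bsub>loc_module R D M\<^esub>"
      and i: "i < k" for C i
    proof -
      have "\<exists>z. fst z \<in> carrier R \<and> snd z \<in> D \<and> C i = frac R D (self_module R) (fst z) (snd z)" if "i < k" for i
      proof -
        have "C i \<in> carrier (loc_ring R D)" using C that by auto
        then show ?thesis by (auto simp: loc_ring_carrier)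
      qed
      then obtain w where w: "\<And>i. i < k \<Longrightarrow> fst (w i) \<in> carrier R \<and> snd (w i) \<in> D \<and>
          C i = frac R D (self_module R) (fst (w i)) (snd (w i))"
        by metis
      define a t where "a i = fst (w i)" and "t i = snd (w i)" for i
      have a: "\<And>i. i < k \<Longrightarrow> a i \<in> carrier R" and t: "\<And>i. i < k \<Longrightarrow> t i \<in> D"
        and C_eq: "\<And>i. i < k \<Longrightarrow> C i = frac R D (self_module R) (a i) (t i)" using w by (auto simp: a_def t_def)
      have prod_D: "finprod R t K \<in> D" if "K \<subseteq> {..<k}" for K
        using finite_subset[OF that finite_lessThan] that
      proof (induction K rule: finite_induct)
        case (insert j K)
        then show ?case using t by (subst finprod_insert) (auto intro!: D_mult)
      qed (simp add: D_one)
      \<comment> \<open>\<open>q i\<close> is the factor that brings the denominator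
        \<open>t i\<close> to the common denominator \<open>Q\<close>.\<close>
      define q where "q i = finprod R t ({..<k} - {i})" for i
      define Q where "Q = finprod R t {..<k}"
      have q: "q i \<in> D" for i unfolding q_def by (rule prod_D) auto
      have Q: "Q \<in> D" unfolding Q_def by (rule prod_D) auto
      have Qq: "Q = q i \<otimes> t i" if i: "i < k" for i
      proof -
        have "Q = finprod R t (insert i ({..<k} - {i}))" unfolding Q_def using i by (simp add: insert_absorb)
        also have "\<dots> = t i \<otimes> q i" unfolding q_def using t i by (intro finprod_insert) auto
        finally show ?thesis using t[OF i] q[of i] by (simp add: m_comm)
      qed
      have Ce: "C i \<odot>\<^bsub>loc_module R D M\<^esub> e i = frac R D M ((q i \<otimes> a i) \<odot>\<^bsub>M\<^esub> x i) Q" if i: "i < k" for i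
      proof -
        have "C i \<odot>\<^bsub>loc_module R D M\<^esub> e i = frac R D M (a i \<odot>\<^bsub>M\<^esub> x i) (t i)"
          using i a t x D_one by (simp add: C_eq e_def frac_smult)
        also have "\<dots> = frac R D M (q i \<odot>\<^bsub>M\<^esub> (a i \<odot>\<^bsub>M\<^esub> x i)) (q i \<otimes> t i)"
          using i a t x q by (intro frac_cancel[symmetric]) auto
        finally show ?thesis using i a x q Qq[OF i] by (simp add: smult_assoc1)
      qed
      let ?b = "\<lambda>i. q i \<otimes> a i"
      have bx: "?b i \<odot>\<^bsub>M\<^esub> x i \<in> carrier M" if "i < k" for i using that q a x by simp
      have sum: "(\<Oplus>\<^bsub>M\<^esub>i\<in>{..<k}. ?b i \<odot>\<^bsub>M\<^esub> x i) \<in> carrier M" using bx by (intro M.finsum_closed) auto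
      have "(\<Oplus>\<^bsub>loc_module R D M\<^esub>i\<in>{..<k}. C i \<odot>\<^bsub>loc_module R D M\<^esub> e i)
          = (\<Oplus>\<^bsub>loc_module R D M\<^esub>i\<in>{..<k}. frac R D M (?b i \<odot>\<^bsub>M\<^esub> x i) Q)"
        using bx Q by (intro L.finsum_cong') (auto simp: Ce)
      also have "\<dots> = frac R D M (\<Oplus>\<^bsub>M\<^esub>i\<in>{..<k}. ?b i \<odot>\<^bsub>M\<^esub> x i) Q"
        using bx Q by (intro frac_finsum) auto
      finally obtain d where d: "d \<in> D" "d \<odot>\<^bsub>M\<^esub> (\<Oplus>\<^bsub>M\<^esub>i\<in>{..<k}. ?b i \<odot>\<^bsub>M\<^esub> x i) = \<zero>\<^bsub>M\<^esub>"
        using z frac_eq_zero_iff[OF sum Q] by auto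
      have "d \<odot>\<^bsub>M\<^esub> (\<Oplus>\<^bsub>M\<^esub>i\<in>{..<k}. ?b i \<odot>\<^bsub>M\<^esub> x i) = (\<Oplus>\<^bsub>M\<^esub>i\<in>{..<k}. d \<odot>\<^bsub>M\<^esub> (?b i \<odot>\<^bsub>M\<^esub> x i))"
        using d bx by (intro finsum_smult_ldistr) auto
      also have "\<dots> = (\<Oplus>\<^bsub>M\<^esub>i\<in>{..<k}. (d \<otimes> ?b i) \<odot>\<^bsub>M\<^esub> x i)"
        using d q a x by (intro M.finsum_cong') (auto simp: smult_assoc1)
      finally have "(\<Oplus>\<^bsub>M\<^esub>i\<in>{..<k}. (d \<otimes> ?b i) \<odot>\<^bsub>M\<^esub> x i) = \<zero>\<^bsub>M\<^esub>" using d by simp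
      then have "d \<otimes> ?b i \<in> p" using ind[of "\<lambda>i. d \<otimes> ?b i" i] d q a i by auto
      then have "?b i \<in> p" using p_cancel d q a i by (meson D_carrier m_closed)
      then have "a i \<in> p" using p_cancel q a i by blast
      then show ?thesis using zero_iff a[OF i] t[OF i] C_eq[OF i] by simp
    qed
    then have "lin_indep (loc_ring R D) (loc_module R D M) k e"
      unfolding lin_indep_def using e by (intro conjI ballI impI allI)
    then show "\<exists>e. lin_indep (loc_ring R D) (loc_module R D M) k e" by blast
  }
qed

end

text \<open>By injectivity a kernel element becomes zero in the localization, and a fraction is zero
  only if some denominator kills its numerator.\<close>

lemma loc_map_kernel:
  assumes "localization R M D" "localization R N D"
    and f: "f \<in> carrier M \<rightarrow> carrier N"
    and linear: "\<And>a x. a \<in> carrier R \<Longrightarrow> x \<in> carrier M \<Longrightarrow> f (a \<odot>\<^bsub>M\<^esub> x) = a \<odot>\<^bsub>N\<^esub> f x"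
    and inj: "inj_on (loc_map R D N f) (carrier (loc_module R D M))"
    and x: "x \<in> carrier M" "f x = \<zero>\<^bsub>N\<^esub>"
  shows "\<exists>d\<in>D. d \<odot>\<^bsub>M\<^esub> x = \<zero>\<^bsub>M\<^esub>"
proof -
  interpret M: localization R M D by fact
  interpret N: localization R N D by fact
  have map: "loc_map R D N f (frac R D M x s) = frac R D N (f x) s" if x: "x \<in> carrier M" and s: "s \<in> D" for x s
  proof -
    have *: "frac R D N (f x') s' = frac R D N (f x) s" if x': "(x', s') \<in> frac R D M x s" for x' s'
    proof -
      note m = M.frac_memD[OF x']
      obtain d where d: "d \<in> D" "d \<odot>\<^bsub>M\<^esub> (s \<odot>\<^bsub>M\<^esub> x') = d \<odot>\<^bsub>M\<^esub> (s' \<odot>\<^bsub>M\<^esub> x)"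
        using M.frac_eq_iff[of x' x s' s] m x s by auto
      have "f (d \<odot>\<^bsub>M\<^esub> (s \<odot>\<^bsub>M\<^esub> x')) = d \<odot>\<^bsub>N\<^esub> (s \<odot>\<^bsub>N\<^esub> f x')"
        using d(1) m x s by (simp add: linear)
      moreover have "f (d \<odot>\<^bsub>M\<^esub> (s' \<odot>\<^bsub>M\<^esub> x)) = d \<odot>\<^bsub>N\<^esub> (s' \<odot>\<^bsub>N\<^esub> f x)"
        using d(1) m x s by (simp add: linear)
      ultimately have "d \<odot>\<^bsub>N\<^esub> (s \<odot>\<^bsub>N\<^esub> f x') = d \<odot>\<^bsub>N\<^esub> (s' \<odot>\<^bsub>N\<^esub> f x)" using d(2) by simp
      then show ?thesis using d(1) m x s f by (subst N.frac_eq_iff) auto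
    qed
    show ?thesis unfolding loc_map_def
    proof (rule UN_constant_on)
      fix z assume "z \<in> frac R D M x s"
      then show "(case z of (x', s') \<Rightarrow> frac R D N (f x') s') = frac R D N (f x) s"
        using *[of "fst z" "snd z"] by (cases z) simp
    qed (use M.frac_self[OF x s] in blast)
  qed
  have f0: "f \<zero>\<^bsub>M\<^esub> = \<zero>\<^bsub>N\<^esub>"
    using linear[of "\<zero>\<^bsub>R\<^esub>" "\<zero>\<^bsub>M\<^esub>"] f by (auto simp: Pi_iff)
  have "loc_map R D N f (frac R D M x \<one>\<^bsub>R\<^esub>) = loc_map R D N f (frac R D M \<zero>\<^bsub>M\<^esub> \<one>\<^bsub>R\<^esub>)"
    using x f0 M.D_one by (simp add: map)
  then have "frac R D M x \<one>\<^bsub>R\<^esub> = frac R D M \<zero>\<^bsub>M\<^esub> \<one>\<^bsub>R\<^esub>"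
    using inj_onD[OF inj] x M.D_one by auto
  then show ?thesis using M.frac_eq_zero_iff[OF x(1) M.D_one] by (simp add: M.frac_zero)
qed

section \<open>Power series\<close>

text \<open>The code induces a wellorder on the variables and thereby one on monomials that is
  compatible with multiplication; \<open>vanishing_prime\<close> relies on least monomials. Residues
  modulo 3 separate the three kinds of variables.\<close>

fun variable_code :: "variable \<Rightarrow> nat" where
  "variable_code (VX i) = 3 * i"
| "variable_code (VY i) = 3 * i + 1"
| "variable_code (VT i) = 3 * i + 2"

lemma variable_code_inj: "variable_code a = variable_code b \<Longrightarrow> a = b"
  by (cases a; cases b) (simp_all, presburger+)

instantiation variable :: linorder
begin

definition less_eq_variable :: "variable \<Rightarrow> variable \<Rightarrow> bool" where
  "a \<le> b \<longleftrightarrow> variable_code a \<le> variable_code b"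

definition less_variable :: "variable \<Rightarrow> variable \<Rightarrow> bool" where
  "a < b \<longleftrightarrow> variable_code a < variable_code b"

instance
  by standard (auto simp: less_eq_variable_def less_variable_def intro: variable_code_inj)

end

instance variable :: wellorder
proof
  fix P :: "variable \<Rightarrow> bool" and a
  assume step: "\<And>x. (\<And>y. y < x \<Longrightarrow> P y) \<Longrightarrow> P x"
  show "P a"
  proof (induction "variable_code a" arbitrary: a rule: less_induct)
    case less
    show ?case by (rule step, rule less) (simp add: less_variable_def)
  qed
qed

lemma finite_submultisets: "finite {k. k \<subseteq># m}"
proof (induction m)
  case (add x m)
  have "k \<in> {k. k \<subseteq># m} \<union> add_mset x ` {k. k \<subseteq># m}" if "k \<subseteq># add_mset x m" for k
  proof (cases "x \<in># k")
    case True
    then have "k = add_mset x (k - {#x#})" by simp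
    moreover have "k - {#x#} \<subseteq># m" using that by (simp add: subset_eq_diff_conv)
    ultimately show ?thesis by blast
  next
    case False
    have "count k a \<le> count m a" for a
      using mset_subset_eq_count[OF that, of a] False by (cases "a = x") (auto simp: not_in_iff)
    then show ?thesis by (simp add: subseteq_mset_def)
  qed
  then have "{k. k \<subseteq># add_mset x m} \<subseteq> {k. k \<subseteq># m} \<union> add_mset x ` {k. k \<subseteq># m}" by blast
  then show ?case using add finite_subset by blast
qed simp

lemma diff_diff_submset:
  assumes "a \<subseteq># m"
  shows "m - (m - a) = a"
proof (rule multiset_eqI)
  fix x
  show "count (m - (m - a)) x = count a x" using mset_subset_eq_count[OF assms, of x] by simp
qed

lemma (in abelian_group) minus_left_cancel:
  assumes "c \<in> carrier G" "a \<in> carrier G" "b \<in> carrier G" "c \<ominus> a = c \<ominus> b"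
  shows "b = a"
proof -
  have "\<ominus> a = \<ominus> b" using assms by (simp add: a_minus_def)
  then have "\<ominus> (\<ominus> a) = \<ominus> (\<ominus> b)" by simp
  then show ?thesis using assms by simp
qed

lemma (in abelian_group) add_minus_cancel:
  "a \<in> carrier G \<Longrightarrow> b \<in> carrier G \<Longrightarrow> (a \<oplus> b) \<ominus> a = b"
  by (simp add: a_minus_def a_comm[of a b] a_assoc r_neg)

lemma (in abelian_monoid) finsum_Sigma:
  assumes "finite A" "\<And>a. a \<in> A \<Longrightarrow> finite (B a)" "\<And>a b. a \<in> A \<Longrightarrow> b \<in> B a \<Longrightarrow> F a b \<in> carrier G"
  shows "(\<Oplus>a\<in>A. \<Oplus>b\<in>B a. F a b) = (\<Oplus>p\<in>Sigma A B. F (fst p) (snd p))"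
  using assms
proof (induction A rule: finite_induct)
  case (insert a A)
  have inner: "(\<Oplus>p\<in>Pair a ` B a. F (fst p) (snd p)) = (\<Oplus>b\<in>B a. F a b)"
    using insert.prems by (subst finsum_reindex) (auto simp: inj_on_def)
  have "Sigma (insert a A) B = Pair a ` B a \<union> Sigma A B" by auto
  then have "(\<Oplus>p\<in>Sigma (insert a A) B. F (fst p) (snd p))
      = (\<Oplus>p\<in>Pair a ` B a. F (fst p) (snd p)) \<oplus> (\<Oplus>p\<in>Sigma A B. F (fst p) (snd p))"
    using insert by (simp, intro finsum_Un_disjoint) auto
  also have "\<dots> = (\<Oplus>b\<in>B a. F a b) \<oplus> (\<Oplus>a\<in>A. \<Oplus>b\<in>B a. F a b)"
    using inner insert by simp
  also have "\<dots> = (\<Oplus>a\<in>insert a A. \<Oplus>b\<in>B a. F a b)"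
    using insert by (intro finsum_insert[symmetric]) (auto intro!: finsum_closed)
  finally show ?case by simp
qed simp

lemma (in abelian_monoid) finsum_reindex_bij:
  assumes "bij_betw h A B" "\<And>b. b \<in> B \<Longrightarrow> F b \<in> carrier G"
  shows "(\<Oplus>b\<in>B. F b) = (\<Oplus>a\<in>A. F (h a))"
proof -
  have "B = h ` A" "inj_on h A" using assms(1) by (auto simp: bij_betw_def)
  then have "(\<Oplus>b\<in>h ` A. F b) = (\<Oplus>a\<in>A. F (h a))"
    using assms(2) by (intro finsum_reindex) auto
  then show ?thesis using \<open>B = h ` A\<close> by (simp only:)
qed

section \<open>The commutative ring of power series\<close>

lemma series_add: "(f \<oplus>\<^bsub>series_ring R V\<^esub> h) m = f m \<oplus>\<^bsub>R\<^esub> h m"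
  by (simp add: series_ring_def)

lemma series_zero: "\<zero>\<^bsub>series_ring R V\<^esub> m = \<zero>\<^bsub>R\<^esub>"
  by (simp add: series_ring_def)

lemma series_one: "\<one>\<^bsub>series_ring R V\<^esub> m = (if m = {#} then \<one>\<^bsub>R\<^esub> else \<zero>\<^bsub>R\<^esub>)"
  by (simp add: series_ring_def)

lemma series_mult:
  "(f \<otimes>\<^bsub>series_ring R V\<^esub> h) m = (\<Oplus>\<^bsub>R\<^esub>k\<in>{k. k \<subseteq># m}. f k \<otimes>\<^bsub>R\<^esub> h (m - k))"
  by (simp add: series_ring_def)

lemma series_coeff [simp]: "f \<in> carrier (series_ring R V) \<Longrightarrow> f m \<in> carrier R"
  by (simp add: series_ring_def)

lemma series_outside: "f \<in> carrier (series_ring R V) \<Longrightarrow> \<not> set_mset m \<subseteq> V \<Longrightarrow> f m = \<zero>\<^bsub>R\<^esub>"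
  by (simp add: series_ring_def del: series_coeff)

lemma series_support: "f \<in> carrier (series_ring R V) \<Longrightarrow> f m \<noteq> \<zero>\<^bsub>R\<^esub> \<Longrightarrow> x \<in># m \<Longrightarrow> x \<in> V"
  using series_outside by fastforce

lemma series_memI: "(\<And>m. f m \<in> carrier R) \<Longrightarrow> (\<And>m x. f m \<noteq> \<zero>\<^bsub>R\<^esub> \<Longrightarrow> x \<in># m \<Longrightarrow> x \<in> V) \<Longrightarrow>
    f \<in> carrier (series_ring R V)"
  by (auto simp: series_ring_def simp del: series_coeff)

context cring
begin

abbreviation "PS \<equiv> series_ring R"

lemma series_ring_cring: "cring (PS V)"
proof (rule cringI)
  show "abelian_group (PS V)"
  proof (rule abelian_groupI)
    fix f assume "f \<in> carrier (PS V)"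
    then show "\<exists>h\<in>carrier (PS V). h \<oplus>\<^bsub>PS V\<^esub> f = \<zero>\<^bsub>PS V\<^esub>"
      by (intro bexI[of _ "\<lambda>m. \<ominus> f m"]) (auto intro!: series_memI dest: series_support simp: series_add series_zero l_neg fun_eq_iff)
    show "f \<oplus>\<^bsub>PS V\<^esub> h \<in> carrier (PS V)" if f: "f \<in> carrier (PS V)" and h: "h \<in> carrier (PS V)" for f h
    proof (rule series_memI)
      fix m z assume "(f \<oplus>\<^bsub>PS V\<^esub> h) m \<noteq> \<zero>" "z \<in># m"
      then show "z \<in> V" using series_support[OF f, of m z] series_support[OF h, of m z]
        by (cases "h m = \<zero>"; cases "f m = \<zero>") (auto simp: series_add)
    qed (use f h in \<open>simp add: series_add\<close>)
  qed (auto intro!: series_memI dest: series_support simp: series_add series_zero a_ac fun_eq_iff)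
next
  have closed: "f \<otimes>\<^bsub>PS V\<^esub> h \<in> carrier (PS V)" if f: "f \<in> carrier (PS V)" and h: "h \<in> carrier (PS V)" for f h
  proof -
    have "(f \<otimes>\<^bsub>PS V\<^esub> h) m = \<zero>" if "\<not> set_mset m \<subseteq> V" for m
    proof -
      have "f k \<otimes> h (m - k) = \<zero>" if k: "k \<subseteq># m" for k
      proof -
        have "set_mset m = set_mset k \<union> set_mset (m - k)"
          using k by (metis set_mset_union subset_mset.add_diff_inverse)
        then have "\<not> set_mset k \<subseteq> V \<or> \<not> set_mset (m - k) \<subseteq> V" using \<open>\<not> set_mset m \<subseteq> V\<close> by blast
        then show ?thesis
          using series_outside[OF f, of k] series_outside[OF h, of "m - k"] f h by (elim disjE) simp_all
      qed
      then have "(\<Oplus>k\<in>{k. k \<subseteq># m}. f k \<otimes> h (m - k)) = (\<Oplus>k\<in>{k. k \<subseteq># m}. \<zero>)"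
        by (intro finsum_cong') auto
      then show ?thesis by (simp add: series_mult)
    qed
    moreover have "(f \<otimes>\<^bsub>PS V\<^esub> h) m \<in> carrier R" for m
      unfolding series_mult using f h by (intro finsum_closed) auto
    ultimately show ?thesis by (intro series_memI) blast+
  qed
  have comm: "f \<otimes>\<^bsub>PS V\<^esub> h = h \<otimes>\<^bsub>PS V\<^esub> f" if f: "f \<in> carrier (PS V)" and h: "h \<in> carrier (PS V)" for f h
  proof (rule ext)
    fix m :: "variable multiset"
    have "bij_betw (\<lambda>k. m - k) {k. k \<subseteq># m} {k. k \<subseteq># m}"
      by (rule bij_betw_byWitness[of _ "\<lambda>k. m - k"]) (auto simp: diff_diff_submset diff_subset_eq_self)
    then have "(f \<otimes>\<^bsub>PS V\<^esub> h) m = (\<Oplus>k\<in>{k. k \<subseteq># m}. f (m - k) \<otimes> h (m - (m - k)))"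
      unfolding series_mult using f h by (intro finsum_reindex_bij) auto
    also have "\<dots> = (h \<otimes>\<^bsub>PS V\<^esub> f) m"
      unfolding series_mult using f h
      by (intro finsum_cong') (auto simp: m_comm diff_diff_submset subset_mset.add_diff_inverse)
    finally show "(f \<otimes>\<^bsub>PS V\<^esub> h) m = (h \<otimes>\<^bsub>PS V\<^esub> f) m" .
  qed
  show "Group.comm_monoid (PS V)"
  proof (rule comm_monoidI)
    show "\<one>\<^bsub>PS V\<^esub> \<in> carrier (PS V)" by (auto intro!: series_memI simp: series_one split: if_splits)
    show "\<one>\<^bsub>PS V\<^esub> \<otimes>\<^bsub>PS V\<^esub> f = f" if f: "f \<in> carrier (PS V)" for f
    proof (rule ext)
      fix m
      have "(\<one>\<^bsub>PS V\<^esub> \<otimes>\<^bsub>PS V\<^esub> f) m = (\<Oplus>k\<in>{k. k \<subseteq># m}. if {#} = k then f (m - k) else \<zero>)"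
        unfolding series_mult series_one using f by (intro finsum_cong') auto
      also have "\<dots> = f (m - {#})"
        using f finite_submultisets by (intro finsum_singleton) auto
      finally show "(\<one>\<^bsub>PS V\<^esub> \<otimes>\<^bsub>PS V\<^esub> f) m = f m" by simp
    qed
    show "f \<otimes>\<^bsub>PS V\<^esub> h \<otimes>\<^bsub>PS V\<^esub> w = f \<otimes>\<^bsub>PS V\<^esub> (h \<otimes>\<^bsub>PS V\<^esub> w)"
      if f: "f \<in> carrier (PS V)" and h: "h \<in> carrier (PS V)" and w: "w \<in> carrier (PS V)" for f h w
    proof (rule ext)
      fix m
      let ?D = "\<lambda>m. {k. k \<subseteq># (m :: variable multiset)}"
      let ?F = "\<lambda>k j. f j \<otimes> h (k - j) \<otimes> w (m - k)" and ?G = "\<lambda>j l. f j \<otimes> (h l \<otimes> w (m - j - l))"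
      have "(f \<otimes>\<^bsub>PS V\<^esub> h \<otimes>\<^bsub>PS V\<^esub> w) m = (\<Oplus>k\<in>?D m. \<Oplus>j\<in>?D k. ?F k j)"
        unfolding series_mult using f h w finite_submultisets
        by (intro finsum_cong') (auto intro!: finsum_ldistr finsum_closed)
      also have "\<dots> = (\<Oplus>p\<in>Sigma (?D m) ?D. ?F (fst p) (snd p))"
        using f h w finite_submultisets by (intro finsum_Sigma) auto
      \<comment> \<open>Chains of divisors \<open>j\<close> of \<open>k\<close> of \<open>m\<close>
        correspond to pairs of \<open>j\<close> and \<open>l = k - j\<close>, where \<open>l\<close>
        divides \<open>m - j\<close>.\<close>
      also have "\<dots> = (\<Oplus>p\<in>Sigma (?D m) (\<lambda>j. ?D (m - j)). ?F (fst p + snd p) (fst p))"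
      proof -
        have "bij_betw (\<lambda>p. (fst p + snd p, fst p)) (Sigma (?D m) (\<lambda>j. ?D (m - j))) (Sigma (?D m) ?D)"
        proof (rule bij_betw_byWitness[of _ "\<lambda>p. (snd p, fst p - snd p)"])
          show "(\<lambda>p. (fst p + snd p, fst p)) ` (Sigma (?D m) (\<lambda>j. ?D (m - j))) \<subseteq> Sigma (?D m) ?D"
            by (auto simp: subset_mset.le_diff_conv2 add.commute)
          show "(\<lambda>p. (snd p, fst p - snd p)) ` Sigma (?D m) ?D \<subseteq> Sigma (?D m) (\<lambda>j. ?D (m - j))"
            by (auto intro: subset_mset.order_trans) (simp add: subseteq_mset_def diff_le_mono)
        qed (auto simp: subset_mset.add_diff_inverse)
        from finsum_reindex_bij[OF this, of "\<lambda>p. ?F (fst p) (snd p)"] show ?thesis using f h w by auto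
      qed
      also have "\<dots> = (\<Oplus>p\<in>Sigma (?D m) (\<lambda>j. ?D (m - j)). ?G (fst p) (snd p))"
        using f h w by (intro finsum_cong') (auto simp: m_assoc)
      also have "\<dots> = (\<Oplus>j\<in>?D m. \<Oplus>l\<in>?D (m - j). ?G j l)"
        using f h w finite_submultisets by (intro finsum_Sigma[symmetric]) auto
      also have "\<dots> = (f \<otimes>\<^bsub>PS V\<^esub> (h \<otimes>\<^bsub>PS V\<^esub> w)) m"
        unfolding series_mult using f h w finite_submultisets
        by (intro finsum_cong') (auto intro!: finsum_rdistr[symmetric] finsum_closed)
      finally show "(f \<otimes>\<^bsub>PS V\<^esub> h \<otimes>\<^bsub>PS V\<^esub> w) m = (f \<otimes>\<^bsub>PS V\<^esub> (h \<otimes>\<^bsub>PS V\<^esub> w)) m" .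
    qed
  qed (use closed comm in auto)
  show "(f \<oplus>\<^bsub>PS V\<^esub> h) \<otimes>\<^bsub>PS V\<^esub> w = f \<otimes>\<^bsub>PS V\<^esub> w \<oplus>\<^bsub>PS V\<^esub> h \<otimes>\<^bsub>PS V\<^esub> w"
    if f: "f \<in> carrier (PS V)" and h: "h \<in> carrier (PS V)" and w: "w \<in> carrier (PS V)" for f h w
  proof (rule ext)
    fix m
    have "((f \<oplus>\<^bsub>PS V\<^esub> h) \<otimes>\<^bsub>PS V\<^esub> w) m = (\<Oplus>k\<in>{k. k \<subseteq># m}. f k \<otimes> w (m - k) \<oplus> h k \<otimes> w (m - k))"
      unfolding series_mult series_add using f h w by (intro finsum_cong') (auto simp: l_distr)
    also have "\<dots> = (f \<otimes>\<^bsub>PS V\<^esub> w \<oplus>\<^bsub>PS V\<^esub> h \<otimes>\<^bsub>PS V\<^esub> w) m"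
      unfolding series_mult series_add using f h w by (intro finsum_addf) auto
    finally show "((f \<oplus>\<^bsub>PS V\<^esub> h) \<otimes>\<^bsub>PS V\<^esub> w) m = (f \<otimes>\<^bsub>PS V\<^esub> w \<oplus>\<^bsub>PS V\<^esub> h \<otimes>\<^bsub>PS V\<^esub> w) m" .
  qed
qed

section \<open>Monomials, monomial ideals and units\<close>

definition series_term :: "'a \<Rightarrow> variable multiset \<Rightarrow> 'a series" where
  "series_term c m0 = (\<lambda>m. if m = m0 then c else \<zero>)"

lemma series_const_term: "series_const R c = series_term c {#}"
  by (simp add: series_const_def series_term_def)

lemma series_var_term: "series_var R z = series_term \<one> {#z#}"
  by (simp add: series_var_def series_term_def)

lemma series_term_closed: "c \<in> carrier R \<Longrightarrow> set_mset m \<subseteq> V \<Longrightarrow> series_term c m \<in> carrier (PS V)"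
  by (auto intro!: series_memI simp: series_term_def split: if_splits)

lemma series_term_mult:
  assumes "c \<in> carrier R" "f \<in> carrier (PS V)"
  shows "(series_term c m0 \<otimes>\<^bsub>PS V\<^esub> f) m = (if m0 \<subseteq># m then c \<otimes> f (m - m0) else \<zero>)"
proof -
  have "(series_term c m0 \<otimes>\<^bsub>PS V\<^esub> f) m = (\<Oplus>k\<in>{k. k \<subseteq># m}. if m0 = k then c \<otimes> f (m - k) else \<zero>)"
    unfolding series_mult series_term_def using assms by (intro finsum_cong') auto
  also have "\<dots> = (if m0 \<subseteq># m then c \<otimes> f (m - m0) else \<zero>)"
  proof (cases "m0 \<subseteq># m")
    case True
    have "(\<Oplus>k\<in>{k. k \<subseteq># m}. if m0 = k then c \<otimes> f (m - k) else \<zero>) = c \<otimes> f (m - m0)"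
      by (rule finsum_singleton) (use True assms finite_submultisets in auto)
    then show ?thesis using True by simp
  next
    case False
    have "(\<Oplus>k\<in>{k. k \<subseteq># m}. if m0 = k then c \<otimes> f (m - k) else \<zero>) = (\<Oplus>k\<in>{k. k \<subseteq># m}. \<zero>)"
      using False assms by (intro finsum_cong') auto
    then show ?thesis using False by simp
  qed
  finally show ?thesis .
qed

lemma series_a_inv: "f \<in> carrier (PS V) \<Longrightarrow> (\<ominus>\<^bsub>PS V\<^esub> f) m = \<ominus> f m"
proof -
  assume f: "f \<in> carrier (PS V)"
  interpret P: cring "PS V" by (rule series_ring_cring)
  have "(\<ominus>\<^bsub>PS V\<^esub> f \<oplus>\<^bsub>PS V\<^esub> f) m = \<zero>" using P.l_neg[OF f] by (simp add: series_zero)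
  then have "(\<ominus>\<^bsub>PS V\<^esub> f) m \<oplus> f m = \<zero>" by (simp add: series_add)
  moreover have "(\<ominus>\<^bsub>PS V\<^esub> f) m \<in> carrier R" "f m \<in> carrier R"
    using series_coeff[OF P.a_inv_closed[OF f]] series_coeff[OF f] by auto
  ultimately show ?thesis using minus_equality[of "(\<ominus>\<^bsub>PS V\<^esub> f) m" "f m"] by simp
qed

lemma series_minus: "f \<in> carrier (PS V) \<Longrightarrow> h \<in> carrier (PS V) \<Longrightarrow> (f \<ominus>\<^bsub>PS V\<^esub> h) m = f m \<ominus> h m"
  by (simp add: a_minus_def series_add series_a_inv)

text \<open>The ideals defining A, the \<open>A_S\<close> and the components are generated by
  monomials. Each is recorded by the set W of monomials outside it, which is closed under divisors,
  so that membership is a condition on coefficients.\<close>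

definition vanishing :: "variable set \<Rightarrow> variable multiset set \<Rightarrow> 'a series set" where
  "vanishing V W = {f \<in> carrier (PS V). \<forall>m\<in>W. f m = \<zero>}"

lemma vanishing_ideal:
  assumes "\<And>k m. k \<subseteq># m \<Longrightarrow> m \<in> W \<Longrightarrow> k \<in> W"
  shows "ideal (vanishing V W) (PS V)"
proof -
  interpret P: cring "PS V" by (rule series_ring_cring)
  have mult: "f \<otimes>\<^bsub>PS V\<^esub> h \<in> vanishing V W" if f: "f \<in> vanishing V W" and h: "h \<in> carrier (PS V)" for f h
  proof -
    have "(f \<otimes>\<^bsub>PS V\<^esub> h) m = \<zero>" if m: "m \<in> W" for m
    proof -
      have "(f \<otimes>\<^bsub>PS V\<^esub> h) m = (\<Oplus>k\<in>{k. k \<subseteq># m}. \<zero>)"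
        unfolding series_mult using f h m assms by (intro finsum_cong') (auto simp: vanishing_def)
      then show ?thesis by simp
    qed
    then show ?thesis using f h by (simp add: vanishing_def)
  qed
  show ?thesis
  proof (rule idealI)
    show "subgroup (vanishing V W) (add_monoid (PS V))"
      by (rule P.add.subgroupI)
        (auto simp: vanishing_def series_zero series_add series_a_inv simp flip: a_inv_def
          intro!: exI[of _ "\<zero>\<^bsub>PS V\<^esub>"])
  qed (use mult P.ring_axioms in \<open>auto simp: vanishing_def P.m_comm\<close>)
qed

text \<open>Finiteness of G matters, since an ideal need not be closed under infinite sums: for one
  generator after the other, all terms divisible by it are collected into a single multiple.\<close>

lemma vanishing_subset_ideal:
  assumes "ideal K (PS V)" "finite G" "\<And>g. g \<in> G \<Longrightarrow> set_mset g \<subseteq> V"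
    "\<And>g. g \<in> G \<Longrightarrow> series_term \<one> g \<in> K"
  shows "f \<in> carrier (PS V) \<Longrightarrow> (\<And>m. f m \<noteq> \<zero> \<Longrightarrow> \<exists>g\<in>G. g \<subseteq># m) \<Longrightarrow> f \<in> K"
  using assms(2-4)
proof (induction G arbitrary: f rule: finite_induct)
  case empty
  then have "f = \<zero>\<^bsub>PS V\<^esub>" by (auto simp: fun_eq_iff series_zero)
  then show ?case using assms(1) additive_subgroup.zero_closed ideal.axioms(1) by metis
next
  case (insert g G)
  interpret P: cring "PS V" by (rule series_ring_cring)
  note f = insert.prems(1)
  \<comment> \<open>\<open>q\<close> is the quotient by \<open>g\<close> of the part of
    \<open>f\<close> divisible by \<open>g\<close>, and \<open>f2\<close> is the remaining
    part.\<close>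
  define q where "q = (\<lambda>m. f (m + g))"
  define f2 where "f2 = (\<lambda>m. if g \<subseteq># m then \<zero> else f m)"
  have q: "q \<in> carrier (PS V)"
    using series_coeff[OF f] series_support[OF f] by (auto intro!: series_memI simp: q_def)
  have f2: "f2 \<in> carrier (PS V)" using series_coeff[OF f] series_support[OF f] by (auto intro!: series_memI simp: f2_def split: if_splits)
  have "f2 \<in> K"
  proof (rule insert.IH[OF f2])
    fix m assume "f2 m \<noteq> \<zero>"
    then show "\<exists>g\<in>G. g \<subseteq># m" using insert.prems(2)[of m] by (auto simp: f2_def split: if_splits)
  qed (use insert.prems in auto)
  moreover have "series_term \<one> g \<otimes>\<^bsub>PS V\<^esub> q \<in> K"
    using ideal.I_r_closed[OF assms(1)] insert.prems(4) q by simp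
  ultimately have "series_term \<one> g \<otimes>\<^bsub>PS V\<^esub> q \<oplus>\<^bsub>PS V\<^esub> f2 \<in> K"
    using additive_subgroup.a_closed[OF ideal.axioms(1)[OF assms(1)]] by blast
  moreover have "series_term \<one> g \<otimes>\<^bsub>PS V\<^esub> q \<oplus>\<^bsub>PS V\<^esub> f2 = f"
    using f q by (auto simp: fun_eq_iff series_add series_term_mult f2_def q_def)
  ultimately show ?case by simp
qed

text \<open>With \<open>c\<close> the inverse of the constant term, \<open>c f = 1 - h\<close>, and
  the geometric series in \<open>h\<close> converges coefficientwise because \<open>h\<close> has no
  constant term.\<close>

lemma series_inverse:
  assumes f: "f \<in> carrier (PS V)" and u: "f {#} \<in> Units R"
  shows "f \<in> Units (PS V)"
proof -
  interpret P: cring "PS V" by (rule series_ring_cring)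
  define c where "c = inv (f {#})"
  have c: "c \<in> carrier R" "c \<otimes> f {#} = \<one>" using u by (auto simp: c_def)
  define h where "h = \<one>\<^bsub>PS V\<^esub> \<ominus>\<^bsub>PS V\<^esub> series_term c {#} \<otimes>\<^bsub>PS V\<^esub> f"
  have C: "series_term c {#} \<in> carrier (PS V)" using c by (intro series_term_closed) auto
  have h: "h \<in> carrier (PS V)" using f C by (simp add: h_def)
  have h0: "h {#} = \<zero>" using f c C by (simp add: h_def series_minus series_one series_term_mult r_right_minus_eq)
  \<comment> \<open>\<open>A k\<close> is the sum of the powers of \<open>h\<close> with exponent
    below \<open>k\<close>. Its coefficient at \<open>m\<close> is final once \<open>k\<close>
    exceeds the degree of \<open>m\<close>.\<close>
  define A where "A = rec_nat \<zero>\<^bsub>PS V\<^esub> (\<lambda>_ a. \<one>\<^bsub>PS V\<^esub> \<oplus>\<^bsub>PS V\<^esub> h \<otimes>\<^bsub>PS V\<^esub> a)"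
  have A_Suc: "A (Suc k) = \<one>\<^bsub>PS V\<^esub> \<oplus>\<^bsub>PS V\<^esub> h \<otimes>\<^bsub>PS V\<^esub> A k" for k by (simp add: A_def)
  have A: "A k \<in> carrier (PS V)" for k using h by (induction k) (simp_all add: A_Suc, simp add: A_def)
  have local: "(h \<otimes>\<^bsub>PS V\<^esub> a) m = (h \<otimes>\<^bsub>PS V\<^esub> b) m"
    if a: "a \<in> carrier (PS V)" "b \<in> carrier (PS V)" and eq: "\<And>k. size k < size m \<Longrightarrow> a k = b k" for a b m
    unfolding series_mult
  proof (rule finsum_cong')
    fix k assume k: "k \<in> {k. k \<subseteq># m}"
    show "h k \<otimes> a (m - k) = h k \<otimes> b (m - k)"
    proof (cases "k = {#}")
      case False
      have "size k \<le> size m" using k size_mset_mono by auto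
      moreover have "size (m - k) = size m - size k" using k by (simp add: size_Diff_submset)
      moreover have "0 < size k" using False by (simp add: nonempty_has_size)
      ultimately show ?thesis by (simp add: eq)
    qed (use h0 a in simp)
  qed (use h a in auto)
  have stable: "A (Suc k) m = A k m" if "size m < k" for k m
    using that
  proof (induction k arbitrary: m)
    case (Suc k)
    have "(h \<otimes>\<^bsub>PS V\<^esub> A (Suc k)) m = (h \<otimes>\<^bsub>PS V\<^esub> A k) m"
      using Suc by (intro local A) auto
    then show ?case by (simp add: A_Suc[of "Suc k"] A_Suc[of k] series_add)
  qed simp
  have stable': "A k m = A (Suc (size m)) m" if "size m < k" for k m
    using that
  proof (induction k)
    case (Suc k)
    then show ?case using stable[of m k] by (cases "size m = k") auto
  qed simp
  define g where "g m = A (Suc (size m)) m" for m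
  have g: "g \<in> carrier (PS V)" using series_coeff[OF A] series_support[OF A] by (auto intro!: series_memI simp: g_def)
  have "h \<otimes>\<^bsub>PS V\<^esub> g = g \<ominus>\<^bsub>PS V\<^esub> \<one>\<^bsub>PS V\<^esub>"
  proof (rule ext)
    fix m
    have "(h \<otimes>\<^bsub>PS V\<^esub> g) m = (h \<otimes>\<^bsub>PS V\<^esub> A (size m)) m"
    proof (rule local[OF g A])
      fix k :: "variable multiset" assume "size k < size m"
      then show "g k = A (size m) k" using stable'[of k "size m"] by (simp only: g_def)
    qed
    also have "\<dots> = (A (Suc (size m)) \<ominus>\<^bsub>PS V\<^esub> \<one>\<^bsub>PS V\<^esub>) m"
      unfolding A_Suc using h A[of "size m"] by (subst P.add_minus_cancel) auto
    also have "\<dots> = (g \<ominus>\<^bsub>PS V\<^esub> \<one>\<^bsub>PS V\<^esub>) m"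
      by (simp only: series_minus[OF A P.one_closed] series_minus[OF g P.one_closed] g_def)
    finally show "(h \<otimes>\<^bsub>PS V\<^esub> g) m = (g \<ominus>\<^bsub>PS V\<^esub> \<one>\<^bsub>PS V\<^esub>) m" .
  qed
  moreover have "h \<otimes>\<^bsub>PS V\<^esub> g = g \<ominus>\<^bsub>PS V\<^esub> (series_term c {#} \<otimes>\<^bsub>PS V\<^esub> f) \<otimes>\<^bsub>PS V\<^esub> g"
  proof -
    have "(\<one>\<^bsub>PS V\<^esub> \<ominus>\<^bsub>PS V\<^esub> w) \<otimes>\<^bsub>PS V\<^esub> g = g \<ominus>\<^bsub>PS V\<^esub> w \<otimes>\<^bsub>PS V\<^esub> g" if "w \<in> carrier (PS V)" for w
      using that g by (simp add: a_minus_def P.l_distr P.l_minus)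
    then show ?thesis using P.m_closed[OF C f] unfolding h_def by blast
  qed
  ultimately have "g \<ominus>\<^bsub>PS V\<^esub> (series_term c {#} \<otimes>\<^bsub>PS V\<^esub> f) \<otimes>\<^bsub>PS V\<^esub> g = g \<ominus>\<^bsub>PS V\<^esub> \<one>\<^bsub>PS V\<^esub>"
    by (rule trans[OF sym, rotated])
  then have "\<one>\<^bsub>PS V\<^esub> = (series_term c {#} \<otimes>\<^bsub>PS V\<^esub> f) \<otimes>\<^bsub>PS V\<^esub> g"
    by (rule P.minus_left_cancel[OF g P.m_closed[OF P.m_closed[OF C f] g] P.one_closed])
  then have fg: "f \<otimes>\<^bsub>PS V\<^esub> (series_term c {#} \<otimes>\<^bsub>PS V\<^esub> g) = \<one>\<^bsub>PS V\<^esub>"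
    using f C g by (simp add: P.m_ac)
  have Cg: "series_term c {#} \<otimes>\<^bsub>PS V\<^esub> g \<in> carrier (PS V)" using C g by simp
  have gf: "(series_term c {#} \<otimes>\<^bsub>PS V\<^esub> g) \<otimes>\<^bsub>PS V\<^esub> f = \<one>\<^bsub>PS V\<^esub>"
    using fg P.m_comm[OF f Cg] by simp
  show ?thesis unfolding Units_def
    by (rule CollectI, rule conjI[OF f], rule bexI[OF _ Cg], rule conjI[OF gf fg])
qed

end

text \<open>Modulo this ideal only the variables of U remain. If \<open>m\<close> and
  \<open>m'\<close> are the least monomials in these variables of \<open>f\<close> and
  \<open>h\<close>, the coefficient of the product at \<open>m + m'\<close> is the single product of
  their coefficients.\<close>

lemma (in domain) vanishing_prime:
  "primeideal (vanishing V {m. set_mset m \<subseteq> U}) (series_ring R V)"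
proof -
  let ?P = "series_ring R V" and ?W = "{m. set_mset m \<subseteq> U}"
  interpret P: cring ?P by (rule series_ring_cring)
  have ideal: "ideal (vanishing V ?W) ?P"
    by (rule vanishing_ideal) (use set_mset_mono in blast)
  show ?thesis
  proof (rule primeidealI[OF ideal P.cring_axioms])
    have "\<one>\<^bsub>?P\<^esub> \<notin> vanishing V ?W" by (auto simp: vanishing_def series_one intro!: exI[of _ "{#}"])
    then show "carrier ?P \<noteq> vanishing V ?W" using P.one_closed by metis
  next
    fix f h assume f: "f \<in> carrier ?P" and h: "h \<in> carrier ?P" and fh: "f \<otimes>\<^bsub>?P\<^esub> h \<in> vanishing V ?W"
    show "f \<in> vanishing V ?W \<or> h \<in> vanishing V ?W"
    proof (rule ccontr)
      assume n: "\<not> (f \<in> vanishing V ?W \<or> h \<in> vanishing V ?W)"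
      define m where "m = (LEAST m. m \<in> ?W \<and> f m \<noteq> \<zero>)"
      define m' where "m' = (LEAST m. m \<in> ?W \<and> h m \<noteq> \<zero>)"
      have "\<exists>m. m \<in> ?W \<and> f m \<noteq> \<zero>" "\<exists>m. m \<in> ?W \<and> h m \<noteq> \<zero>" using n f h by (auto simp: vanishing_def)
      then have m: "m \<in> ?W" "f m \<noteq> \<zero>" and m': "m' \<in> ?W" "h m' \<noteq> \<zero>"
        unfolding m_def m'_def by (metis (mono_tags, lifting) LeastI)+
      have mm: "m + m' \<in> ?W" using m m' by auto
      have "f k \<otimes> h (m + m' - k) = (if m = k then f k \<otimes> h (m + m' - k) else \<zero>)" if k: "k \<subseteq># m + m'" for k
      proof (cases "m = k")
        case False
        have sum: "k + (m + m' - k) = m + m'" using k by (simp add: subset_mset.add_diff_inverse)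
        then have W: "k \<in> ?W" "m + m' - k \<in> ?W" using mm by (auto simp: set_mset_union[symmetric] simp del: set_mset_union) (metis UnCI set_mset_union subsetD)+
        show ?thesis
        proof (cases "k < m")
          case True
          then have "f k = \<zero>" using not_less_Least[of k] W(1) unfolding m_def by blast
          then show ?thesis using False h by simp
        next
          case k_gt: False
          \<comment> \<open>The complementary monomial then lies below \<open>m'\<close>, the least
            one of \<open>h\<close>.\<close>
          then have "m < k" using False by simp
          then have "m + m' - k < m'"
            by (metis add_less_cancel_left add_less_cancel_right sum linorder_not_less add_mono order_less_le order_le_less_trans nle_le)
          then have "h (m + m' - k) = \<zero>" using not_less_Least[of "m + m' - k"] W(2) unfolding m'_def by blast
          then show ?thesis using False f by simp
        qed
      qed simp
      then have "(f \<otimes>\<^bsub>?P\<^esub> h) (m + m')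
          = (\<Oplus>k\<in>{k. k \<subseteq># m + m'}. if m = k then f k \<otimes> h (m + m' - k) else \<zero>)"
        unfolding series_mult using f h by (intro finsum_cong') auto
      also have "\<dots> = f m \<otimes> h m'"
        using f h finite_submultisets by (subst finsum_singleton) auto
      finally have "f m \<otimes> h m' = \<zero>" using fh mm by (simp add: vanishing_def)
      then show False using m m' integral series_coeff[OF f, of m] series_coeff[OF h, of m'] by blast
    qed
  qed
qed

section \<open>Evaluation of power series\<close>

locale evaluation = complete_dvr R u for R (structure) and u +
  fixes V :: "variable set" and v :: "variable \<Rightarrow> 'a"
  assumes finite_V: "finite V" and v_mem: "z \<in> V \<Longrightarrow> v z \<in> PIdl u"
begin

definition I :: "nat \<Rightarrow> 'a set" where "I k = PIdl (u [^] k)"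

lemma u_pow [simp]: "u [^] (k::nat) \<in> carrier R"
  using uniformizer_carrier by simp

lemma I_ideal: "ideal (I k) R"
  unfolding I_def by (rule cgenideal_ideal) simp

lemma I_mem_iff: "a \<in> I k \<longleftrightarrow> (\<exists>r\<in>carrier R. a = r \<otimes> u [^] k)"
  by (auto simp: I_def cgenideal_def)

lemma I_carrier: "a \<in> I k \<Longrightarrow> a \<in> carrier R"
  by (auto simp: I_mem_iff)

lemma I_mult: assumes "a \<in> I j" "b \<in> I k" shows "a \<otimes> b \<in> I (j + k)"
proof -
  obtain r s where r: "r \<in> carrier R" "a = r \<otimes> u [^] j" and s: "s \<in> carrier R" "b = s \<otimes> u [^] k"
    using assms by (auto simp: I_mem_iff)
  have "a \<otimes> b = (r \<otimes> s) \<otimes> (u [^] j \<otimes> u [^] k)"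
    using r s by (simp add: m_ac)
  also have "\<dots> = (r \<otimes> s) \<otimes> u [^] (j + k)" using uniformizer_carrier by (simp add: nat_pow_mult)
  finally show ?thesis using r s by (auto simp: I_mem_iff)
qed

lemma I_mono: assumes "a \<in> I k" "j \<le> k" shows "a \<in> I j"
proof -
  obtain r where r: "r \<in> carrier R" "a = r \<otimes> u [^] k" using assms by (auto simp: I_mem_iff)
  have "u [^] k = u [^] (k - j) \<otimes> u [^] j" using assms uniformizer_carrier by (simp add: nat_pow_mult)
  then have "a = (r \<otimes> u [^] (k - j)) \<otimes> u [^] j" using r by (simp add: m_assoc)
  then show ?thesis using r unfolding I_mem_iff by (metis m_closed u_pow)
qed

lemma I_0: "a \<in> carrier R \<Longrightarrow> a \<in> I 0"
  unfolding I_mem_iff by (rule bexI[of _ a]) simp_all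

lemma I_add: "a \<in> I k \<Longrightarrow> b \<in> I k \<Longrightarrow> a \<oplus> b \<in> I k"
  using additive_subgroup.a_closed[OF ideal.axioms(1)[OF I_ideal]] by blast

lemma I_neg: "a \<in> I k \<Longrightarrow> \<ominus> a \<in> I k"
  using additive_subgroup.a_inv_closed[OF ideal.axioms(1)[OF I_ideal]] by blast

lemma I_zero: "\<zero> \<in> I k"
  using additive_subgroup.zero_closed[OF ideal.axioms(1)[OF I_ideal]] .

lemma I_smult: "a \<in> I k \<Longrightarrow> b \<in> carrier R \<Longrightarrow> b \<otimes> a \<in> I k"
  using ideal.I_l_closed[OF I_ideal] by blast

lemma I_separated:
  assumes "\<And>k. a \<ominus> b \<in> I k" "a \<in> carrier R" "b \<in> carrier R"
  shows "a = b"
proof -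
  have "a \<ominus> b \<in> (\<Inter>k::nat. I k)" using assms by blast
  then have "a \<ominus> b = \<zero>" using adic_separated by (simp add: I_def)
  then show ?thesis using assms by (simp add: minus_eq_zero_iff)
qed

lemma v_closed [simp]: "z \<in> V \<Longrightarrow> v z \<in> carrier R"
  using ideal.Icarr[OF cgenideal_ideal[OF uniformizer_carrier] v_mem] .

lemma v_I: "z \<in> V \<Longrightarrow> v z \<in> I 1"
  using v_mem uniformizer_carrier by (simp add: I_def)

definition mval :: "variable multiset \<Rightarrow> 'a" where
  "mval m = (\<Otimes>z\<in>V. v z [^] count m z)"

lemma mval_closed [simp]: "mval m \<in> carrier R"
  unfolding mval_def by (rule finprod_closed) auto

lemma mval_add: "mval (m + m') = mval m \<otimes> mval m'"
proof -
  have "mval (m + m') = (\<Otimes>z\<in>V. v z [^] count m z \<otimes> v z [^] count m' z)"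
    unfolding mval_def by (intro finprod_cong') (auto simp: nat_pow_mult)
  also have "\<dots> = mval m \<otimes> mval m'"
    unfolding mval_def by (intro finprod_multf) auto
  finally show ?thesis .
qed

lemma mval_empty [simp]: "mval {#} = \<one>"
  unfolding mval_def by (rule finprod_one_eqI) simp

lemma mval_single: assumes "z \<in> V" shows "mval {#z#} = v z"
proof -
  have "mval {#z#} = (\<Otimes>y\<in>V. if z = y then v y else \<one>)"
    unfolding mval_def by (intro finprod_cong') auto
  also have "\<dots> = v z" using assms finite_V by (intro finprod_singleton) auto
  finally show ?thesis .
qed

lemma mval_mem: assumes "set_mset m \<subseteq> V" shows "mval m \<in> I (size m)"
  using assms
proof (induction m)
  case empty
  then show ?case using I_0 by simp
next
  case (add z m)
  then have "v z \<otimes> mval m \<in> I (1 + size m)" by (intro I_mult v_I) auto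
  moreover have "mval (add_mset z m) = v z \<otimes> mval m"
    using mval_add[of "{#z#}" m] mval_single[of z] add.prems by simp
  ultimately show ?case by simp
qed

definition Mon :: "nat \<Rightarrow> variable multiset set" where
  "Mon k = {m. set_mset m \<subseteq> V \<and> size m < k}"

lemma finite_Mon: "finite (Mon k)"
proof -
  have "Mon k \<subseteq> mset ` {xs. set xs \<subseteq> V \<and> length xs \<le> k}"
  proof
    fix m assume m: "m \<in> Mon k"
    obtain xs where xs: "mset xs = m" using ex_mset by blast
    then have "set xs \<subseteq> V" "length xs \<le> k" using m by (auto simp: Mon_def)
    then show "m \<in> mset ` {xs. set xs \<subseteq> V \<and> length xs \<le> k}" using xs by blast
  qed
  then show ?thesis using finite_lists_length_le[OF finite_V] finite_subset by blast
qed

text \<open>Truncation by total degree. There are finitely many monomials of each degree, and those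
  of degree d take values in the ideal of \<open>u\<close> to the power d, so the truncations are
  finite sums forming a Cauchy sequence.\<close>

definition psum :: "nat \<Rightarrow> 'a series \<Rightarrow> 'a" where
  "psum k f = (\<Oplus>m\<in>Mon k. f m \<otimes> mval m)"

abbreviation "PV \<equiv> series_ring R V"

lemma term_mem: "f \<in> carrier PV \<Longrightarrow> set_mset m \<subseteq> V \<Longrightarrow> f m \<otimes> mval m \<in> I (size m)"
  by (rule I_smult[OF mval_mem series_coeff])

lemma psum_closed [simp]: "f \<in> carrier PV \<Longrightarrow> psum k f \<in> carrier R"
  unfolding psum_def by (rule finsum_closed, rule funcsetI, rule m_closed, erule series_coeff, rule mval_closed)

lemma psum_step:
  assumes f: "f \<in> carrier PV"
  shows "psum (Suc k) f \<ominus> psum k f \<in> I k"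
proof -
  let ?N = "{m. set_mset m \<subseteq> V \<and> size m = k}"
  have fin: "finite ?N" by (rule finite_subset[OF _ finite_Mon[of "Suc k"]]) (auto simp: Mon_def)
  have cl: "f m \<otimes> mval m \<in> carrier R" for m using series_coeff[OF f] by simp
  have Mon: "Mon (Suc k) = Mon k \<union> ?N" by (auto simp: Mon_def)
  have "psum (Suc k) f = psum k f \<oplus> (\<Oplus>m\<in>?N. f m \<otimes> mval m)"
    unfolding psum_def Mon
  proof (rule finsum_Un_disjoint)
    show "Mon k \<inter> ?N = {}" by (auto simp: Mon_def)
  qed (use finite_Mon fin cl in auto)
  moreover have N: "(\<Oplus>m\<in>?N. f m \<otimes> mval m) \<in> I k"
    by (rule ideal.finsum_mem[OF I_ideal fin]) (use term_mem[OF f] in auto)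
  ultimately have "psum (Suc k) f \<ominus> psum k f = (\<Oplus>m\<in>?N. f m \<otimes> mval m)"
    using add_minus_cancel[OF psum_closed[OF f] I_carrier[OF N]] by simp
  then show ?thesis using N by simp
qed

definition evals :: "'a series \<Rightarrow> 'a" where
  "evals f = (SOME z. z \<in> carrier R \<and> (\<forall>k. z \<ominus> psum k f \<in> I k))"

lemma evals:
  assumes "f \<in> carrier PV"
  shows "evals f \<in> carrier R" "evals f \<ominus> psum k f \<in> I k"
proof -
  have "\<exists>z\<in>carrier R. \<forall>k. z \<ominus> psum k f \<in> I k"
    unfolding I_def using psum_step[OF assms] assms by (intro adic_complete) (auto simp: I_def)
  then have "\<exists>z. z \<in> carrier R \<and> (\<forall>k. z \<ominus> psum k f \<in> I k)" by blast
  from someI_ex[OF this] show "evals f \<in> carrier R" "evals f \<ominus> psum k f \<in> I k"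
    unfolding evals_def by blast+
qed

lemma diff_trans:
  assumes "a \<in> carrier R" "b \<in> carrier R" "c \<in> carrier R" "a \<ominus> b \<in> I k" "b \<ominus> c \<in> I k"
  shows "a \<ominus> c \<in> I k"
proof -
  have "(a \<ominus> b) \<oplus> (b \<ominus> c) = a \<ominus> c"
    using assms(1-3) by (simp add: a_minus_def a_assoc r_neg1)
  then show ?thesis using I_add[OF assms(4,5)] by simp
qed

lemma diff_sym:
  assumes "a \<in> carrier R" "b \<in> carrier R" "a \<ominus> b \<in> I k"
  shows "b \<ominus> a \<in> I k"
proof -
  have "\<ominus> (a \<ominus> b) = b \<ominus> a" using assms by (simp add: a_minus_def minus_add a_comm)
  then show ?thesis using I_neg[OF assms(3)] by simp
qed

lemma evals_unique:
  assumes f: "f \<in> carrier PV" and z: "z \<in> carrier R" "\<And>k. z \<ominus> psum k f \<in> I k"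
  shows "evals f = z"
proof (rule I_separated)
  fix k
  show "evals f \<ominus> z \<in> I k"
    by (rule diff_trans[OF evals(1)[OF f] psum_closed[OF f] z(1) evals(2)[OF f]
          diff_sym[OF z(1) psum_closed[OF f] z(2)]])
qed (use evals[OF f] z in auto)

lemma psum_term:
  assumes "c \<in> carrier R" "set_mset m \<subseteq> V"
  shows "psum k (series_term c m) = (if size m < k then c \<otimes> mval m else \<zero>)"
proof -
  have "psum k (series_term c m) = (\<Oplus>m'\<in>Mon k. if m = m' then c \<otimes> mval m' else \<zero>)"
    unfolding psum_def series_term_def using assms by (intro finsum_cong') auto
  also have "\<dots> = (if size m < k then c \<otimes> mval m else \<zero>)"
  proof (cases "size m < k")
    case True
    have "(\<Oplus>m'\<in>Mon k. if m = m' then c \<otimes> mval m' else \<zero>) = c \<otimes> mval m"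
      by (rule finsum_singleton) (use True assms finite_Mon in \<open>auto simp: Mon_def\<close>)
    then show ?thesis using True by simp
  next
    case False
    have "(\<Oplus>m'\<in>Mon k. if m = m' then c \<otimes> mval m' else \<zero>) = (\<Oplus>m'\<in>Mon k. \<zero>)"
      using False by (intro finsum_cong') (auto simp: Mon_def)
    then show ?thesis using False by simp
  qed
  finally show ?thesis .
qed

lemma evals_term:
  assumes "c \<in> carrier R" "set_mset m \<subseteq> V"
  shows "evals (series_term c m) = c \<otimes> mval m"
proof (rule evals_unique)
  fix k
  have "c \<otimes> mval m \<in> I (size m)" using assms by (intro I_smult mval_mem)
  then have "k \<le> size m \<Longrightarrow> c \<otimes> mval m \<in> I k" by (rule I_mono)
  then show "c \<otimes> mval m \<ominus> psum k (series_term c m) \<in> I k"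
    using assms I_zero by (auto simp: psum_term a_minus_def r_neg)
qed (use assms in \<open>auto intro: series_term_closed\<close>)

lemma evals_add:
  assumes f: "f \<in> carrier PV" and h: "h \<in> carrier PV"
  shows "evals (f \<oplus>\<^bsub>PV\<^esub> h) = evals f \<oplus> evals h"
proof (rule evals_unique)
  interpret P: cring PV by (rule series_ring_cring)
  show "f \<oplus>\<^bsub>PV\<^esub> h \<in> carrier PV" using f h by simp
  fix k
  have "psum k (f \<oplus>\<^bsub>PV\<^esub> h) = (\<Oplus>m\<in>Mon k. f m \<otimes> mval m \<oplus> h m \<otimes> mval m)"
    unfolding psum_def series_add using series_coeff[OF f] series_coeff[OF h]
    by (intro finsum_cong') (auto simp: l_distr)
  also have "\<dots> = psum k f \<oplus> psum k h"
    unfolding psum_def using series_coeff[OF f] series_coeff[OF h] by (intro finsum_addf) auto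
  finally have "(evals f \<oplus> evals h) \<ominus> psum k (f \<oplus>\<^bsub>PV\<^esub> h) = (evals f \<ominus> psum k f) \<oplus> (evals h \<ominus> psum k h)"
    using evals(1)[OF f] evals(1)[OF h] f h by (simp add: a_minus_def minus_add a_ac)
  then show "(evals f \<oplus> evals h) \<ominus> psum k (f \<oplus>\<^bsub>PV\<^esub> h) \<in> I k"
    using evals(2)[OF f] evals(2)[OF h] I_add by simp
qed (simp add: evals(1)[OF f] evals(1)[OF h])

text \<open>The product of the truncations exceeds the truncation of the product by the pairs of
  monomials in \<open>U\<close>, whose total degree is at least \<open>k\<close>.\<close>

lemma psum_mult:
  assumes f: "f \<in> carrier PV" and h: "h \<in> carrier PV"
  shows "psum k f \<otimes> psum k h \<ominus> psum k (f \<otimes>\<^bsub>PV\<^esub> h) \<in> I k"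
proof -
  let ?F = "\<lambda>m. f m \<otimes> mval m" and ?H = "\<lambda>m. h m \<otimes> mval m"
  let ?D = "\<lambda>m. {k. k \<subseteq># (m :: variable multiset)}"
  have F: "?F m \<in> carrier R" and H: "?H m \<in> carrier R" for m
    using series_coeff[OF f] series_coeff[OF h] by auto
  define L where "L = {p \<in> Mon k \<times> Mon k. size (fst p) + size (snd p) < k}"
  define U where "U = {p \<in> Mon k \<times> Mon k. \<not> size (fst p) + size (snd p) < k}"
  have fin: "finite L" "finite U" using finite_Mon by (auto simp: L_def U_def)
  have FH: "?F (fst p) \<otimes> ?H (snd p) \<in> carrier R" for p using F H by auto
  have "psum k f \<otimes> psum k h = (\<Oplus>a\<in>Mon k. \<Oplus>b\<in>Mon k. ?F a \<otimes> ?H b)"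
  proof -
    have "psum k f \<otimes> psum k h = (\<Oplus>a\<in>Mon k. ?F a \<otimes> psum k h)"
      unfolding psum_def[of k f] using F h finite_Mon by (intro finsum_ldistr) auto
    also have "\<dots> = (\<Oplus>a\<in>Mon k. \<Oplus>b\<in>Mon k. ?F a \<otimes> ?H b)"
      unfolding psum_def using F H finite_Mon
      by (intro finsum_cong') (auto intro!: finsum_rdistr finsum_closed)
    finally show ?thesis .
  qed
  also have "\<dots> = (\<Oplus>p\<in>Mon k \<times> Mon k. ?F (fst p) \<otimes> ?H (snd p))"
    using F H finite_Mon by (intro finsum_Sigma) auto
  also have "Mon k \<times> Mon k = L \<union> U" by (auto simp: L_def U_def)
  also have "(\<Oplus>p\<in>L \<union> U. ?F (fst p) \<otimes> ?H (snd p))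
      = (\<Oplus>p\<in>L. ?F (fst p) \<otimes> ?H (snd p)) \<oplus> (\<Oplus>p\<in>U. ?F (fst p) \<otimes> ?H (snd p))"
    using fin FH by (intro finsum_Un_disjoint) (auto simp: L_def U_def)
  finally have 1: "psum k f \<otimes> psum k h
      = (\<Oplus>p\<in>L. ?F (fst p) \<otimes> ?H (snd p)) \<oplus> (\<Oplus>p\<in>U. ?F (fst p) \<otimes> ?H (snd p))" .
  have "psum k (f \<otimes>\<^bsub>PV\<^esub> h) = (\<Oplus>m\<in>Mon k. \<Oplus>a\<in>?D m. ?F a \<otimes> ?H (m - a))"
    unfolding psum_def series_mult
  proof (intro finsum_cong')
    fix m
    have "(\<Oplus>a\<in>?D m. f a \<otimes> h (m - a)) \<otimes> mval m = (\<Oplus>a\<in>?D m. f a \<otimes> h (m - a) \<otimes> mval m)"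
      using series_coeff[OF f] series_coeff[OF h] finite_submultisets by (intro finsum_ldistr) auto
    also have "\<dots> = (\<Oplus>a\<in>?D m. ?F a \<otimes> ?H (m - a))"
    proof (intro finsum_cong')
      fix a assume "a \<in> ?D m"
      then have "mval m = mval a \<otimes> mval (m - a)"
        using mval_add[of a "m - a"] by (simp add: subset_mset.add_diff_inverse)
      then show "f a \<otimes> h (m - a) \<otimes> mval m = ?F a \<otimes> ?H (m - a)"
        using series_coeff[OF f, of a] series_coeff[OF h, of "m - a"] by (simp add: m_ac)
    qed (use F H in auto)
    finally show "(\<Oplus>a\<in>?D m. f a \<otimes> h (m - a)) \<otimes> mval m = (\<Oplus>a\<in>?D m. ?F a \<otimes> ?H (m - a))" .
  qed (use F H in \<open>auto intro!: finsum_closed\<close>)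
  also have "\<dots> = (\<Oplus>p\<in>Sigma (Mon k) ?D. ?F (snd p) \<otimes> ?H (fst p - snd p))"
    using F H finite_Mon finite_submultisets by (intro finsum_Sigma) auto
  also have "\<dots> = (\<Oplus>p\<in>L. ?F (fst p) \<otimes> ?H (snd p))"
  proof -
    have "bij_betw (\<lambda>p. (fst p + snd p, fst p)) L (Sigma (Mon k) ?D)"
    proof (rule bij_betw_byWitness[of _ "\<lambda>p. (snd p, fst p - snd p)"])
      show "(\<lambda>p. (fst p + snd p, fst p)) ` L \<subseteq> Sigma (Mon k) ?D"
        by (auto simp: L_def Mon_def)
      show "(\<lambda>p. (snd p, fst p - snd p)) ` Sigma (Mon k) ?D \<subseteq> L"
      proof (rule image_subsetI)
        fix p assume p: "p \<in> Sigma (Mon k) ?D"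
        obtain m a where ma: "p = (m, a)" "m \<in> Mon k" "a \<subseteq># m" using p by auto
        have "m = a + (m - a)" using ma(3) by (simp add: subset_mset.add_diff_inverse)
        then have "size m = size a + size (m - a)" "set_mset m = set_mset a \<union> set_mset (m - a)"
          by (metis size_union) (metis \<open>m = a + (m - a)\<close> set_mset_union)
        then show "(snd p, fst p - snd p) \<in> L" using ma by (auto simp: L_def Mon_def)
      qed
    qed (auto simp: subset_mset.add_diff_inverse)
    from finsum_reindex_bij[OF this, of "\<lambda>p. ?F (snd p) \<otimes> ?H (fst p - snd p)"] show ?thesis
      using F H by auto
  qed
  finally have 2: "psum k (f \<otimes>\<^bsub>PV\<^esub> h) = (\<Oplus>p\<in>L. ?F (fst p) \<otimes> ?H (snd p))" .
  have U: "(\<Oplus>p\<in>U. ?F (fst p) \<otimes> ?H (snd p)) \<in> I k"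
  proof (rule ideal.finsum_mem[OF I_ideal fin(2)])
    fix p assume "p \<in> U"
    then have "?F (fst p) \<otimes> ?H (snd p) \<in> I (size (fst p) + size (snd p))" "k \<le> size (fst p) + size (snd p)"
      by (auto simp: U_def Mon_def intro!: I_mult term_mem f h)
    then show "?F (fst p) \<otimes> ?H (snd p) \<in> I k" by (rule I_mono)
  qed
  have "(\<Oplus>p\<in>L. ?F (fst p) \<otimes> ?H (snd p)) \<in> carrier R" using FH by (intro finsum_closed) auto
  then show ?thesis unfolding 1 2 using add_minus_cancel[OF _ I_carrier[OF U]] U by simp
qed

lemma evals_mult:
  assumes f: "f \<in> carrier PV" and h: "h \<in> carrier PV"
  shows "evals (f \<otimes>\<^bsub>PV\<^esub> h) = evals f \<otimes> evals h"
proof (rule evals_unique)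
  interpret P: cring PV by (rule series_ring_cring)
  show fh: "f \<otimes>\<^bsub>PV\<^esub> h \<in> carrier PV" using f h by simp
  fix k
  have c: "evals f \<in> carrier R" "evals h \<in> carrier R" "psum k f \<in> carrier R" "psum k h \<in> carrier R"
    using evals f h by auto
  have "evals f \<otimes> evals h \<ominus> psum k f \<otimes> psum k h
      = evals h \<otimes> (evals f \<ominus> psum k f) \<oplus> psum k f \<otimes> (evals h \<ominus> psum k h)"
  proof -
    have "b \<otimes> (a \<ominus> a') \<oplus> a' \<otimes> (b \<ominus> b') = a \<otimes> b \<ominus> a' \<otimes> b'"
      if "a \<in> carrier R" "b \<in> carrier R" "a' \<in> carrier R" "b' \<in> carrier R" for a b a' b'
      using that by (simp add: a_minus_def r_distr r_minus m_comm[of b] a_assoc r_neg1)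
    then show ?thesis using c by simp
  qed
  also have "\<dots> \<in> I k" using evals(2)[OF f] evals(2)[OF h] c by (intro I_add I_smult) auto
  finally have "evals f \<otimes> evals h \<ominus> psum k f \<otimes> psum k h \<in> I k" .
  then show "evals f \<otimes> evals h \<ominus> psum k (f \<otimes>\<^bsub>PV\<^esub> h) \<in> I k"
    by (rule diff_trans[OF m_closed[OF c(1,2)] m_closed[OF c(3,4)] psum_closed[OF fh] _ psum_mult[OF f h]])
qed (simp add: evals(1)[OF f] evals(1)[OF h])

lemma evals_hom: "evals \<in> ring_hom PV R"
proof (rule ring_hom_memI)
  have "\<one>\<^bsub>PV\<^esub> = series_term \<one> {#}" by (simp add: fun_eq_iff series_one series_term_def)
  then show "evals \<one>\<^bsub>PV\<^esub> = \<one>" using evals_term[of \<one> "{#}"] by simp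
qed (use evals(1) evals_add evals_mult in auto)

text \<open>No continuity is assumed of the two homomorphisms; they agree modulo every power of
  \<open>u\<close> by induction. A series is a constant plus a combination of finitely many
  variables, and a product with a variable needs its other factor only to the precision already
  reached.\<close>

lemma evaluation_unique:
  assumes g: "g \<in> ring_hom PV R" and h: "h \<in> ring_hom PV R"
    and const: "\<And>c. c \<in> carrier R \<Longrightarrow> g (series_const R c) = c" "\<And>c. c \<in> carrier R \<Longrightarrow> h (series_const R c) = c"
    and var: "\<And>z. z \<in> V \<Longrightarrow> g (series_var R z) = v z" "\<And>z. z \<in> V \<Longrightarrow> h (series_var R z) = v z"
    and f: "f \<in> carrier PV"
  shows "g f = h f"
proof -
  interpret P: cring PV by (rule series_ring_cring)
  interpret g: ring_hom_ring PV R g using g by (intro ring_hom_ringI2 P.ring_axioms ring_axioms)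
  interpret h: ring_hom_ring PV R h using h by (intro ring_hom_ringI2 P.ring_axioms ring_axioms)
  have "\<forall>f\<in>carrier PV. g f \<ominus> h f \<in> I k" for k
  proof (induction k)
    case 0
    show ?case by (intro ballI I_0 minus_closed g.hom_closed h.hom_closed)
  next
    case (Suc k)
    \<comment> \<open>The condition on \<open>h f\<close> provides the gain: in the difference of
      the two images of a product of \<open>f\<close> and \<open>w\<close>, the difference for
      \<open>w\<close>, known to precision \<open>k\<close>, is multiplied by
      \<open>h f\<close>.\<close>
    define K where "K = {f \<in> carrier PV. g f \<ominus> h f \<in> I (Suc k) \<and> h f \<in> I 1}"
    have K_mult: "f \<otimes>\<^bsub>PV\<^esub> w \<in> K" if f: "f \<in> K" and w: "w \<in> carrier PV" for f w
    proof -
      have c: "f \<in> carrier PV" "g f \<in> carrier R" "h f \<in> carrier R" "g w \<in> carrier R" "h w \<in> carrier R"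
        using f w by (auto simp: K_def)
      have "g f \<otimes> g w \<ominus> h f \<otimes> h w = g w \<otimes> (g f \<ominus> h f) \<oplus> h f \<otimes> (g w \<ominus> h w)"
      proof -
        have "b \<otimes> (a \<ominus> a') \<oplus> a' \<otimes> (b \<ominus> b') = a \<otimes> b \<ominus> a' \<otimes> b'"
          if "a \<in> carrier R" "b \<in> carrier R" "a' \<in> carrier R" "b' \<in> carrier R" for a b a' b'
          using that by (simp add: a_minus_def r_distr r_minus m_comm[of b] a_assoc r_neg1)
        then show ?thesis using c by simp
      qed
      moreover have "h f \<otimes> (g w \<ominus> h w) \<in> I (1 + k)"
        by (rule I_mult) (use f w Suc in \<open>simp_all add: K_def\<close>)
      then have "h f \<otimes> (g w \<ominus> h w) \<in> I (Suc k)" by (simp only: plus_1_eq_Suc)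
      moreover have "g w \<otimes> (g f \<ominus> h f) \<in> I (Suc k)" using f c by (intro I_smult) (simp_all add: K_def)
      ultimately have 1: "g f \<otimes> g w \<ominus> h f \<otimes> h w \<in> I (Suc k)" using I_add by (simp)
      have 2: "h f \<otimes> h w \<in> I 1" unfolding m_comm[OF c(3,5)]
        using f c by (intro I_smult) (simp_all add: K_def)
      show ?thesis using 1 2 c w by (simp add: K_def)
    qed
    have K: "ideal K PV"
    proof (rule idealI[OF P.ring_axioms])
      show "subgroup K (add_monoid PV)"
      proof (rule P.add.subgroupI)
        have "\<zero>\<^bsub>PV\<^esub> \<in> K" using I_zero by (simp add: K_def a_minus_def)
        then show "K \<noteq> {}" by blast
        show "\<ominus>\<^bsub>PV\<^esub> f \<in> K" if f: "f \<in> K" for f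
        proof -
          have c: "f \<in> carrier PV" "g f \<in> carrier R" "h f \<in> carrier R" using f by (auto simp: K_def)
          have "\<ominus> (g f) \<ominus> \<ominus> (h f) = \<ominus> (g f \<ominus> h f)" using c by (simp add: a_minus_def minus_add)
          then show ?thesis using f c I_neg by (simp add: K_def)
        qed
        show "f \<oplus>\<^bsub>PV\<^esub> w \<in> K" if f: "f \<in> K" and w: "w \<in> K" for f w
        proof -
          have c: "f \<in> carrier PV" "g f \<in> carrier R" "h f \<in> carrier R" "w \<in> carrier PV" "g w \<in> carrier R" "h w \<in> carrier R"
            using f w by (auto simp: K_def)
          have "(g f \<oplus> g w) \<ominus> (h f \<oplus> h w) = (g f \<ominus> h f) \<oplus> (g w \<ominus> h w)"
            using c by (simp add: a_minus_def minus_add a_ac)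
          then show ?thesis using f w c I_add by (simp add: K_def)
        qed
      qed (auto simp: K_def)
    qed (use K_mult P.m_comm in \<open>auto simp: K_def\<close>)
    have vars: "series_term \<one> {#z#} \<in> K" if z: "z \<in> V" for z
      using var[OF z] z v_I[OF z] I_zero
      by (auto simp: K_def series_var_term r_right_minus_eq a_minus_def r_neg intro!: series_term_closed)
    show ?case
    proof
      fix f assume f: "f \<in> carrier PV"
      have f0: "f {#} \<in> carrier R" using series_coeff[OF f] .
      have C: "series_const R (f {#}) \<in> carrier PV"
        using f0 by (simp add: series_const_term series_term_closed)
      have "f \<ominus>\<^bsub>PV\<^esub> series_const R (f {#}) \<in> K"
      proof (rule vanishing_subset_ideal[OF K, of "(\<lambda>z. {#z#}) ` V"])
        fix m assume m: "(f \<ominus>\<^bsub>PV\<^esub> series_const R (f {#})) m \<noteq> \<zero>"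
        then have "m \<noteq> {#}" using f0 f C by (auto simp: series_minus series_const_def r_right_minus_eq)
        then obtain z where z: "z \<in># m" by blast
        have "f \<ominus>\<^bsub>PV\<^esub> series_const R (f {#}) \<in> carrier PV" using f C by simp
        then have "z \<in> V" using series_support m z by metis
        then show "\<exists>g\<in>(\<lambda>z. {#z#}) ` V. g \<subseteq># m" using z by auto
      qed (use f C finite_V vars in auto)
      then have "g (f \<ominus>\<^bsub>PV\<^esub> series_const R (f {#})) \<ominus> h (f \<ominus>\<^bsub>PV\<^esub> series_const R (f {#})) \<in> I (Suc k)"
        by (simp add: K_def)
      moreover have "g (f \<ominus>\<^bsub>PV\<^esub> series_const R (f {#})) \<ominus> h (f \<ominus>\<^bsub>PV\<^esub> series_const R (f {#})) = g f \<ominus> h f"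
      proof -
        have "(a \<ominus> c) \<ominus> (b \<ominus> c) = a \<ominus> b" if "a \<in> carrier R" "b \<in> carrier R" "c \<in> carrier R" for a b c
          using that by (simp add: a_minus_def minus_add a_assoc a_lcomm[of "\<ominus> c"] r_neg l_neg)
        then show ?thesis using f C f0 const by (simp add: a_minus_def)
      qed
      ultimately show "g f \<ominus> h f \<in> I (Suc k)" by (simp)
    qed
  qed
  then show ?thesis using f by (intro I_separated) auto
qed

end

section \<open>The rings \<open>A\<close> and \<open>A\<^sub>S\<close>\<close>

locale surjective_hom = ring_hom_cring R S h
  for R :: "('a, 'c) ring_scheme" (structure) and S :: "('b, 'd) ring_scheme" (structure) and h +
  assumes surjective: "h ` carrier R = carrier S"
begin

lemma surjE: "b \<in> carrier S \<Longrightarrow> (\<And>a. a \<in> carrier R \<Longrightarrow> b = h a \<Longrightarrow> P) \<Longrightarrow> P"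
  using surjective by blast

lemma hom_minus: "a \<in> carrier R \<Longrightarrow> b \<in> carrier R \<Longrightarrow> h (a \<ominus>\<^bsub>R\<^esub> b) = h a \<ominus>\<^bsub>S\<^esub> h b"
  by (simp add: a_minus_def)

lemma image_ideal:
  assumes K: "ideal K R"
  shows "ideal (h ` K) S"
proof (rule idealI[OF S.ring_axioms])
  interpret K: ideal K R by fact
  show "subgroup (h ` K) (add_monoid S)" using ring.img_is_add_subgroup[OF K.a_subgroup] .
  fix b c assume "b \<in> h ` K" and c: "c \<in> carrier S"
  then obtain a where a: "a \<in> K" "b = h a" by blast
  obtain d where d: "d \<in> carrier R" "c = h d" using surjE[OF c] .
  have "c \<otimes>\<^bsub>S\<^esub> b = h (d \<otimes>\<^bsub>R\<^esub> a)" using a d K.Icarr by simp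
  then show "c \<otimes>\<^bsub>S\<^esub> b \<in> h ` K" using K.I_l_closed a d by blast
  have "b \<otimes>\<^bsub>S\<^esub> c = h (a \<otimes>\<^bsub>R\<^esub> d)" using a d K.Icarr by simp
  then show "b \<otimes>\<^bsub>S\<^esub> c \<in> h ` K" using K.I_r_closed a d by blast
qed

lemma image_mem:
  assumes K: "ideal K R" and ker: "\<And>a. a \<in> carrier R \<Longrightarrow> h a = \<zero>\<^bsub>S\<^esub> \<Longrightarrow> a \<in> K" and a: "a \<in> carrier R"
  shows "h a \<in> h ` K \<longleftrightarrow> a \<in> K"
proof
  interpret K: ideal K R by fact
  assume "h a \<in> h ` K"
  then obtain k where k: "k \<in> K" "h a = h k" by blast
  then have kc: "k \<in> carrier R" using K.Icarr by blast
  have "h (a \<ominus>\<^bsub>R\<^esub> k) = \<zero>\<^bsub>S\<^esub>" using a k(2) kc by (simp add: hom_minus S.minus_eq_zero_iff)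
  then have "a \<ominus>\<^bsub>R\<^esub> k \<in> K" using ker a kc by simp
  then have "(a \<ominus>\<^bsub>R\<^esub> k) \<oplus>\<^bsub>R\<^esub> k \<in> K" using k by simp
  then show "a \<in> K" using a kc by (simp add: R.minus_add_cancel)
qed blast

lemma image_prime:
  assumes K: "primeideal K R" and ker: "\<And>a. a \<in> carrier R \<Longrightarrow> h a = \<zero>\<^bsub>S\<^esub> \<Longrightarrow> a \<in> K"
  shows "primeideal (h ` K) S"
proof -
  interpret K: primeideal K R by fact
  note mem = image_mem[OF K.is_ideal ker]
  show ?thesis
  proof (rule primeidealI[OF image_ideal[OF K.is_ideal] S.cring_axioms])
    have "\<one>\<^bsub>R\<^esub> \<notin> K" using K.I_notcarr K.one_imp_carrier by blast
    then have "h \<one>\<^bsub>R\<^esub> \<notin> h ` K" using mem R.one_closed by blast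
    moreover have "h \<one>\<^bsub>R\<^esub> \<in> carrier S" by simp
    ultimately show "carrier S \<noteq> h ` K" by blast
  next
    fix b c assume b: "b \<in> carrier S" and c: "c \<in> carrier S" and bc: "b \<otimes>\<^bsub>S\<^esub> c \<in> h ` K"
    obtain a where a: "a \<in> carrier R" "b = h a" using surjE[OF b] .
    obtain d where d: "d \<in> carrier R" "c = h d" using surjE[OF c] .
    have "h (a \<otimes>\<^bsub>R\<^esub> d) \<in> h ` K" using bc a d by simp
    then have "a \<otimes>\<^bsub>R\<^esub> d \<in> K" using mem[of "a \<otimes>\<^bsub>R\<^esub> d"] a d by blast
    then have "a \<in> K \<or> d \<in> K" using K.I_prime[OF a(1) d(1)] by blast
    then show "b \<in> h ` K \<or> c \<in> h ` K" using a d by blast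
  qed
qed

lemma hom_Units:
  assumes "a \<in> Units R"
  shows "h a \<in> Units S"
proof -
  have c: "a \<in> carrier R" "inv\<^bsub>R\<^esub> a \<in> carrier R" using assms by auto
  have 1: "h (inv\<^bsub>R\<^esub> a) \<otimes>\<^bsub>S\<^esub> h a = \<one>\<^bsub>S\<^esub>"
    using assms c hom_mult[OF c(2,1)] by simp
  have 2: "h a \<otimes>\<^bsub>S\<^esub> h (inv\<^bsub>R\<^esub> a) = \<one>\<^bsub>S\<^esub>"
    using assms c hom_mult[OF c] by simp
  show ?thesis unfolding Units_def
    by (rule CollectI, rule conjI[OF hom_closed[OF c(1)]], rule bexI[where x = "h (inv\<^bsub>R\<^esub> a)"], rule conjI[OF 1 2], rule hom_closed[OF c(2)])
qed

end

lemma FactRing_carrier_image: "carrier (R Quot I) = (+>\<^bsub>R\<^esub>) I ` carrier R"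
  by (auto simp: FactRing_def A_RCOSETS_def')

lemma (in cring) quotient_surjective_hom:
  assumes "ideal I R"
  shows "surjective_hom R (R Quot I) ((+>) I)"
proof -
  interpret I: ideal I R by fact
  interpret q: ring_hom_cring R "R Quot I" "(+>) I" by (rule I.rcos_ring_hom_cring[OF is_cring])
  show ?thesis
    by (intro surjective_hom.intro q.ring_hom_cring_axioms surjective_hom_axioms.intro FactRing_carrier_image[symmetric])
qed

lemma (in cring) quotient_zero_iff:
  assumes I: "ideal I R" and a: "a \<in> carrier R"
  shows "I +> a = \<zero>\<^bsub>R Quot I\<^esub> \<longleftrightarrow> a \<in> I"
  using a_rcos_zero[OF I] ideal.rcos_const_imp_mem[OF I a] by (auto simp: FactRing_def)

lemma in_repeat_msetD: "z \<in># repeat_mset k m \<Longrightarrow> z \<in># m"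
  by (simp flip: count_greater_zero_iff)

locale crossing_setting = complete_dvr R u for R :: "('a, 'c) ring_scheme" (structure) and u +
  fixes n g :: nat
begin

abbreviation "V \<equiv> vars n g"
abbreviation "T \<equiv> {1..n}"
abbreviation "P \<equiv> P_ring R n g"
abbreviation "A \<equiv> A_ring R n g"
abbreviation "xmon m \<equiv> series_term \<one> m"

sublocale P: cring P by (rule series_ring_cring)

section \<open>Surviving monomials and the quotient maps\<close>

lemma V_iff [simp]: "VX i \<in> V \<longleftrightarrow> i \<in> T" "VY i \<in> V \<longleftrightarrow> i \<in> T" "VT i \<in> V \<longleftrightarrow> i \<in> {1..g}"
  by (auto simp: vars_def)

lemma finite_V: "finite V"
  by (simp add: vars_def)

text \<open>The monomials that are nonzero in A.\<close>

definition uncrossed :: "variable multiset set" where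
  "uncrossed = {m. \<forall>i\<in>T. \<not> (VX i \<in># m \<and> VY i \<in># m)}"

text \<open>The monomials that are nonzero in \<open>A_S\<close>.\<close>

definition support :: "nat set \<Rightarrow> variable multiset set" where
  "support S = {m \<in> uncrossed. \<forall>i\<in>T - S. VX i \<notin># m}"

text \<open>The variables that do not vanish on the component S. In terms of Stanley-Reisner rings,
  A belongs to the boundary of a cross polytope with vertices \<open>x i\<close> and
  \<open>y i\<close>, coned over the \<open>t k\<close>, and these sets are the facets.\<close>

definition face :: "nat set \<Rightarrow> variable set" where
  "face S = VX ` S \<union> VY ` (T - S) \<union> VT ` {1..g}"

lemma mono_closed: "set_mset m \<subseteq> V \<Longrightarrow> xmon m \<in> carrier P"
  by (rule series_term_closed[OF one_closed])

lemma var_closed: "z \<in> V \<Longrightarrow> series_var R z \<in> carrier P"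
  unfolding series_var_term by (rule mono_closed) simp

lemma mono_mult:
  assumes "set_mset m \<subseteq> V" "set_mset m' \<subseteq> V"
  shows "xmon m \<otimes>\<^bsub>P\<^esub> xmon m' = xmon (m + m')"
proof (rule ext)
  fix k
  have "(xmon m \<otimes>\<^bsub>P\<^esub> xmon m') k = (if m \<subseteq># k then \<one> \<otimes> xmon m' (k - m) else \<zero>)"
    by (rule series_term_mult[OF one_closed mono_closed[OF assms(2)]])
  also have "\<dots> = xmon (m + m') k"
  proof (cases "m \<subseteq># k")
    case True
    then have "k - m = m' \<longleftrightarrow> k = m + m'"
      by (metis add_diff_cancel_left' subset_mset.add_diff_inverse)
    then show ?thesis using True by (simp add: series_term_def)
  next
    case False
    then show ?thesis by (auto simp: series_term_def)
  qed
  finally show "(xmon m \<otimes>\<^bsub>P\<^esub> xmon m') k = xmon (m + m') k" .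
qed

lemma mono_vanishing: "set_mset m \<subseteq> V \<Longrightarrow> xmon m \<in> vanishing V W \<longleftrightarrow> m \<notin> W"
  using mono_closed by (auto simp: vanishing_def series_term_def)

lemma uncrossed_ideal: "ideal (vanishing V uncrossed) P"
  by (rule vanishing_ideal) (auto simp: uncrossed_def dest: mset_subset_eqD)

lemma support_ideal: "ideal (vanishing V (support S)) P"
  by (rule vanishing_ideal) (auto simp: support_def uncrossed_def dest: mset_subset_eqD)

lemma crossed_generators:
  assumes "i \<in> T"
  shows "series_var R (VX i) \<otimes>\<^bsub>P\<^esub> series_var R (VY i) = xmon {#VX i, VY i#}"
  unfolding series_var_term using assms by (subst mono_mult) (auto simp: add_mset_commute)

lemma support_imp_generator:
  assumes "set_mset m \<subseteq> V" "m \<notin> support S"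
  shows "\<exists>m'\<in>(\<lambda>i. {#VX i, VY i#}) ` T \<union> (\<lambda>i. {#VX i#}) ` (T - S). m' \<subseteq># m"
proof (cases "m \<in> uncrossed")
  case True
  then obtain i where "i \<in> T - S" "VX i \<in># m" using assms by (auto simp: support_def)
  then show ?thesis by (intro bexI[of _ "{#VX i#}"]) auto
next
  case False
  then obtain i where i: "i \<in> T" "VX i \<in># m" "VY i \<in># m" by (auto simp: uncrossed_def)
  then have "{#VX i, VY i#} \<subseteq># m"
    by (auto simp: insert_subset_eq_iff in_diff_count)
  then show ?thesis using i by blast
qed

lemma vanishing_outside: "f \<in> vanishing V W \<Longrightarrow> f m \<noteq> \<zero> \<Longrightarrow> m \<notin> W \<and> set_mset m \<subseteq> V"
  using series_outside[of f R V m] by (auto simp: vanishing_def)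

lemma vanishing_support_subset:
  assumes "ideal K P" "\<And>i. i \<in> T \<Longrightarrow> xmon {#VX i, VY i#} \<in> K" "\<And>i. i \<in> T - S \<Longrightarrow> xmon {#VX i#} \<in> K"
  shows "vanishing V (support S) \<subseteq> K"
proof
  fix f assume f: "f \<in> vanishing V (support S)"
  show "f \<in> K"
  proof (rule vanishing_subset_ideal[OF assms(1), of "(\<lambda>i. {#VX i, VY i#}) ` T \<union> (\<lambda>i. {#VX i#}) ` (T - S)"])
    show "f \<in> carrier P" using f by (simp add: vanishing_def)
    fix m assume "f m \<noteq> \<zero>"
    then show "\<exists>m'\<in>(\<lambda>i. {#VX i, VY i#}) ` T \<union> (\<lambda>i. {#VX i#}) ` (T - S). m' \<subseteq># m"
      using support_imp_generator vanishing_outside[OF f] by blast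
  qed (use assms in auto)
qed

lemma support_T: "support T = uncrossed"
  by (auto simp: support_def)

lemma A_ideal_eq: "A_ideal R n g = vanishing V uncrossed"
proof
  have gens: "(\<lambda>i. series_var R (VX i) \<otimes>\<^bsub>P\<^esub> series_var R (VY i)) ` T = (\<lambda>i. xmon {#VX i, VY i#}) ` T"
    using crossed_generators by (rule image_cong[OF refl])
  have sub: "(\<lambda>i. xmon {#VX i, VY i#}) ` T \<subseteq> carrier P" by (auto intro!: mono_closed)
  show "A_ideal R n g \<subseteq> vanishing V uncrossed"
    unfolding A_ideal_def gens
    by (rule P.genideal_minimal[OF uncrossed_ideal]) (auto simp: mono_vanishing uncrossed_def)
  show "vanishing V uncrossed \<subseteq> A_ideal R n g"
    unfolding support_T[symmetric] A_ideal_def gens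
    by (rule vanishing_support_subset[OF P.genideal_ideal[OF sub]])
      (use P.genideal_self[OF sub] in auto)
qed

abbreviation q :: "'a series \<Rightarrow> 'a series set" where "q f \<equiv> A_ideal R n g +>\<^bsub>P\<^esub> f"

sublocale q: surjective_hom P A q
  unfolding A_ring_def A_ideal_eq by (rule P.quotient_surjective_hom[OF uncrossed_ideal])

lemma q_zero_iff: "f \<in> carrier P \<Longrightarrow> q f = \<zero>\<^bsub>A\<^esub> \<longleftrightarrow> f \<in> vanishing V uncrossed"
  unfolding A_ring_def A_ideal_eq by (rule P.quotient_zero_iff[OF uncrossed_ideal])

lemma A_var_q: "A_var R n g z = q (xmon {#z#})"
  by (simp add: A_var_def series_var_term)

lemma A_var_closed: "z \<in> V \<Longrightarrow> A_var R n g z \<in> carrier A"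
  unfolding A_var_q by (rule q.hom_closed, rule mono_closed) simp

lemma q_crossed: "i \<in> T \<Longrightarrow> q (xmon {#VX i, VY i#}) = \<zero>\<^bsub>A\<^esub>"
  by (subst q_zero_iff) (auto intro!: mono_closed simp: mono_vanishing uncrossed_def)

lemma q_image_mem:
  assumes "ideal (vanishing V W) P" "W \<subseteq> uncrossed" "f \<in> carrier P"
  shows "q f \<in> q ` vanishing V W \<longleftrightarrow> f \<in> vanishing V W"
proof (rule q.image_mem[OF assms(1) _ assms(3)])
  fix f assume "f \<in> carrier P" "q f = \<zero>\<^bsub>A\<^esub>"
  then show "f \<in> vanishing V W" using assms(2) by (auto simp: q_zero_iff vanishing_def)
qed

text \<open>As the image of a monomial ideal that contains the kernel of \<open>q\<close>, the ideal
  can be tested on the coefficients of any lift.\<close>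

lemma AS_ideal_eq:
  assumes "S \<subseteq> T"
  shows "AS_ideal R n g S = q ` vanishing V (support S)"
proof
  have sub: "(\<lambda>i. A_var R n g (VX i)) ` (T - S) \<subseteq> carrier A" using A_var_closed by auto
  show "AS_ideal R n g S \<subseteq> q ` vanishing V (support S)"
    unfolding AS_ideal_def
  proof (rule q.S.genideal_minimal[OF q.image_ideal[OF support_ideal]], rule image_subsetI)
    fix i assume i: "i \<in> T - S"
    have "xmon {#VX i#} \<in> vanishing V (support S)"
      using i by (subst mono_vanishing) (auto simp: support_def)
    then show "A_var R n g (VX i) \<in> q ` vanishing V (support S)" unfolding A_var_q by blast
  qed
  have I: "ideal (AS_ideal R n g S) A" unfolding AS_ideal_def by (rule q.S.genideal_ideal[OF sub])
  let ?K = "{f \<in> carrier P. q f \<in> AS_ideal R n g S}"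
  have "vanishing V (support S) \<subseteq> ?K"
  proof (rule vanishing_support_subset)
    show "ideal ?K P" by (rule q.ring.ideal_vimage[OF I])
    fix i assume i: "i \<in> T"
    have "xmon {#VX i, VY i#} \<in> carrier P" using i by (intro mono_closed) auto
    moreover have "\<zero>\<^bsub>A\<^esub> \<in> AS_ideal R n g S" using additive_subgroup.zero_closed[OF ideal.axioms(1)[OF I]] .
    ultimately show "xmon {#VX i, VY i#} \<in> ?K" using q_crossed[OF i] by simp
  next
    fix i assume i: "i \<in> T - S"
    have "A_var R n g (VX i) \<in> AS_ideal R n g S"
      unfolding AS_ideal_def using q.S.genideal_self[OF sub] i by blast
    then show "xmon {#VX i#} \<in> ?K" using i unfolding A_var_q by (auto intro!: mono_closed)
  qed
  then show "q ` vanishing V (support S) \<subseteq> AS_ideal R n g S" by blast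
qed

lemma AS_ideal: "S \<subseteq> T \<Longrightarrow> ideal (AS_ideal R n g S) A"
  by (simp only: AS_ideal_eq q.image_ideal[OF support_ideal])

lemma AS_proj_surjective_hom: "S \<subseteq> T \<Longrightarrow> surjective_hom A (AS_ring R n g S) (AS_proj R n g S)"
  unfolding AS_ring_def AS_proj_def by (rule q.S.quotient_surjective_hom[OF AS_ideal])

lemma AS_proj_zero_iff:
  "S \<subseteq> T \<Longrightarrow> a \<in> carrier A \<Longrightarrow> AS_proj R n g S a = \<zero>\<^bsub>AS_ring R n g S\<^esub> \<longleftrightarrow> a \<in> AS_ideal R n g S"
  unfolding AS_ring_def AS_proj_def by (rule q.S.quotient_zero_iff[OF AS_ideal])

lemma AS_proj_q_zero_iff:
  assumes "S \<subseteq> T" "f \<in> carrier P"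
  shows "AS_proj R n g S (q f) = \<zero>\<^bsub>AS_ring R n g S\<^esub> \<longleftrightarrow> f \<in> vanishing V (support S)"
proof -
  have "support S \<subseteq> uncrossed" by (auto simp: support_def)
  then show ?thesis
    unfolding AS_proj_zero_iff[OF assms(1) q.hom_closed[OF assms(2)]] AS_ideal_eq[OF assms(1)]
    by (rule q_image_mem[OF support_ideal _ assms(2)])
qed

section \<open>The primes of the components\<close>

definition comp_prime :: "nat set \<Rightarrow> 'a series set set" where
  "comp_prime S = q ` vanishing V {m. set_mset m \<subseteq> face S}"

lemma face_uncrossed: "{m. set_mset m \<subseteq> face S} \<subseteq> uncrossed"
  by (auto simp: uncrossed_def face_def)

lemma face_ideal: "ideal (vanishing V {m. set_mset m \<subseteq> face S}) P"
  using vanishing_prime by (rule primeideal.axioms(1))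

lemma comp_prime_iff: "f \<in> carrier P \<Longrightarrow> q f \<in> comp_prime S \<longleftrightarrow> f \<in> vanishing V {m. set_mset m \<subseteq> face S}"
  unfolding comp_prime_def by (rule q_image_mem[OF face_ideal face_uncrossed])

lemma comp_prime_primeideal: "primeideal (comp_prime S) A"
  unfolding comp_prime_def
proof (rule q.image_prime[OF vanishing_prime])
  fix f assume "f \<in> carrier P" "q f = \<zero>\<^bsub>A\<^esub>"
  then show "f \<in> vanishing V {m. set_mset m \<subseteq> face S}"
    using face_uncrossed by (auto simp: q_zero_iff vanishing_def)
qed

text \<open>A monomial that survives in \<open>A_S\<close> lives on the facet selected by the
  \<open>x i\<close> occurring in it.\<close>

lemma support_face:
  assumes "m \<in> support S" "set_mset m \<subseteq> V" "S \<subseteq> T"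
  obtains S' where "S' \<subseteq> S" "set_mset m \<subseteq> face S'"
proof -
  define S' where "S' = {i \<in> T. VX i \<in># m}"
  have "S' \<subseteq> S" using assms by (auto simp: S'_def support_def)
  moreover have "z \<in> face S'" if "z \<in># m" for z
  proof -
    have z: "z \<in> V" using that assms(2) by blast
    show ?thesis
    proof (cases z)
      case (VY i)
      then have "i \<in> T" using z by simp
      moreover then have "i \<notin> S'" using assms(1) that VY by (auto simp: S'_def support_def uncrossed_def)
      ultimately show ?thesis unfolding VY face_def by blast
    qed (use z that in \<open>auto simp: S'_def face_def\<close>)
  qed
  ultimately show ?thesis using that by blast
qed

lemma var_comp_prime_iff: "z \<in> V \<Longrightarrow> A_var R n g z \<in> comp_prime S \<longleftrightarrow> z \<notin> face S"
  unfolding A_var_q by (subst comp_prime_iff) (auto intro!: mono_closed simp: mono_vanishing)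

lemma q_mono_finprod:
  assumes "finite K" "\<And>i. i \<in> K \<Longrightarrow> w i \<in> V" "inj_on w K"
  shows "(\<Otimes>\<^bsub>A\<^esub>i\<in>K. A_var R n g (w i)) = q (xmon (mset_set (w ` K)))"
  using assms
proof (induction K rule: finite_induct)
  case empty
  have "xmon {#} = \<one>\<^bsub>P\<^esub>" by (simp add: fun_eq_iff series_term_def series_one)
  then show ?case by simp
next
  case (insert k K)
  have wk: "w k \<notin> w ` K" using insert.hyps insert.prems(2) by auto
  have "(\<Otimes>\<^bsub>A\<^esub>i\<in>insert k K. A_var R n g (w i)) = A_var R n g (w k) \<otimes>\<^bsub>A\<^esub> (\<Otimes>\<^bsub>A\<^esub>i\<in>K. A_var R n g (w i))"
    using insert.hyps insert.prems(1) by (intro q.S.finprod_insert) (auto intro!: A_var_closed)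
  also have "\<dots> = q (xmon {#w k#}) \<otimes>\<^bsub>A\<^esub> q (xmon (mset_set (w ` K)))"
    using insert by (simp add: A_var_q)
  also have "\<dots> = q (xmon {#w k#} \<otimes>\<^bsub>P\<^esub> xmon (mset_set (w ` K)))"
    using insert by (intro q.hom_mult[symmetric] mono_closed) auto
  also have "xmon {#w k#} \<otimes>\<^bsub>P\<^esub> xmon (mset_set (w ` K)) = xmon (mset_set (w ` insert k K))"
    using insert wk by (subst mono_mult) auto
  finally show ?case .
qed

lemma q_mono_pow:
  assumes "set_mset m \<subseteq> V"
  shows "q (xmon m) [^]\<^bsub>A\<^esub> k = q (xmon (repeat_mset k m))"
proof (induction k)
  case 0
  have "xmon {#} = \<one>\<^bsub>P\<^esub>" by (simp add: fun_eq_iff series_term_def series_one)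
  then show ?case by simp
next
  case (Suc k)
  have sub: "set_mset (repeat_mset k m) \<subseteq> V" using assms by (auto dest: in_repeat_msetD)
  have "q (xmon m) [^]\<^bsub>A\<^esub> Suc k = q (xmon (repeat_mset k m)) \<otimes>\<^bsub>A\<^esub> q (xmon m)" using Suc by simp
  also have "\<dots> = q (xmon (repeat_mset k m) \<otimes>\<^bsub>P\<^esub> xmon m)"
    using assms sub by (intro q.hom_mult[symmetric] mono_closed) auto
  also have "xmon (repeat_mset k m) \<otimes>\<^bsub>P\<^esub> xmon m = xmon (repeat_mset (Suc k) m)"
    using assms sub by (subst mono_mult) (auto simp: add.commute)
  finally show ?case .
qed

text \<open>Take the representative supported on the surviving monomials. Multiplication by
  \<open>x i\<close> keeps distinct monomials distinct, so each of them must become crossed, which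
  means that it contains \<open>y i\<close>.\<close>

lemma annihilator_A:
  assumes S: "S \<subseteq> T" and a: "a \<in> carrier A"
    and ann: "\<And>i. i \<in> T - S \<Longrightarrow> A_var R n g (VX i) \<otimes>\<^bsub>A\<^esub> a = \<zero>\<^bsub>A\<^esub>"
  shows "\<exists>b\<in>carrier A. a = finprod A (\<lambda>i. A_var R n g (VY i)) (T - S) \<otimes>\<^bsub>A\<^esub> b"
proof -
  obtain f where f: "f \<in> carrier P" "a = q f" using q.surjE[OF a] .
  define f' where "f' m = (if m \<in> uncrossed then f m else \<zero>)" for m
  have f': "f' \<in> carrier P"
    using series_coeff[OF f(1)] series_support[OF f(1)] by (auto intro!: series_memI simp: f'_def split: if_splits)
  have "f \<ominus>\<^bsub>P\<^esub> f' \<in> vanishing V uncrossed"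
    using f(1) f' by (auto simp: vanishing_def series_minus f'_def minus_eq_zero_iff series_coeff[OF f(1)])
  then have "q (f \<ominus>\<^bsub>P\<^esub> f') = \<zero>\<^bsub>A\<^esub>" using f(1) f' by (subst q_zero_iff) auto
  then have qf': "q f' = a" using f f' by (simp add: q.hom_minus q.S.minus_eq_zero_iff)
  have y: "VY i \<in># m" if m: "f' m \<noteq> \<zero>" and i: "i \<in> T - S" for i m
  proof -
    have c: "xmon {#VX i#} \<in> carrier P" using i by (intro mono_closed) auto
    have "q (xmon {#VX i#} \<otimes>\<^bsub>P\<^esub> f') = \<zero>\<^bsub>A\<^esub>"
      using ann[OF i] qf' c f' by (simp add: A_var_q)
    then have "xmon {#VX i#} \<otimes>\<^bsub>P\<^esub> f' \<in> vanishing V uncrossed" using q_zero_iff[OF P.m_closed[OF c f']] by blast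
    moreover have "(xmon {#VX i#} \<otimes>\<^bsub>P\<^esub> f') (add_mset (VX i) m) = f' m"
      using f' series_coeff[OF f', of m] by (simp add: series_term_mult[OF one_closed])
    ultimately have "add_mset (VX i) m \<notin> uncrossed" using m by (auto simp: vanishing_def)
    moreover have "m \<in> uncrossed" using m by (auto simp: f'_def split: if_splits)
    ultimately show ?thesis by (auto simp: uncrossed_def)
  qed
  let ?y = "mset_set (VY ` (T - S))"
  have ysub: "set_mset ?y \<subseteq> V" by auto
  have y': "?y \<subseteq># m" if m: "f' m \<noteq> \<zero>" for m
  proof (rule mset_subset_eqI)
    fix z
    show "count ?y z \<le> count m z"
    proof (cases "z \<in> VY ` (T - S)")
      case True
      then show ?thesis using y[OF m] by (auto simp: Suc_le_eq)
    next
      case False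
      then show ?thesis by simp
    qed
  qed
  define b where "b = (\<lambda>m. f' (m + ?y))"
  have b: "b \<in> carrier P"
    using series_coeff[OF f'] series_support[OF f'] by (auto intro!: series_memI simp: b_def)
  have "xmon ?y \<otimes>\<^bsub>P\<^esub> b = f'"
  proof (rule ext)
    fix m
    have 1: "(xmon ?y \<otimes>\<^bsub>P\<^esub> b) m = (if ?y \<subseteq># m then \<one> \<otimes> b (m - ?y) else \<zero>)"
      by (rule series_term_mult[OF one_closed b])
    have 2: "b (m - ?y) = f' m" if "?y \<subseteq># m"
      unfolding b_def using that by (simp only: subset_mset.diff_add)
    show "(xmon ?y \<otimes>\<^bsub>P\<^esub> b) m = f' m"
    proof (cases "?y \<subseteq># m")
      case True
      then show ?thesis unfolding 1 using 2 series_coeff[OF f', of m] by simp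
    next
      case False
      then have "f' m = \<zero>" using y'[of m] by blast
      then show ?thesis unfolding 1 using False by simp
    qed
  qed
  then have "a = q (xmon ?y) \<otimes>\<^bsub>A\<^esub> q b"
    using qf' b mono_closed[OF ysub] by (metis q.hom_mult)
  moreover have "finprod A (\<lambda>i. A_var R n g (VY i)) (T - S) = q (xmon ?y)"
    by (rule q_mono_finprod) (auto simp: inj_on_def)
  ultimately show ?thesis using b by auto
qed

text \<open>Compare coefficients at \<open>m\<close> times the k-th powers of the \<open>x i\<close>
  with \<open>i\<close> in S, where \<open>k\<close> exceeds the exponent of \<open>y s\<close> in
  \<open>m\<close>: a multiple of the k-th power of \<open>y s\<close> has no term there, so
  \<open>f\<close> has none at \<open>m\<close>.\<close>

lemma coprime_powers_A:
  assumes S: "S \<subseteq> T" and s: "s \<in> T - S" and a: "a \<in> carrier A"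
    and div: "\<And>k::nat. \<exists>d\<in>carrier A. finprod A (\<lambda>i. A_var R n g (VX i)) S [^]\<^bsub>A\<^esub> k \<otimes>\<^bsub>A\<^esub> a
      \<ominus>\<^bsub>A\<^esub> A_var R n g (VY s) [^]\<^bsub>A\<^esub> k \<otimes>\<^bsub>A\<^esub> d \<in> comp_prime S"
  shows "a \<in> comp_prime S"
proof -
  obtain f where f: "f \<in> carrier P" "a = q f" using q.surjE[OF a] .
  have fS: "finite S" using S finite_subset by blast
  let ?x = "mset_set (VX ` S)"
  have xsub: "set_mset ?x \<subseteq> V" using S fS by auto
  have X: "finprod A (\<lambda>i. A_var R n g (VX i)) S = q (xmon ?x)"
    using S fS by (intro q_mono_finprod) (auto simp: inj_on_def)
  have "f m = \<zero>" if m: "set_mset m \<subseteq> face S" for m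
  proof -
    define k where "k = Suc (count m (VY s))"
    define xk where "xk = repeat_mset k ?x"
    define yk where "yk = repeat_mset k {#VY s#}"
    have sub: "set_mset xk \<subseteq> V" "set_mset yk \<subseteq> V"
      using xsub s by (auto simp: xk_def yk_def dest: in_repeat_msetD)
    obtain d where d: "d \<in> carrier A" "finprod A (\<lambda>i. A_var R n g (VX i)) S [^]\<^bsub>A\<^esub> k \<otimes>\<^bsub>A\<^esub> a
      \<ominus>\<^bsub>A\<^esub> A_var R n g (VY s) [^]\<^bsub>A\<^esub> k \<otimes>\<^bsub>A\<^esub> d \<in> comp_prime S" using div[of k] by blast
    obtain h where h: "h \<in> carrier P" "d = q h" using q.surjE[OF d(1)] .
    have xk: "finprod A (\<lambda>i. A_var R n g (VX i)) S [^]\<^bsub>A\<^esub> k = q (xmon xk)"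
      unfolding X xk_def by (rule q_mono_pow[OF xsub])
    have yk: "A_var R n g (VY s) [^]\<^bsub>A\<^esub> k = q (xmon yk)"
      unfolding A_var_q yk_def using s by (intro q_mono_pow) auto
    note c = mono_closed[OF sub(1)] mono_closed[OF sub(2)]
    have "q (xmon xk \<otimes>\<^bsub>P\<^esub> f \<ominus>\<^bsub>P\<^esub> xmon yk \<otimes>\<^bsub>P\<^esub> h) \<in> comp_prime S"
      using d(2) f h c unfolding xk yk by (simp add: q.hom_minus)
    then have v: "xmon xk \<otimes>\<^bsub>P\<^esub> f \<ominus>\<^bsub>P\<^esub> xmon yk \<otimes>\<^bsub>P\<^esub> h \<in> vanishing V {m. set_mset m \<subseteq> face S}"
      by (subst (asm) comp_prime_iff) (use f h c in simp_all)
    have "set_mset (m + xk) \<subseteq> face S"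
      using m fS by (auto simp: xk_def face_def dest: in_repeat_msetD)
    then have "(xmon xk \<otimes>\<^bsub>P\<^esub> f \<ominus>\<^bsub>P\<^esub> xmon yk \<otimes>\<^bsub>P\<^esub> h) (m + xk) = \<zero>" using v by (simp add: vanishing_def)
    then have "(xmon xk \<otimes>\<^bsub>P\<^esub> f) (m + xk) \<ominus> (xmon yk \<otimes>\<^bsub>P\<^esub> h) (m + xk) = \<zero>"
      by (subst (asm) series_minus[OF P.m_closed[OF c(1) f(1)] P.m_closed[OF c(2) h(1)]])
    moreover have "(xmon xk \<otimes>\<^bsub>P\<^esub> f) (m + xk) = f m"
      using series_coeff[OF f(1), of m] by (simp add: series_term_mult[OF one_closed f(1)])
    moreover have "(xmon yk \<otimes>\<^bsub>P\<^esub> h) (m + xk) = \<zero>"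
    proof -
      have "VY s \<notin># xk" using fS by (auto simp: xk_def dest: in_repeat_msetD)
      then have "count (m + xk) (VY s) < count yk (VY s)" by (simp add: yk_def k_def not_in_iff)
      then have "\<not> yk \<subseteq># m + xk" using mset_subset_eq_count[of yk "m + xk" "VY s"] by linarith
      then show ?thesis by (simp add: series_term_mult[OF one_closed h(1)])
    qed
    ultimately show ?thesis using series_coeff[OF f(1), of m] by (simp add: minus_eq_zero_iff)
  qed
  then show ?thesis unfolding f(2) using f(1) by (subst comp_prime_iff) (auto simp: vanishing_def)
qed

lemma preimage_ideal: "ideal I A \<Longrightarrow> ideal {f \<in> carrier P. q f \<in> I} P"
  by (rule q.ring.ideal_vimage)

lemma ideal_zero_mem: "ideal I A \<Longrightarrow> \<zero>\<^bsub>A\<^esub> \<in> I"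
  using additive_subgroup.zero_closed ideal.axioms(1) by blast

sublocale crossing A T "\<lambda>i. A_var R n g (VX i)" "\<lambda>i. A_var R n g (VY i)" comp_prime
proof (rule crossing.intro[OF q.S.cring_axioms], rule crossing_axioms.intro)
  show "finite T" by simp
  show "A_var R n g (VX i) \<in> carrier A" "A_var R n g (VY i) \<in> carrier A" if "i \<in> T" for i
    using that A_var_closed by auto
  show "primeideal (comp_prime S) A" for S by (rule comp_prime_primeideal)
  show "A_var R n g (VX i) \<in> comp_prime S" if "S \<subseteq> T" "i \<in> T - S" for S i
    using that by (subst var_comp_prime_iff) (auto simp: face_def)
  show "A_var R n g (VX i) \<notin> comp_prime S" if "S \<subseteq> T" "i \<in> S" for S i
    using that by (subst var_comp_prime_iff) (auto simp: face_def)
  show "A_var R n g (VY i) \<in> comp_prime S" if "S \<subseteq> T" "i \<in> S" for S i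
    using that by (subst var_comp_prime_iff) (auto simp: face_def)
  show "A_var R n g (VY i) \<notin> comp_prime S" if "S \<subseteq> T" "i \<in> T - S" for S i
    using that by (subst var_comp_prime_iff) (auto simp: face_def)
  show "a = \<zero>\<^bsub>A\<^esub>" if a: "a \<in> carrier A" and mem: "\<And>S. S \<subseteq> T \<Longrightarrow> a \<in> comp_prime S" for a
  proof -
    obtain f where f: "f \<in> carrier P" "a = q f" using q.surjE[OF a] .
    have "f m = \<zero>" if m: "m \<in> uncrossed" for m
    proof (cases "set_mset m \<subseteq> V")
      case True
      then obtain S' where S': "S' \<subseteq> T" "set_mset m \<subseteq> face S'"
        using m support_face[of m T] support_T by blast
      then have "f \<in> vanishing V {m. set_mset m \<subseteq> face S'}"
        using mem[OF S'(1)] comp_prime_iff[OF f(1)] f(2) by simp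
      then show ?thesis using S' by (simp add: vanishing_def)
    next
      case False
      then show ?thesis using series_outside[OF f(1)] by blast
    qed
    then show ?thesis unfolding f(2) using f(1) by (subst q_zero_iff) (auto simp: vanishing_def)
  qed
  show "comp_prime S \<subseteq> I" if S: "S \<subseteq> T" and I: "ideal I A"
    and x: "(\<lambda>i. A_var R n g (VX i)) ` (T - S) \<subseteq> I" and y: "(\<lambda>i. A_var R n g (VY i)) ` S \<subseteq> I" for S I
  proof -
    let ?K = "{f \<in> carrier P. q f \<in> I}"
    have "vanishing V {m. set_mset m \<subseteq> face S} \<subseteq> ?K"
    proof
      fix f assume f: "f \<in> vanishing V {m. set_mset m \<subseteq> face S}"
      show "f \<in> ?K"
      proof (rule vanishing_subset_ideal[OF preimage_ideal[OF I], of "(\<lambda>i. {#VX i#}) ` (T - S) \<union> (\<lambda>i. {#VY i#}) ` S"])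
        show "f \<in> carrier P" using f by (simp add: vanishing_def)
        show "finite ((\<lambda>i. {#VX i#}) ` (T - S) \<union> (\<lambda>i. {#VY i#}) ` S)" using S finite_subset by auto
        fix m assume "f m \<noteq> \<zero>"
        then have "\<not> set_mset m \<subseteq> face S" "set_mset m \<subseteq> V" using vanishing_outside[OF f] by auto
        then obtain z where z: "z \<in># m" "z \<notin> face S" "z \<in> V" by blast
        have "{#z#} \<in> (\<lambda>i. {#VX i#}) ` (T - S) \<union> (\<lambda>i. {#VY i#}) ` S"
          using z(2,3) by (cases z) (auto simp: face_def)
        moreover have "{#z#} \<subseteq># m" using z(1) by simp
        ultimately show "\<exists>m'\<in>(\<lambda>i. {#VX i#}) ` (T - S) \<union> (\<lambda>i. {#VY i#}) ` S. m' \<subseteq># m" by blast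
      qed (use S x y in \<open>auto simp: A_var_q intro!: mono_closed\<close>)
    qed
    then show ?thesis unfolding comp_prime_def by blast
  qed
  show "a \<in> I" if S: "S \<subseteq> T" and I: "ideal I A" and x: "(\<lambda>i. A_var R n g (VX i)) ` (T - S) \<subseteq> I"
    and a: "a \<in> carrier A" and mem: "\<And>S'. S' \<subseteq> S \<Longrightarrow> a \<in> comp_prime S'" for S I a
  proof -
    let ?K = "{f \<in> carrier P. q f \<in> I}"
    obtain f where f: "f \<in> carrier P" "a = q f" using q.surjE[OF a] .
    have "f m = \<zero>" if m: "m \<in> support S" for m
    proof (cases "set_mset m \<subseteq> V")
      case True
      then obtain S' where S': "S' \<subseteq> S" "set_mset m \<subseteq> face S'" using support_face[OF m True S] by blast
      then have "f \<in> vanishing V {m. set_mset m \<subseteq> face S'}"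
        using mem[OF S'(1)] comp_prime_iff[OF f(1)] f(2) by simp
      then show ?thesis using S' by (simp add: vanishing_def)
    next
      case False
      then show ?thesis using series_outside[OF f(1)] by blast
    qed
    then have "f \<in> vanishing V (support S)" using f(1) by (simp add: vanishing_def)
    moreover have "vanishing V (support S) \<subseteq> ?K"
      using x by (intro vanishing_support_subset[OF preimage_ideal[OF I]])
        (auto simp: q_crossed ideal_zero_mem[OF I] A_var_q intro!: mono_closed)
    ultimately show ?thesis using f(2) by blast
  qed
  show "\<exists>b\<in>carrier A. a = finprod A (\<lambda>i. A_var R n g (VY i)) (T - S) \<otimes>\<^bsub>A\<^esub> b"
    if "S \<subseteq> T" "a \<in> carrier A" "\<And>i. i \<in> T - S \<Longrightarrow> A_var R n g (VX i) \<otimes>\<^bsub>A\<^esub> a = \<zero>\<^bsub>A\<^esub>" for S a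
    using that by (rule annihilator_A)
  show "a \<in> Units A" if a: "a \<in> carrier A" and mem: "a \<ominus>\<^bsub>A\<^esub> \<one>\<^bsub>A\<^esub> \<in> comp_prime {}" for a
  proof -
    obtain f where f: "f \<in> carrier P" "a = q f" using q.surjE[OF a] .
    have "q (f \<ominus>\<^bsub>P\<^esub> \<one>\<^bsub>P\<^esub>) \<in> comp_prime {}" using mem f by (simp add: q.hom_minus)
    then have "f \<ominus>\<^bsub>P\<^esub> \<one>\<^bsub>P\<^esub> \<in> vanishing V {m. set_mset m \<subseteq> face {}}"
      by (subst (asm) comp_prime_iff) (use f in simp_all)
    \<comment> \<open>The empty monomial belongs to every facet, so the constant term of
      \<open>f\<close> is 1 and \<open>f\<close> is a unit.\<close>
    then have "(f \<ominus>\<^bsub>P\<^esub> \<one>\<^bsub>P\<^esub>) {#} = \<zero>" by (simp add: vanishing_def)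
    then have "f {#} \<ominus> \<one> = \<zero>" using series_minus[OF f(1) P.one_closed, of "{#}"] by (simp add: series_one)
    then have "f {#} = \<one>" using series_coeff[OF f(1), of "{#}"] by (simp add: minus_eq_zero_iff)
    then have "f \<in> Units P" using series_inverse[OF f(1)] by simp
    then show ?thesis unfolding f(2) by (rule q.hom_Units)
  qed
  show "a \<in> comp_prime S" if "S \<subseteq> T" "s \<in> T - S" "a \<in> carrier A"
    "\<And>k::nat. \<exists>d\<in>carrier A. finprod A (\<lambda>i. A_var R n g (VX i)) S [^]\<^bsub>A\<^esub> k \<otimes>\<^bsub>A\<^esub> a
      \<ominus>\<^bsub>A\<^esub> A_var R n g (VY s) [^]\<^bsub>A\<^esub> k \<otimes>\<^bsub>A\<^esub> d \<in> comp_prime S" for S s a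
    using that by (rule coprime_powers_A)
qed

end

section \<open>The component \<open>S = {}\<close>\<close>

text \<open>These elements form the ideal generated by \<open>xs\<close>, with cofactors collected
  in a list as the Koszul lemmas demand.\<close>

lemma (in module) dot_ideal:
  "set xs \<subseteq> carrier R \<Longrightarrow> ideal {dot ps xs | ps. length ps = length xs \<and> set ps \<subseteq> carrier R} R \<and>
     set xs \<subseteq> {dot ps xs | ps. length ps = length xs \<and> set ps \<subseteq> carrier R}"
proof (induction xs)
  case Nil
  have "{dot ps [] | ps. length ps = length ([] :: 'a list) \<and> set ps \<subseteq> carrier R} = {\<zero>}" by auto
  then show ?case using zeroideal by simp
next
  case (Cons x xs)
  let ?D = "\<lambda>xs. {dot ps xs | ps. length ps = length xs \<and> set ps \<subseteq> carrier R}"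
  have x: "x \<in> carrier R" and xs: "set xs \<subseteq> carrier R" using Cons.prems by auto
  have IH: "ideal (?D xs) R" "set xs \<subseteq> ?D xs" using Cons.IH[OF xs] by auto
  have eq: "?D (x # xs) = PIdl x <+> ?D xs"
  proof (rule equalityI; rule subsetI)
    fix a :: 'a assume "a \<in> ?D (x # xs)"
    then obtain ps where ps: "length ps = Suc (length xs)" "set ps \<subseteq> carrier R" "a = dot ps (x # xs)" by auto
    then obtain p ps' where p: "ps = p # ps'" by (cases ps) auto
    then have "a = p \<otimes> x \<oplus> dot ps' xs" using ps by simp
    moreover have "p \<otimes> x \<in> PIdl x" using ps p by (auto simp: cgenideal_def)
    moreover have "dot ps' xs \<in> ?D xs" using ps p by auto
    ultimately show "a \<in> PIdl x <+> ?D xs" unfolding set_add_def' by blast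
  next
    fix a :: 'a assume "a \<in> PIdl x <+> ?D xs"
    then obtain p ps where p: "p \<in> carrier R" "length ps = length xs" "set ps \<subseteq> carrier R" "a = p \<otimes> x \<oplus> dot ps xs"
      by (auto simp: set_add_def' cgenideal_def)
    then have "a = dot (p # ps) (x # xs) \<and> length (p # ps) = length (x # xs) \<and> set (p # ps) \<subseteq> carrier R" by auto
    then show "a \<in> ?D (x # xs)" by blast
  qed
  have id: "ideal (?D (x # xs)) R" unfolding eq by (rule add_ideals[OF cgenideal_ideal[OF x] IH(1)])
  have z: "\<zero> \<in> ?D xs" using additive_subgroup.zero_closed[OF ideal.axioms(1)[OF IH(1)]] .
  have "x \<oplus> \<zero> \<in> PIdl x <+> ?D xs"
    unfolding set_add_def' using cgenideal_self[OF x] z by blast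
  then have "x \<in> ?D (x # xs)" unfolding eq using x by simp
  moreover have "y \<in> ?D (x # xs)" if "y \<in> set xs" for y
  proof -
    have y: "y \<in> carrier R" "y \<in> ?D xs" using that xs IH by auto
    have "\<zero> \<in> PIdl x" using additive_subgroup.zero_closed[OF ideal.axioms(1)[OF cgenideal_ideal[OF x]]] .
    then have "\<zero> \<oplus> y \<in> PIdl x <+> ?D xs" unfolding set_add_def' using y(2) by blast
    then show ?thesis unfolding eq using y by simp
  qed
  ultimately show ?case using id by auto
qed

lemma (in module) dot_minimal:
  assumes "ideal K R" "set xs \<subseteq> K" "set ps \<subseteq> carrier R"
  shows "dot ps xs \<in> K"
proof -
  interpret K: ideal K R by fact
  show ?thesis using assms(2,3) by (induction ps xs rule: dot.induct) (auto intro: K.I_l_closed)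
qed

text \<open>Evaluates the definite description by which the definition of maximal Cohen--Macaulay
  modules refers to the maximal ideal.\<close>

lemma (in cring) local_maximal_ideal:
  assumes J: "ideal J R" and units: "\<And>a. a \<in> carrier R \<Longrightarrow> a \<notin> J \<Longrightarrow> a \<in> Units R" and one: "\<one> \<notin> J"
  shows "(THE I. maximalideal I R) = J"
proof (rule the_equality)
  have full: "K = carrier R" if K: "ideal K R" and a: "a \<in> K" "a \<in> Units R" for K a
  proof -
    have "inv a \<otimes> a \<in> K" using a by (intro ideal.I_l_closed[OF K]) auto
    then show ?thesis using a ideal.one_imp_carrier[OF K] by simp
  qed
  show "maximalideal J R"
  proof (rule maximalidealI[OF J])
    show "carrier R \<noteq> J" using one by blast
    fix K assume K: "ideal K R" "J \<subseteq> K" "K \<subseteq> carrier R"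
    show "K = J \<or> K = carrier R"
    proof (cases "K \<subseteq> J")
      case False
      then obtain a where "a \<in> K" "a \<notin> J" by blast
      then show ?thesis using full[OF K(1)] units K(3) by blast
    qed (use K in blast)
  qed
  fix I assume I: "maximalideal I R"
  interpret I: maximalideal I R by fact
  have "I \<subseteq> J"
  proof
    fix a assume a: "a \<in> I"
    show "a \<in> J"
    proof (rule ccontr)
      assume "a \<notin> J"
      then have "I = carrier R" using full[OF I.is_ideal a] units a I.Icarr by blast
      then show False using I.I_notcarr by simp
    qed
  qed
  moreover have "J \<subseteq> carrier R" using ideal.Icarr[OF J] by blast
  ultimately have "J = I \<or> J = carrier R" using I.I_maximal[OF J] by blast
  then show "I = J" using one by auto
qed

lemma (in surjective_hom) image_psubset:
  assumes "K \<subseteq> K'" "a \<in> K'" "a \<in> carrier R" "a \<notin> K" "ideal K R"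
    and "\<And>b. b \<in> carrier R \<Longrightarrow> h b = \<zero>\<^bsub>S\<^esub> \<Longrightarrow> b \<in> K"
  shows "h ` K \<subset> h ` K'"
proof -
  have "h a \<notin> h ` K" using image_mem[OF assms(5,6,3)] assms(4) by blast
  then show ?thesis using assms(1,2) by blast
qed

context dvr
begin

text \<open>A nonzero nonunit has an irreducible divisor, which generates a maximal ideal, and there
  is only one such ideal.\<close>

lemma nonunit_mem:
  assumes a: "a \<in> carrier R" "a \<notin> PIdl u"
  shows "a \<in> Units R"
proof (rule ccontr)
  assume nu: "a \<notin> Units R"
  have "\<zero> \<in> PIdl u"
    using additive_subgroup.zero_closed[OF ideal.axioms(1)[OF cgenideal_ideal[OF uniformizer_carrier]]] .
  then have "a \<in> carrier R - {\<zero>}" using a by auto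
  then obtain b where b: "b \<in> carrier R" "ring_irreducible b" "b divides a"
    using exists_irreducible_divisor nu by blast
  have "PIdl b = PIdl u" using unique_maximal[OF irreducible_imp_maximalideal[OF b(1,2)]] .
  moreover obtain c where "c \<in> carrier R" "a = b \<otimes> c" using b(3) unfolding factor_def by blast
  then have "a \<in> PIdl b" using b m_comm unfolding cgenideal_def by blast
  ultimately show False using a by simp
qed

lemma one_not_mem: "\<one> \<notin> PIdl u"
proof -
  interpret U: maximalideal "PIdl u" R by (rule uniformizer_maximal)
  show ?thesis using U.I_notcarr U.one_imp_carrier by blast
qed

end

context crossing_setting
begin

text \<open>Evaluation at the origin, introduced for its ideals \<open>E.I k\<close>, the powers of
  the maximal ideal of the coefficient ring.\<close>

sublocale E: evaluation R u V "\<lambda>_. \<zero>"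
  by unfold_locales
    (simp_all add: finite_V additive_subgroup.zero_closed[OF ideal.axioms(1)[OF cgenideal_ideal[OF uniformizer_carrier]]])

section \<open>The regular local ring belonging to the empty set\<close>

abbreviation "R0 \<equiv> AS_ring R n g {}"

abbreviation \<theta> :: "'a series \<Rightarrow> 'a series set set" where "\<theta> f \<equiv> AS_proj R n g {} (q f)"

sublocale \<theta>: surjective_hom P R0 \<theta>
proof -
  interpret b: surjective_hom A R0 "AS_proj R n g {}" by (rule AS_proj_surjective_hom) simp
  have "AS_proj R n g {} \<circ> q \<in> ring_hom P R0" by (rule ring_hom_trans[OF q.homh b.homh])
  then have hom: "\<theta> \<in> ring_hom P R0" by (simp add: comp_def)
  have "\<theta> ` carrier P = AS_proj R n g {} ` (q ` carrier P)" by (simp only: image_image)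
  then have "\<theta> ` carrier P = carrier R0" by (simp only: q.surjective b.surjective)
  then show "surjective_hom P R0 \<theta>"
    by (intro surjective_hom.intro surjective_hom_axioms.intro ring_hom_cring.intro ring_hom_cring_axioms.intro
        P.cring_axioms b.S.cring_axioms hom)
qed

lemma \<theta>_zero_iff: "f \<in> carrier P \<Longrightarrow> \<theta> f = \<zero>\<^bsub>R0\<^esub> \<longleftrightarrow> f \<in> vanishing V (support {})"
  by (rule AS_proj_q_zero_iff) simp

lemma coeff0_hom: "(\<lambda>f. f {#}) \<in> ring_hom P R"
proof (rule ring_hom_memI)
  fix f h assume f: "f \<in> carrier P" and h: "h \<in> carrier P"
  have "{k. k \<subseteq># ({#} :: variable multiset)} = {{#}}" by auto
  then show "(f \<otimes>\<^bsub>P\<^esub> h) {#} = f {#} \<otimes> h {#}"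
    using series_coeff[OF f, of "{#}"] series_coeff[OF h, of "{#}"] by (simp add: series_mult)
qed (use series_coeff in \<open>auto simp: series_add series_one\<close>)

text \<open>The preimage of the maximal ideal of \<open>R0\<close> in the power series ring.\<close>

definition Kmax :: "'a series set" where
  "Kmax = {f \<in> carrier P. f {#} \<in> PIdl u}"

lemma Kmax_prime: "primeideal Kmax P"
proof -
  interpret c: ring_hom_cring P R "\<lambda>f. f {#}" by unfold_locales (rule coeff0_hom)
  interpret U: primeideal "PIdl u" R by (rule maximalideal_prime[OF uniformizer_maximal])
  show ?thesis
  proof (rule primeidealI[OF _ P.cring_axioms])
    show "ideal Kmax P" unfolding Kmax_def by (rule c.ring.ideal_vimage[OF U.is_ideal])
    have "\<one>\<^bsub>P\<^esub> \<notin> Kmax" using one_not_mem by (simp add: Kmax_def series_one)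
    then show "carrier P \<noteq> Kmax" using P.one_closed by blast
    fix f h assume f: "f \<in> carrier P" and h: "h \<in> carrier P" and "f \<otimes>\<^bsub>P\<^esub> h \<in> Kmax"
    then have "f {#} \<otimes> h {#} \<in> PIdl u" using c.hom_mult[OF f h] by (simp add: Kmax_def)
    then show "f \<in> Kmax \<or> h \<in> Kmax"
      using U.I_prime[OF series_coeff[OF f] series_coeff[OF h]] f h by (auto simp: Kmax_def)
  qed
qed

lemma ker_\<theta>_Kmax: "f \<in> carrier P \<Longrightarrow> \<theta> f = \<zero>\<^bsub>R0\<^esub> \<Longrightarrow> f \<in> Kmax"
  using E.I_zero[of 1] uniformizer_carrier
  by (simp add: \<theta>_zero_iff Kmax_def vanishing_def support_def uncrossed_def E.I_def)

definition vars0 :: "variable list" where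
  "vars0 = map VY [1..<Suc n] @ map VT [1..<Suc g]"

lemma vars0: "set vars0 \<subseteq> V" "length vars0 = n + g" "distinct vars0"
  "set vars0 \<inter> range VX = {}" "\<And>z. z \<in> V \<Longrightarrow> z \<notin> set vars0 \<Longrightarrow> z \<in> VX ` T"
proof -
  show "z \<in> VX ` T" if "z \<in> V" "z \<notin> set vars0" for z
    using that by (cases z) (auto simp: vars0_def)
qed (auto simp: vars0_def distinct_map inj_on_def)

lemma support_empty: "m \<in> support {} \<longleftrightarrow> (\<forall>i\<in>T. VX i \<notin># m)"
  by (auto simp: support_def uncrossed_def)

text \<open>The variables \<open>y i\<close> and \<open>t k\<close> are sent to zero one after the
  other, and finally the uniformizer, which gives a chain of primes with n + g + 1 strict steps. A
  module whose depth equals the dimension must then have a regular sequence of at least that length,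
  unless its depth is infinite by definition.\<close>

lemma krull_dim_ge: "enat (Suc (n + g)) \<le> krull_dim R0"
proof -
  define W where "W i = set (drop i vars0)" for i
  define Z where "Z i = vanishing V {m. set_mset m \<subseteq> W i}" for i
  \<comment> \<open>The indices from 0 to \<open>n + g\<close> carry the primes with the first
    \<open>i\<close> variables sent to zero; the index \<open>n + g + 1\<close> carries the maximal
    ideal.\<close>
  define C where "C i = (if i \<le> n + g then \<theta> ` Z i else \<theta> ` Kmax)" for i
  have W: "W i \<subseteq> set vars0" for i by (simp add: W_def set_drop_subset)
  have Zp: "primeideal (Z i) P" for i unfolding Z_def by (rule vanishing_prime)
  have sup: "{m. set_mset m \<subseteq> W i} \<subseteq> support {}" for i
  proof
    fix m assume "m \<in> {m. set_mset m \<subseteq> W i}"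
    then have "set_mset m \<inter> range VX = {}" using W[of i] vars0(4) by blast
    then show "m \<in> support {}" unfolding support_empty by blast
  qed
  have Zker: "f \<in> Z i" if "f \<in> carrier P" "\<theta> f = \<zero>\<^bsub>R0\<^esub>" for f i
    using iffD1[OF \<theta>_zero_iff[OF that(1)] that(2)] sup[of i] unfolding vanishing_def Z_def by blast
  have prime: "primeideal (C i) R0" for i
  proof (cases "i \<le> n + g")
    case True
    have "primeideal (\<theta> ` Z i) R0" by (rule \<theta>.image_prime[OF Zp Zker])
    then show ?thesis unfolding C_def if_P[OF True] .
  next
    case False
    have "primeideal (\<theta> ` Kmax) R0" by (rule \<theta>.image_prime[OF Kmax_prime ker_\<theta>_Kmax])
    then show ?thesis unfolding C_def if_not_P[OF False] .
  qed
  have "C i \<subset> C (Suc i)" if i: "i < Suc (n + g)" for i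
  proof (cases "i < n + g")
    case True
    define z where "z = vars0 ! i"
    have z: "z \<in> set vars0" using True vars0(2) by (simp add: z_def)
    then have zV: "z \<in> V" using vars0(1) by blast
    have drop: "drop i vars0 = z # drop (Suc i) vars0"
      using True vars0(2) by (simp add: z_def Cons_nth_drop_Suc)
    then have zW: "z \<in> W i" "z \<notin> W (Suc i)" "W (Suc i) \<subseteq> W i"
      using distinct_drop[OF vars0(3), of i] by (auto simp: W_def)
    have "\<theta> ` Z i \<subset> \<theta> ` Z (Suc i)"
    proof (rule \<theta>.image_psubset)
      show "Z i \<subseteq> Z (Suc i)" using zW(3) by (auto simp: Z_def vanishing_def)
      show "xmon {#z#} \<in> Z (Suc i)" unfolding Z_def using zV zW by (subst mono_vanishing) auto
      show "xmon {#z#} \<notin> Z i" unfolding Z_def using zV zW by (subst mono_vanishing) auto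
      show "xmon {#z#} \<in> carrier P" using zV by (intro mono_closed) simp
      show "ideal (Z i) P" using Zp by (rule primeideal.axioms(1))
    qed (rule Zker)
    moreover have "i \<le> n + g" "Suc i \<le> n + g" using True by auto
    ultimately show ?thesis unfolding C_def by (simp only: if_True)
  next
    case False
    then have i: "i = n + g" using i by simp
    have W0: "W i = {}" using i vars0(2) by (simp add: W_def)
    have c: "series_term u {#} \<in> carrier P" using uniformizer_carrier by (intro series_term_closed) auto
    have "\<theta> ` Z i \<subset> \<theta> ` Kmax"
    proof (rule \<theta>.image_psubset)
      show "Z i \<subseteq> Kmax"
        using E.I_zero[of 1] uniformizer_carrier by (auto simp: Z_def vanishing_def W0 Kmax_def E.I_def)
      show "series_term u {#} \<in> Kmax"
        using c cgenideal_self[OF uniformizer_carrier] by (simp add: Kmax_def series_term_def)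
      show "series_term u {#} \<notin> Z i"
        using uniformizer_nonzero by (simp add: Z_def vanishing_def W0 series_term_def)
      show "ideal (Z i) P" using Zp by (rule primeideal.axioms(1))
    qed (use c in \<open>simp_all only: Zker\<close>)
    moreover have "i \<le> n + g" "\<not> Suc i \<le> n + g" using i by auto
    ultimately show ?thesis unfolding C_def by (simp only: if_True if_False)
  qed
  then have "\<exists>C. (\<forall>i\<le>Suc (n + g). primeideal (C i) R0) \<and> (\<forall>i<Suc (n + g). C i \<subset> C (Suc i))"
    using prime by (intro exI[of _ C]) blast
  then show ?thesis unfolding krull_dim_def by (intro SUP_upper CollectI)
qed

text \<open>Lifts of a regular system of parameters of \<open>R0\<close>.\<close>

definition params :: "'a series list" where
  "params = series_term u {#} # map (\<lambda>z. xmon {#z#}) vars0"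

lemma params: "set params \<subseteq> carrier P" "length params = Suc (n + g)"
  using vars0(1,2) uniformizer_carrier
  by (auto simp: params_def intro!: series_term_closed mono_closed)

text \<open>Modulo the variables \<open>x i\<close> this is the k-th power of the maximal ideal,
  read off coefficients: at a monomial of degree d the coefficient is divisible by \<open>u\<close>
  to the power k - d. The truncated subtraction imposes no condition from degree k on.\<close>

definition level :: "nat \<Rightarrow> 'a series set" where
  "level k = {f \<in> carrier P. \<forall>m\<in>support {}. f m \<in> E.I (k - size m)}"

lemma level_mult:
  assumes y: "y \<in> set params" and f: "f \<in> level k"
  shows "y \<otimes>\<^bsub>P\<^esub> f \<in> level (Suc k)"
proof -
  have fc: "f \<in> carrier P" and fl: "\<And>m. m \<in> support {} \<Longrightarrow> f m \<in> E.I (k - size m)"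
    using f by (auto simp: level_def)
  have yc: "y \<in> carrier P" using y params by blast
  have "(y \<otimes>\<^bsub>P\<^esub> f) m \<in> E.I (Suc k - size m)" if m: "m \<in> support {}" for m
  proof -
    consider "y = series_term u {#}" | z where "z \<in> set vars0" "y = xmon {#z#}" using y by (auto simp: params_def)
    then show ?thesis
    proof cases
      case 1
      have "(y \<otimes>\<^bsub>P\<^esub> f) m = u \<otimes> f m"
        unfolding 1 using series_term_mult[OF uniformizer_carrier fc, of "{#}" m] by simp
      moreover have "u \<otimes> f m \<in> E.I (1 + (k - size m))"
        using cgenideal_self[OF uniformizer_carrier] uniformizer_carrier
        by (intro E.I_mult fl[OF m]) (simp add: E.I_def)
      then have "u \<otimes> f m \<in> E.I (Suc k - size m)" by (rule E.I_mono) simp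
      ultimately show ?thesis by simp
    next
      case (2 z)
      have eq: "(y \<otimes>\<^bsub>P\<^esub> f) m = (if {#z#} \<subseteq># m then \<one> \<otimes> f (m - {#z#}) else \<zero>)"
        unfolding 2 by (rule series_term_mult[OF one_closed fc])
      show ?thesis
      proof (cases "z \<in># m")
        case True
        have "m - {#z#} \<in> support {}" using m by (auto simp: support_empty dest: in_diffD)
        then have "f (m - {#z#}) \<in> E.I (k - size (m - {#z#}))" by (rule fl)
        \<comment> \<open>The degree of \<open>m\<close> is positive because \<open>z\<close> occurs
          in it, so lowering it by one and raising \<open>k\<close> by one have the same
          effect.\<close>
        moreover have "k - size (m - {#z#}) = Suc k - size m"
          using True by (simp add: size_Diff_singleton) (metis Suc_pred diff_Suc_Suc nonempty_has_size set_mset_eq_empty_iff empty_iff)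
        ultimately show ?thesis unfolding eq using True series_coeff[OF fc, of "m - {#z#}"] by simp
      next
        case False
        then show ?thesis unfolding eq using E.I_zero by simp
      qed
    qed
  qed
  then show ?thesis using yc fc by (simp add: level_def)
qed

text \<open>\<open>R0\<close> is regular: as many elements as the chain in
  \<open>krull_dim_ge\<close> has steps generate its maximal ideal. This is the balance between
  generators and depth that \<open>free_of_depth\<close> requires, with \<open>level\<close> giving
  its separated filtration.\<close>

theorem base_free:
  fixes M :: "('a series set set, 'm) module"
  assumes mcm: "maximal_cohen_macaulay R0 M"
  shows "\<exists>(r::nat) e. e \<in> {..<r} \<rightarrow> carrier M \<and>
    (\<forall>m\<in>carrier M. \<exists>c\<in>{..<r} \<rightarrow> carrier R0. m = (\<Oplus>\<^bsub>M\<^esub>i\<in>{..<r}. c i \<odot>\<^bsub>M\<^esub> e i)) \<and>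
    (\<forall>c\<in>{..<r} \<rightarrow> carrier R0. (\<Oplus>\<^bsub>M\<^esub>i\<in>{..<r}. c i \<odot>\<^bsub>M\<^esub> e i) = \<zero>\<^bsub>M\<^esub> \<longrightarrow> (\<forall>i<r. c i = \<zero>\<^bsub>R0\<^esub>))"
proof -
  interpret M: plain_module R0 M
    using mcm by (simp add: maximal_cohen_macaulay_def plain_module_def)
  define xs where "xs = map \<theta> params"
  have xs: "set xs \<subseteq> carrier R0" using params by (auto simp: xs_def)
  define J where "J = {M.dot ps xs | ps. length ps = length xs \<and> set ps \<subseteq> carrier R0}"
  have J: "ideal J R0" "set xs \<subseteq> J" using M.dot_ideal[OF xs] by (auto simp: J_def)
  have Kmax: "ideal Kmax P" using Kmax_prime by (rule primeideal.axioms(1))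
  have J_eq: "J = \<theta> ` Kmax"
  proof
    have "set xs \<subseteq> \<theta> ` Kmax"
    proof -
      have "y \<in> Kmax" if "y \<in> set params" for y
        using that vars0(1) params(1) cgenideal_self[OF uniformizer_carrier] E.I_zero[of 1] uniformizer_carrier
        by (auto simp: params_def Kmax_def series_term_def E.I_def)
      then show ?thesis by (auto simp: xs_def)
    qed
    then show "J \<subseteq> \<theta> ` Kmax"
      unfolding J_def using M.dot_minimal[OF \<theta>.image_ideal[OF Kmax]] by blast
    let ?K = "{f \<in> carrier P. \<theta> f \<in> J}"
    have K: "ideal ?K P" by (rule \<theta>.ring.ideal_vimage[OF J(1)])
    \<comment> \<open>Subtracting the constant term, a multiple of the uniformizer, leaves a
      combination of variables. Those of the kind \<open>VX\<close> vanish in \<open>R0\<close>, the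
      others are parameters.\<close>
    have "f \<in> ?K" if f: "f \<in> Kmax" for f
    proof -
      have fc: "f \<in> carrier P" using f by (simp add: Kmax_def)
      obtain a where a: "a \<in> carrier R" "f {#} = a \<otimes> u" using f by (auto simp: Kmax_def cgenideal_def)
      define h where "h = series_term a {#} \<otimes>\<^bsub>P\<^esub> series_term u {#}"
      have c: "series_term a {#} \<in> carrier P" "series_term u {#} \<in> carrier P"
        using a uniformizer_carrier by (auto intro!: series_term_closed)
      have h: "h \<in> carrier P" using c by (simp add: h_def)
      have h0: "h {#} = a \<otimes> u"
        using series_term_mult[OF a(1) c(2), of "{#}" "{#}"] by (simp add: h_def series_term_def)
      have "\<theta> (series_term u {#}) \<in> J" using J(2) by (simp add: xs_def params_def)
      then have "series_term u {#} \<in> ?K" using c by simp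
      then have hK: "h \<in> ?K" unfolding h_def using ideal.I_l_closed[OF K] c by blast
      have "f \<ominus>\<^bsub>P\<^esub> h \<in> ?K"
      proof (rule vanishing_subset_ideal[OF K, of "(\<lambda>z. {#z#}) ` V"])
        show fh: "f \<ominus>\<^bsub>P\<^esub> h \<in> carrier P" using fc h by simp
        fix m assume m: "(f \<ominus>\<^bsub>P\<^esub> h) m \<noteq> \<zero>"
        have "(f \<ominus>\<^bsub>P\<^esub> h) {#} = \<zero>"
          using a uniformizer_carrier by (simp add: series_minus[OF fc h] h0 minus_eq_zero_iff)
        then have "m \<noteq> {#}" using m by auto
        then obtain z where "z \<in># m" by blast
        then show "\<exists>m'\<in>(\<lambda>z. {#z#}) ` V. m' \<subseteq># m" using series_support[OF fh m] by auto
      next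
        fix m assume "m \<in> (\<lambda>z. {#z#}) ` V"
        then obtain z where z: "z \<in> V" "m = {#z#}" by blast
        have mc: "xmon {#z#} \<in> carrier P" using z by (intro mono_closed) simp
        have "\<theta> (xmon {#z#}) \<in> J"
        proof (cases "z \<in> set vars0")
          case True
          then show ?thesis using J(2) by (auto simp: xs_def params_def)
        next
          case False
          then obtain i where i: "i \<in> T" "z = VX i" using vars0(5)[OF z(1)] by blast
          have "xmon {#z#} \<in> vanishing V (support {})"
            using z i by (subst mono_vanishing) (auto simp: support_empty)
          then have "\<theta> (xmon {#z#}) = \<zero>\<^bsub>R0\<^esub>" using \<theta>_zero_iff[OF mc] by simp
          then show ?thesis using additive_subgroup.zero_closed[OF ideal.axioms(1)[OF J(1)]] by simp
        qed
        then show "xmon m \<in> ?K" using z mc by simp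
      qed (use finite_V in auto)
      then have "(f \<ominus>\<^bsub>P\<^esub> h) \<oplus>\<^bsub>P\<^esub> h \<in> ?K"
        using hK additive_subgroup.a_closed[OF ideal.axioms(1)[OF K]] by blast
      then show ?thesis using P.minus_add_cancel[OF fc h] by simp
    qed
    then show "\<theta> ` Kmax \<subseteq> J" by blast
  qed
  have J_iff: "\<theta> f \<in> J \<longleftrightarrow> f \<in> Kmax" if "f \<in> carrier P" for f
    unfolding J_eq by (rule \<theta>.image_mem[OF Kmax ker_\<theta>_Kmax that])
  have units: "a \<in> Units R0" if a: "a \<in> carrier R0" "a \<notin> J" for a
  proof -
    obtain f where f: "f \<in> carrier P" "a = \<theta> f" using \<theta>.surjE[OF a(1)] .
    then have "f {#} \<notin> PIdl u" using a J_iff by (auto simp: Kmax_def)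
    then have "f {#} \<in> Units R" using nonunit_mem series_coeff[OF f(1)] by blast
    then have "f \<in> Units P" by (rule series_inverse[OF f(1)])
    then show ?thesis unfolding f(2) by (rule \<theta>.hom_Units)
  qed
  have one: "\<one>\<^bsub>R0\<^esub> \<notin> J"
  proof -
    have "\<one>\<^bsub>P\<^esub> \<notin> Kmax" using one_not_mem by (simp add: Kmax_def series_one)
    then show ?thesis using J_iff[OF P.one_closed] unfolding \<theta>.hom_one by blast
  qed
  have max: "(THE I. maximalideal I R0) = J"
    by (rule \<theta>.S.local_maximal_ideal[OF J(1) units one])
  define Q where "Q k = \<theta> ` level k" for k
  have level_zero: "\<zero>\<^bsub>P\<^esub> \<in> level k" for k using E.I_zero by (simp add: level_def series_zero)
  have level_add: "f \<oplus>\<^bsub>P\<^esub> h \<in> level k" if "f \<in> level k" "h \<in> level k" for f h k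
    using that E.I_add by (simp add: level_def series_add)
  \<comment> \<open>Only a lower bound for the dimension is at hand, so infinite depth cannot be
    excluded by comparison and remains as the first alternative. Otherwise, if every regular
    sequence were shorter than the system of parameters, the depth would fall below that
    bound.\<close>
  have depth: "scaled_submodule R0 J M = carrier M \<or>
      (\<exists>rs. set rs \<subseteq> J \<and> regular_sequence R0 M rs \<and> length xs \<le> length rs)"
  proof (rule ccontr)
    assume n: "\<not> ?thesis"
    then have "depth R0 J M = (SUP rs\<in>{rs. set rs \<subseteq> J \<and> regular_sequence R0 M rs}. enat (length rs))"
      by (simp add: depth_def)
    also have "\<dots> \<le> enat (n + g)"
    proof (rule SUP_least)
      fix rs assume "rs \<in> {rs. set rs \<subseteq> J \<and> regular_sequence R0 M rs}"
      then have "\<not> length xs \<le> length rs" using n by blast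
      then show "enat (length rs) \<le> enat (n + g)" using params(2) by (simp add: xs_def)
    qed
    finally have "depth R0 J M \<le> enat (n + g)" .
    moreover have "depth R0 J M = krull_dim R0"
      using mcm max by (simp add: maximal_cohen_macaulay_def)
    ultimately have "enat (Suc (n + g)) \<le> enat (n + g)" using krull_dim_ge by (metis order_trans)
    then show False by simp
  qed
  show ?thesis
  proof (rule M.free_of_depth[of xs Q, folded J_def])
    show "finitely_generated R0 M" using mcm by (simp add: maximal_cohen_macaulay_def)
    have "level 0 = carrier P"
      using E.I_0 series_coeff by (auto simp: level_def)
    then show "Q 0 = carrier R0" by (simp add: Q_def \<theta>.surjective)
    show "\<zero>\<^bsub>R0\<^esub> \<in> Q k" for k
      unfolding Q_def using level_zero \<theta>.hom_zero by (metis image_eqI)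
    show "a \<oplus>\<^bsub>R0\<^esub> b \<in> Q k" if ab: "a \<in> Q k" "b \<in> Q k" for k a b
    proof -
      obtain f h where f: "f \<in> level k" "a = \<theta> f" and h: "h \<in> level k" "b = \<theta> h" using ab by (auto simp: Q_def)
      have "a \<oplus>\<^bsub>R0\<^esub> b = \<theta> (f \<oplus>\<^bsub>P\<^esub> h)" unfolding f(2) h(2) using f(1) h(1)
        by (intro \<theta>.hom_add[symmetric]) (simp_all add: level_def)
      then show ?thesis using level_add[OF f(1) h(1)] by (auto simp: Q_def)
    qed
    show "x \<otimes>\<^bsub>R0\<^esub> a \<in> Q (Suc k)" if x: "x \<in> set xs" and a: "a \<in> Q k" for k a x
    proof -
      obtain f where f: "f \<in> level k" "a = \<theta> f" using a by (auto simp: Q_def)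
      obtain y where y: "y \<in> set params" "x = \<theta> y" using x by (auto simp: xs_def)
      have "x \<otimes>\<^bsub>R0\<^esub> a = \<theta> (y \<otimes>\<^bsub>P\<^esub> f)" unfolding f(2) y(2) using f(1) y(1) params(1)
        by (intro \<theta>.hom_mult[symmetric]) (auto simp: level_def)
      then show ?thesis using level_mult[OF y(1) f(1)] by (auto simp: Q_def)
    qed
    show "a = \<zero>\<^bsub>R0\<^esub>" if a: "\<And>k. a \<in> Q k" for a
    proof -
      have "a \<in> \<theta> ` level 0" using a[of 0] by (simp add: Q_def)
      then obtain f where f: "f \<in> carrier P" "a = \<theta> f" by (auto simp: level_def)
      have "f m = \<zero>" if m: "m \<in> support {}" for m
      proof (rule E.I_separated)
        fix k
        have "a \<in> \<theta> ` level (k + size m)" using a by (simp add: Q_def)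
        then obtain h where h: "h \<in> level (k + size m)" "a = \<theta> h" by blast
        have hc: "h \<in> carrier P" using h by (simp add: level_def)
        have "\<theta> f = \<theta> h" using f(2) h(2) by (rule trans[OF sym])
        then have "\<theta> f \<ominus>\<^bsub>R0\<^esub> \<theta> h = \<zero>\<^bsub>R0\<^esub>"
          by (rule iffD2[OF \<theta>.S.minus_eq_zero_iff[OF \<theta>.hom_closed[OF f(1)] \<theta>.hom_closed[OF hc]]])
        then have "\<theta> (f \<ominus>\<^bsub>P\<^esub> h) = \<zero>\<^bsub>R0\<^esub>"
          by (rule trans[OF \<theta>.hom_minus[OF f(1) hc]])
        then have "f \<ominus>\<^bsub>P\<^esub> h \<in> vanishing V (support {})"
          by (rule iffD1[OF \<theta>_zero_iff[OF P.minus_closed[OF f(1) hc]]])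
        then have "(f \<ominus>\<^bsub>P\<^esub> h) m = \<zero>" using m by (simp add: vanishing_def)
        then have "f m = h m"
          using series_coeff[OF f(1), of m] series_coeff[OF hc, of m]
          by (simp add: series_minus[OF f(1) hc] minus_eq_zero_iff)
        moreover have "h m \<in> E.I (k + size m - size m)" using h(1) m unfolding level_def by blast
        ultimately show "f m \<ominus> \<zero> \<in> E.I k" using series_coeff[OF f(1), of m] by (simp add: a_minus_def)
      qed (use series_coeff[OF f(1)] in auto)
      then show ?thesis unfolding f(2) using f(1) by (subst \<theta>_zero_iff) (auto simp: vanishing_def)
    qed
  qed (use xs J units one depth in auto)
qed

end

section \<open>The \<open>\<O>\<close>-points\<close>

context crossing_setting
begin

text \<open>Existence and uniqueness behind the definite description: evaluation at \<open>v\<close>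
  kills the crossed monomials and so factors through A, and \<open>evaluation_unique\<close> applies
  to the composition with \<open>q\<close>.\<close>

lemma point_hom_spec:
  assumes v: "v \<in> points R u n g"
  shows "point_hom R n g v \<in> ring_hom A R \<and> point_hom R n g v \<in> extensional (carrier A) \<and>
    (\<forall>c\<in>carrier R. point_hom R n g v (A_const R n g c) = c) \<and>
    (\<forall>z\<in>V. point_hom R n g v (A_var R n g z) = v z)"
proof -
  have vz: "v z \<in> PIdl u" if "z \<in> V" for z using v that by (auto simp: points_def)
  interpret v: evaluation R u V v by unfold_locales (simp_all add: finite_V vz)
  interpret ev: ring_hom_cring P R v.evals by unfold_locales (rule v.evals_hom)
  have "vanishing V (support T) \<subseteq> {f \<in> carrier P. v.evals f \<in> {\<zero>}}"
  proof (rule vanishing_support_subset[OF ev.ring.ideal_vimage[OF zeroideal]])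
    fix i assume i: "i \<in> T"
    have c: "xmon {#VX i, VY i#} \<in> carrier P" using i by (intro mono_closed) auto
    have "v.evals (xmon {#VX i, VY i#}) = \<one> \<otimes> v.mval ({#VX i#} + {#VY i#})"
      using i by (subst v.evals_term) (auto simp: add_mset_commute)
    also have "\<dots> = v (VX i) \<otimes> v (VY i)"
      using i by (simp only: v.mval_add v.mval_single V_iff) simp
    also have "\<dots> = \<zero>" using v i by (simp add: points_def)
    finally show "xmon {#VX i, VY i#} \<in> {f \<in> carrier P. v.evals f \<in> {\<zero>}}" using c by simp
  qed simp
  then have ker: "v.evals f = \<zero>" if "f \<in> vanishing V uncrossed" for f using that support_T by auto
  have well: "v.evals f = v.evals f'" if f: "f \<in> carrier P" "f' \<in> carrier P" "q f = q f'" for f f'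
  proof -
    have "q (f \<ominus>\<^bsub>P\<^esub> f') = \<zero>\<^bsub>A\<^esub>"
      by (rule trans[OF q.hom_minus[OF f(1,2)]])
        (rule iffD2[OF q.S.minus_eq_zero_iff[OF q.hom_closed[OF f(1)] q.hom_closed[OF f(2)]] f(3)])
    then have "f \<ominus>\<^bsub>P\<^esub> f' \<in> vanishing V uncrossed"
      by (rule iffD1[OF q_zero_iff[OF P.minus_closed[OF f(1,2)]]])
    then have "v.evals (f \<ominus>\<^bsub>P\<^esub> f') = \<zero>" by (rule ker)
    then have "v.evals f \<ominus> v.evals f' = \<zero>" using f by (simp add: a_minus_def)
    then show ?thesis using f by (simp add: minus_eq_zero_iff)
  qed
  define h where "h = restrict (\<lambda>a. v.evals (SOME f. f \<in> carrier P \<and> q f = a)) (carrier A)"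
  have hq: "h (q f) = v.evals f" if f: "f \<in> carrier P" for f
  proof -
    let ?f = "SOME f'. f' \<in> carrier P \<and> q f' = q f"
    have "?f \<in> carrier P \<and> q ?f = q f" by (rule someI[of _ f]) (use f in simp)
    then have "v.evals ?f = v.evals f" using well f by blast
    then show ?thesis using q.hom_closed[OF f] by (simp add: h_def)
  qed
  define spec where "spec h \<longleftrightarrow> h \<in> ring_hom A R \<and> h \<in> extensional (carrier A) \<and>
    (\<forall>c\<in>carrier R. h (A_const R n g c) = c) \<and> (\<forall>z\<in>V. h (A_var R n g z) = v z)" for h
  have "h \<in> ring_hom A R"
  proof (rule ring_hom_memI)
    fix a assume "a \<in> carrier A"
    then obtain f where f: "f \<in> carrier P" "a = q f" by (rule q.surjE)
    show "h a \<in> carrier R" unfolding f(2) hq[OF f(1)] by (rule ev.hom_closed[OF f(1)])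
    fix b assume "b \<in> carrier A"
    then obtain k where k: "k \<in> carrier P" "b = q k" by (rule q.surjE)
    show "h (a \<otimes>\<^bsub>A\<^esub> b) = h a \<otimes> h b"
      unfolding f(2) k(2) q.hom_mult[OF f(1) k(1), symmetric] hq[OF f(1)] hq[OF k(1)] hq[OF P.m_closed[OF f(1) k(1)]]
      by (rule ev.hom_mult[OF f(1) k(1)])
    show "h (a \<oplus>\<^bsub>A\<^esub> b) = h a \<oplus> h b"
      unfolding f(2) k(2) q.hom_add[OF f(1) k(1), symmetric] hq[OF f(1)] hq[OF k(1)] hq[OF P.a_closed[OF f(1) k(1)]]
      by (rule ev.hom_add[OF f(1) k(1)])
  next
    show "h \<one>\<^bsub>A\<^esub> = \<one>" unfolding q.hom_one[symmetric] hq[OF P.one_closed] by (rule ev.hom_one)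
  qed
  moreover have "h \<in> extensional (carrier A)" by (simp add: h_def)
  moreover have "h (A_const R n g c) = c" if "c \<in> carrier R" for c
  proof -
    have c: "series_const R c \<in> carrier P" unfolding series_const_term by (rule series_term_closed[OF that]) simp
    have "v.evals (series_const R c) = c" unfolding series_const_term using that by (subst v.evals_term) auto
    then show ?thesis unfolding A_const_def hq[OF c] .
  qed
  moreover have "h (A_var R n g z) = v z" if z: "z \<in> V" for z
  proof -
    have "v.evals (series_var R z) = v z"
      unfolding series_var_term using z v.mval_single[OF z] by (subst v.evals_term) auto
    then show ?thesis unfolding A_var_def hq[OF var_closed[OF z]] .
  qed
  ultimately have ex: "spec h" by (simp add: spec_def)
  have uniq: "h' = h" if h': "spec h'" for h'
  proof (rule extensionalityI)
    show "h' \<in> extensional (carrier A)" "h \<in> extensional (carrier A)" using h' ex by (auto simp: spec_def)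
    fix a assume "a \<in> carrier A"
    then obtain f where f: "f \<in> carrier P" "a = q f" by (rule q.surjE)
    have hom: "k \<circ> q \<in> ring_hom P R" if "spec k" for k
      using that by (intro ring_hom_trans[OF q.homh]) (simp add: spec_def)
    have "(h' \<circ> q) f = (h \<circ> q) f"
    proof (rule v.evaluation_unique[OF hom[OF h'] hom[OF ex] _ _ _ _ f(1)])
      show "(h' \<circ> q) (series_const R c) = c" "(h \<circ> q) (series_const R c) = c" if "c \<in> carrier R" for c
        using h' ex that by (auto simp: spec_def A_const_def)
      show "(h' \<circ> q) (series_var R z) = v z" "(h \<circ> q) (series_var R z) = v z" if "z \<in> V" for z
        using h' ex that by (auto simp: spec_def A_var_def)
    qed
    then show "h' a = h a" by (simp add: f(2))
  qed
  have "spec (point_hom R n g v)"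
    unfolding point_hom_def spec_def[symmetric] by (rule theI[of spec, OF ex uniq])
  then show ?thesis by (simp add: spec_def)
qed

text \<open>The product of the \<open>x i\<close> with \<open>i\<close> in S and the
  \<open>y i\<close> with \<open>i\<close> outside S is nonzero at \<open>v\<close> and annihilates
  \<open>comp_prime S\<close>, while the prime of \<open>v\<close> contains
  \<open>comp_prime S\<close>. Hence \<open>comp_prime S\<close> is the kernel of the localization
  at \<open>v\<close>, as \<open>lin_indep_loc_iff\<close> requires.\<close>

lemma Z_points_facts:
  assumes S: "S \<subseteq> T" and v: "v \<in> Z_points R u n g S"
  shows "off_prime R n g v \<subseteq> carrier A" "\<one>\<^bsub>A\<^esub> \<in> off_prime R n g v"
    and "\<And>s t. s \<in> off_prime R n g v \<Longrightarrow> t \<in> off_prime R n g v \<Longrightarrow> s \<otimes>\<^bsub>A\<^esub> t \<in> off_prime R n g v"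
    and "\<And>d. d \<in> off_prime R n g v \<Longrightarrow> d \<notin> comp_prime S"
    and "\<And>a. a \<in> carrier A \<Longrightarrow> a \<in> comp_prime S \<longleftrightarrow> (\<exists>d\<in>off_prime R n g v. d \<otimes>\<^bsub>A\<^esub> a = \<zero>\<^bsub>A\<^esub>)"
proof -
  let ?h = "point_hom R n g v"
  let ?D = "off_prime R n g v"
  have vp: "v \<in> points R u n g" using v by (simp add: Z_points_def)
  note spec = point_hom_spec[OF vp]
  interpret h: ring_hom_cring A R ?h
    using spec by (intro ring_hom_cring.intro ring_hom_cring_axioms.intro q.S.cring_axioms cring_axioms) blast
  have D: "a \<in> ?D \<longleftrightarrow> a \<in> carrier A \<and> ?h a \<noteq> \<zero>" for a
    unfolding point_prime_def a_kernel_def' Diff_iff mem_Collect_eq by blast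
  have var: "?h (A_var R n g z) = v z" if "z \<in> V" for z using spec that by blast
  have vc: "v z \<in> carrier R" if "z \<in> V" for z
    using vp that ideal.Icarr[OF cgenideal_ideal[OF uniformizer_carrier]] by (auto simp: points_def)
  have prod: "v (VX i) \<otimes> v (VY i) = \<zero>" if "i \<in> T" for i using vp that by (simp add: points_def)
  have vx: "v (VX i) \<noteq> \<zero>" if "i \<in> S" for i using v that by (simp add: Z_points_def)
  have vy: "v (VY i) \<noteq> \<zero>" if "i \<in> T - S" for i using v that by (simp add: Z_points_def)
  show "?D \<subseteq> carrier A" by (rule Diff_subset)
  show one: "\<one>\<^bsub>A\<^esub> \<in> ?D" unfolding D using h.hom_one by simp
  show mult: "s \<otimes>\<^bsub>A\<^esub> t \<in> ?D" if "s \<in> ?D" "t \<in> ?D" for s t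
  proof -
    have st: "s \<in> carrier A" "?h s \<noteq> \<zero>" "t \<in> carrier A" "?h t \<noteq> \<zero>" using that unfolding D by blast+
    have "?h (s \<otimes>\<^bsub>A\<^esub> t) \<noteq> \<zero>"
      unfolding h.hom_mult[OF st(1,3)]
      using integral_iff[OF h.hom_closed[OF st(1)] h.hom_closed[OF st(3)]] st(2,4) by blast
    then show ?thesis unfolding D using q.S.m_closed[OF st(1,3)] by blast
  qed
  have sub: "comp_prime S \<subseteq> {a \<in> carrier A. ?h a \<in> {\<zero>}}"
  proof (rule p_minimal[OF S h.ring.ideal_vimage[OF zeroideal]])
    show "(\<lambda>i. A_var R n g (VX i)) ` (T - S) \<subseteq> {a \<in> carrier A. ?h a \<in> {\<zero>}}"
    proof (rule image_subsetI)
      fix i assume i: "i \<in> T - S"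
      then have V: "VX i \<in> V" "VY i \<in> V" by auto
      have "v (VX i) = \<zero>" using prod[of i] vy[OF i] vc[OF V(1)] vc[OF V(2)] i integral by blast
      then show "A_var R n g (VX i) \<in> {a \<in> carrier A. ?h a \<in> {\<zero>}}"
        using var[OF V(1)] A_var_closed[OF V(1)] by simp
    qed
    show "(\<lambda>i. A_var R n g (VY i)) ` S \<subseteq> {a \<in> carrier A. ?h a \<in> {\<zero>}}"
    proof (rule image_subsetI)
      fix i assume i: "i \<in> S"
      then have V: "VX i \<in> V" "VY i \<in> V" using S by auto
      have "v (VY i) = \<zero>" using prod[of i] vx[OF i] vc[OF V(1)] vc[OF V(2)] i S integral by blast
      then show "A_var R n g (VY i) \<in> {a \<in> carrier A. ?h a \<in> {\<zero>}}"
        using var[OF V(2)] A_var_closed[OF V(2)] by simp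
    qed
  qed
  show off: "d \<notin> comp_prime S" if "d \<in> ?D" for d using that sub unfolding D by blast
  have hprod: "?h (finprod A (\<lambda>i. A_var R n g (w i)) K) \<noteq> \<zero>"
    if "finite K" "\<And>i. i \<in> K \<Longrightarrow> w i \<in> V \<and> v (w i) \<noteq> \<zero>" for K :: "nat set" and w
    using that
  proof (induction K rule: finite_induct)
    case (insert k K)
    have c: "A_var R n g (w i) \<in> carrier A" if "i \<in> insert k K" for i using insert.prems[OF that] A_var_closed by blast
    have fc: "finprod A (\<lambda>i. A_var R n g (w i)) K \<in> carrier A" using c by (intro q.S.finprod_closed) auto
    have "finprod A (\<lambda>i. A_var R n g (w i)) (insert k K)
        = A_var R n g (w k) \<otimes>\<^bsub>A\<^esub> finprod A (\<lambda>i. A_var R n g (w i)) K"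
      using insert.hyps c by (intro q.S.finprod_insert) auto
    then have "?h (finprod A (\<lambda>i. A_var R n g (w i)) (insert k K))
        = v (w k) \<otimes> ?h (finprod A (\<lambda>i. A_var R n g (w i)) K)"
      using h.hom_mult[OF c[of k] fc] var[of "w k"] insert.prems[of k] by simp
    moreover have "?h (finprod A (\<lambda>i. A_var R n g (w i)) K) \<noteq> \<zero>" using insert by simp
    ultimately show ?case
      using insert.prems[of k] vc[of "w k"] h.hom_closed[OF fc] by (simp add: integral_iff)
  qed simp
  have fS: "finite S" using S finite_subset by blast
  define e where "e = xprod S \<otimes>\<^bsub>A\<^esub> yprod (T - S)"
  have XYc: "xprod S \<in> carrier A" "yprod (T - S) \<in> carrier A" using S by auto
  have eD: "e \<in> ?D" unfolding e_def
  proof (rule mult)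
    show "xprod S \<in> ?D" unfolding D
    proof (intro conjI XYc hprod fS)
      show "VX i \<in> V" "v (VX i) \<noteq> \<zero>" if "i \<in> S" for i using that S vx unfolding V_iff by blast+
    qed
    show "yprod (T - S) \<in> ?D" unfolding D
    proof (intro conjI XYc hprod)
      show "VY i \<in> V" "v (VY i) \<noteq> \<zero>" if "i \<in> T - S" for i using that vy unfolding V_iff by blast+
    qed simp
  qed
  show "a \<in> comp_prime S \<longleftrightarrow> (\<exists>d\<in>?D. d \<otimes>\<^bsub>A\<^esub> a = \<zero>\<^bsub>A\<^esub>)" if a: "a \<in> carrier A" for a
  proof
    assume "a \<in> comp_prime S"
    then have "e \<otimes>\<^bsub>A\<^esub> a = \<zero>\<^bsub>A\<^esub>"
      using XY_mult_zero[OF S] a XYc by (simp add: e_def q.S.m_assoc)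
    then show "\<exists>d\<in>?D. d \<otimes>\<^bsub>A\<^esub> a = \<zero>\<^bsub>A\<^esub>" using eD by blast
  next
    assume "\<exists>d\<in>?D. d \<otimes>\<^bsub>A\<^esub> a = \<zero>\<^bsub>A\<^esub>"
    then obtain d where d: "d \<in> ?D" "d \<otimes>\<^bsub>A\<^esub> a = \<zero>\<^bsub>A\<^esub>" by blast
    then have "d \<otimes>\<^bsub>A\<^esub> a \<in> comp_prime S" using p_zero[OF S] by simp
    then show "a \<in> comp_prime S" using p_mult_iff[OF S _ a, of d] off[OF d(1)] d(1) by auto
  qed
qed

text \<open>The point takes the value \<open>u\<close> at the variables of the facet and zero
  elsewhere. Its existence makes the condition on localizations effective and the rank of a
  component well defined.\<close>

lemma Z_points_nonempty:
  assumes S: "S \<subseteq> T"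
  shows "Z_points R u n g S \<noteq> {}"
proof -
  define v where "v = restrict (\<lambda>z. if z \<in> face S then u else \<zero>) V"
  have z: "\<zero> \<in> PIdl u"
    using additive_subgroup.zero_closed[OF ideal.axioms(1)[OF cgenideal_ideal[OF uniformizer_carrier]]] .
  have "v \<in> V \<rightarrow>\<^sub>E PIdl u" using z cgenideal_self[OF uniformizer_carrier] by (auto simp: v_def)
  moreover have "v (VX i) = (if i \<in> S then u else \<zero>)" "v (VY i) = (if i \<in> S then \<zero> else u)" if "i \<in> T" for i
    using that by (auto simp: v_def face_def)
  ultimately have "v \<in> Z_points R u n g S"
    using S uniformizer_nonzero uniformizer_carrier by (auto simp: Z_points_def points_def subset_iff)
  then show ?thesis by blast
qed

lemma J_eq: assumes S: "S \<subseteq> T" shows "J S = AS_ideal R n g S"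
proof
  have x: "(\<lambda>i. A_var R n g (VX i)) ` (T - S) \<subseteq> AS_ideal R n g S"
    unfolding AS_ideal_def by (rule q.S.genideal_self) (auto intro!: A_var_closed)
  show "J S \<subseteq> AS_ideal R n g S"
    using J_minimal[OF S AS_ideal[OF S] x] by (auto simp: J_def)
  have "A_var R n g (VX i) \<in> J S" if i: "i \<in> T - S" for i
    using i S A_var_closed by (auto simp: J_def intro!: x_mem)
  then show "AS_ideal R n g S \<subseteq> J S"
    unfolding AS_ideal_def by (intro q.S.genideal_minimal[OF J_ideal[OF S]]) auto
qed

lemma AS_proj_J: "S \<subseteq> T \<Longrightarrow> a \<in> carrier A \<Longrightarrow> AS_proj R n g S a = \<zero>\<^bsub>AS_ring R n g S\<^esub> \<longleftrightarrow> a \<in> J S"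
  by (simp only: AS_proj_zero_iff J_eq)

text \<open>Linearity of the maps \<open>\<pi>\<close> is stated over \<open>A_S\<close> through
  \<open>AS_trans\<close>; this turns it into linearity over A.\<close>

lemma AS_trans_proj:
  assumes S: "S \<subseteq> T" "S' \<subseteq> S" and a: "a \<in> carrier A"
  shows "AS_trans R n g S' (AS_proj R n g S a) = AS_proj R n g S' a"
  unfolding AS_trans_def
proof (rule UN_constant_on)
  have S'T: "S' \<subseteq> T" using S by blast
  interpret p: surjective_hom A "AS_ring R n g S'" "AS_proj R n g S'" by (rule AS_proj_surjective_hom[OF S'T])
  interpret I: ideal "AS_ideal R n g S" A by (rule AS_ideal[OF S(1)])
  show "AS_proj R n g S a \<noteq> {}"
    unfolding AS_proj_def using I.a_rcos_self[OF a] by blast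
  fix b assume "b \<in> AS_proj R n g S a"
  then obtain i where i: "i \<in> AS_ideal R n g S" "b = i \<oplus>\<^bsub>A\<^esub> a"
    by (auto simp: AS_proj_def a_r_coset_def')
  have "i \<in> J S'" using i(1) J_mono[OF S(2)] J_eq[OF S(1)] by blast
  then have "AS_proj R n g S' i = \<zero>\<^bsub>AS_ring R n g S'\<^esub>" using AS_proj_J[OF S'T I.Icarr[OF i(1)]] by blast
  then show "AS_proj R n g S' b = AS_proj R n g S' a"
    using p.hom_add[OF I.Icarr[OF i(1)] a] p.hom_closed[OF a] unfolding i(2) by simp
qed

end

lemma restrict_scalars_simps [simp]:
  "carrier (restrict_scalars p M) = carrier M" "\<zero>\<^bsub>restrict_scalars p M\<^esub> = \<zero>\<^bsub>M\<^esub>"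
  "add (restrict_scalars p M) = add M" "a \<odot>\<^bsub>restrict_scalars p M\<^esub> x = p a \<odot>\<^bsub>M\<^esub> x"
  by (simp_all add: restrict_scalars_def)

lemma restrict_scalars_finsum: "finsum (restrict_scalars p M) f K = finsum M f K"
  by (simp add: finsum_def finprod_def restrict_scalars_def)

lemma (in surjective_hom) restrict_scalars_module:
  fixes M :: "('b, 'm) module"
  assumes "module S M"
  shows "module R (restrict_scalars h M)"
proof -
  interpret M: module S M by fact
  show ?thesis
  proof (rule moduleI[OF R.cring_axioms])
    show "abelian_group (restrict_scalars h M)"
    proof (rule abelian_groupI)
      fix x assume "x \<in> carrier (restrict_scalars h M)"
      then show "\<exists>y\<in>carrier (restrict_scalars h M). y \<oplus>\<^bsub>restrict_scalars h M\<^esub> x = \<zero>\<^bsub>restrict_scalars h M\<^esub>"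
        using M.M.l_neg by (intro bexI[of _ "\<ominus>\<^bsub>M\<^esub> x"]) auto
    qed (auto simp: M.M.a_ac)
  qed (auto simp: M.smult_l_distr M.smult_r_distr M.smult_assoc1)
qed

section \<open>Ranks and linear combinations\<close>

lemma (in module) finsum_smult_exchange:
  assumes K: "finite K" and L: "finite L"
    and c: "c \<in> K \<rightarrow> carrier R" and a: "\<And>i. i \<in> K \<Longrightarrow> a i \<in> L \<rightarrow> carrier R" and e: "e \<in> L \<rightarrow> carrier M"
  shows "(\<Oplus>\<^bsub>M\<^esub>i\<in>K. c i \<odot>\<^bsub>M\<^esub> (\<Oplus>\<^bsub>M\<^esub>l\<in>L. a i l \<odot>\<^bsub>M\<^esub> e l)) = (\<Oplus>\<^bsub>M\<^esub>l\<in>L. (\<Oplus>i\<in>K. c i \<otimes> a i l) \<odot>\<^bsub>M\<^esub> e l)"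
  using K c a
proof (induction K rule: finite_induct)
  case empty
  have "(\<Oplus>\<^bsub>M\<^esub>l\<in>L. \<zero> \<odot>\<^bsub>M\<^esub> e l) = (\<Oplus>\<^bsub>M\<^esub>l\<in>L. \<zero>\<^bsub>M\<^esub>)"
    using e by (intro M.finsum_cong') (auto simp: Pi_iff)
  then show ?case by simp
next
  case (insert k K)
  have cc: "c i \<in> carrier R" "a i \<in> L \<rightarrow> carrier R" if "i \<in> insert k K" for i
    using insert.prems that by auto
  have s: "(\<lambda>l. c k \<otimes> a k l) \<in> L \<rightarrow> carrier R" "(\<lambda>l. \<Oplus>i\<in>K. c i \<otimes> a i l) \<in> L \<rightarrow> carrier R"
    using cc by (auto intro!: R.finsum_closed simp: Pi_iff)
  have cl: "(\<Oplus>\<^bsub>M\<^esub>l\<in>L. a i l \<odot>\<^bsub>M\<^esub> e l) \<in> carrier M" if "i \<in> insert k K" for i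
    using finsum_smult_closed[OF cc(2)[OF that] e] .
  have "(\<Oplus>\<^bsub>M\<^esub>i\<in>insert k K. c i \<odot>\<^bsub>M\<^esub> (\<Oplus>\<^bsub>M\<^esub>l\<in>L. a i l \<odot>\<^bsub>M\<^esub> e l))
      = c k \<odot>\<^bsub>M\<^esub> (\<Oplus>\<^bsub>M\<^esub>l\<in>L. a k l \<odot>\<^bsub>M\<^esub> e l) \<oplus>\<^bsub>M\<^esub> (\<Oplus>\<^bsub>M\<^esub>i\<in>K. c i \<odot>\<^bsub>M\<^esub> (\<Oplus>\<^bsub>M\<^esub>l\<in>L. a i l \<odot>\<^bsub>M\<^esub> e l))"
    using insert.hyps cc(1) cl by (intro M.finsum_insert) auto
  also have "\<dots> = (\<Oplus>\<^bsub>M\<^esub>l\<in>L. (c k \<otimes> a k l) \<odot>\<^bsub>M\<^esub> e l) \<oplus>\<^bsub>M\<^esub> (\<Oplus>\<^bsub>M\<^esub>l\<in>L. (\<Oplus>i\<in>K. c i \<otimes> a i l) \<odot>\<^bsub>M\<^esub> e l)"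
    using insert.IH cc finsum_mult_smult[OF L cc(1) cc(2) e, of k k] by simp
  also have "\<dots> = (\<Oplus>\<^bsub>M\<^esub>l\<in>L. (c k \<otimes> a k l \<oplus> (\<Oplus>i\<in>K. c i \<otimes> a i l)) \<odot>\<^bsub>M\<^esub> e l)"
    by (rule finsum_add_smult[OF s e, symmetric])
  also have "\<dots> = (\<Oplus>\<^bsub>M\<^esub>l\<in>L. (\<Oplus>i\<in>insert k K. c i \<otimes> a i l) \<odot>\<^bsub>M\<^esub> e l)"
  proof (rule M.finsum_cong')
    fix l assume l: "l \<in> L"
    have "(\<Oplus>i\<in>insert k K. c i \<otimes> a i l) = c k \<otimes> a k l \<oplus> (\<Oplus>i\<in>K. c i \<otimes> a i l)"
      using insert.hyps cc l by (intro R.finsum_insert) (auto simp: Pi_iff)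
    then show "(c k \<otimes> a k l \<oplus> (\<Oplus>i\<in>K. c i \<otimes> a i l)) \<odot>\<^bsub>M\<^esub> e l = (\<Oplus>i\<in>insert k K. c i \<otimes> a i l) \<odot>\<^bsub>M\<^esub> e l"
      by simp
  next
    show "(\<lambda>l. (\<Oplus>i\<in>insert k K. c i \<otimes> a i l) \<odot>\<^bsub>M\<^esub> e l) \<in> L \<rightarrow> carrier M"
      using cc e by (intro Pi_I smult_closed R.finsum_closed) (auto simp: Pi_iff)
  qed simp
  finally show ?case .
qed

context crossing
begin

text \<open>With more elements than generators, \<open>linear_dependence\<close> provides a
  combination whose coefficients with respect to the generators lie in \<open>p S\<close>. The
  product \<open>D\<close>, nonzero on the component S only, annihilates \<open>p S\<close>, so
  \<open>D\<close> times the combination is a relation with a coefficient outside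
  \<open>p S\<close>.\<close>

lemma indep_le_generators:
  assumes N: "module A N" and S: "S \<subseteq> T" and L: "finite L" and e: "e \<in> L \<rightarrow> carrier N"
    and gen: "\<And>m. m \<in> carrier N \<Longrightarrow> \<exists>c\<in>L \<rightarrow> carrier A. m = (\<Oplus>\<^bsub>N\<^esub>l\<in>L. c l \<odot>\<^bsub>N\<^esub> e l)"
    and ind: "indep N S k"
  shows "k \<le> card L"
proof (rule ccontr)
  interpret N: module A N by fact
  assume "\<not> k \<le> card L"
  then have less: "card L < card {..<k}" by simp
  obtain x where x: "x \<in> {..<k} \<rightarrow> carrier N" and xi: "\<forall>c\<in>{..<k} \<rightarrow> carrier A.
      (\<Oplus>\<^bsub>N\<^esub>i\<in>{..<k}. c i \<odot>\<^bsub>N\<^esub> x i) = \<zero>\<^bsub>N\<^esub> \<longrightarrow> (\<forall>i<k. c i \<in> p S)"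
    using ind unfolding indep_def by (elim bexE) (rule that)
  have "\<forall>i\<in>{..<k}. \<exists>b. b \<in> L \<rightarrow> carrier A \<and> x i = (\<Oplus>\<^bsub>N\<^esub>l\<in>L. b l \<odot>\<^bsub>N\<^esub> e l)"
  proof
    fix i assume "i \<in> {..<k}"
    then show "\<exists>b. b \<in> L \<rightarrow> carrier A \<and> x i = (\<Oplus>\<^bsub>N\<^esub>l\<in>L. b l \<odot>\<^bsub>N\<^esub> e l)"
      using gen[OF Pi_mem[OF x]] by blast
  qed
  from bchoice[OF this] obtain a where
    a: "\<forall>i\<in>{..<k}. a i \<in> L \<rightarrow> carrier A \<and> x i = (\<Oplus>\<^bsub>N\<^esub>l\<in>L. a i l \<odot>\<^bsub>N\<^esub> e l)"
    by (elim exE) (rule that)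
  have ac: "a i \<in> L \<rightarrow> carrier A" if "i \<in> {..<k}" for i using a that by blast
  have "\<exists>c. c \<in> {..<k} \<rightarrow> carrier A \<and> (\<exists>i\<in>{..<k}. c i \<notin> p S) \<and>
      (\<forall>l\<in>L. (\<Oplus>i\<in>{..<k}. c i \<otimes> a i l) \<in> p S)"
    by (rule primeideal.linear_dependence[OF p_prime[OF S] L finite_lessThan less])
      (rule Pi_mem[OF ac])
  then obtain c where c: "c \<in> {..<k} \<rightarrow> carrier A" "\<exists>i\<in>{..<k}. c i \<notin> p S"
    "\<forall>l\<in>L. (\<Oplus>i\<in>{..<k}. c i \<otimes> a i l) \<in> p S"
    by (elim exE conjE) (rule that)
  define D where "D = xprod S \<otimes> yprod (T - S)"
  have D: "D \<in> carrier A" "D \<notin> p S"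
    using S by (auto simp: D_def p_mult_iff X_mem_iff Y_mem_iff)
  have D0: "D \<otimes> b = \<zero>" if "b \<in> p S" for b
    using XY_mult_zero[OF S that] p_carrier[OF S that] S by (simp add: D_def m_assoc)
  define s where "s = (\<lambda>l. \<Oplus>i\<in>{..<k}. c i \<otimes> a i l)"
  have s: "s \<in> L \<rightarrow> carrier A" "\<And>l. l \<in> L \<Longrightarrow> s l \<in> p S" using c(3) p_carrier[OF S] by (auto simp: s_def)
  have xc: "c i \<in> carrier A" "x i \<in> carrier N" if "i \<in> {..<k}" for i using c(1) x that by auto
  have "(\<Oplus>\<^bsub>N\<^esub>i\<in>{..<k}. c i \<odot>\<^bsub>N\<^esub> x i) = (\<Oplus>\<^bsub>N\<^esub>i\<in>{..<k}. c i \<odot>\<^bsub>N\<^esub> (\<Oplus>\<^bsub>N\<^esub>l\<in>L. a i l \<odot>\<^bsub>N\<^esub> e l))"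
    using a xc N.finsum_smult_closed[OF ac e] by (intro N.M.finsum_cong') auto
  also have "\<dots> = (\<Oplus>\<^bsub>N\<^esub>l\<in>L. s l \<odot>\<^bsub>N\<^esub> e l)"
    unfolding s_def by (rule N.finsum_smult_exchange[OF finite_lessThan L c(1) ac e])
  finally have eq: "(\<Oplus>\<^bsub>N\<^esub>i\<in>{..<k}. c i \<odot>\<^bsub>N\<^esub> x i) = (\<Oplus>\<^bsub>N\<^esub>l\<in>L. s l \<odot>\<^bsub>N\<^esub> e l)" .
  have "(\<Oplus>\<^bsub>N\<^esub>i\<in>{..<k}. (D \<otimes> c i) \<odot>\<^bsub>N\<^esub> x i) = D \<odot>\<^bsub>N\<^esub> (\<Oplus>\<^bsub>N\<^esub>i\<in>{..<k}. c i \<odot>\<^bsub>N\<^esub> x i)"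
    by (rule N.finsum_mult_smult[OF finite_lessThan D(1) c(1) x])
  also have "\<dots> = (\<Oplus>\<^bsub>N\<^esub>l\<in>L. (D \<otimes> s l) \<odot>\<^bsub>N\<^esub> e l)"
    unfolding eq by (rule N.finsum_mult_smult[OF L D(1) s(1) e, symmetric])
  also have "\<dots> = (\<Oplus>\<^bsub>N\<^esub>l\<in>L. \<zero>\<^bsub>N\<^esub>)"
    using s(2) e by (intro N.M.finsum_cong') (auto simp: D0 Pi_iff)
  also have "\<dots> = \<zero>\<^bsub>N\<^esub>" by simp
  finally have "\<forall>i<k. D \<otimes> c i \<in> p S"
    using bspec[OF xi, of "\<lambda>i. D \<otimes> c i"] xc(1) D(1) by (simp add: Pi_iff)
  then show False using c(2) D xc(1) p_mult_iff[OF S D(1)] by blast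
qed

end

section \<open>The modules over \<open>A\<close>\<close>

locale self_dual_family = crossing_setting R u n g
  for R :: "('a, 'c) ring_scheme" (structure) and u n g +
  fixes M :: "nat set \<Rightarrow> ('a series set set, 'm) module"
    and \<pi> :: "nat set \<Rightarrow> nat set \<Rightarrow> 'm \<Rightarrow> 'm"
    and \<phi> :: "nat set \<Rightarrow> 'm \<Rightarrow> 'm \<Rightarrow> 'a series set"
  assumes module: "\<And>S. S \<subseteq> T \<Longrightarrow> module (AS_ring R n g S) (M S)"
    and linear: "\<And>S S'. S' \<subseteq> S \<Longrightarrow> S \<subseteq> T \<Longrightarrow>
      \<pi> S S' \<in> mod_hom (AS_ring R n g S) (M S) (restrict_scalars (AS_trans R n g S') (M S'))"
    and surj: "\<And>S S'. S' \<subseteq> S \<Longrightarrow> S \<subseteq> T \<Longrightarrow> \<pi> S S' ` carrier (M S) = carrier (M S')"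
    and mcm: "\<And>S. S \<subseteq> T \<Longrightarrow> maximal_cohen_macaulay (AS_ring R n g S) (M S)"
    and self_dual: "\<And>S. S \<subseteq> T \<Longrightarrow> \<phi> S \<in> mod_iso (AS_ring R n g S) (M S) (dual R n g S (M S))"
    and local_iso: "\<And>S S' v. S' \<subseteq> S \<Longrightarrow> S \<subseteq> T \<Longrightarrow> v \<in> V_points R u n g S' \<Longrightarrow>
      loc_map A (off_prime R n g v) (as_A_module R n g S' (M S')) (\<pi> S S')
      \<in> mod_iso (loc_ring A (off_prime R n g v))
          (loc_module A (off_prime R n g v) (as_A_module R n g S (M S)))
          (loc_module A (off_prime R n g v) (as_A_module R n g S' (M S')))"
    and composition: "\<And>S S' s x. S' \<subset> T \<Longrightarrow> s \<in> T - S' \<Longrightarrow> S = S' \<union> {s} \<Longrightarrow> x \<in> carrier (M S') \<Longrightarrow>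
      \<pi> S S' (inv_into (carrier (M S)) (\<phi> S) (compose (carrier (M S)) (\<phi> S' x) (\<pi> S S')))
      = AS_proj R n g S' (A_var R n g (VY s)) \<odot>\<^bsub>M S'\<^esub> x"
begin

abbreviation "AS S \<equiv> AS_ring R n g S"
abbreviation "pr S \<equiv> AS_proj R n g S"

text \<open>All modules of the family are compared over the common ring A.\<close>

definition "N S = as_A_module R n g S (M S)"

lemma N_simps: "carrier (N S) = carrier (M S)" "\<zero>\<^bsub>N S\<^esub> = \<zero>\<^bsub>M S\<^esub>"
  "add (N S) = add (M S)" "a \<odot>\<^bsub>N S\<^esub> x = pr S a \<odot>\<^bsub>M S\<^esub> x" "finsum (N S) f K = finsum (M S) f K"
  by (simp_all add: N_def restrict_scalars_finsum)

lemma N_module: "S \<subseteq> T \<Longrightarrow> module A (N S)"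
  unfolding N_def by (rule surjective_hom.restrict_scalars_module[OF AS_proj_surjective_hom module])

lemma pr_closed: "S \<subseteq> T \<Longrightarrow> a \<in> carrier A \<Longrightarrow> pr S a \<in> carrier (AS S)"
proof -
  assume S: "S \<subseteq> T" and a: "a \<in> carrier A"
  interpret p: surjective_hom A "AS S" "pr S" by (rule AS_proj_surjective_hom[OF S])
  show ?thesis using a by (rule p.hom_closed)
qed

lemma dual_carrier:
  "h \<in> carrier (dual R n g S (M S)) \<longleftrightarrow> h \<in> mod_hom A (N S) (self_module A) \<and> h \<in> extensional (carrier (M S))"
  by (simp add: dual_def N_def)

lemma functional_iff:
  "h \<in> mod_hom A (N S) (self_module A) \<longleftrightarrow> h \<in> carrier (N S) \<rightarrow> carrier A \<and>
    (\<forall>m\<in>carrier (N S). \<forall>m'\<in>carrier (N S). h (m \<oplus>\<^bsub>N S\<^esub> m') = h m \<oplus>\<^bsub>A\<^esub> h m') \<and>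
    (\<forall>a\<in>carrier A. \<forall>m\<in>carrier (N S). h (a \<odot>\<^bsub>N S\<^esub> m) = a \<otimes>\<^bsub>A\<^esub> h m)"
  by (simp add: mod_hom_def self_module_def)

text \<open>\<open>\<phi> S m\<close> is itself a functional, so \<open>\<phi> S\<close> read with
  two arguments is the pairing. Homogeneity on the left comes from the module structure of the dual,
  where scalars act on the argument.\<close>

lemma pairing:
  assumes S: "S \<subseteq> T" and m: "m \<in> carrier (N S)" and w: "w \<in> carrier (N S)"
  shows "\<phi> S m w \<in> carrier A"
    and "m' \<in> carrier (N S) \<Longrightarrow> \<phi> S (m \<oplus>\<^bsub>N S\<^esub> m') w = \<phi> S m w \<oplus>\<^bsub>A\<^esub> \<phi> S m' w"
    and "m' \<in> carrier (N S) \<Longrightarrow> \<phi> S w (m \<oplus>\<^bsub>N S\<^esub> m') = \<phi> S w m \<oplus>\<^bsub>A\<^esub> \<phi> S w m'"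
    and "a \<in> carrier A \<Longrightarrow> \<phi> S (a \<odot>\<^bsub>N S\<^esub> m) w = a \<otimes>\<^bsub>A\<^esub> \<phi> S m w"
    and "a \<in> carrier A \<Longrightarrow> \<phi> S w (a \<odot>\<^bsub>N S\<^esub> m) = a \<otimes>\<^bsub>A\<^esub> \<phi> S w m"
proof -
  have hom: "\<phi> S \<in> mod_hom (AS S) (M S) (dual R n g S (M S))"
    using self_dual[OF S] by (simp add: mod_iso_def)
  have f: "\<phi> S x \<in> mod_hom A (N S) (self_module A)" if "x \<in> carrier (N S)" for x
    using hom that dual_carrier unfolding mod_hom_def N_simps by blast
  show "\<phi> S m w \<in> carrier A" using f[OF m] w unfolding functional_iff by blast
  show "\<phi> S w (m \<oplus>\<^bsub>N S\<^esub> m') = \<phi> S w m \<oplus>\<^bsub>A\<^esub> \<phi> S w m'" if "m' \<in> carrier (N S)"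
    using f[OF w] m that unfolding functional_iff by blast
  show r: "\<phi> S w (a \<odot>\<^bsub>N S\<^esub> m) = a \<otimes>\<^bsub>A\<^esub> \<phi> S w m" if "a \<in> carrier A"
    using f[OF w] m that unfolding functional_iff by blast
  show "\<phi> S (m \<oplus>\<^bsub>N S\<^esub> m') w = \<phi> S m w \<oplus>\<^bsub>A\<^esub> \<phi> S m' w" if m': "m' \<in> carrier (N S)"
  proof -
    have "\<phi> S (m \<oplus>\<^bsub>N S\<^esub> m') = \<phi> S m \<oplus>\<^bsub>dual R n g S (M S)\<^esub> \<phi> S m'"
      using hom m m' unfolding mod_hom_def N_simps by blast
    then show ?thesis using w by (simp add: dual_def N_simps)
  qed
  show "\<phi> S (a \<odot>\<^bsub>N S\<^esub> m) w = a \<otimes>\<^bsub>A\<^esub> \<phi> S m w" if a: "a \<in> carrier A"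
  proof -
    have "\<phi> S (a \<odot>\<^bsub>N S\<^esub> m) = pr S a \<odot>\<^bsub>dual R n g S (M S)\<^esub> \<phi> S m"
      using hom m pr_closed[OF S a] unfolding mod_hom_def N_simps by blast
    then have "\<phi> S (a \<odot>\<^bsub>N S\<^esub> m) w = \<phi> S m (a \<odot>\<^bsub>N S\<^esub> w)" using w by (simp add: dual_def N_simps)
    also have "\<dots> = a \<otimes>\<^bsub>A\<^esub> \<phi> S m w" using f[OF m] w a unfolding functional_iff by blast
    finally show ?thesis .
  qed
qed

lemma \<phi>_bij: "S \<subseteq> T \<Longrightarrow> bij_betw (\<phi> S) (carrier (N S)) (carrier (dual R n g S (M S)))"
  using self_dual[of S] by (simp add: mod_iso_def N_simps)

text \<open>Injectivity of \<open>\<phi> S\<close> is nondegeneracy and surjectivity is the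
  representation of functionals. Functionals are compared after restriction, because members of the
  dual are extensional.\<close>

lemma paired_N:
  assumes S: "S \<subseteq> T"
  shows "paired A T (\<lambda>i. A_var R n g (VX i)) (\<lambda>i. A_var R n g (VY i)) comp_prime (N S) S (\<phi> S)"
proof (intro paired.intro paired_axioms.intro crossing_axioms N_module[OF S] S)
  interpret N: module A "N S" by (rule N_module[OF S])
  interpret Ms: module "AS S" "M S" by (rule module[OF S])
  show "a \<odot>\<^bsub>N S\<^esub> m = \<zero>\<^bsub>N S\<^esub>" if a: "a \<in> J S" and m: "m \<in> carrier (N S)" for a m
  proof -
    have "a \<in> carrier A" using a by (simp add: J_def)
    then have "pr S a = \<zero>\<^bsub>AS S\<^esub>" using AS_proj_J[OF S] a by blast
    then show ?thesis using m by (simp add: N_simps)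
  qed
  show "m = \<zero>\<^bsub>N S\<^esub>" if m: "m \<in> carrier (N S)" and null: "\<And>w. w \<in> carrier (N S) \<Longrightarrow> \<phi> S m w = \<zero>\<^bsub>A\<^esub>" for m
  proof (rule inj_onD[OF bij_betw_imp_inj_on[OF \<phi>_bij[OF S]]])
    show "\<phi> S m = \<phi> S \<zero>\<^bsub>N S\<^esub>"
    proof (rule extensionalityI)
      show "\<phi> S m \<in> extensional (carrier (N S))" "\<phi> S \<zero>\<^bsub>N S\<^esub> \<in> extensional (carrier (N S))"
        using bij_betwE[OF \<phi>_bij[OF S]] m N.zero_closed dual_carrier unfolding N_simps(1) by blast+
      fix w assume w: "w \<in> carrier (N S)"
      have "\<phi> S (\<zero>\<^bsub>A\<^esub> \<odot>\<^bsub>N S\<^esub> \<zero>\<^bsub>N S\<^esub>) w = \<zero>\<^bsub>A\<^esub> \<otimes>\<^bsub>A\<^esub> \<phi> S \<zero>\<^bsub>N S\<^esub> w"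
        by (rule pairing(4)[OF S N.zero_closed w q.S.zero_closed])
      then have "\<phi> S \<zero>\<^bsub>N S\<^esub> w = \<zero>\<^bsub>A\<^esub>" using pairing(1)[OF S N.zero_closed w] by simp
      then show "\<phi> S m w = \<phi> S \<zero>\<^bsub>N S\<^esub> w" using null[OF w] by simp
    qed
  qed (use m in auto)
  show "\<exists>m\<in>carrier (N S). \<forall>w\<in>carrier (N S). \<phi> S m w = h w" if h: "h \<in> mod_hom A (N S) (self_module A)" for h
  proof -
    have "restrict h (carrier (N S)) \<in> mod_hom A (N S) (self_module A)"
      using h unfolding functional_iff by (auto simp: Pi_iff)
    then have "restrict h (carrier (N S)) \<in> \<phi> S ` carrier (N S)"
      using bij_betw_imp_surj_on[OF \<phi>_bij[OF S]] unfolding dual_carrier[symmetric] N_simps(1)[symmetric]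
      by (simp add: dual_carrier N_simps(1))
    then obtain m where m: "m \<in> carrier (N S)" "restrict h (carrier (N S)) = \<phi> S m" by (elim imageE) (rule that)
    have "\<phi> S m w = h w" if "w \<in> carrier (N S)" for w using fun_cong[OF m(2), of w] that by simp
    then show ?thesis using m(1) by blast
  qed
qed (rule pairing[OF S]; assumption)+

lemma \<pi>_linear:
  assumes S: "S' \<subseteq> S" "S \<subseteq> T" and m: "m \<in> carrier (N S)"
  shows "\<pi> S S' m \<in> carrier (N S')"
    and "m' \<in> carrier (N S) \<Longrightarrow> \<pi> S S' (m \<oplus>\<^bsub>N S\<^esub> m') = \<pi> S S' m \<oplus>\<^bsub>N S'\<^esub> \<pi> S S' m'"
    and "a \<in> carrier A \<Longrightarrow> \<pi> S S' (a \<odot>\<^bsub>N S\<^esub> m) = a \<odot>\<^bsub>N S'\<^esub> \<pi> S S' m"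
proof -
  note l = linear[OF S, unfolded mod_hom_def, simplified]
  show "\<pi> S S' m \<in> carrier (N S')" using l m unfolding N_simps by blast
  show "\<pi> S S' (m \<oplus>\<^bsub>N S\<^esub> m') = \<pi> S S' m \<oplus>\<^bsub>N S'\<^esub> \<pi> S S' m'" if "m' \<in> carrier (N S)"
    using l m that unfolding N_simps by blast
  show "\<pi> S S' (a \<odot>\<^bsub>N S\<^esub> m) = a \<odot>\<^bsub>N S'\<^esub> \<pi> S S' m" if a: "a \<in> carrier A"
    using l m pr_closed[OF S(2) a] AS_trans_proj[OF S(2,1) a] unfolding N_simps by simp
qed

lemma \<pi>_surjective: "S' \<subseteq> S \<Longrightarrow> S \<subseteq> T \<Longrightarrow> z \<in> carrier (N S') \<Longrightarrow> \<exists>m\<in>carrier (N S). \<pi> S S' m = z"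
  unfolding N_simps by (metis surj image_iff)

text \<open>A point on the component S'' alone belongs to the locus of S', as S'' is contained in
  S', so \<open>\<pi>\<close> is injective after localization there. The denominator that kills
  \<open>m\<close> is nonzero at the point, hence outside \<open>comp_prime S''\<close>.\<close>

lemma \<pi>_kernel:
  assumes S: "S'' \<subseteq> S'" "S' \<subseteq> S" "S \<subseteq> T" and m: "m \<in> carrier (N S)" "\<pi> S S' m = \<zero>\<^bsub>N S'\<^esub>"
  shows "\<exists>a\<in>carrier A. a \<notin> comp_prime S'' \<and> a \<odot>\<^bsub>N S\<^esub> m = \<zero>\<^bsub>N S\<^esub>"
proof -
  have ST: "S'' \<subseteq> T" "S' \<subseteq> T" using S by blast+
  obtain v where v: "v \<in> Z_points R u n g S''" using Z_points_nonempty[OF ST(1)] by blast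
  then have vV: "v \<in> V_points R u n g S'" using S by (auto simp: V_points_def)
  note D = Z_points_facts[OF ST(1) v]
  have loc: "localization A (N S) (off_prime R n g v)" if "S \<subseteq> T" for S
    by (intro localization.intro localization_axioms.intro N_module[OF that]) (rule D; assumption)+
  have inj: "inj_on (loc_map A (off_prime R n g v) (N S') (\<pi> S S')) (carrier (loc_module A (off_prime R n g v) (N S)))"
    using local_iso[OF S(2,3) vV] by (auto simp: mod_iso_def N_def bij_betw_def)
  have "\<exists>d\<in>off_prime R n g v. d \<odot>\<^bsub>N S\<^esub> m = \<zero>\<^bsub>N S\<^esub>"
    by (rule loc_map_kernel[OF loc[OF S(3)] loc[OF ST(2)] _ _ inj m])
      (use \<pi>_linear[OF S(2,3)] in auto)
  then show ?thesis using D(1,4) by blast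
qed

lemma adjacent_N:
  assumes S: "S \<subseteq> T" and s: "s \<in> T - S"
  shows "adjacent A T (\<lambda>i. A_var R n g (VX i)) (\<lambda>i. A_var R n g (VY i)) comp_prime
    (N S) S (\<phi> S) (N (insert s S)) s (\<phi> (insert s S)) (\<pi> (insert s S) S)"
proof -
  let ?S = "insert s S"
  have S2: "S \<subseteq> ?S" "?S \<subseteq> T" using S s by auto
  note lin = \<pi>_linear[OF S2]
  show ?thesis
  proof (intro adjacent.intro adjacent_axioms.intro crossing_axioms paired_N S S2(2) s)
    show "\<pi> ?S S m \<in> carrier (N S)" if "m \<in> carrier (N ?S)" for m using lin(1)[OF that] .
    show "\<pi> ?S S (m \<oplus>\<^bsub>N ?S\<^esub> m') = \<pi> ?S S m \<oplus>\<^bsub>N S\<^esub> \<pi> ?S S m'"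
      if "m \<in> carrier (N ?S)" "m' \<in> carrier (N ?S)" for m m' using lin(2)[OF that] .
    show "\<pi> ?S S (a \<odot>\<^bsub>N ?S\<^esub> m) = a \<odot>\<^bsub>N S\<^esub> \<pi> ?S S m"
      if "a \<in> carrier A" "m \<in> carrier (N ?S)" for a m using lin(3)[OF that(2,1)] .
    show "\<exists>m\<in>carrier (N ?S). \<pi> ?S S m = z" if "z \<in> carrier (N S)" for z using \<pi>_surjective[OF S2 that] .
    show "\<exists>a\<in>carrier A. a \<notin> comp_prime S' \<and> a \<odot>\<^bsub>N ?S\<^esub> m = \<zero>\<^bsub>N ?S\<^esub>"
      if "m \<in> carrier (N ?S)" "\<pi> ?S S m = \<zero>\<^bsub>N S\<^esub>" "S' \<subseteq> S" for m S'
      using \<pi>_kernel[OF that(3) S2 that(1,2)] .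
    fix z assume z: "z \<in> carrier (N S)"
    interpret N2: module A "N ?S" by (rule N_module[OF S2(2)])
    define h where "h = compose (carrier (M ?S)) (\<phi> S z) (\<pi> ?S S)"
    have h: "h m = \<phi> S z (\<pi> ?S S m)" if "m \<in> carrier (N ?S)" for m
      using that by (simp add: h_def compose_def N_simps)
    have "h \<in> mod_hom A (N ?S) (self_module A)"
      unfolding functional_iff
      using lin pairing[OF S] z by (auto simp: h)
    then have hd: "h \<in> \<phi> ?S ` carrier (N ?S)"
      using bij_betw_imp_surj_on[OF \<phi>_bij[OF S2(2)]] by (simp add: dual_carrier h_def)
    \<comment> \<open>The first three maps of the composition in the hypothesis, applied to
      \<open>z\<close>: self-duality, the transpose of \<open>\<pi>\<close>, and the inverse of
      self-duality.\<close>
    define w where "w = inv_into (carrier (N ?S)) (\<phi> ?S) h"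
    have w: "w \<in> carrier (N ?S)" "\<phi> ?S w = h"
      unfolding w_def using inv_into_into[OF hd] f_inv_into_f[OF hd] by blast+
    have "S \<subset> T" using S s by blast
    from composition[OF this s _ z[unfolded N_simps], of ?S]
    have "\<pi> ?S S w = A_var R n g (VY s) \<odot>\<^bsub>N S\<^esub> z"
      by (simp add: w_def h_def N_simps)
    then show "\<exists>w\<in>carrier (N ?S). (\<forall>m\<in>carrier (N ?S). \<phi> ?S w m = \<phi> S z (\<pi> ?S S m)) \<and>
        \<pi> ?S S w = A_var R n g (VY s) \<odot>\<^bsub>N S\<^esub> z"
      using w h by (intro bexI[of _ w]) simp_all
  qed
qed

lemma \<pi>_finsum:
  assumes S: "S' \<subseteq> S" "S \<subseteq> T" and K: "finite K" and c: "c \<in> K \<rightarrow> carrier A" and e: "e \<in> K \<rightarrow> carrier (N S)"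
  shows "\<pi> S S' (\<Oplus>\<^bsub>N S\<^esub>i\<in>K. c i \<odot>\<^bsub>N S\<^esub> e i) = (\<Oplus>\<^bsub>N S'\<^esub>i\<in>K. c i \<odot>\<^bsub>N S'\<^esub> \<pi> S S' (e i))"
proof -
  have S'T: "S' \<subseteq> T" using S by blast
  interpret N: module A "N S" by (rule N_module[OF S(2)])
  interpret N': module A "N S'" by (rule N_module[OF S'T])
  note lin = \<pi>_linear[OF S]
  show ?thesis using K c e
  proof (induction K rule: finite_induct)
    case empty
    have "\<pi> S S' (\<zero>\<^bsub>A\<^esub> \<odot>\<^bsub>N S\<^esub> \<zero>\<^bsub>N S\<^esub>) = \<zero>\<^bsub>A\<^esub> \<odot>\<^bsub>N S'\<^esub> \<pi> S S' \<zero>\<^bsub>N S\<^esub>"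
      by (rule lin(3)[OF N.zero_closed q.S.zero_closed])
    then show ?case using lin(1)[OF N.zero_closed] by simp
  next
    case (insert k K)
    have ce: "c i \<in> carrier A" "e i \<in> carrier (N S)" "\<pi> S S' (e i) \<in> carrier (N S')" if "i \<in> insert k K" for i
      using insert.prems that lin(1) by auto
    have "(\<Oplus>\<^bsub>N S\<^esub>i\<in>insert k K. c i \<odot>\<^bsub>N S\<^esub> e i) = c k \<odot>\<^bsub>N S\<^esub> e k \<oplus>\<^bsub>N S\<^esub> (\<Oplus>\<^bsub>N S\<^esub>i\<in>K. c i \<odot>\<^bsub>N S\<^esub> e i)"
      using insert.hyps ce by (intro N.M.finsum_insert) auto
    moreover have "(\<Oplus>\<^bsub>N S'\<^esub>i\<in>insert k K. c i \<odot>\<^bsub>N S'\<^esub> \<pi> S S' (e i))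
        = c k \<odot>\<^bsub>N S'\<^esub> \<pi> S S' (e k) \<oplus>\<^bsub>N S'\<^esub> (\<Oplus>\<^bsub>N S'\<^esub>i\<in>K. c i \<odot>\<^bsub>N S'\<^esub> \<pi> S S' (e i))"
      using insert.hyps ce by (intro N'.M.finsum_insert) auto
    moreover have "c k \<odot>\<^bsub>N S\<^esub> e k \<in> carrier (N S)" "(\<Oplus>\<^bsub>N S\<^esub>i\<in>K. c i \<odot>\<^bsub>N S\<^esub> e i) \<in> carrier (N S)"
      using ce by (auto intro!: N.finsum_smult_closed)
    moreover have "\<pi> S S' (\<Oplus>\<^bsub>N S\<^esub>i\<in>K. c i \<odot>\<^bsub>N S\<^esub> e i) = (\<Oplus>\<^bsub>N S'\<^esub>i\<in>K. c i \<odot>\<^bsub>N S'\<^esub> \<pi> S S' (e i))"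
      using insert.IH insert.prems by blast
    ultimately show ?case using lin(2) lin(3)[OF ce(2,1)[of k]] by simp
  qed
qed

text \<open>Families are carried along \<open>\<pi>\<close> by images and back by arbitrary lifts. A
  relation between images holds for the original family after multiplication by an element outside
  the prime, which primality removes from the coefficients.\<close>

lemma indep_transfer:
  assumes S: "S'' \<subseteq> S'" "S' \<subseteq> S" "S \<subseteq> T"
  shows "indep (N S) S'' k \<longleftrightarrow> indep (N S') S'' k"
proof
  have ST: "S'' \<subseteq> T" "S' \<subseteq> T" using S by blast+
  interpret N: module A "N S" by (rule N_module[OF S(3)])
  interpret N': module A "N S'" by (rule N_module[OF ST(2)])
  note lin = \<pi>_linear[OF S(2,3)]
  {
    assume "indep (N S) S'' k"
    then obtain e where e: "e \<in> {..<k} \<rightarrow> carrier (N S)" and ei: "\<forall>c\<in>{..<k} \<rightarrow> carrier A.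
        (\<Oplus>\<^bsub>N S\<^esub>i\<in>{..<k}. c i \<odot>\<^bsub>N S\<^esub> e i) = \<zero>\<^bsub>N S\<^esub> \<longrightarrow> (\<forall>i<k. c i \<in> comp_prime S'')"
      unfolding indep_def by (elim bexE) (rule that)
    have "\<forall>i<k. c i \<in> comp_prime S''" if c: "c \<in> {..<k} \<rightarrow> carrier A"
      and z: "(\<Oplus>\<^bsub>N S'\<^esub>i\<in>{..<k}. c i \<odot>\<^bsub>N S'\<^esub> \<pi> S S' (e i)) = \<zero>\<^bsub>N S'\<^esub>" for c
    proof -
      have "\<pi> S S' (\<Oplus>\<^bsub>N S\<^esub>i\<in>{..<k}. c i \<odot>\<^bsub>N S\<^esub> e i) = \<zero>\<^bsub>N S'\<^esub>"
        by (rule trans[OF \<pi>_finsum[OF S(2,3) finite_lessThan c e] z])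
      then obtain a where a: "a \<in> carrier A" "a \<notin> comp_prime S''"
          "a \<odot>\<^bsub>N S\<^esub> (\<Oplus>\<^bsub>N S\<^esub>i\<in>{..<k}. c i \<odot>\<^bsub>N S\<^esub> e i) = \<zero>\<^bsub>N S\<^esub>"
        using \<pi>_kernel[OF S N.finsum_smult_closed[OF c e]] by blast
      have "(\<Oplus>\<^bsub>N S\<^esub>i\<in>{..<k}. (a \<otimes>\<^bsub>A\<^esub> c i) \<odot>\<^bsub>N S\<^esub> e i) = \<zero>\<^bsub>N S\<^esub>"
        by (rule trans[OF N.finsum_mult_smult[OF finite_lessThan a(1) c e] a(3)])
      moreover have "(\<lambda>i. a \<otimes>\<^bsub>A\<^esub> c i) \<in> {..<k} \<rightarrow> carrier A" using a(1) c by auto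
      ultimately have "\<forall>i<k. a \<otimes>\<^bsub>A\<^esub> c i \<in> comp_prime S''" using bspec[OF ei, of "\<lambda>i. a \<otimes>\<^bsub>A\<^esub> c i"] by simp
      then show ?thesis using p_mult_iff[OF ST(1) a(1)] a(2) c by auto
    qed
    moreover have "(\<lambda>i. \<pi> S S' (e i)) \<in> {..<k} \<rightarrow> carrier (N S')" using e lin(1) by auto
    ultimately show "indep (N S') S'' k"
      unfolding indep_def by (intro bexI[of _ "\<lambda>i. \<pi> S S' (e i)"]) blast+
  }
  assume "indep (N S') S'' k"
  then obtain e where e: "e \<in> {..<k} \<rightarrow> carrier (N S')" and ei: "\<forall>c\<in>{..<k} \<rightarrow> carrier A.
      (\<Oplus>\<^bsub>N S'\<^esub>i\<in>{..<k}. c i \<odot>\<^bsub>N S'\<^esub> e i) = \<zero>\<^bsub>N S'\<^esub> \<longrightarrow> (\<forall>i<k. c i \<in> comp_prime S'')"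
    unfolding indep_def by (elim bexE) (rule that)
  have "\<forall>i\<in>{..<k}. \<exists>m. m \<in> carrier (N S) \<and> \<pi> S S' m = e i"
  proof
    fix i assume i: "i \<in> {..<k}"
    show "\<exists>m. m \<in> carrier (N S) \<and> \<pi> S S' m = e i" using \<pi>_surjective[OF S(2,3) Pi_mem[OF e i]] by blast
  qed
  from bchoice[OF this] obtain e' where e': "\<forall>i\<in>{..<k}. e' i \<in> carrier (N S) \<and> \<pi> S S' (e' i) = e i"
    by (elim exE) (rule that)
  then have e'c: "e' \<in> {..<k} \<rightarrow> carrier (N S)" by auto
  have "\<forall>i<k. c i \<in> comp_prime S''" if c: "c \<in> {..<k} \<rightarrow> carrier A"
    and z: "(\<Oplus>\<^bsub>N S\<^esub>i\<in>{..<k}. c i \<odot>\<^bsub>N S\<^esub> e' i) = \<zero>\<^bsub>N S\<^esub>" for c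
  proof -
    have "(\<Oplus>\<^bsub>N S'\<^esub>i\<in>{..<k}. c i \<odot>\<^bsub>N S'\<^esub> e i) = (\<Oplus>\<^bsub>N S'\<^esub>i\<in>{..<k}. c i \<odot>\<^bsub>N S'\<^esub> \<pi> S S' (e' i))"
      using e e' c by (intro N'.M.finsum_cong') (auto simp: Pi_iff)
    also have "\<dots> = \<pi> S S' \<zero>\<^bsub>N S\<^esub>"
      using \<pi>_finsum[OF S(2,3) finite_lessThan c e'c] z by simp
    also have "\<dots> = \<zero>\<^bsub>N S'\<^esub>" using \<pi>_finsum[OF S(2,3) finite.emptyI, of c e'] by simp
    finally show ?thesis using bspec[OF ei c] by blast
  qed
  then show "indep (N S) S'' k"
    unfolding indep_def using e'c by (intro bexI[of _ e']) blast+
qed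

lemma lift_combination:
  assumes S: "S \<subseteq> T" and c: "c \<in> L \<rightarrow> carrier (AS S)" and e: "e \<in> L \<rightarrow> carrier (M S)"
  shows "\<exists>c'\<in>L \<rightarrow> carrier A. (\<forall>l\<in>L. pr S (c' l) = c l) \<and>
    (\<Oplus>\<^bsub>N S\<^esub>l\<in>L. c' l \<odot>\<^bsub>N S\<^esub> e l) = (\<Oplus>\<^bsub>M S\<^esub>l\<in>L. c l \<odot>\<^bsub>M S\<^esub> e l)"
proof -
  interpret p: surjective_hom A "AS S" "pr S" by (rule AS_proj_surjective_hom[OF S])
  interpret Ms: module "AS S" "M S" by (rule module[OF S])
  have "\<forall>l\<in>L. \<exists>a. a \<in> carrier A \<and> pr S a = c l"
  proof
    fix l assume l: "l \<in> L"
    show "\<exists>a. a \<in> carrier A \<and> pr S a = c l"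
      by (rule p.surjE[OF Pi_mem[OF c l]]) (rule exI, rule conjI, assumption, rule sym)
  qed
  from bchoice[OF this] obtain c' where c': "\<forall>l\<in>L. c' l \<in> carrier A \<and> pr S (c' l) = c l"
    by (elim exE) (rule that)
  have "(\<Oplus>\<^bsub>M S\<^esub>l\<in>L. pr S (c' l) \<odot>\<^bsub>M S\<^esub> e l) = (\<Oplus>\<^bsub>M S\<^esub>l\<in>L. c l \<odot>\<^bsub>M S\<^esub> e l)"
    using c c' e by (intro Ms.M.finsum_cong') (auto simp: Pi_iff)
  then show ?thesis using c' by (intro bexI[of _ c']) (auto simp: N_simps)
qed

lemma base_basis: "\<exists>r e. basis_mod_J (N {}) {} r e"
proof -
  have E: "{} \<subseteq> T" by simp
  obtain r :: nat and e where e: "e \<in> {..<r} \<rightarrow> carrier (M {})"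
    and gen: "\<forall>m\<in>carrier (M {}). \<exists>c\<in>{..<r} \<rightarrow> carrier (AS {}). m = (\<Oplus>\<^bsub>M {}\<^esub>i\<in>{..<r}. c i \<odot>\<^bsub>M {}\<^esub> e i)"
    and ind: "\<forall>c\<in>{..<r} \<rightarrow> carrier (AS {}). (\<Oplus>\<^bsub>M {}\<^esub>i\<in>{..<r}. c i \<odot>\<^bsub>M {}\<^esub> e i) = \<zero>\<^bsub>M {}\<^esub>
      \<longrightarrow> (\<forall>i<r. c i = \<zero>\<^bsub>AS {}\<^esub>)"
    using base_free[OF mcm[OF E]] by (elim exE conjE) (rule that)
  have "basis_mod_J (N {}) {} r e"
    unfolding basis_mod_J_def
  proof (intro conjI ballI impI)
    show "e \<in> {..<r} \<rightarrow> carrier (N {})" using e by (simp add: N_simps)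
  next
    fix m assume "m \<in> carrier (N {})"
    then obtain c where c: "c \<in> {..<r} \<rightarrow> carrier (AS {})" "m = (\<Oplus>\<^bsub>M {}\<^esub>i\<in>{..<r}. c i \<odot>\<^bsub>M {}\<^esub> e i)"
      using gen unfolding N_simps by blast
    show "\<exists>c\<in>{..<r} \<rightarrow> carrier A. m = (\<Oplus>\<^bsub>N {}\<^esub>i\<in>{..<r}. c i \<odot>\<^bsub>N {}\<^esub> e i)"
    proof -
      obtain d where d: "d \<in> {..<r} \<rightarrow> carrier A"
        "(\<Oplus>\<^bsub>N {}\<^esub>i\<in>{..<r}. d i \<odot>\<^bsub>N {}\<^esub> e i) = (\<Oplus>\<^bsub>M {}\<^esub>i\<in>{..<r}. c i \<odot>\<^bsub>M {}\<^esub> e i)"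
        using lift_combination[OF E c(1) e] by (elim bexE conjE) (rule that)
      show ?thesis unfolding c(2) by (intro bexI[of _ d] d(1) d(2)[symmetric])
    qed
  next
    fix c assume c: "c \<in> {..<r} \<rightarrow> carrier A" and z: "(\<Oplus>\<^bsub>N {}\<^esub>i\<in>{..<r}. c i \<odot>\<^bsub>N {}\<^esub> e i) = \<zero>\<^bsub>N {}\<^esub>"
    have cA: "c i \<in> carrier A" if "i < r" for i using c that by auto
    have pc: "(\<lambda>i. pr {} (c i)) \<in> {..<r} \<rightarrow> carrier (AS {})" using pr_closed[OF E] cA by auto
    have "\<forall>i<r. pr {} (c i) = \<zero>\<^bsub>AS {}\<^esub>"
      using bspec[OF ind pc] z[unfolded N_simps] by blast
    then show "\<forall>i<r. c i \<in> J {}" using AS_proj_J[OF E] cA by blast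
  qed
  then show ?thesis by blast
qed

text \<open>The rank at a point does not involve the point, and points exist, so the definite
  description is determined. \<open>GREATEST\<close> is informative only for a bounded property;
  bounds come with the two components considered next.\<close>

lemma component_rank_eq:
  assumes S: "S \<subseteq> T"
  shows "component_rank R u n g (N T) S = (GREATEST k. indep (N T) S k)"
proof -
  have rank: "module_rank (loc_ring A (off_prime R n g v)) (loc_module A (off_prime R n g v) (N T))
      = (GREATEST k. indep (N T) S k)" if v: "v \<in> Z_points R u n g S" for v
  proof -
    note D = Z_points_facts[OF S v]
    interpret localization A "N T" "off_prime R n g v"
      by (intro localization.intro localization_axioms.intro N_module subset_refl) (rule D; assumption)+
    have "(\<exists>e. lin_indep (loc_ring A (off_prime R n g v)) (loc_module A (off_prime R n g v) (N T)) k e)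
        \<longleftrightarrow> indep (N T) S k" for k
      unfolding indep_def by (rule lin_indep_loc_iff[OF D(5)])
    then show ?thesis unfolding module_rank_def by simp
  qed
  obtain v where v: "v \<in> Z_points R u n g S" using Z_points_nonempty[OF S] by blast
  show ?thesis unfolding component_rank_def
  proof (rule the_equality)
    show "\<forall>v\<in>Z_points R u n g S. module_rank (loc_ring A (off_prime R n g v))
        (loc_module A (off_prime R n g v) (N T)) = (GREATEST k. indep (N T) S k)"
      using rank by blast
    fix k assume "\<forall>v\<in>Z_points R u n g S. module_rank (loc_ring A (off_prime R n g v))
        (loc_module A (off_prime R n g v) (N T)) = k"
    from bspec[OF this v] rank[OF v] show "k = (GREATEST k. indep (N T) S k)" by (rule trans[OF sym])
  qed
qed

text \<open>On the component {} the rank of \<open>M_T\<close> can be computed on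
  \<open>M_{}\<close>, where it is the length of a basis.\<close>

lemma component_rank_empty:
  assumes b: "basis_mod_J (N {}) {} r e"
  shows "component_rank R u n g (N T) {} = r"
proof -
  have E: "{} \<subseteq> T" by simp
  have iff: "indep (N T) {} k \<longleftrightarrow> indep (N {}) {} k" for k by (rule indep_transfer) auto
  have e: "e \<in> {..<r} \<rightarrow> carrier (N {})" using b by (simp add: basis_mod_J_def)
  have "indep (N {}) {} r"
    using b unfolding indep_def basis_mod_J_def by (intro bexI[of _ e] ballI impI) (auto simp: J_def)
  moreover have "k \<le> r" if "indep (N {}) {} k" for k
  proof -
    have "k \<le> card {..<r}"
    proof (rule indep_le_generators[OF N_module[OF E] E finite_lessThan e _ that])
      show "\<exists>c\<in>{..<r} \<rightarrow> carrier A. m = (\<Oplus>\<^bsub>N {}\<^esub>i\<in>{..<r}. c i \<odot>\<^bsub>N {}\<^esub> e i)" if "m \<in> carrier (N {})" for m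
        using b that unfolding basis_mod_J_def by blast
    qed
    then show ?thesis by simp
  qed
  ultimately show ?thesis unfolding component_rank_eq[OF E] iff by (intro Greatest_equality)
qed

text \<open>A finite generating set bounds the independent families, which gives
  \<open>GREATEST\<close> its meaning.\<close>

lemma component_rank_top:
  assumes "indep (N T) T k"
  shows "k \<le> component_rank R u n g (N T) T"
proof -
  interpret Mt: plain_module "AS T" "M T" unfolding plain_module_def by (rule module) simp
  have "finitely_generated (AS T) (M T)" using mcm[of T] by (simp add: maximal_cohen_macaulay_def)
  then obtain E where E: "finite E" "E \<subseteq> carrier (M T)" "Mt.lin E = carrier (M T)"
    by (rule Mt.minimal_generators) (rule that; assumption)
  have id: "(\<lambda>x. x) \<in> E \<rightarrow> carrier (M T)" using E(2) by auto
  have bound: "k \<le> card E" if "indep (N T) T k" for k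
  proof (rule indep_le_generators[OF N_module[OF subset_refl] subset_refl E(1) _ _ that])
    show "(\<lambda>x. x) \<in> E \<rightarrow> carrier (N T)" using id by (simp add: N_simps)
    fix m assume "m \<in> carrier (N T)"
    then have "m \<in> Mt.lin E" unfolding E(3) N_simps(1) .
    then obtain c where c: "c \<in> E \<rightarrow> carrier (AS T)" "m = (\<Oplus>\<^bsub>M T\<^esub>x\<in>E. c x \<odot>\<^bsub>M T\<^esub> x)"
      unfolding Mt.lin_def by blast
    show "\<exists>c\<in>E \<rightarrow> carrier A. m = (\<Oplus>\<^bsub>N T\<^esub>x\<in>E. c x \<odot>\<^bsub>N T\<^esub> x)"
    proof -
      obtain d where d: "d \<in> E \<rightarrow> carrier A"
        "(\<Oplus>\<^bsub>N T\<^esub>x\<in>E. d x \<odot>\<^bsub>N T\<^esub> x) = (\<Oplus>\<^bsub>M T\<^esub>x\<in>E. c x \<odot>\<^bsub>M T\<^esub> x)"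
        using lift_combination[OF subset_refl c(1) id] by (elim bexE conjE) (rule that)
      show ?thesis unfolding c(2) by (intro bexI[of _ d] d(1) d(2)[symmetric])
    qed
  qed
  show ?thesis unfolding component_rank_eq[OF subset_refl]
    by (rule Greatest_le_nat[of "indep (N T) T" k "card E"]) (use assms bound in auto)
qed

text \<open>The isomorphism is the inverse of \<open>G\<close>, which forms linear combinations of
  the basis; uniqueness of coordinates modulo \<open>J S\<close> becomes injectivity over
  \<open>A_S\<close>.\<close>

lemma basis_imp_free:
  assumes S: "S \<subseteq> T" and b: "basis_mod_J (N S) S r f"
  shows "\<exists>F. F \<in> mod_iso (AS S) (M S) (free_module (AS S) r)"
proof -
  interpret p: surjective_hom A "AS S" "pr S" by (rule AS_proj_surjective_hom[OF S])
  interpret Ms: module "AS S" "M S" by (rule module[OF S])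
  interpret Ns: module A "N S" by (rule N_module[OF S])
  have f: "f \<in> {..<r} \<rightarrow> carrier (M S)" using b by (simp add: basis_mod_J_def N_simps)
  let ?F = "free_module (AS S) r"
  have Fc: "c \<in> carrier ?F \<longleftrightarrow> c \<in> {..<r} \<rightarrow>\<^sub>E carrier (AS S)" for c by (simp add: free_module_def)
  have Fcc: "c \<in> {..<r} \<rightarrow> carrier (AS S)" if "c \<in> carrier ?F" for c using that by (auto simp: Fc)
  define G where "G c = (\<Oplus>\<^bsub>M S\<^esub>i\<in>{..<r}. c i \<odot>\<^bsub>M S\<^esub> f i)" for c
  have Gc: "G c \<in> carrier (M S)" if "c \<in> carrier ?F" for c
    unfolding G_def by (rule Ms.finsum_smult_closed[OF Fcc[OF that] f])
  have Gcong: "G c = G d" if "\<And>i. i < r \<Longrightarrow> c i = d i" "d \<in> {..<r} \<rightarrow> carrier (AS S)" for c d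
    unfolding G_def using that f by (intro Ms.M.finsum_cong') (auto simp: Pi_iff)
  have add: "G (c \<oplus>\<^bsub>?F\<^esub> d) = G c \<oplus>\<^bsub>M S\<^esub> G d" "c \<oplus>\<^bsub>?F\<^esub> d \<in> carrier ?F"
    if cd: "c \<in> carrier ?F" "d \<in> carrier ?F" for c d
  proof -
    show "c \<oplus>\<^bsub>?F\<^esub> d \<in> carrier ?F" using Fcc[OF cd(1)] Fcc[OF cd(2)]
      unfolding Fc by (auto simp: free_module_def Pi_iff)
    have "G (c \<oplus>\<^bsub>?F\<^esub> d) = G (\<lambda>i. c i \<oplus>\<^bsub>AS S\<^esub> d i)"
      using Fcc[OF cd(1)] Fcc[OF cd(2)] by (intro Gcong) (auto simp: free_module_def Pi_iff)
    also have "\<dots> = G c \<oplus>\<^bsub>M S\<^esub> G d"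
      unfolding G_def by (rule Ms.finsum_add_smult[OF Fcc[OF cd(1)] Fcc[OF cd(2)] f])
    finally show "G (c \<oplus>\<^bsub>?F\<^esub> d) = G c \<oplus>\<^bsub>M S\<^esub> G d" .
  qed
  have smult: "G (a \<odot>\<^bsub>?F\<^esub> c) = a \<odot>\<^bsub>M S\<^esub> G c" "a \<odot>\<^bsub>?F\<^esub> c \<in> carrier ?F"
    if a: "a \<in> carrier (AS S)" and c: "c \<in> carrier ?F" for a c
  proof -
    show "a \<odot>\<^bsub>?F\<^esub> c \<in> carrier ?F" using Fcc[OF c] a
      unfolding Fc by (auto simp: free_module_def Pi_iff)
    have "G (a \<odot>\<^bsub>?F\<^esub> c) = G (\<lambda>i. a \<otimes>\<^bsub>AS S\<^esub> c i)"
      using Fcc[OF c] a by (intro Gcong) (auto simp: free_module_def Pi_iff)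
    also have "\<dots> = a \<odot>\<^bsub>M S\<^esub> G c"
      unfolding G_def by (rule Ms.finsum_mult_smult[OF finite_lessThan a Fcc[OF c] f])
    finally show "G (a \<odot>\<^bsub>?F\<^esub> c) = a \<odot>\<^bsub>M S\<^esub> G c" .
  qed
  have ind: "\<forall>i<r. c i = \<zero>\<^bsub>AS S\<^esub>" if c: "c \<in> {..<r} \<rightarrow> carrier (AS S)" and z: "G c = \<zero>\<^bsub>M S\<^esub>" for c
  proof -
    obtain c' where c': "c' \<in> {..<r} \<rightarrow> carrier A" "\<forall>i\<in>{..<r}. pr S (c' i) = c i"
        "(\<Oplus>\<^bsub>N S\<^esub>i\<in>{..<r}. c' i \<odot>\<^bsub>N S\<^esub> f i) = (\<Oplus>\<^bsub>M S\<^esub>i\<in>{..<r}. c i \<odot>\<^bsub>M S\<^esub> f i)"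
      using lift_combination[OF S c f] by (elim bexE conjE) (rule that)
    have "(\<Oplus>\<^bsub>N S\<^esub>i\<in>{..<r}. c' i \<odot>\<^bsub>N S\<^esub> f i) = \<zero>\<^bsub>N S\<^esub>" using c'(3) z by (simp add: N_simps(2) G_def)
    then have "\<forall>i<r. c' i \<in> J S" using b c'(1) unfolding basis_mod_J_def by blast
    then show ?thesis using AS_proj_J[OF S Pi_mem[OF c'(1)]] c'(2) by simp
  qed
  have inj: "inj_on G (carrier ?F)"
  proof (rule inj_onI)
    fix c d assume cd: "c \<in> carrier ?F" "d \<in> carrier ?F" "G c = G d"
    have ci: "c i \<in> carrier (AS S)" "d i \<in> carrier (AS S)" if "i < r" for i
      using Fcc[OF cd(1)] Fcc[OF cd(2)] that by auto
    have e: "(\<lambda>i. c i \<ominus>\<^bsub>AS S\<^esub> d i) \<in> {..<r} \<rightarrow> carrier (AS S)" using ci by auto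
    have "G c = G (\<lambda>i. (c i \<ominus>\<^bsub>AS S\<^esub> d i) \<oplus>\<^bsub>AS S\<^esub> d i)"
      using ci by (intro Gcong) (auto simp: p.S.minus_add_cancel)
    also have "\<dots> = G (\<lambda>i. c i \<ominus>\<^bsub>AS S\<^esub> d i) \<oplus>\<^bsub>M S\<^esub> G d"
      unfolding G_def by (rule Ms.finsum_add_smult[OF e Fcc[OF cd(2)] f])
    finally have "G (\<lambda>i. c i \<ominus>\<^bsub>AS S\<^esub> d i) = \<zero>\<^bsub>M S\<^esub>"
      using cd(3) Gc[OF cd(2)] Ms.finsum_smult_closed[OF e f] by (simp add: G_def)
    then have "\<forall>i<r. c i = d i" using ind[OF e] ci p.S.minus_eq_zero_iff by blast
    then show "c = d" using cd(1,2) unfolding Fc by (intro PiE_ext) auto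
  qed
  have surj: "G ` carrier ?F = carrier (M S)"
  proof
    show "carrier (M S) \<subseteq> G ` carrier ?F"
    proof
      fix m assume m: "m \<in> carrier (M S)"
      obtain c where c: "c \<in> {..<r} \<rightarrow> carrier A" "m = (\<Oplus>\<^bsub>N S\<^esub>i\<in>{..<r}. c i \<odot>\<^bsub>N S\<^esub> f i)"
        using b m unfolding basis_mod_J_def N_simps(1) by blast
      have pc: "pr S (c i) \<in> carrier (AS S)" if "i < r" for i using c(1) that pr_closed[OF S] by auto
      let ?c = "\<lambda>i\<in>{..<r}. pr S (c i)"
      have "m = G (\<lambda>i. pr S (c i))" unfolding c(2) G_def N_simps ..
      also have "\<dots> = G ?c" using pc by (intro Gcong) auto
      finally show "m \<in> G ` carrier ?F" using pc by (intro image_eqI[of _ _ ?c]) (auto simp: Fc)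
    qed
  qed (use Gc in blast)
  have bij: "bij_betw G (carrier ?F) (carrier (M S))" using inj surj by (simp add: bij_betw_def)
  define F where "F = inv_into (carrier ?F) G"
  have F: "F m \<in> carrier ?F" "G (F m) = m" if "m \<in> carrier (M S)" for m
  proof -
    have m: "m \<in> G ` carrier ?F" using that surj by simp
    show "F m \<in> carrier ?F" "G (F m) = m"
      unfolding F_def by (rule inv_into_into[OF m], rule f_inv_into_f[OF m])
  qed
  have FG: "F (G c) = c" if "c \<in> carrier ?F" for c
    unfolding F_def by (rule inv_into_f_f[OF inj that])
  have "F \<in> mod_hom (AS S) (M S) ?F"
    unfolding mod_hom_def
  proof (intro CollectI conjI ballI)
    show "F \<in> carrier (M S) \<rightarrow> carrier ?F" using F(1) by blast
    fix x assume x: "x \<in> carrier (M S)"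
    show "F (x \<oplus>\<^bsub>M S\<^esub> y) = F x \<oplus>\<^bsub>?F\<^esub> F y" if y: "y \<in> carrier (M S)" for y
      using FG[OF add(2)[OF F(1)[OF x] F(1)[OF y]]] unfolding add(1)[OF F(1)[OF x] F(1)[OF y]] F(2)[OF x] F(2)[OF y] .
  next
    fix a x assume ax: "a \<in> carrier (AS S)" "x \<in> carrier (M S)"
    show "F (a \<odot>\<^bsub>M S\<^esub> x) = a \<odot>\<^bsub>?F\<^esub> F x"
      using FG[OF smult(2)[OF ax(1) F(1)[OF ax(2)]]] unfolding smult(1)[OF ax(1) F(1)[OF ax(2)]] F(2)[OF ax(2)] .
  qed
  moreover have "bij_betw F (carrier (M S)) (carrier ?F)" unfolding F_def by (rule bij_betw_inv_into[OF bij])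
  ultimately show ?thesis unfolding mod_iso_def by blast
qed

theorem free_of_component_ranks:
  assumes le: "component_rank R u n g (N T) T \<le> component_rank R u n g (N T) {}" and S: "S \<subseteq> T"
  shows "\<exists>F. F \<in> mod_iso (AS S) (M S) (free_module (AS S) (component_rank R u n g (N T) {}))"
proof -
  obtain r e where b: "basis_mod_J (N {}) {} r e" using base_basis by (elim exE) (rule that)
  note r = component_rank_empty[OF b]
  \<comment> \<open>Here the comparison of ranks enters: r is the rank on the component {} and
    bounds the rank on the component T.\<close>
  have top: "\<not> indep (N T) T (Suc r)" using component_rank_top le r by fastforce
  have "\<exists>f. basis_mod_J (N S) S r f"
  proof (rule free_of_rank_bound[where N = N and B = \<phi> and \<pi> = "\<lambda>S s. \<pi> (insert s S) S", OF paired_N adjacent_N _ b top S])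
    show "indep (N S') S' k" if "S \<subseteq> T" "S' \<subseteq> S" "indep (N S) S' k" for S S' k
      using indep_transfer[OF subset_refl that(2,1)] that(3) by blast
  qed auto
  then show ?thesis unfolding r using basis_imp_free[OF S] by blast
qed

end

theorem theorem4p1:
  fixes \<O> :: "('o, 'c) ring_scheme" and u :: 'o and n g :: nat
    and M :: "nat set \<Rightarrow> ('o series set set, 'm) module"
    and \<pi> :: "nat set \<Rightarrow> nat set \<Rightarrow> 'm \<Rightarrow> 'm"
    and \<phi> :: "nat set \<Rightarrow> 'm \<Rightarrow> 'm \<Rightarrow> 'o series set"
    and \<mu> :: "nat set \<Rightarrow> nat"
  defines "\<mu> \<equiv> component_rank \<O> u n g (as_A_module \<O> n g {1..n} (M {1..n}))"
  assumes O: "complete_dvr \<O> u" and n: "n \<ge> 1" and g: "g \<ge> 1"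
    and module: "\<And>S. S \<subseteq> {1..n} \<Longrightarrow> module (AS_ring \<O> n g S) (M S)"
    and linear: "\<And>S S'. S' \<subseteq> S \<Longrightarrow> S \<subseteq> {1..n} \<Longrightarrow>
      \<pi> S S' \<in> mod_hom (AS_ring \<O> n g S) (M S)
        (restrict_scalars (AS_trans \<O> n g S') (M S'))"
    and surj: "\<And>S S'. S' \<subseteq> S \<Longrightarrow> S \<subseteq> {1..n} \<Longrightarrow> \<pi> S S' ` carrier (M S) = carrier (M S')"
    and mcm: "\<And>S. S \<subseteq> {1..n} \<Longrightarrow> maximal_cohen_macaulay (AS_ring \<O> n g S) (M S)"
    and self_dual: "\<And>S. S \<subseteq> {1..n} \<Longrightarrow>
      \<phi> S \<in> mod_iso (AS_ring \<O> n g S) (M S) (dual \<O> n g S (M S))"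
    and local_iso: "\<And>S S' v. S' \<subseteq> S \<Longrightarrow> S \<subseteq> {1..n} \<Longrightarrow> v \<in> V_points \<O> u n g S' \<Longrightarrow>
      loc_map (A_ring \<O> n g) (off_prime \<O> n g v) (as_A_module \<O> n g S' (M S')) (\<pi> S S')
      \<in> mod_iso (loc_ring (A_ring \<O> n g) (off_prime \<O> n g v))
          (loc_module (A_ring \<O> n g) (off_prime \<O> n g v) (as_A_module \<O> n g S (M S)))
          (loc_module (A_ring \<O> n g) (off_prime \<O> n g v) (as_A_module \<O> n g S' (M S')))"
    and composition: "\<And>S S' s x. S' \<subset> {1..n} \<Longrightarrow> s \<in> {1..n} - S' \<Longrightarrow> S = S' \<union> {s} \<Longrightarrow>
      x \<in> carrier (M S') \<Longrightarrow>
      \<pi> S S' (inv_into (carrier (M S)) (\<phi> S) (compose (carrier (M S)) (\<phi> S' x) (\<pi> S S')))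
      = AS_proj \<O> n g S' (A_var \<O> n g (VY s)) \<odot>\<^bsub>M S'\<^esub> x"
    and ranks: "\<mu> {1..n} \<le> \<mu> {}"
  shows "\<forall>S. S \<subseteq> {1..n} \<longrightarrow>
    (\<exists>f. f \<in> mod_iso (AS_ring \<O> n g S) (M S) (free_module (AS_ring \<O> n g S) (\<mu> {})))"
proof (intro allI impI)
  fix S assume S: "S \<subseteq> {1..n}"
  interpret crossing_setting \<O> u n g by (rule crossing_setting.intro[OF O])
  interpret self_dual_family \<O> u n g M \<pi> \<phi>
    by (intro self_dual_family.intro self_dual_family_axioms.intro crossing_setting_axioms
        module linear surj mcm self_dual local_iso composition)
  show "\<exists>f. f \<in> mod_iso (AS_ring \<O> n g S) (M S) (free_module (AS_ring \<O> n g S) (\<mu> {}))"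
    using free_of_component_ranks[OF ranks[unfolded \<mu>_def, folded N_def] S]
    unfolding \<mu>_def N_def .
qed

end
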